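(* Let $\Omega\subseteq\mathbb{R}^n$ be open. Both for the special and the full Colombeau algebras $\mathcal{G}(\Omega)\in\{\mathcal{G}^s(\Omega),\mathcal{G}^e(\Omega)\}$, regarded as diffeological spaces, the sum, product and derivation maps $$+:\mathcal{G}(\Omega)\times\mathcal{G}(\Omega)\to\mathcal{G}(\Omega),\qquad \cdot:\mathcal{G}(\Omega)\times\mathcal{G}(\Omega)\to\mathcal{G}(\Omega),\qquad \partial^\alpha:\mathcal{G}(\Omega)\to\mathcal{G}(\Omega)\quad\forall\alpha\in\mathbb{N}^n$$ are smooth. Therefore, with respect to the $D$-topology, $\mathcal{G}(\Omega)$ is a topological algebra with continuous derivations. Moreover, let $(\psi_\varepsilon)\in\mathcal{D}(\mathbb{R}^n)^I$ be a net satisfying properties (a)-(e) listed in the context, let $\iota_\Omega:|\mathcal{D}'(\Omega)|\to\mathcal{G}(\Omega)$ be the embedding of distributions described in the context (for $\mathcal{G}^s(\Omega)$ it is the one constructed from $(\psi_\varepsilon)$), and let $\sigma_\Omega(f):=[f]\in\mathcal{G}(\Omega)$ for all $f\in\mathcal{C}^\infty(\Omega)$. Then the embeddings $$\iota_\Omega:|\mathcal{D}'(\Omega)|\to\mathcal{G}(\Omega),\qquad \sigma_\Omega:\mathcal{C}^\infty(\Omega)\to\mathcal{G}(\Omega)$$ are smooth maps if we equip $|\mathcal{D}'(\Omega)|$ with the sub-diffeology of $\mathcal{C}^\infty(\mathcal{D}(\Omega),\mathbb{R})$.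
   Context: **Diffeological spaces.** A diffeological space $X=(|X|,\mathcal{D})$ is a set $|X|$ with a family $\mathcal{D}=\bigcup_U\mathcal{D}_U$, $U$ ranging over all open subsets of all $\mathbb{R}^n$, $n\in\mathbb{N}=\{0,1,\dots\}$, where $\mathcal{D}_U$ is a set of functions $U\to|X|$ (plots; write $d\in_U X$) containing all constants, closed under precomposition with ordinary smooth maps $V\to U$, and such that a function $d:U\to|X|$ that is locally (on an open cover of $U$) in $\mathcal{D}$ belongs to $\mathcal{D}_U$. A map $f:X\to Y$ is smooth if it sends plots to plots by composition; $\mathcal{C}^\infty(X,Y)$ is the set of smooth maps, equipped with the functional diffeology: $d\in_U\mathcal{C}^\infty(X,Y)$ iff $d^\vee:(u,x)\mapsto d(u)(x)$ is smooth $U\times X\to Y$. Manifolds carry the diffeology of usual smooth maps; products carry the product diffeology (plots are componentwise plots). For $A\subseteq|X|$, $(A\prec X)$ is $A$ with the sub-diffeology (plots are the maps into $A$ that are plots of $X$). A quotient $X/{\sim}$ has the quotient diffeology: plots are the maps that locally lift to plots of $X$. The $D$-topology is the final topology with respect to all plots. The discrete diffeology consists of the locally constant maps. **Test functions and distributions.** $\mathcal{D}(\Omega)$ is the set of real-valued smooth functions on $\Omega$ with compact support, with the canonical diffeology: $d\in_U\mathcal{D}(\Omega)$ iff $l\circ d\in\mathcal{C}^\infty(U,\mathbb{R})$ for every linear functional $l$ on $\mathcal{D}(\Omega)$ continuous for the usual locally convex topology. $|\mathcal{D}'(\Omega)|$ is the set of distributions, i.e. of those continuous linear functionals. $K\Subset\Omega$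 means that $K$ is a compact subset of $\Omega$. For $\phi\in\mathcal{D}(\mathbb{R}^n)$ and $\varepsilon\in I:=(0,1]$, $(\varepsilon\odot\phi)(x):=\varepsilon^{-n}\phi(x/\varepsilon)$. All $O$-relations are for $\varepsilon\to0^+$. **Special algebra.** $I$ carries the discrete diffeology. $\mathcal{E}^s_M(\Omega)$ is the set of nets $(u_\varepsilon)\in\mathcal{C}^\infty(\Omega)^I$ such that $\forall K\Subset\Omega\,\forall\alpha\in\mathbb{N}^n\,\exists N\in\mathbb{N}$: $\sup_{x\in K}|\partial^\alpha u_\varepsilon(x)|=O(\varepsilon^{-N})$; $\mathcal{N}^s(\Omega)$ is the set of nets such that $\forall K\Subset\Omega\,\forall\alpha\,\forall m\in\mathbb{N}$: $\sup_{x\in K}|\partial^\alpha u_\varepsilon(x)|=O(\varepsilon^m)$. $\mathcal{E}^s_M(\Omega)$ has the sub-diffeology of $\mathcal{C}^\infty(I,\mathcal{C}^\infty(\Omega,\mathbb{R}))$ (so plots are maps $d:U\to\mathcal{E}^s_M(\Omega)$ with $(u,x)\mapsto d(u)_\varepsilon(x)$ smooth on $U\times\Omega$ for each $\varepsilon\in I$), and $\mathcal{G}^s(\Omega)=\mathcal{E}^s_M(\Omega)/\mathcal{N}^s(\Omega)$ has the quotient diffeology. Operations and derivatives are defined $\varepsilon$-wise on representatives; $\sigma_\Omega(f)$ is the class of the constant net $u_\varepsilon=f$. Properties of $(\psi_\varepsilon)$: (a) $|x|<1$ for all $\varepsilon\in I$ and $x\in\operatorname{supp}(\psi_\varepsilon)$;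 (b) $\int\psi_\varepsilon=1$ for all $\varepsilon\in I$; (c) $\forall\alpha\in\mathbb{N}^n\,\exists N\in\mathbb{N}$: $\sup_{x\in\mathbb{R}^n}|\partial^\alpha\psi_\varepsilon(x)|=O(\varepsilon^{-N})$; (d) $\forall j\in\mathbb{N}\,\exists\varepsilon_0\in I\,\forall\varepsilon\in(0,\varepsilon_0]\,\forall\alpha\in\mathbb{N}^n$: $1\le|\alpha|\le j\Rightarrow\int x^\alpha\psi_\varepsilon(x)\,dx=0$; (e) $\forall\eta>0\,\exists\varepsilon_0\in I\,\forall\varepsilon\in(0,\varepsilon_0]$: $\int|\psi_\varepsilon|\le1+\eta$. For $\mathcal{G}^s(\Omega)$, $\iota_\Omega(u):=[u*(\varepsilon\odot\psi_\varepsilon|_\Omega)]$, i.e. the class of the net $x\in\Omega\mapsto\langle u,\varepsilon^{-n}\psi_\varepsilon(\frac{x-\,\cdot}{\varepsilon})\rangle$ (for each $K\Subset\Omega$, $\varepsilon^{-n}\psi_\varepsilon(\frac{x-\,\cdot}{\varepsilon})\in\mathcal{D}(\Omega)$ for all $x\in K$ and all small $\varepsilon$, and the class is determined by these values). **Full algebra.** $\mathcal{A}_0=\{\phi\in\mathcal{D}(\mathbb{R}^n):\int\phi=1\}$; $\mathcal{A}_q=\{\phi\in\mathcal{A}_0:\int x^\alpha\phi(x)\,dx=0\text{ for }1\le|\alpha|\le q\}$; $U(\Omega)=\{(\phi,x)\in\mathcal{A}_0\times\Omega:\operatorname{supp}(\phi)\subseteq\Omega-x\}$; $\Omega_\phi=\{x\in\Omega:\operatorname{supp}(\phi)\subseteq\Omega-x\}$.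 $\mathcal{E}^e(\Omega)$ is the set of $R:U(\Omega)\to\mathbb{R}$ with $R(\phi,-)$ smooth on $\Omega_\phi$ for all $\phi\in\mathcal{A}_0$. $\mathcal{E}^e_M(\Omega)$ is the set of $R\in\mathcal{E}^e(\Omega)$ with $\forall K\Subset\Omega\,\forall\alpha\,\exists N\in\mathbb{N}\,\forall\phi\in\mathcal{A}_N$: $\sup_{x\in K}|\partial^\alpha R(\varepsilon\odot\phi,x)|=O(\varepsilon^{-N})$; $\mathcal{N}^e(\Omega)$ is the set of $R\in\mathcal{E}^e(\Omega)$ with $\forall K\Subset\Omega\,\forall\alpha\,\forall m\in\mathbb{N}\,\exists q\in\mathbb{N}\,\forall\phi\in\mathcal{A}_q$: $\sup_{x\in K}|\partial^\alpha R(\varepsilon\odot\phi,x)|=O(\varepsilon^m)$ (derivatives in $x$). $U(\Omega)$ has the sub-diffeology of $\mathcal{A}_0\times\Omega$ with $\mathcal{A}_0$ discrete; $\mathcal{E}^e(\Omega)$ has the sub-diffeology of $\mathcal{C}^\infty(U(\Omega),\mathbb{R})$; equivalently, plots $d:V\to\mathcal{E}^e(\Omega)$ are the maps such that $(v,x)\mapsto d(v)(\phi,x)$ is smooth on $V\times\Omega_\phi$ for each $\phi\in\mathcal{A}_0$. $\mathcal{E}^e_M(\Omega)$ has the sub-diffeology and $\mathcal{G}^e(\Omega)=\mathcal{E}^e_M(\Omega)/\mathcal{N}^e(\Omega)$ the quotient diffeology. Operations are pointwise on representatives and $\partial^\alpha$ acts in $x$; $\sigma_\Omega(f)$ is the class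 of $(\phi,x)\mapsto f(x)$; $\iota_\Omega(u)$ is the class of $(\phi,x)\mapsto\langle u,\phi(\cdot-x)\rangle$. *)

theory Defs
  imports "HOL-Analysis.Analysis" "HOL-Library.Landau_Symbols" "HOL-Algebra.Module"
begin

section \<open>Smooth functions on open subsets of Euclidean spaces of varying dimension\<close>

text \<open>Plots have domains in all spaces \<open>\<real>\<^sup>k\<close> at once, so the dimension has to be a number and not
  a type. \<open>\<real>\<^sup>k\<close> is the carrier of the library topology \<^const>\<open>Euclidean_space\<close>: sequences
  that vanish from index \<open>k\<close> on, with coordinates \<open>0, \<dots>, k - 1\<close>. Its topology is the one
  induced by the type-class topology of \<^typ>\<open>nat \<Rightarrow> real\<close>, so \<^const>\<open>continuous_on\<close>,
  \<^const>\<open>compact\<close> and \<^const>\<open>closure\<close> have their usual meaning on subsets of it.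
  A function with a given domain is extensional, i.e. \<^const>\<open>undefined\<close> outside the domain.\<close>

type_synonym rvec = "nat \<Rightarrow> real"
type_synonym rfun = "rvec \<Rightarrow> real"
type_synonym multi_index = "nat \<Rightarrow> nat"

abbreviation Rn :: "nat \<Rightarrow> rvec set" where
  "Rn n \<equiv> topspace (Euclidean_space n)"

definition pderiv_at :: "nat \<Rightarrow> rfun \<Rightarrow> rfun" where
  "pderiv_at i f x = deriv (\<lambda>t. f (x(i := t))) (x i)"

primrec Ck_on :: "nat \<Rightarrow> nat \<Rightarrow> rvec set \<Rightarrow> rfun \<Rightarrow> bool" where
  "Ck_on 0 k U f \<longleftrightarrow> continuous_on U f"
| "Ck_on (Suc m) k U f \<longleftrightarrow> continuous_on U f \<and>
     (\<forall>i<k. (\<forall>x\<in>U. (\<lambda>t. f (x(i := t))) differentiable (at (x i))) \<and>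
            Ck_on m k U (pderiv_at i f))"

definition Csmooth :: "nat \<Rightarrow> rvec set \<Rightarrow> rfun set" where
  "Csmooth k U = {f \<in> extensional U. \<forall>m. Ck_on m k U f}"

text \<open>\<open>\<partial>\<^sup>\<alpha>\<close> on \<open>\<real>\<^sup>n\<close>. Of a multi-index only the entries below \<open>n\<close> are ever used, here and below.\<close>

primrec mderiv :: "nat \<Rightarrow> multi_index \<Rightarrow> rfun \<Rightarrow> rfun" where
  "mderiv 0 \<alpha> f = f"
| "mderiv (Suc n) \<alpha> f = (pderiv_at n ^^ \<alpha> n) (mderiv n \<alpha> f)"

definition mi_order :: "nat \<Rightarrow> multi_index \<Rightarrow> nat" where
  "mi_order n \<alpha> = (\<Sum>i<n. \<alpha> i)"

definition mi_power :: "nat \<Rightarrow> rvec \<Rightarrow> multi_index \<Rightarrow> real" where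
  "mi_power n x \<alpha> = (\<Prod>i<n. x i ^ \<alpha> i)"

definition mi_unit :: "nat \<Rightarrow> multi_index" where
  "mi_unit i = (\<lambda>j. if j = i then 1 else 0)"

text \<open>The elements of the library product measure are \<^const>\<open>undefined\<close>, not zero, from index
  \<open>n\<close> on.\<close>

definition integral_Rn :: "nat \<Rightarrow> rfun \<Rightarrow> real" where
  "integral_Rn n f =
     (\<integral>x. f (\<lambda>i. if i < n then x i else 0) \<partial>(\<Pi>\<^sub>M i\<in>{..<n}. (lborel :: real measure)))"

text \<open>The supremum of \<open>|f|\<close> on \<open>K\<close>; inserting 0 only serves to make it 0 for empty \<open>K\<close>.\<close>

definition sup_abs :: "rvec set \<Rightarrow> rfun \<Rightarrow> real" where
  "sup_abs K f = Sup (insert 0 ((\<lambda>x. \<bar>f x\<bar>) ` K))"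

definition supp_in :: "rvec set \<Rightarrow> rfun \<Rightarrow> rvec set" where
  "supp_in \<Omega> f = \<Omega> \<inter> closure {x \<in> \<Omega>. f x \<noteq> 0}"


section \<open>Diffeological spaces\<close>

text \<open>\<open>plots X k U\<close> is the set of plots \<open>U \<rightarrow> |X|\<close> for \<open>U\<close> an open subset of \<open>\<real>\<^sup>k\<close>.\<close>

record 'a dspace =
  points :: "'a set"
  plots :: "nat \<Rightarrow> rvec set \<Rightarrow> (rvec \<Rightarrow> 'a) set"

definition eucl_space :: "nat \<Rightarrow> rvec set \<Rightarrow> rvec dspace" where
  "eucl_space n \<Omega> = \<lparr>points = \<Omega>,
     plots = (\<lambda>k U. {d \<in> U \<rightarrow>\<^sub>E \<Omega>. openin (Euclidean_space k) U \<and>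
       (\<forall>j<n. (\<lambda>u\<in>U. d u j) \<in> Csmooth k U)})\<rparr>"

definition real_space :: "real dspace" where
  "real_space = \<lparr>points = UNIV,
     plots = (\<lambda>k U. {d. openin (Euclidean_space k) U \<and> d \<in> Csmooth k U})\<rparr>"

definition diffeological_space :: "'a dspace \<Rightarrow> bool" where
  "diffeological_space X \<longleftrightarrow>
     (\<forall>k U. \<forall>d\<in>plots X k U. openin (Euclidean_space k) U \<and> d \<in> U \<rightarrow>\<^sub>E points X) \<and>
     (\<forall>k U. \<forall>a\<in>points X. openin (Euclidean_space k) U \<longrightarrow> (\<lambda>u\<in>U. a) \<in> plots X k U) \<and>
     (\<forall>k U l V. \<forall>d\<in>plots X k U. \<forall>g\<in>plots (eucl_space k U) l V. compose V d g \<in> plots X l V) \<and>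
     (\<forall>k U. \<forall>d\<in>U \<rightarrow>\<^sub>E points X. openin (Euclidean_space k) U \<longrightarrow>
        (\<forall>u\<in>U. \<exists>W. openin (Euclidean_space k) W \<and> u \<in> W \<and> W \<subseteq> U \<and> restrict d W \<in> plots X k W) \<longrightarrow>
        d \<in> plots X k U)"

definition smooth_map :: "'a dspace \<Rightarrow> 'b dspace \<Rightarrow> ('a \<Rightarrow> 'b) \<Rightarrow> bool" where
  "smooth_map X Y f \<longleftrightarrow> f \<in> points X \<rightarrow> points Y \<and>
     (\<forall>k U. \<forall>d\<in>plots X k U. compose U f d \<in> plots Y k U)"

definition discrete_space :: "'a set \<Rightarrow> 'a dspace" where
  "discrete_space A = \<lparr>points = A,
     plots = (\<lambda>k U. {d \<in> U \<rightarrow>\<^sub>E A. openin (Euclidean_space k) U \<and>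
       (\<forall>u\<in>U. \<exists>W. openin (Euclidean_space k) W \<and> u \<in> W \<and> W \<subseteq> U \<and> (\<forall>w\<in>W. d w = d u))})\<rparr>"

definition prod_space :: "'a dspace \<Rightarrow> 'b dspace \<Rightarrow> ('a \<times> 'b) dspace" where
  "prod_space X Y = \<lparr>points = points X \<times> points Y,
     plots = (\<lambda>k U. {d \<in> extensional U.
       (\<lambda>u\<in>U. fst (d u)) \<in> plots X k U \<and> (\<lambda>u\<in>U. snd (d u)) \<in> plots Y k U})\<rparr>"

definition sub_space :: "'a set \<Rightarrow> 'a dspace \<Rightarrow> 'a dspace" where
  "sub_space A X = \<lparr>points = A, plots = (\<lambda>k U. {d \<in> plots X k U. d ` U \<subseteq> A})\<rparr>"

definition fun_space :: "'a dspace \<Rightarrow> 'b dspace \<Rightarrow> ('a \<Rightarrow> 'b) dspace" where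
  "fun_space X Y = \<lparr>points = {f \<in> extensional (points X). smooth_map X Y f},
     plots = (\<lambda>k U. {d \<in> U \<rightarrow>\<^sub>E {f \<in> extensional (points X). smooth_map X Y f}.
       openin (Euclidean_space k) U \<and>
       smooth_map (prod_space (eucl_space k U) X) Y (\<lambda>(u, x). d u x)})\<rparr>"

definition quot_space :: "'a dspace \<Rightarrow> ('a \<times> 'a) set \<Rightarrow> 'a set dspace" where
  "quot_space X r = \<lparr>points = points X // r,
     plots = (\<lambda>k U. {d \<in> U \<rightarrow>\<^sub>E points X // r. openin (Euclidean_space k) U \<and>
       (\<forall>u\<in>U. \<exists>W. \<exists>p\<in>plots X k W. openin (Euclidean_space k) W \<and> u \<in> W \<and> W \<subseteq> U \<and>
         (\<forall>w\<in>W. d w = r `` {p w}))})\<rparr>"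

definition D_topology :: "'a dspace \<Rightarrow> 'a topology" where
  "D_topology X = topology (\<lambda>V. V \<subseteq> points X \<and>
     (\<forall>k U. \<forall>d\<in>plots X k U. openin (Euclidean_space k) U \<longrightarrow>
        openin (Euclidean_space k) {u \<in> U. d u \<in> V}))"

lemma openin_D_topology:
  "openin (D_topology X) V \<longleftrightarrow> V \<subseteq> points X \<and>
     (\<forall>k U. \<forall>d\<in>plots X k U. openin (Euclidean_space k) U \<longrightarrow>
        openin (Euclidean_space k) {u \<in> U. d u \<in> V})"
proof -
  let ?P = "\<lambda>V. V \<subseteq> points X \<and> (\<forall>k U. \<forall>d\<in>plots X k U. openin (Euclidean_space k) U \<longrightarrow>
    openin (Euclidean_space k) {u \<in> U. d u \<in> V})"
  have "istopology ?P"
    unfolding istopology_def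
  proof (rule conjI; intro allI impI)
    fix S T assume S: "?P S" and T: "?P T"
    have "{u \<in> U. d u \<in> S \<inter> T} = {u \<in> U. d u \<in> S} \<inter> {u \<in> U. d u \<in> T}"
      for U :: "rvec set" and d by auto
    then show "?P (S \<inter> T)" using S T by (auto intro: openin_Int)
  next
    fix \<K> assume K: "\<forall>S\<in>\<K>. ?P S"
    have "{u \<in> U. d u \<in> \<Union>\<K>} = \<Union>((\<lambda>S. {u \<in> U. d u \<in> S}) ` \<K>)"
      for U :: "rvec set" and d by auto
    then show "?P (\<Union>\<K>)" using K by (auto intro!: openin_Union)
  qed
  then show ?thesis by (simp add: D_topology_def topology_inverse')
qed


section \<open>Topological algebras\<close>

definition real_ring :: "real ring" where
  "real_ring = \<lparr>carrier = UNIV, mult = (*), one = 1, zero = 0, add = (+)\<rparr>"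

text \<open>The qualified name selects the notion of HOL-Algebra (commutative, unital algebra over a
  commutative ring) rather than the one of measure theory.\<close>

definition topological_algebra :: "'a topology \<Rightarrow> (real, 'a) module \<Rightarrow> bool" where
  "topological_algebra T A \<longleftrightarrow> Module.algebra real_ring A \<and> topspace T = carrier A \<and>
     continuous_map (prod_topology T T) T (\<lambda>(a, b). a \<oplus>\<^bsub>A\<^esub> b) \<and>
     continuous_map (prod_topology T T) T (\<lambda>(a, b). a \<otimes>\<^bsub>A\<^esub> b) \<and>
     continuous_map (prod_topology euclideanreal T) T (\<lambda>(c, a). c \<odot>\<^bsub>A\<^esub> a)"

definition derivation :: "(real, 'a) module \<Rightarrow> ('a \<Rightarrow> 'a) \<Rightarrow> bool" where
  "derivation A D \<longleftrightarrow> D \<in> carrier A \<rightarrow> carrier A \<and>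
     (\<forall>a\<in>carrier A. \<forall>b\<in>carrier A. D (a \<oplus>\<^bsub>A\<^esub> b) = D a \<oplus>\<^bsub>A\<^esub> D b) \<and>
     (\<forall>c. \<forall>a\<in>carrier A. D (c \<odot>\<^bsub>A\<^esub> a) = c \<odot>\<^bsub>A\<^esub> D a) \<and>
     (\<forall>a\<in>carrier A. \<forall>b\<in>carrier A.
        D (a \<otimes>\<^bsub>A\<^esub> b) = (D a \<otimes>\<^bsub>A\<^esub> b) \<oplus>\<^bsub>A\<^esub> (a \<otimes>\<^bsub>A\<^esub> D b))"

text \<open>Operations on equivalence classes induced by operations on representatives.\<close>

definition lift1 :: "('a \<times> 'a) set \<Rightarrow> ('a \<Rightarrow> 'a) \<Rightarrow> 'a set \<Rightarrow> 'a set" where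
  "lift1 r f A = (\<Union>a\<in>A. r `` {f a})"

definition lift2 :: "('a \<times> 'a) set \<Rightarrow> ('a \<Rightarrow> 'a \<Rightarrow> 'a) \<Rightarrow> 'a set \<Rightarrow> 'a set \<Rightarrow> 'a set" where
  "lift2 r f A B = (\<Union>a\<in>A. \<Union>b\<in>B. r `` {f a b})"


section \<open>Test functions and distributions\<close>

definition test_funs :: "nat \<Rightarrow> rvec set \<Rightarrow> rfun set" where
  "test_funs n \<Omega> = {\<phi> \<in> Csmooth n \<Omega>. compact (supp_in \<Omega> \<phi>)}"

definition test_funs_in :: "nat \<Rightarrow> rvec set \<Rightarrow> rvec set \<Rightarrow> rfun set" where
  "test_funs_in n \<Omega> K = {\<phi> \<in> test_funs n \<Omega>. supp_in \<Omega> \<phi> \<subseteq> K}"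

text \<open>Open sets of the Frechet topology of the test functions with support in \<open>K\<close>, given by the
  seminorms \<open>max\<^bsub>|\<alpha>| \<le> N\<^esub> sup |\<partial>\<^sup>\<alpha> \<phi>|\<close>.\<close>

definition frechet_open :: "nat \<Rightarrow> rvec set \<Rightarrow> rvec set \<Rightarrow> rfun set \<Rightarrow> bool" where
  "frechet_open n \<Omega> K S \<longleftrightarrow> S \<subseteq> test_funs_in n \<Omega> K \<and>
     (\<forall>\<phi>\<in>S. \<exists>N. \<exists>\<delta>>0. \<forall>\<psi>\<in>test_funs_in n \<Omega> K.
        (\<forall>\<alpha>. mi_order n \<alpha> \<le> N \<longrightarrow> sup_abs \<Omega> (mderiv n \<alpha> (\<lambda>x\<in>\<Omega>. \<psi> x - \<phi> x)) < \<delta>) \<longrightarrow> \<psi> \<in> S)"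

text \<open>The usual (LF) topology: a base of neighbourhoods of 0 is formed by the convex balanced
  sets whose intersections with all the Frechet spaces above are open.\<close>

definition test_nhds_0 :: "nat \<Rightarrow> rvec set \<Rightarrow> rfun set set" where
  "test_nhds_0 n \<Omega> = {W. W \<subseteq> test_funs n \<Omega> \<and> (\<lambda>x\<in>\<Omega>. 0) \<in> W \<and>
     (\<forall>\<phi>\<in>W. \<forall>\<psi>\<in>W. \<forall>t\<in>{0..1}. (\<lambda>x\<in>\<Omega>. (1 - t) * \<phi> x + t * \<psi> x) \<in> W) \<and>
     (\<forall>\<phi>\<in>W. \<forall>c. \<bar>c\<bar> \<le> 1 \<longrightarrow> (\<lambda>x\<in>\<Omega>. c * \<phi> x) \<in> W) \<and>
     (\<forall>K. compact K \<and> K \<subseteq> \<Omega> \<longrightarrow> frechet_open n \<Omega> K (W \<inter> test_funs_in n \<Omega> K))}"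

definition test_topology :: "nat \<Rightarrow> rvec set \<Rightarrow> rfun topology" where
  "test_topology n \<Omega> = topology (\<lambda>V. V \<subseteq> test_funs n \<Omega> \<and>
     (\<forall>\<phi>\<in>V. \<exists>W\<in>test_nhds_0 n \<Omega>. \<forall>\<psi>\<in>W. (\<lambda>x\<in>\<Omega>. \<phi> x + \<psi> x) \<in> V))"

lemma frechet_open_Int:
  assumes "frechet_open n \<Omega> K S" "frechet_open n \<Omega> K T"
  shows "frechet_open n \<Omega> K (S \<inter> T)"
  unfolding frechet_open_def
proof (intro conjI ballI)
  show "S \<inter> T \<subseteq> test_funs_in n \<Omega> K" using assms unfolding frechet_open_def by blast
next
  fix \<phi> assume \<phi>: "\<phi> \<in> S \<inter> T"
  let ?s = "\<lambda>\<psi> \<alpha>. sup_abs \<Omega> (mderiv n \<alpha> (\<lambda>x\<in>\<Omega>. \<psi> x - \<phi> x))"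
  obtain N1 \<delta>1 where 1: "\<delta>1 > 0" "\<And>\<psi>. \<psi> \<in> test_funs_in n \<Omega> K \<Longrightarrow>
      (\<And>\<alpha>. mi_order n \<alpha> \<le> N1 \<Longrightarrow> ?s \<psi> \<alpha> < \<delta>1) \<Longrightarrow> \<psi> \<in> S"
    using assms(1) \<phi> unfolding frechet_open_def by (meson IntD1)
  obtain N2 \<delta>2 where 2: "\<delta>2 > 0" "\<And>\<psi>. \<psi> \<in> test_funs_in n \<Omega> K \<Longrightarrow>
      (\<And>\<alpha>. mi_order n \<alpha> \<le> N2 \<Longrightarrow> ?s \<psi> \<alpha> < \<delta>2) \<Longrightarrow> \<psi> \<in> T"
    using assms(2) \<phi> unfolding frechet_open_def by (meson IntD2)
  show "\<exists>N. \<exists>\<delta>>0. \<forall>\<psi>\<in>test_funs_in n \<Omega> K.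
      (\<forall>\<alpha>. mi_order n \<alpha> \<le> N \<longrightarrow> ?s \<psi> \<alpha> < \<delta>) \<longrightarrow> \<psi> \<in> S \<inter> T"
  proof (intro exI[of _ "max N1 N2"] exI[of _ "min \<delta>1 \<delta>2"] conjI ballI impI)
    show "0 < min \<delta>1 \<delta>2" using 1 2 by simp
    fix \<psi> assume *: "\<psi> \<in> test_funs_in n \<Omega> K"
      "\<forall>\<alpha>. mi_order n \<alpha> \<le> max N1 N2 \<longrightarrow> ?s \<psi> \<alpha> < min \<delta>1 \<delta>2"
    then show "\<psi> \<in> S \<inter> T" using 1(2)[of \<psi>] 2(2)[of \<psi>] by (simp add: le_max_iff_disj)
  qed
qed

lemma test_nhds_0_Int:
  assumes V: "V \<in> test_nhds_0 n \<Omega>" and W: "W \<in> test_nhds_0 n \<Omega>"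
  shows "V \<inter> W \<in> test_nhds_0 n \<Omega>"
  unfolding test_nhds_0_def mem_Collect_eq
proof (intro conjI ballI allI impI)
  note V' = V[unfolded test_nhds_0_def mem_Collect_eq]
  note W' = W[unfolded test_nhds_0_def mem_Collect_eq]
  show "V \<inter> W \<subseteq> test_funs n \<Omega>" using V'[THEN conjunct1] by (rule le_infI1)
  show "(\<lambda>x\<in>\<Omega>. 0) \<in> V \<inter> W" using V' W' by (intro IntI) (elim conjE; assumption)+
  show "(\<lambda>x\<in>\<Omega>. (1 - t) * \<phi> x + t * \<psi> x) \<in> V \<inter> W"
    if "\<phi> \<in> V \<inter> W" "\<psi> \<in> V \<inter> W" "t \<in> {0..1}" for \<phi> \<psi> and t :: real
    using V'[THEN conjunct2, THEN conjunct2, THEN conjunct1, THEN bspec, THEN bspec, THEN bspec,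
        of \<phi> \<psi> t]
      W'[THEN conjunct2, THEN conjunct2, THEN conjunct1, THEN bspec, THEN bspec, THEN bspec,
        of \<phi> \<psi> t] that by simp
  show "(\<lambda>x\<in>\<Omega>. c * \<phi> x) \<in> V \<inter> W" if "\<phi> \<in> V \<inter> W" "\<bar>c\<bar> \<le> 1" for \<phi> and c :: real
    using V'[THEN conjunct2, THEN conjunct2, THEN conjunct2, THEN conjunct1, THEN bspec, of \<phi>]
      W'[THEN conjunct2, THEN conjunct2, THEN conjunct2, THEN conjunct1, THEN bspec, of \<phi>] that
    by simp
  show "frechet_open n \<Omega> K (V \<inter> W \<inter> test_funs_in n \<Omega> K)" if "compact K \<and> K \<subseteq> \<Omega>" for K
  proof -
    have "frechet_open n \<Omega> K (V \<inter> test_funs_in n \<Omega> K)" "frechet_open n \<Omega> K (W \<inter> test_funs_in n \<Omega> K)"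
      using that V' W' by (elim conjE allE[of _ K]; simp)+
    then have "frechet_open n \<Omega> K ((V \<inter> test_funs_in n \<Omega> K) \<inter> (W \<inter> test_funs_in n \<Omega> K))"
      by (rule frechet_open_Int)
    moreover have "(V \<inter> test_funs_in n \<Omega> K) \<inter> (W \<inter> test_funs_in n \<Omega> K) =
        V \<inter> W \<inter> test_funs_in n \<Omega> K" by auto
    ultimately show ?thesis by simp
  qed
qed

lemma openin_test_topology:
  "openin (test_topology n \<Omega>) V \<longleftrightarrow> V \<subseteq> test_funs n \<Omega> \<and>
     (\<forall>\<phi>\<in>V. \<exists>W\<in>test_nhds_0 n \<Omega>. \<forall>\<psi>\<in>W. (\<lambda>x\<in>\<Omega>. \<phi> x + \<psi> x) \<in> V)"
proof -
  let ?P = "\<lambda>V. V \<subseteq> test_funs n \<Omega> \<and>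
    (\<forall>\<phi>\<in>V. \<exists>W\<in>test_nhds_0 n \<Omega>. \<forall>\<psi>\<in>W. (\<lambda>x\<in>\<Omega>. \<phi> x + \<psi> x) \<in> V)"
  have "istopology ?P"
    unfolding istopology_def
  proof (rule conjI; intro allI impI)
    fix S T assume S: "?P S" and T: "?P T"
    show "?P (S \<inter> T)"
    proof (intro conjI ballI)
      show "S \<inter> T \<subseteq> test_funs n \<Omega>" using S by blast
      fix \<phi> assume "\<phi> \<in> S \<inter> T"
      then obtain W1 W2 where "W1 \<in> test_nhds_0 n \<Omega>" "\<forall>\<psi>\<in>W1. (\<lambda>x\<in>\<Omega>. \<phi> x + \<psi> x) \<in> S"
        "W2 \<in> test_nhds_0 n \<Omega>" "\<forall>\<psi>\<in>W2. (\<lambda>x\<in>\<Omega>. \<phi> x + \<psi> x) \<in> T" using S T by blast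
      then show "\<exists>W\<in>test_nhds_0 n \<Omega>. \<forall>\<psi>\<in>W. (\<lambda>x\<in>\<Omega>. \<phi> x + \<psi> x) \<in> S \<inter> T"
        by (intro bexI[of _ "W1 \<inter> W2"] test_nhds_0_Int) auto
    qed
  next
    fix \<K> assume "\<forall>S\<in>\<K>. ?P S"
    then show "?P (\<Union>\<K>)" by (meson Union_iff Union_least)
  qed
  then show ?thesis by (simp add: test_topology_def topology_inverse')
qed

definition distributions :: "nat \<Rightarrow> rvec set \<Rightarrow> (rfun \<Rightarrow> real) set" where
  "distributions n \<Omega> = {l \<in> extensional (test_funs n \<Omega>).
     (\<forall>\<phi>\<in>test_funs n \<Omega>. \<forall>\<psi>\<in>test_funs n \<Omega>. l (\<lambda>x\<in>\<Omega>. \<phi> x + \<psi> x) = l \<phi> + l \<psi>) \<and>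
     (\<forall>c. \<forall>\<phi>\<in>test_funs n \<Omega>. l (\<lambda>x\<in>\<Omega>. c * \<phi> x) = c * l \<phi>) \<and>
     continuous_map (test_topology n \<Omega>) euclideanreal l}"

definition test_space :: "nat \<Rightarrow> rvec set \<Rightarrow> rfun dspace" where
  "test_space n \<Omega> = \<lparr>points = test_funs n \<Omega>,
     plots = (\<lambda>k U. {d \<in> U \<rightarrow>\<^sub>E test_funs n \<Omega>. openin (Euclidean_space k) U \<and>
       (\<forall>l\<in>distributions n \<Omega>. compose U l d \<in> Csmooth k U)})\<rparr>"

definition distribution_space :: "nat \<Rightarrow> rvec set \<Rightarrow> (rfun \<Rightarrow> real) dspace" where
  "distribution_space n \<Omega> = sub_space (distributions n \<Omega>) (fun_space (test_space n \<Omega>) real_space)"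

definition Csmooth_space :: "nat \<Rightarrow> rvec set \<Rightarrow> rfun dspace" where
  "Csmooth_space n \<Omega> = fun_space (eucl_space n \<Omega>) real_space"

definition rescale :: "nat \<Rightarrow> real \<Rightarrow> rfun \<Rightarrow> rfun" where
  "rescale n \<epsilon> \<phi> = (\<lambda>x\<in>Rn n. \<phi> (\<lambda>i. x i / \<epsilon>) / \<epsilon> ^ n)"


section \<open>The special Colombeau algebra\<close>

type_synonym net = "real \<Rightarrow> rfun"

definition eps_set :: "real set" where
  "eps_set = {0<..1}"

definition EM_s :: "nat \<Rightarrow> rvec set \<Rightarrow> net set" where
  "EM_s n \<Omega> = {u \<in> eps_set \<rightarrow>\<^sub>E Csmooth n \<Omega>. \<forall>K. compact K \<and> K \<subseteq> \<Omega> \<longrightarrow>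
     (\<forall>\<alpha>. \<exists>N::nat. (\<lambda>\<epsilon>. sup_abs K (mderiv n \<alpha> (u \<epsilon>))) \<in> O[at_right 0](\<lambda>\<epsilon>. 1 / \<epsilon> ^ N))}"

definition N_s :: "nat \<Rightarrow> rvec set \<Rightarrow> net set" where
  "N_s n \<Omega> = {u \<in> eps_set \<rightarrow>\<^sub>E Csmooth n \<Omega>. \<forall>K. compact K \<and> K \<subseteq> \<Omega> \<longrightarrow>
     (\<forall>\<alpha>. \<forall>m::nat. (\<lambda>\<epsilon>. sup_abs K (mderiv n \<alpha> (u \<epsilon>))) \<in> O[at_right 0](\<lambda>\<epsilon>. \<epsilon> ^ m))}"

definition rel_s :: "nat \<Rightarrow> rvec set \<Rightarrow> (net \<times> net) set" where
  "rel_s n \<Omega> = {(u, v). u \<in> EM_s n \<Omega> \<and> v \<in> EM_s n \<Omega> \<and>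
     (\<lambda>\<epsilon>\<in>eps_set. \<lambda>x\<in>\<Omega>. u \<epsilon> x - v \<epsilon> x) \<in> N_s n \<Omega>}"

definition G_s :: "nat \<Rightarrow> rvec set \<Rightarrow> net set dspace" where
  "G_s n \<Omega> = quot_space
     (sub_space (EM_s n \<Omega>) (fun_space (discrete_space eps_set) (Csmooth_space n \<Omega>))) (rel_s n \<Omega>)"

definition Alg_s :: "nat \<Rightarrow> rvec set \<Rightarrow> (real, net set) module" where
  "Alg_s n \<Omega> = \<lparr>carrier = EM_s n \<Omega> // rel_s n \<Omega>,
     mult = lift2 (rel_s n \<Omega>) (\<lambda>u v. \<lambda>\<epsilon>\<in>eps_set. \<lambda>x\<in>\<Omega>. u \<epsilon> x * v \<epsilon> x),
     one = rel_s n \<Omega> `` {\<lambda>\<epsilon>\<in>eps_set. \<lambda>x\<in>\<Omega>. 1},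
     zero = rel_s n \<Omega> `` {\<lambda>\<epsilon>\<in>eps_set. \<lambda>x\<in>\<Omega>. 0},
     add = lift2 (rel_s n \<Omega>) (\<lambda>u v. \<lambda>\<epsilon>\<in>eps_set. \<lambda>x\<in>\<Omega>. u \<epsilon> x + v \<epsilon> x),
     smult = (\<lambda>c. lift1 (rel_s n \<Omega>) (\<lambda>u. \<lambda>\<epsilon>\<in>eps_set. \<lambda>x\<in>\<Omega>. c * u \<epsilon> x))\<rparr>"

definition deriv_s :: "nat \<Rightarrow> rvec set \<Rightarrow> multi_index \<Rightarrow> net set \<Rightarrow> net set" where
  "deriv_s n \<Omega> \<alpha> = lift1 (rel_s n \<Omega>) (\<lambda>u. \<lambda>\<epsilon>\<in>eps_set. \<lambda>x\<in>\<Omega>. mderiv n \<alpha> (u \<epsilon>) x)"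

definition sigma_s :: "nat \<Rightarrow> rvec set \<Rightarrow> rfun \<Rightarrow> net set" where
  "sigma_s n \<Omega> f = rel_s n \<Omega> `` {\<lambda>\<epsilon>\<in>eps_set. f}"

definition mollifier_net :: "nat \<Rightarrow> net \<Rightarrow> bool" where
  "mollifier_net n \<psi> \<longleftrightarrow>
     (\<forall>\<epsilon>\<in>eps_set. \<psi> \<epsilon> \<in> test_funs n (Rn n)) \<and>
     (\<forall>\<epsilon>\<in>eps_set. \<forall>x\<in>supp_in (Rn n) (\<psi> \<epsilon>). L2_set x {..<n} < 1) \<and>
     (\<forall>\<epsilon>\<in>eps_set. integral_Rn n (\<psi> \<epsilon>) = 1) \<and>
     (\<forall>\<alpha>. \<exists>N::nat. (\<lambda>\<epsilon>. sup_abs (Rn n) (mderiv n \<alpha> (\<psi> \<epsilon>))) \<in> O[at_right 0](\<lambda>\<epsilon>. 1 / \<epsilon> ^ N)) \<and>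
     (\<forall>j::nat. \<exists>\<epsilon>0\<in>eps_set. \<forall>\<epsilon>\<in>{0<..\<epsilon>0}. \<forall>\<alpha>. 1 \<le> mi_order n \<alpha> \<and> mi_order n \<alpha> \<le> j \<longrightarrow>
        integral_Rn n (\<lambda>x. mi_power n x \<alpha> * \<psi> \<epsilon> x) = 0) \<and>
     (\<forall>\<eta>>0. \<exists>\<epsilon>0\<in>eps_set. \<forall>\<epsilon>\<in>{0<..\<epsilon>0}. integral_Rn n (\<lambda>x. \<bar>\<psi> \<epsilon> x\<bar>) \<le> 1 + \<eta>)"

text \<open>The function \<open>\<epsilon>\<^bsup>-n\<^esup> \<psi>\<^sub>\<epsilon>((x - \<cdot>)/\<epsilon>)\<close> is a test function on \<open>\<Omega>\<close> only for small \<open>\<epsilon>\<close>, uniformly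
  for \<open>x\<close> in a compact set. The value of the embedding is therefore the class of any moderate
  net of smooth functions on \<open>\<Omega>\<close> that eventually agrees with the regularization on each compact
  set; all such nets are equivalent.\<close>

definition iota_s :: "nat \<Rightarrow> rvec set \<Rightarrow> net \<Rightarrow> (rfun \<Rightarrow> real) \<Rightarrow> net set" where
  "iota_s n \<Omega> \<psi> T = \<Union>{rel_s n \<Omega> `` {w} | w. w \<in> EM_s n \<Omega> \<and>
     (\<forall>K. compact K \<and> K \<subseteq> \<Omega> \<longrightarrow> (\<exists>\<epsilon>0\<in>eps_set. \<forall>\<epsilon>\<in>{0<..\<epsilon>0}. \<forall>x\<in>K.
        w \<epsilon> x = T (\<lambda>y\<in>\<Omega>. rescale n \<epsilon> (\<psi> \<epsilon>) (\<lambda>i. x i - y i))))}"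


section \<open>The full Colombeau algebra\<close>

type_synonym ffun = "rfun \<times> rvec \<Rightarrow> real"

definition A0_set :: "nat \<Rightarrow> rfun set" where
  "A0_set n = {\<phi> \<in> test_funs n (Rn n). integral_Rn n \<phi> = 1}"

definition A_set :: "nat \<Rightarrow> nat \<Rightarrow> rfun set" where
  "A_set n q = {\<phi> \<in> A0_set n. \<forall>\<alpha>. 1 \<le> mi_order n \<alpha> \<and> mi_order n \<alpha> \<le> q \<longrightarrow>
     integral_Rn n (\<lambda>x. mi_power n x \<alpha> * \<phi> x) = 0}"

definition Omega_phi :: "nat \<Rightarrow> rvec set \<Rightarrow> rfun \<Rightarrow> rvec set" where
  "Omega_phi n \<Omega> \<phi> = {x \<in> \<Omega>. supp_in (Rn n) \<phi> \<subseteq> (\<lambda>y i. y i - x i) ` \<Omega>}"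

definition U_set :: "nat \<Rightarrow> rvec set \<Rightarrow> (rfun \<times> rvec) set" where
  "U_set n \<Omega> = {(\<phi>, x). \<phi> \<in> A0_set n \<and> x \<in> \<Omega> \<and> supp_in (Rn n) \<phi> \<subseteq> (\<lambda>y i. y i - x i) ` \<Omega>}"

definition U_space :: "nat \<Rightarrow> rvec set \<Rightarrow> (rfun \<times> rvec) dspace" where
  "U_space n \<Omega> = sub_space (U_set n \<Omega>) (prod_space (discrete_space (A0_set n)) (eucl_space n \<Omega>))"

definition E_e :: "nat \<Rightarrow> rvec set \<Rightarrow> ffun set" where
  "E_e n \<Omega> = {R \<in> extensional (U_set n \<Omega>).
     \<forall>\<phi>\<in>A0_set n. (\<lambda>x\<in>Omega_phi n \<Omega> \<phi>. R (\<phi>, x)) \<in> Csmooth n (Omega_phi n \<Omega> \<phi>)}"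

definition EM_e :: "nat \<Rightarrow> rvec set \<Rightarrow> ffun set" where
  "EM_e n \<Omega> = {R \<in> E_e n \<Omega>. \<forall>K. compact K \<and> K \<subseteq> \<Omega> \<longrightarrow> (\<forall>\<alpha>. \<exists>N. \<forall>\<phi>\<in>A_set n N.
     (\<lambda>\<epsilon>. sup_abs K (mderiv n \<alpha> (\<lambda>x. R (rescale n \<epsilon> \<phi>, x)))) \<in> O[at_right 0](\<lambda>\<epsilon>. 1 / \<epsilon> ^ N))}"

definition N_e :: "nat \<Rightarrow> rvec set \<Rightarrow> ffun set" where
  "N_e n \<Omega> = {R \<in> E_e n \<Omega>. \<forall>K. compact K \<and> K \<subseteq> \<Omega> \<longrightarrow> (\<forall>\<alpha>. \<forall>m::nat. \<exists>q. \<forall>\<phi>\<in>A_set n q.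
     (\<lambda>\<epsilon>. sup_abs K (mderiv n \<alpha> (\<lambda>x. R (rescale n \<epsilon> \<phi>, x)))) \<in> O[at_right 0](\<lambda>\<epsilon>. \<epsilon> ^ m))}"

definition rel_e :: "nat \<Rightarrow> rvec set \<Rightarrow> (ffun \<times> ffun) set" where
  "rel_e n \<Omega> = {(R, S). R \<in> EM_e n \<Omega> \<and> S \<in> EM_e n \<Omega> \<and>
     (\<lambda>p\<in>U_set n \<Omega>. R p - S p) \<in> N_e n \<Omega>}"

definition E_e_space :: "nat \<Rightarrow> rvec set \<Rightarrow> ffun dspace" where
  "E_e_space n \<Omega> = sub_space (E_e n \<Omega>) (fun_space (U_space n \<Omega>) real_space)"

definition G_e :: "nat \<Rightarrow> rvec set \<Rightarrow> ffun set dspace" where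
  "G_e n \<Omega> = quot_space (sub_space (EM_e n \<Omega>) (E_e_space n \<Omega>)) (rel_e n \<Omega>)"

definition Alg_e :: "nat \<Rightarrow> rvec set \<Rightarrow> (real, ffun set) module" where
  "Alg_e n \<Omega> = \<lparr>carrier = EM_e n \<Omega> // rel_e n \<Omega>,
     mult = lift2 (rel_e n \<Omega>) (\<lambda>R S. \<lambda>p\<in>U_set n \<Omega>. R p * S p),
     one = rel_e n \<Omega> `` {\<lambda>p\<in>U_set n \<Omega>. 1},
     zero = rel_e n \<Omega> `` {\<lambda>p\<in>U_set n \<Omega>. 0},
     add = lift2 (rel_e n \<Omega>) (\<lambda>R S. \<lambda>p\<in>U_set n \<Omega>. R p + S p),
     smult = (\<lambda>c. lift1 (rel_e n \<Omega>) (\<lambda>R. \<lambda>p\<in>U_set n \<Omega>. c * R p))\<rparr>"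

definition deriv_e :: "nat \<Rightarrow> rvec set \<Rightarrow> multi_index \<Rightarrow> ffun set \<Rightarrow> ffun set" where
  "deriv_e n \<Omega> \<alpha> =
     lift1 (rel_e n \<Omega>) (\<lambda>R. \<lambda>(\<phi>, x)\<in>U_set n \<Omega>. mderiv n \<alpha> (\<lambda>y. R (\<phi>, y)) x)"

definition sigma_e :: "nat \<Rightarrow> rvec set \<Rightarrow> rfun \<Rightarrow> ffun set" where
  "sigma_e n \<Omega> f = rel_e n \<Omega> `` {\<lambda>(\<phi>, x)\<in>U_set n \<Omega>. f x}"

definition iota_e :: "nat \<Rightarrow> rvec set \<Rightarrow> (rfun \<Rightarrow> real) \<Rightarrow> ffun set" where
  "iota_e n \<Omega> T =
     rel_e n \<Omega> `` {\<lambda>(\<phi>, x)\<in>U_set n \<Omega>. T (\<lambda>y\<in>\<Omega>. \<phi> (\<lambda>i. y i - x i))}"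

end

theory Submission
  imports Defs "HOL-Real_Asymp.Real_Asymp"
begin

text \<open>Sums, products, derivatives and \<open>\<sigma>\<close> are smooth because they are smooth on representatives.
  Smoothness does not make the addition continuous for the product topology, since the
  \<open>D\<close>-topology of a product may be finer. But \<open>exp (- (t / \<epsilon>)\<^sup>2)\<close> is
  negligible unless \<open>t = 0\<close>, which for any two classes gives a plot that is the first one at \<open>t = 0\<close>
  and the second one elsewhere; so the \<open>D\<close>-topology is indiscrete. The exception is
  the full algebra on a nonempty set in dimension 0, where rescaling is trivial and the algebra is
  the real line.

  For the embeddings, the kernel \<open>y \<mapsto> g (a (y - x))\<close> is a plot of test functions in \<open>x\<close>, and the
  \<open>i\<close>-th partial derivative of \<open>x \<mapsto> T (g (a (\<cdot> - x)))\<close> is \<open>- a\<close> times the same expression for the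
  \<open>i\<close>-th derivative of \<open>g\<close>; moderateness then follows from the seminorm estimate for \<open>T\<close>. In the
  special algebra the kernels leave \<open>\<Omega>\<close> for large \<open>\<epsilon>\<close>, so the representative is cut off smoothly
  along an exhaustion of \<open>\<Omega>\<close> by compact sets.\<close>

section \<open>Topology of the spaces \<open>Rn n\<close>\<close>

text \<open>Indices carry the discrete diffeology, so a plot has to be smooth in (u, x) for each
  index separately and nothing links different \<epsilon>. This is why a family may switch from one
  class to another as abruptly as exp (- (t / \<epsilon>)^2) does, and why the cutoffs may be chosen
  independently for each \<epsilon>. In the full algebra \<epsilon> is not part of the index; its
  inverse is replaced by the supremum of |\<phi>|, which rescaling multiplies by \<epsilon>^(-n). In
  dimension 0 this factor is 1, whence the exception. The functional diffeology makes a plot of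
  distributions smooth jointly with plots of test functions, and plots of test functions are tested
  by one distribution at a time. Joint smoothness in parameter and point therefore reduces to
  smoothness of x -> T (kernel at x) for a fixed T. Smoothness on \<open>Rn n\<close> is defined by
  iterated partial derivatives alone, so the chain rule and the symmetry of second derivatives are
  derived from the mean value theorem and the continuity of the partial derivatives.\<close>

lemma Rn_iff: "x \<in> Rn n \<longleftrightarrow> (\<forall>i\<ge>n. x i = 0)"
  by (simp add: topspace_Euclidean_space)

lemma Rn_upd: "x \<in> Rn n \<Longrightarrow> i < n \<Longrightarrow> x(i := t) \<in> Rn n"
  by (auto simp: Rn_iff)

text \<open>Boxes instead of balls: a basic open set of the product topology prescribes coordinates
  one by one, and from index \<open>n\<close> on the coordinates are fixed to 0.\<close>

definition obox :: "nat \<Rightarrow> rvec \<Rightarrow> real \<Rightarrow> rvec set" where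
  "obox n x r = {y \<in> Rn n. \<forall>i<n. \<bar>y i - x i\<bar> < r}"

lemma openin_Euclidean_open:
  "openin (Euclidean_space n) U \<longleftrightarrow> (\<exists>T. open T \<and> U = Rn n \<inter> T)"
proof -
  have "Euclidean_space n = top_of_set (Rn n)"
    by (simp add: Euclidean_space_def euclidean_product_topology topspace_Euclidean_space)
  then show ?thesis by (metis openin_open)
qed

lemma openin_Euclidean_subset: "openin (Euclidean_space n) U \<Longrightarrow> U \<subseteq> Rn n"
  by (rule openin_subset)

lemma openin_obox: "openin (Euclidean_space n) (obox n x r)"
proof -
  have "open {f :: rvec. \<forall>i\<in>{..<n}. f i \<in> {x i - r<..<x i + r}}"
    by (rule product_topology_basis'[of "{..<n}" "\<lambda>i. {x i - r<..<x i + r}" "\<lambda>i. i"]) auto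
  moreover have "obox n x r = Rn n \<inter> {f. \<forall>i\<in>{..<n}. f i \<in> {x i - r<..<x i + r}}"
    by (auto simp: obox_def abs_diff_less_iff)
  ultimately show ?thesis
    unfolding openin_Euclidean_open by blast
qed

lemma obox_mono: "r \<le> s \<Longrightarrow> obox n x r \<subseteq> obox n x s"
  by (auto simp: obox_def)

lemma obox_self: "x \<in> Rn n \<Longrightarrow> r > 0 \<Longrightarrow> x \<in> obox n x r"
  by (auto simp: obox_def)

lemma open_contains_obox:
  assumes "open T" "x \<in> T" "x \<in> Rn n"
  shows "\<exists>r>0. obox n x r \<subseteq> T"
proof -
  obtain X where X: "x \<in> Pi\<^sub>E UNIV X" "\<And>i. open (X i)" "Pi\<^sub>E UNIV X \<subseteq> T"
    using product_topology_open_contains_basis[of "\<lambda>i. euclidean" UNIV T x] assms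
    by (auto simp: euclidean_product_topology)
  have "\<exists>e>0. ball (x i) e \<subseteq> X i" for i
  proof -
    have "x i \<in> X i" using X(1) by (simp add: PiE_iff)
    then show ?thesis using X(2)[of i] by (simp add: open_contains_ball)
  qed
  then obtain e where e: "\<And>i. e i > 0" "\<And>i. ball (x i) (e i) \<subseteq> X i" by metis
  \<comment> \<open>Only the coordinates below \<open>n\<close> are free, so finitely many radii
    matter; the 1 keeps the minimum defined when \<open>n = 0\<close>.\<close>
  let ?r = "Min (insert 1 (e ` {..<n}))"
  have "?r > 0" using e(1) by (subst Min_gr_iff) auto
  moreover have "obox n x ?r \<subseteq> T"
  proof
    fix y assume y: "y \<in> obox n x ?r"
    have "y i \<in> X i" for i
    proof (cases "i < n")
      case True
      then have "\<bar>y i - x i\<bar> < e i" using y by (auto simp: obox_def)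
      then have "y i \<in> ball (x i) (e i)" by (metis abs_minus_commute dist_real_def mem_ball)
      then show ?thesis using e(2) by blast
    next
      case False
      then have "y i = x i" using y assms(3) by (simp add: obox_def Rn_iff)
      then show ?thesis using X(1) by (auto simp: PiE_iff)
    qed
    then show "y \<in> T" using X(3) by auto
  qed
  ultimately show ?thesis by blast
qed

lemma openin_Euclidean_iff:
  "openin (Euclidean_space n) U \<longleftrightarrow> U \<subseteq> Rn n \<and> (\<forall>x\<in>U. \<exists>r>0. obox n x r \<subseteq> U)"
proof
  assume U: "openin (Euclidean_space n) U"
  then obtain T where T: "open T" "U = Rn n \<inter> T"
    by (auto simp: openin_Euclidean_open)
  have "\<exists>r>0. obox n x r \<subseteq> U" if "x \<in> U" for x
    using open_contains_obox[OF T(1), of x n] that T(2) by (auto simp: obox_def)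
  then show "U \<subseteq> Rn n \<and> (\<forall>x\<in>U. \<exists>r>0. obox n x r \<subseteq> U)"
    using openin_Euclidean_subset[OF U] by blast
next
  assume *: "U \<subseteq> Rn n \<and> (\<forall>x\<in>U. \<exists>r>0. obox n x r \<subseteq> U)"
  have "\<exists>T. openin (Euclidean_space n) T \<and> x \<in> T \<and> T \<subseteq> U" if "x \<in> U" for x
    using * that openin_obox obox_self by (metis subsetD)
  then show "openin (Euclidean_space n) U" by (subst openin_subopen) blast
qed

lemma openin_EuclideanE:
  assumes "openin (Euclidean_space n) U" "x \<in> U"
  obtains r where "r > 0" "obox n x r \<subseteq> U"
  using assms by (auto simp: openin_Euclidean_iff)

lemma openin_Rn: "openin (Euclidean_space n) (Rn n)"
  by (rule openin_topspace)

lemma eventually_at_Rn: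
  assumes "U \<subseteq> Rn n" "x \<in> Rn n"
  shows "eventually P (at x within U) \<longleftrightarrow> (\<exists>r>0. \<forall>y\<in>U \<inter> obox n x r. y \<noteq> x \<longrightarrow> P y)"
proof
  assume "eventually P (at x within U)"
  then obtain S where S: "open S" "x \<in> S" "\<forall>y\<in>S. y \<noteq> x \<longrightarrow> y \<in> U \<longrightarrow> P y"
    by (auto simp: eventually_at_topological)
  obtain r where "r > 0" "obox n x r \<subseteq> S"
    using open_contains_obox[OF S(1,2)] assms by blast
  then show "\<exists>r>0. \<forall>y\<in>U \<inter> obox n x r. y \<noteq> x \<longrightarrow> P y" using S by blast
next
  assume "\<exists>r>0. \<forall>y\<in>U \<inter> obox n x r. y \<noteq> x \<longrightarrow> P y"
  then obtain r where r: "r > 0" "\<forall>y\<in>U \<inter> obox n x r. y \<noteq> x \<longrightarrow> P y" by blast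
  obtain S where S: "open S" "obox n x r = Rn n \<inter> S"
    using openin_obox[of n x r] by (auto simp: openin_Euclidean_open)
  have "x \<in> S" using obox_self[of x n r] S assms r by blast
  then show "eventually P (at x within U)"
    using r S assms by (auto simp: eventually_at_topological)
qed

lemma continuous_on_Rn_iff:
  fixes f :: "rvec \<Rightarrow> real"
  assumes "U \<subseteq> Rn n"
  shows "continuous_on U f \<longleftrightarrow>
    (\<forall>x\<in>U. \<forall>e>0. \<exists>r>0. \<forall>y\<in>U \<inter> obox n x r. \<bar>f y - f x\<bar> < e)"
proof -
  have "(f \<longlongrightarrow> f x) (at x within U) \<longleftrightarrow> (\<forall>e>0. \<exists>r>0. \<forall>y\<in>U \<inter> obox n x r. \<bar>f y - f x\<bar> < e)"
    if "x \<in> U" for x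
  proof -
    have "x \<in> Rn n" using that assms by blast
    \<comment> \<open>The centre may be included, since the difference is 0 there.\<close>
    moreover have "(\<forall>y\<in>S. y \<noteq> x \<longrightarrow> \<bar>f y - f x\<bar> < e) \<longleftrightarrow> (\<forall>y\<in>S. \<bar>f y - f x\<bar> < e)" if "e > 0" for S e
      using that by (metis abs_zero diff_self)
    ultimately show ?thesis
      by (simp add: tendsto_iff eventually_at_Rn[OF assms] dist_real_def)
  qed
  then show ?thesis by (simp add: continuous_on_def)
qed

lemma continuous_on_coord: "continuous_on S (\<lambda>x::rvec. x i)"
  by (rule continuous_on_subset[OF continuous_on_product_coordinates subset_UNIV])

lemma continuous_on_vecI:
  fixes g :: "'a::topological_space \<Rightarrow> rvec"
  assumes "g ` S \<subseteq> Rn n" "\<And>j. j < n \<Longrightarrow> continuous_on S (\<lambda>x. g x j)"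
  shows "continuous_on S g"
proof (rule continuous_on_coordinatewise_then_product)
  fix i show "continuous_on S (\<lambda>x. g x i)"
  proof (cases "i < n")
    case False
    then have "\<And>x. x \<in> S \<Longrightarrow> g x i = 0" using assms(1) by (auto simp: Rn_iff image_subset_iff)
    then show ?thesis by (simp cong: continuous_on_cong)
  qed (use assms in auto)
qed

text \<open>Openness relative to \<open>V\<close> is openness in \<open>Rn l\<close> because
  \<open>V\<close> is itself open there.\<close>

lemma openin_vimage_Euclidean:
  assumes "openin (Euclidean_space l) V" "continuous_on V g" "g ` V \<subseteq> Rn n"
    "openin (Euclidean_space n) U"
  shows "openin (Euclidean_space l) {v \<in> V. g v \<in> U}"
proof -
  obtain S where S: "open S" "V = Rn l \<inter> S" using assms(1) by (auto simp: openin_Euclidean_open)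
  obtain T where T: "open T" "U = Rn n \<inter> T"
    using assms(4) by (auto simp: openin_Euclidean_open)
  have "{v \<in> V. g v \<in> U} = V \<inter> g -` T" using T assms(3) by auto
  moreover have "openin (top_of_set V) (V \<inter> g -` T)"
    using assms(2) T(1) by (simp add: continuous_openin_preimage_gen)
  ultimately obtain R where "open R" "{v \<in> V. g v \<in> U} = V \<inter> R" by (auto simp: openin_open)
  then have "open (S \<inter> R) \<and> {v \<in> V. g v \<in> U} = Rn l \<inter> (S \<inter> R)" using S by auto
  then show ?thesis unfolding openin_Euclidean_open by blast
qed

text \<open>The closed neighbourhood of radius \<open>r\<close> in the maximum norm, that is the
  Minkowski sum of \<open>C\<close> and a cube. Adding the cube is a continuous map on a compact
  product, so compactness is preserved.\<close>

definition thick :: "nat \<Rightarrow> rvec set \<Rightarrow> real \<Rightarrow> rvec set" where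
  "thick n C r = {y \<in> Rn n. \<exists>c\<in>C. \<forall>i<n. \<bar>y i - c i\<bar> \<le> r}"

text \<open>Tychonoff: the set is a product of intervals and, from index \<open>n\<close> on, of
  singletons.\<close>

lemma compact_cbox_Rn: "compact {v \<in> Rn n. \<forall>i<n. \<bar>v i\<bar> \<le> (r::real)}"
proof -
  let ?S = "\<lambda>i. if i < n then {-r..r} else {0}"
  have "compactin (product_topology (\<lambda>i. euclidean) UNIV) (Pi\<^sub>E UNIV ?S)"
    by (subst compactin_PiE) simp
  moreover have "v \<in> Pi\<^sub>E UNIV ?S \<longleftrightarrow> v \<in> Rn n \<and> (\<forall>i<n. \<bar>v i\<bar> \<le> r)" for v
  proof -
    have "v i \<in> ?S i \<longleftrightarrow> (i \<ge> n \<longrightarrow> v i = 0) \<and> (i < n \<longrightarrow> \<bar>v i\<bar> \<le> r)" for i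
      by (simp add: abs_le_iff) linarith
    then show ?thesis unfolding PiE_UNIV_domain Pi_iff Rn_iff by (metis UNIV_I leI)
  qed
  then have "Pi\<^sub>E UNIV ?S = {v \<in> Rn n. \<forall>i<n. \<bar>v i\<bar> \<le> r}" by blast
  ultimately show ?thesis by (simp add: euclidean_product_topology)
qed

lemma compact_thick:
  assumes "compact C" "C \<subseteq> Rn n"
  shows "compact (thick n C r)"
proof -
  let ?B = "{v \<in> Rn n. \<forall>i<n. \<bar>v i\<bar> \<le> r}"
  have "compact ((\<lambda>(c, v) i. c i + v i :: real) ` (C \<times> ?B))"
  proof (intro compact_continuous_image compact_Times assms compact_cbox_Rn)
    have "continuous_on (C \<times> ?B) (\<lambda>p. fst p i + snd p i)" for i
      by (intro continuous_on_add continuous_on_product_then_coordinatewise[OF continuous_on_fst]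
          continuous_on_product_then_coordinatewise[OF continuous_on_snd] continuous_on_id)
    then show "continuous_on (C \<times> ?B) (\<lambda>(c, v) i. c i + v i :: real)"
      by (intro continuous_on_coordinatewise_then_product) (simp add: case_prod_unfold)
  qed
  moreover have "(\<lambda>(c, v) i. c i + v i :: real) ` (C \<times> ?B) = thick n C r"
  proof (intro equalityI subsetI)
    fix y assume "y \<in> thick n C r"
    then obtain c where c: "c \<in> C" "\<forall>i<n. \<bar>y i - c i\<bar> \<le> r" "y \<in> Rn n" by (auto simp: thick_def)
    have "(\<lambda>i. y i - c i) \<in> ?B" using c assms by (auto simp: Rn_iff)
    then show "y \<in> (\<lambda>(c, v) i. c i + v i :: real) ` (C \<times> ?B)"
      using c(1) by (intro image_eqI[of _ _ "(c, \<lambda>i. y i - c i)"]) auto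
  next
    fix y assume "y \<in> (\<lambda>(c, v) i. c i + v i :: real) ` (C \<times> ?B)"
    then obtain c v where cv: "c \<in> C" "v \<in> ?B" "y = (\<lambda>i. c i + v i)" by auto
    then have "y \<in> Rn n" using assms(2) by (auto simp: Rn_iff)
    moreover have "\<forall>i<n. \<bar>y i - c i\<bar> \<le> r" using cv by simp
    ultimately show "y \<in> thick n C r" using cv(1) by (auto simp: thick_def)
  qed
  ultimately show ?thesis by simp
qed

lemma thick_mono: "r \<le> s \<Longrightarrow> thick n C r \<subseteq> thick n C s"
  by (force simp: thick_def)

text \<open>A Lebesgue number argument: boxes of half the admissible radius around the points of
  \<open>C\<close> have a finite subcover.\<close>

lemma thick_subset_open:
  assumes "compact C" "C \<subseteq> U" "openin (Euclidean_space n) U"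
  obtains r where "r > 0" "thick n C r \<subseteq> U"
proof -
  have "\<exists>r>0. obox n c (2*r) \<subseteq> U" if "c \<in> C" for c
  proof -
    have "c \<in> U" using that assms(2) by blast
    then obtain r where "r > 0" "obox n c r \<subseteq> U" using openin_EuclideanE[OF assms(3)] by metis
    then have "r / 2 > 0 \<and> obox n c (2 * (r / 2)) \<subseteq> U" by simp
    then show ?thesis by blast
  qed
  then obtain r where r: "\<And>c. c \<in> C \<Longrightarrow> r c > 0" "\<And>c. c \<in> C \<Longrightarrow> obox n c (2 * r c) \<subseteq> U" by metis
  have C: "C \<subseteq> Rn n" using assms openin_Euclidean_subset by blast
  have "\<exists>S. open S \<and> obox n c (r c) = Rn n \<inter> S" for c
    using openin_obox[of n c "r c"] by (auto simp: openin_Euclidean_open)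
  then obtain S where S: "\<And>c. open (S c)" "\<And>c. obox n c (r c) = Rn n \<inter> S c" by metis
  have "\<And>c. c \<in> C \<Longrightarrow> c \<in> S c" using S(2) obox_self C r(1) by (metis IntD2 subsetD)
  then have "C \<subseteq> (\<Union>c\<in>C. S c)" by blast
  then obtain F where F: "F \<subseteq> C" "finite F" "C \<subseteq> (\<Union>c\<in>F. S c)"
    using compactE_image[OF assms(1), of C S] S(1) by metis
  \<comment> \<open>Every point of \<open>C\<close> is closer than \<open>r p\<close> to some centre
    \<open>p\<close>; halving makes the extra distance strictly less than \<open>r p\<close>, so the
    total stays below the radius \<open>2 * r p\<close> of a box inside \<open>U\<close>.\<close>
  let ?r = "Min (insert 1 (r ` F)) / 2"
  have "Min (insert 1 (r ` F)) > 0" using r(1) F(1,2) by (subst Min_gr_iff) auto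
  then have "?r > 0" by simp
  moreover have "thick n C ?r \<subseteq> U"
  proof
    fix y assume "y \<in> thick n C ?r"
    then obtain c where c: "c \<in> C" "\<forall>i<n. \<bar>y i - c i\<bar> \<le> ?r" "y \<in> Rn n" by (auto simp: thick_def)
    obtain p where p: "p \<in> F" "c \<in> S p" using c F by blast
    then have "c \<in> obox n p (r p)" using S(2) c C by blast
    moreover have "?r < r p"
    proof -
      have "Min (insert 1 (r ` F)) \<le> r p" using F(2) p(1) by (intro Min_le) auto
      then show ?thesis using \<open>?r > 0\<close> by linarith
    qed
    ultimately have "\<bar>y i - p i\<bar> < 2 * r p" if "i < n" for i
    proof -
      have "\<bar>y i - c i\<bar> \<le> ?r" "\<bar>c i - p i\<bar> < r p"
        using that c(2) \<open>c \<in> obox n p (r p)\<close> by (auto simp: obox_def)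
      then show ?thesis using \<open>?r < r p\<close> by linarith
    qed
    then have "y \<in> obox n p (2 * r p)" using c(3) by (simp add: obox_def)
    then show "y \<in> U" using r(2) p F by blast
  qed
  ultimately show ?thesis using that by blast
qed

lemma slice_eventually:
  assumes "openin (Euclidean_space n) U" "x \<in> U" "i < n"
  shows "eventually (\<lambda>t. x(i := t) \<in> U) (nhds (x i))"
proof -
  obtain r where r: "r > 0" "obox n x r \<subseteq> U" using openin_EuclideanE assms by blast
  have x: "x \<in> Rn n" using assms openin_Euclidean_subset by blast
  have "x(i := t) \<in> U" if "dist t (x i) < r" for t
    using that x r assms(3) by (auto simp: obox_def dist_real_def Rn_iff intro!: subsetD[OF r(2)])
  then show ?thesis using r(1) by (auto simp: eventually_nhds_metric)
qed

section \<open>Calculus of \<open>Ck_on\<close>\<close>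

text \<open>Relational form of \<open>pderiv_at\<close>: \<open>deriv\<close> has a value even where
  no derivative exists, so existence has to be carried along.\<close>

definition has_pd :: "nat \<Rightarrow> rfun \<Rightarrow> rvec \<Rightarrow> real \<Rightarrow> bool" where
  "has_pd i f x D \<longleftrightarrow> ((\<lambda>t. f (x(i := t))) has_real_derivative D) (at (x i))"

lemma has_pd_pderiv: "has_pd i f x D \<Longrightarrow> pderiv_at i f x = D"
  unfolding has_pd_def pderiv_at_def by (rule DERIV_imp_deriv)

lemma differentiable_has_pd:
  "(\<lambda>t. f (x(i := t))) differentiable (at (x i)) \<longleftrightarrow> has_pd i f x (pderiv_at i f x)"
  unfolding has_pd_def pderiv_at_def by (rule DERIV_deriv_iff_real_differentiable[symmetric])

lemma has_pd_cong:
  assumes "openin (Euclidean_space k) U" "x \<in> U" "i < k" "\<And>y. y \<in> U \<Longrightarrow> f y = g y"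
  shows "has_pd i f x D \<longleftrightarrow> has_pd i g x D"
  unfolding has_pd_def
  using slice_eventually[OF assms(1-3)]
  by (intro DERIV_cong_ev refl) (auto elim!: eventually_mono simp: assms(4))

lemma pderiv_at_cong:
  assumes "openin (Euclidean_space k) U" "x \<in> U" "i < k" "\<And>y. y \<in> U \<Longrightarrow> f y = g y"
  shows "pderiv_at i f x = pderiv_at i g x"
  unfolding pderiv_at_def
  using slice_eventually[OF assms(1-3)]
  by (intro deriv_cong_ev refl) (auto elim!: eventually_mono simp: assms(4))

lemma has_pd_const: "has_pd i (\<lambda>_. c) x 0"
  by (simp add: has_pd_def)

lemma has_pd_coord: "has_pd i (\<lambda>x. x j) x (if i = j then 1 else 0)"
  by (simp add: has_pd_def)

lemma has_pd_add: "has_pd i f x D \<Longrightarrow> has_pd i g x E \<Longrightarrow> has_pd i (\<lambda>x. f x + g x) x (D + E)"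
  unfolding has_pd_def by (rule DERIV_add)

lemma has_pd_mult:
  "has_pd i f x D \<Longrightarrow> has_pd i g x E \<Longrightarrow> has_pd i (\<lambda>x. f x * g x) x (D * g x + f x * E)"
  unfolding has_pd_def by (auto dest: DERIV_mult simp: algebra_simps)

lemma has_pd_cmult: "has_pd i f x D \<Longrightarrow> has_pd i (\<lambda>x. c * f x) x (c * D)"
  unfolding has_pd_def by (rule DERIV_cmult)

declare Ck_on.simps(2)[simp del]

lemma Ck_on_Suc:
  "Ck_on (Suc m) k U f \<longleftrightarrow> continuous_on U f \<and>
    (\<forall>i<k. (\<forall>x\<in>U. has_pd i f x (pderiv_at i f x)) \<and> Ck_on m k U (pderiv_at i f))"
  by (simp add: Ck_on.simps(2) differentiable_has_pd)

text \<open>On an open set partial derivatives depend only on values in that set. Extensional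
  functions can therefore be exchanged for plain ones at any order.\<close>

lemma Ck_on_cong:
  assumes "openin (Euclidean_space k) U" "\<And>y. y \<in> U \<Longrightarrow> f y = g y" "Ck_on m k U f"
  shows "Ck_on m k U g"
  using assms(2,3)
proof (induction m arbitrary: f g)
  case 0
  then show ?case by (simp cong: continuous_on_cong)
next
  case (Suc m)
  have eq: "pderiv_at i f x = pderiv_at i g x" if "i < k" "x \<in> U" for i x
    using that Suc.prems(1) by (intro pderiv_at_cong[OF assms(1)])
  have "continuous_on U g"
    using Suc.prems by (simp add: Ck_on_Suc cong: continuous_on_cong)
  moreover have "has_pd i g x (pderiv_at i g x)" if "i < k" "x \<in> U" for i x
  proof -
    have "has_pd i f x (pderiv_at i f x)" using Suc.prems(2) that by (simp add: Ck_on_Suc)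
    then show ?thesis
      using has_pd_cong[OF assms(1) that(2,1) Suc.prems(1)] eq[OF that] by simp
  qed
  moreover have "Ck_on m k U (pderiv_at i g)" if "i < k" for i
    using Suc.IH[of "pderiv_at i f" "pderiv_at i g"] eq[OF that] Suc.prems(2) that
    by (simp add: Ck_on_Suc)
  ultimately show ?case by (simp add: Ck_on_Suc)
qed

text \<open>The partial derivatives may be given by explicit formulas \<open>g i\<close>, so closure
  properties follow by induction on the order.\<close>

lemma Ck_on_SucI:
  assumes "openin (Euclidean_space k) U" "continuous_on U f"
    "\<And>i x. i < k \<Longrightarrow> x \<in> U \<Longrightarrow> has_pd i f x (g i x)" "\<And>i. i < k \<Longrightarrow> Ck_on m k U (g i)"
  shows "Ck_on (Suc m) k U f"
proof -
  have eq: "pderiv_at i f x = g i x" if "i < k" "x \<in> U" for i x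
    using that assms(3) by (intro has_pd_pderiv)
  have "Ck_on m k U (pderiv_at i f)" if "i < k" for i
    using eq[OF that] by (intro Ck_on_cong[OF assms(1) _ assms(4)[OF that]]) simp
  then show ?thesis using assms(2,3) eq by (simp add: Ck_on_Suc)
qed

lemma Ck_on_SucD:
  assumes "Ck_on (Suc m) k U f"
  shows "continuous_on U f" "\<And>i x. i < k \<Longrightarrow> x \<in> U \<Longrightarrow> has_pd i f x (pderiv_at i f x)"
    "\<And>i. i < k \<Longrightarrow> Ck_on m k U (pderiv_at i f)"
  using assms by (simp_all add: Ck_on_Suc)

lemma Ck_on_continuous: "Ck_on m k U f \<Longrightarrow> continuous_on U f"
  by (cases m) (simp_all add: Ck_on_Suc)

lemma Ck_on_subset: "Ck_on m k U f \<Longrightarrow> W \<subseteq> U \<Longrightarrow> Ck_on m k W f"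
proof (induction m arbitrary: f)
  case (Suc m)
  then show ?case by (auto simp: Ck_on_Suc intro: continuous_on_subset)
qed (auto intro: continuous_on_subset)

lemma Ck_on_less: "Ck_on (Suc m) k U f \<Longrightarrow> Ck_on m k U f"
proof (induction m arbitrary: f)
  case 0
  then show ?case by (simp add: Ck_on_Suc)
next
  case (Suc m)
  then show ?case by (subst Ck_on_Suc) (simp add: Ck_on_SucD)
qed

text \<open>Continuity and differentiability are local properties. This is what makes families that
  are described piecewise on an open cover smooth.\<close>

lemma Ck_on_local:
  assumes "openin (Euclidean_space k) U"
    "\<And>x. x \<in> U \<Longrightarrow> \<exists>W. openin (Euclidean_space k) W \<and> x \<in> W \<and> Ck_on m k W f"
  shows "Ck_on m k U f"
  using assms(2)
proof (induction m arbitrary: f)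
  case 0
  have U: "U \<subseteq> Rn k" using assms(1) by (rule openin_Euclidean_subset)
  have "\<exists>r>0. \<forall>y\<in>U \<inter> obox k x r. \<bar>f y - f x\<bar> < e" if x: "x \<in> U" and e: "e > 0" for x e
  proof -
    obtain W where W: "openin (Euclidean_space k) W" "x \<in> W" "continuous_on W f"
      using 0[OF x] by auto
    obtain r where r: "r > 0" "obox k x r \<subseteq> W" using openin_EuclideanE[OF W(1,2)] .
    obtain s where s: "s > 0" "\<forall>y\<in>W \<inter> obox k x s. \<bar>f y - f x\<bar> < e"
      using W(2,3) e continuous_on_Rn_iff[OF openin_Euclidean_subset[OF W(1)], of f] by metis
    have "obox k x (min r s) \<subseteq> W \<inter> obox k x s" using r(2) by (auto simp: obox_def)
    then have "\<forall>y\<in>U \<inter> obox k x (min r s). \<bar>f y - f x\<bar> < e" using s(2) by blast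
    moreover have "min r s > 0" using r(1) s(1) by simp
    ultimately show ?thesis by blast
  qed
  then show ?case by (simp add: continuous_on_Rn_iff[OF U])
next
  case (Suc m)
  have c: "Ck_on m k U f"
  proof (rule Suc.IH)
    show "\<exists>W. openin (Euclidean_space k) W \<and> x \<in> W \<and> Ck_on m k W f" if "x \<in> U" for x
      using Suc.prems[OF that] Ck_on_less by blast
  qed
  have "has_pd i f x (pderiv_at i f x)" if "i < k" "x \<in> U" for i x
    using Suc.prems[OF that(2)] Ck_on_SucD(2) that by blast
  moreover have "Ck_on m k U (pderiv_at i f)" if "i < k" for i
  proof (rule Suc.IH)
    show "\<exists>W. openin (Euclidean_space k) W \<and> x \<in> W \<and> Ck_on m k W (pderiv_at i f)" if "x \<in> U" for x
      using Suc.prems[OF that] Ck_on_SucD(3) \<open>i < k\<close> by blast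
  qed
  ultimately show ?case using Ck_on_continuous[OF c] by (simp add: Ck_on_Suc)
qed

lemma Ck_on_const: "openin (Euclidean_space k) U \<Longrightarrow> Ck_on m k U (\<lambda>_. c)"
proof (induction m arbitrary: c)
  case (Suc m)
  show ?case by (rule Ck_on_SucI[OF Suc.prems _ has_pd_const]) (use Suc in auto)
qed simp

lemma Ck_on_coord: "openin (Euclidean_space k) U \<Longrightarrow> Ck_on m k U (\<lambda>x. x j)"
proof (cases m)
  case (Suc m')
  assume "openin (Euclidean_space k) U"
  then show ?thesis unfolding Suc
    by (intro Ck_on_SucI[OF _ _ has_pd_coord] continuous_on_coord Ck_on_const)
qed (simp add: continuous_on_coord)

lemma Ck_on_add:
  assumes "openin (Euclidean_space k) U"
  shows "Ck_on m k U f \<Longrightarrow> Ck_on m k U g \<Longrightarrow> Ck_on m k U (\<lambda>x. f x + g x)"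
proof (induction m arbitrary: f g)
  case (Suc m)
  show ?case
  proof (rule Ck_on_SucI[OF assms])
    show "continuous_on U (\<lambda>x. f x + g x)"
      using Suc.prems by (intro continuous_on_add Ck_on_SucD(1))
    show "has_pd i (\<lambda>x. f x + g x) x (pderiv_at i f x + pderiv_at i g x)" if "i < k" "x \<in> U" for i x
      using Suc.prems that by (intro has_pd_add Ck_on_SucD(2))
    show "Ck_on m k U (\<lambda>x. pderiv_at i f x + pderiv_at i g x)" if "i < k" for i
      using Suc.prems that by (intro Suc.IH Ck_on_SucD(3))
  qed
qed (auto intro: continuous_on_add)

lemma Ck_on_mult:
  assumes "openin (Euclidean_space k) U"
  shows "Ck_on m k U f \<Longrightarrow> Ck_on m k U g \<Longrightarrow> Ck_on m k U (\<lambda>x. f x * g x)"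
proof (induction m arbitrary: f g)
  case (Suc m)
  show ?case
  proof (rule Ck_on_SucI[OF assms])
    show "continuous_on U (\<lambda>x. f x * g x)"
      using Suc.prems by (intro continuous_on_mult Ck_on_SucD(1))
    show "has_pd i (\<lambda>x. f x * g x) x (pderiv_at i f x * g x + f x * pderiv_at i g x)"
      if "i < k" "x \<in> U" for i x
      using Suc.prems that by (intro has_pd_mult Ck_on_SucD(2))
    show "Ck_on m k U (\<lambda>x. pderiv_at i f x * g x + f x * pderiv_at i g x)" if "i < k" for i
      by (intro Ck_on_add[OF assms] Suc.IH Ck_on_less[OF Suc.prems(1)] Ck_on_less[OF Suc.prems(2)]
          Ck_on_SucD(3)[OF Suc.prems(1) that] Ck_on_SucD(3)[OF Suc.prems(2) that])
  qed
qed (auto intro: continuous_on_mult)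

lemma Ck_on_sum:
  assumes "openin (Euclidean_space k) U" "\<And>j. j \<in> J \<Longrightarrow> Ck_on m k U (f j)"
  shows "Ck_on m k U (\<lambda>x. \<Sum>j\<in>J. f j x)"
  using assms(2)
  by (induction J rule: infinite_finite_induct)
    (auto intro: Ck_on_const Ck_on_add assms(1))

lemma Ck_on_prod:
  assumes "openin (Euclidean_space k) U" "\<And>j. j \<in> J \<Longrightarrow> Ck_on m k U (f j)"
  shows "Ck_on m k U (\<lambda>x. \<Prod>j\<in>J. f j x)"
  using assms(2)
  by (induction J rule: infinite_finite_induct)
    (auto intro: Ck_on_const Ck_on_mult assms(1))

text \<open>\<open>D\<close> is a sequence of successive derivatives. The claim is proved for all
  \<open>j\<close> at once, since the chain rule leads from \<open>D j\<close> to
  \<open>D (Suc j)\<close>.\<close>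

lemma Ck_on_real_comp:
  assumes "openin (Euclidean_space k) U"
    "\<And>m t. (D m has_real_derivative D (Suc m) t) (at t)"
  shows "Ck_on m k U f \<Longrightarrow> Ck_on m k U (\<lambda>x. D j (f x))"
proof (induction m arbitrary: f j)
  case 0
  have "continuous_on UNIV (D j)" using assms(2) by (blast intro: DERIV_continuous_on)
  then show ?case using 0 by (auto intro: continuous_on_compose2)
next
  case (Suc m)
  show ?case
  proof (rule Ck_on_SucI[OF assms(1)])
    have "continuous_on UNIV (D j)" using assms(2) by (blast intro: DERIV_continuous_on)
    then show "continuous_on U (\<lambda>x. D j (f x))"
      using Suc.prems by (auto intro: continuous_on_compose2 Ck_on_SucD(1))
    show "has_pd i (\<lambda>x. D j (f x)) x (D (Suc j) (f x) * pderiv_at i f x)" if "i < k" "x \<in> U" for i x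
    proof -
      have "has_pd i f x (pderiv_at i f x)" using Suc.prems that by (intro Ck_on_SucD(2))
      then show ?thesis
        using DERIV_chain2[of "D j" _ "\<lambda>t. f (x(i := t))" "x i"] assms(2) by (simp add: has_pd_def)
    qed
    show "Ck_on m k U (\<lambda>x. D (Suc j) (f x) * pderiv_at i f x)" if "i < k" for i
      by (intro Ck_on_mult[OF assms(1)] Suc.IH Ck_on_less[OF Suc.prems] Ck_on_SucD(3)[OF Suc.prems that])
  qed
qed

text \<open>The derivative is a product of \<open>pderiv_at i f\<close> and two copies of the
  inverse itself, and the latter is covered by the induction hypothesis at one order less.\<close>

lemma Ck_on_inverse:
  assumes "openin (Euclidean_space k) U" "\<And>x. x \<in> U \<Longrightarrow> f x \<noteq> 0"
  shows "Ck_on m k U f \<Longrightarrow> Ck_on m k U (\<lambda>x. inverse (f x))"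
proof (induction m)
  case 0
  then show ?case using assms(2) by (auto intro: continuous_on_inverse)
next
  case (Suc m)
  have IH: "Ck_on m k U (\<lambda>x. inverse (f x))" using Suc Ck_on_less by blast
  show ?case
  proof (rule Ck_on_SucI[OF assms(1)])
    show "continuous_on U (\<lambda>x. inverse (f x))" using IH by (rule Ck_on_continuous)
    show "has_pd i (\<lambda>x. inverse (f x)) x (- 1 * (inverse (f x) * (pderiv_at i f x * inverse (f x))))"
      if "i < k" "x \<in> U" for i x
    proof -
      have "has_pd i f x (pderiv_at i f x)" using Suc.prems that by (intro Ck_on_SucD(2))
      then show ?thesis
        using DERIV_inverse'[of "\<lambda>t. f (x(i := t))" "pderiv_at i f x" "x i" UNIV] assms(2)[OF that(2)]
        by (simp add: has_pd_def mult.assoc)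
    qed
    show "Ck_on m k U (\<lambda>x. - 1 * (inverse (f x) * (pderiv_at i f x * inverse (f x))))" if "i < k" for i
      using Suc.prems that by (intro Ck_on_mult[OF assms(1)] IH Ck_on_SucD(3) Ck_on_const assms(1))
  qed
qed

subsection \<open>Mean value theorem and chain rule\<close>

lemma mvt_segment:
  fixes h :: "real \<Rightarrow> real"
  assumes "\<And>t. t \<in> closed_segment a b \<Longrightarrow> (h has_real_derivative h' t) (at t)"
  shows "\<exists>z\<in>closed_segment a b. h b - h a = h' z * (b - a)"
proof -
  consider "a < b" | "b < a" | "a = b" by linarith
  then show ?thesis
  proof cases
    case 1
    then obtain z where "a < z" "z < b" "h b - h a = (b - a) * h' z"
      using MVT2[of a b h h'] assms by (auto simp: closed_segment_eq_real_ivl)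
    then show ?thesis using 1 by (intro bexI[of _ z]) (auto simp: closed_segment_eq_real_ivl)
  next
    case 2
    then obtain z where "b < z" "z < a" "h a - h b = (a - b) * h' z"
      using MVT2[of b a h h'] assms by (auto simp: closed_segment_eq_real_ivl)
    then show ?thesis using 2 by (intro bexI[of _ z]) (auto simp: closed_segment_eq_real_ivl algebra_simps)
  qed auto
qed

text \<open>Coordinates are changed one at a time, each change being an instance of the mean value
  theorem in one variable. The intermediate points lie in the coordinate box spanned by
  \<open>x\<close> and \<open>y\<close> but in general not on their segment; hence the assumption
  \<open>hull\<close>.\<close>

lemma mvt_telescope:
  assumes xy: "x \<in> Rn k" "y \<in> Rn k"
    and hull: "\<And>z. (\<And>i. z i \<in> closed_segment (x i) (y i)) \<Longrightarrow> z \<in> U"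
    and pd: "\<And>i z. i < k \<Longrightarrow> z \<in> U \<Longrightarrow> has_pd i f z (g i z)"
  shows "\<exists>\<xi>. (\<forall>j<k. \<forall>i. \<xi> j i \<in> closed_segment (x i) (y i)) \<and>
    f y - f x = (\<Sum>j<k. g j (\<xi> j) * (y j - x j))"
proof -
  define w where "w m = (\<lambda>i. if i < m then y i else x i)" for m :: nat
  have "\<exists>\<xi>. (\<forall>i. \<xi> i \<in> closed_segment (x i) (y i)) \<and> f (w (Suc j)) - f (w j) = g j \<xi> * (y j - x j)"
    if "j < k" for j
  proof -
    let ?z = "\<lambda>t. (w j)(j := t)"
    have z: "?z t i \<in> closed_segment (x i) (y i)" if "t \<in> closed_segment (x j) (y j)" for t i
      using that by (simp add: w_def)
    have "((\<lambda>t. f (?z t)) has_real_derivative g j (?z t)) (at t)"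
      if "t \<in> closed_segment (x j) (y j)" for t
    proof -
      have "has_pd j f (?z t) (g j (?z t))" using z[OF that] by (intro pd hull \<open>j < k\<close>)
      then show ?thesis by (simp add: has_pd_def)
    qed
    then obtain t where t: "t \<in> closed_segment (x j) (y j)"
      "f (?z (y j)) - f (?z (x j)) = g j (?z t) * (y j - x j)"
      using mvt_segment[of "x j" "y j" "\<lambda>t. f (?z t)" "\<lambda>t. g j (?z t)"] by blast
    have "?z (y j) = w (Suc j)" "?z (x j) = w j" by (auto simp: w_def less_Suc_eq)
    then show ?thesis using t z[OF t(1)] by metis
  qed
  then obtain \<xi> where \<xi>: "\<And>j i. j < k \<Longrightarrow> \<xi> j i \<in> closed_segment (x i) (y i)"
    "\<And>j. j < k \<Longrightarrow> f (w (Suc j)) - f (w j) = g j (\<xi> j) * (y j - x j)" by metis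
  have "w 0 = x" by (simp add: w_def)
  moreover have "w k = y" using xy by (auto simp: w_def Rn_iff)
  ultimately have "f y - f x = (\<Sum>j<k. f (w (Suc j)) - f (w j))"
    using sum_lessThan_telescope[of "\<lambda>m. f (w m)" k] by simp
  also have "\<dots> = (\<Sum>j<k. g j (\<xi> j) * (y j - x j))" using \<xi>(2) by simp
  finally show ?thesis using \<xi>(1) by blast
qed

lemma segment_obox:
  assumes "y \<in> obox k x r" "x \<in> Rn k" "\<And>i. z i \<in> closed_segment (x i) (y i)"
  shows "z \<in> obox k x r"
proof -
  have "z i = 0" if "i \<ge> k" for i
    using assms(3)[of i] assms(1,2) that by (simp add: obox_def Rn_iff)
  moreover have "\<bar>z i - x i\<bar> < r" if "i < k" for i
    using assms(3)[of i] assms(1) that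
    by (auto simp: obox_def closed_segment_eq_real_ivl split: if_splits)
  ultimately show ?thesis by (simp add: obox_def Rn_iff)
qed

text \<open>Continuous partial derivatives give total differentiability: the telescoped mean value
  theorem writes the increment with partial derivatives at intermediate points, which converge to
  \<open>c t0\<close>.\<close>

lemma chain_rule_curve:
  fixes c :: "real \<Rightarrow> rvec"
  assumes U: "openin (Euclidean_space k) U" "c t0 \<in> U"
    and ev: "eventually (\<lambda>t. c t \<in> Rn k) (nhds t0)"
    and c: "\<And>j. j < k \<Longrightarrow> ((\<lambda>t. c t j) has_real_derivative c' j) (at t0)"
    and pd: "\<And>i z. i < k \<Longrightarrow> z \<in> U \<Longrightarrow> has_pd i f z (g i z)"
    and g: "\<And>i. i < k \<Longrightarrow> continuous_on U (g i)"
  shows "((\<lambda>t. f (c t)) has_real_derivative (\<Sum>j<k. g j (c t0) * c' j)) (at t0)"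
proof -
  let ?x = "c t0"
  have x: "?x \<in> Rn k" using U openin_Euclidean_subset by blast
  obtain r where r: "r > 0" "obox k ?x r \<subseteq> U" using openin_EuclideanE[OF U] .
  have near: "eventually (\<lambda>t. c t \<in> obox k ?x s) (at t0)" if "s > 0" for s
  proof -
    have "eventually (\<lambda>t. \<bar>c t i - ?x i\<bar> < s) (at t0)" if "i < k" for i
    proof -
      have "((\<lambda>t. c t i) \<longlongrightarrow> c t0 i) (at t0)"
        using DERIV_isCont[OF c[OF that]] by (simp add: isCont_def)
      then show ?thesis using \<open>s > 0\<close> by (simp add: tendsto_iff dist_real_def)
    qed
    then have "eventually (\<lambda>t. \<forall>i\<in>{..<k}. \<bar>c t i - ?x i\<bar> < s) (at t0)"
      by (intro eventually_ball_finite) auto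
    moreover have "eventually (\<lambda>t. c t \<in> Rn k) (at t0)"
      using ev unfolding eventually_at_filter by (rule eventually_mono) simp
    ultimately show ?thesis by eventually_elim (auto simp: obox_def)
  qed
  \<comment> \<open>The implication is put under the quantifier so that intermediate points can be
    chosen as one function of \<open>t\<close>.\<close>
  have "\<exists>\<xi>. c t \<in> obox k ?x r \<longrightarrow> (\<forall>j<k. \<forall>i. \<xi> j i \<in> closed_segment (?x i) (c t i)) \<and>
    f (c t) - f ?x = (\<Sum>j<k. g j (\<xi> j) * (c t j - ?x j))" for t
  proof (cases "c t \<in> obox k ?x r")
    case True
    have "\<exists>\<xi>. (\<forall>j<k. \<forall>i. \<xi> j i \<in> closed_segment (?x i) (c t i)) \<and>
      f (c t) - f ?x = (\<Sum>j<k. g j (\<xi> j) * (c t j - ?x j))"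
    proof (rule mvt_telescope[where U = U])
      show "c t \<in> Rn k" using True by (simp add: obox_def)
      show "z \<in> U" if "\<And>i. z i \<in> closed_segment (?x i) (c t i)" for z
        using segment_obox[OF True x that] r(2) by blast
    qed (use x pd in auto)
    then show ?thesis by blast
  qed simp
  then obtain \<xi> where \<xi>: "\<And>t j i. c t \<in> obox k ?x r \<Longrightarrow> j < k \<Longrightarrow> \<xi> t j i \<in> closed_segment (?x i) (c t i)"
    "\<And>t. c t \<in> obox k ?x r \<Longrightarrow> f (c t) - f ?x = (\<Sum>j<k. g j (\<xi> t j) * (c t j - ?x j))"
    by metis
  have lim: "((\<lambda>t. g j (\<xi> t j)) \<longlongrightarrow> g j ?x) (at t0)" if j: "j < k" for j
    unfolding tendsto_iff
  proof (intro allI impI)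
    fix e :: real assume "e > 0"
    then obtain s where s: "s > 0" "\<forall>y\<in>U \<inter> obox k ?x s. \<bar>g j y - g j ?x\<bar> < e"
      using g[OF j] U(2) continuous_on_Rn_iff[OF openin_Euclidean_subset[OF U(1)], of "g j"] by metis
    have "eventually (\<lambda>t. c t \<in> obox k ?x (min r s)) (at t0)" using r(1) s(1) by (intro near) simp
    then show "eventually (\<lambda>t. dist (g j (\<xi> t j)) (g j ?x) < e) (at t0)"
    proof eventually_elim
      case (elim t)
      then have "c t \<in> obox k ?x r" by (auto simp: obox_def)
      then have "\<xi> t j \<in> obox k ?x (min r s)" using segment_obox[OF elim x] \<xi>(1)[OF _ j] by blast
      then have "\<xi> t j \<in> U \<inter> obox k ?x s" using r(2) by (auto simp: obox_def)
      then show ?case using s(2) by (simp add: dist_real_def)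
    qed
  qed
  have q: "((\<lambda>t. (c t j - ?x j) / (t - t0)) \<longlongrightarrow> c' j) (at t0)" if "j < k" for j
    using c[OF that] by (simp add: has_field_derivative_iff)
  have "((\<lambda>t. \<Sum>j<k. g j (\<xi> t j) * ((c t j - ?x j) / (t - t0))) \<longlongrightarrow> (\<Sum>j<k. g j ?x * c' j)) (at t0)"
    by (intro tendsto_sum tendsto_mult lim q) simp_all
  moreover have "eventually (\<lambda>t. (\<Sum>j<k. g j (\<xi> t j) * ((c t j - ?x j) / (t - t0))) =
      (f (c t) - f ?x) / (t - t0)) (at t0)"
    using near[OF r(1)] by eventually_elim (simp add: \<xi>(2) sum_divide_distrib)
  ultimately show ?thesis
    unfolding has_field_derivative_iff by (rule Lim_transform_eventually)
qed

text \<open>The induction keeps \<open>g\<close> fixed and varies \<open>f\<close>, because the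
  chain rule produces the partial derivatives of \<open>f\<close> composed with the same
  \<open>g\<close>.\<close>

lemma Ck_on_compose:
  assumes V: "openin (Euclidean_space l) V" and U: "openin (Euclidean_space k) U"
    and gU: "g ` V \<subseteq> U"
  shows "Ck_on m k U f \<Longrightarrow> (\<And>j. j < k \<Longrightarrow> Ck_on m l V (\<lambda>x. g x j)) \<Longrightarrow> Ck_on m l V (\<lambda>x. f (g x))"
proof (induction m arbitrary: f)
  case 0
  have "continuous_on V g"
    using 0(2) gU openin_Euclidean_subset[OF U] by (intro continuous_on_vecI[of _ _ k]) auto
  then show ?case using 0(1) gU continuous_on_compose2[of U f V g] by simp
next
  case (Suc m)
  note f = Ck_on_SucD[OF Suc.prems(1)]
  show ?case
  proof (rule Ck_on_SucI[OF V])
    have "continuous_on V g"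
      using Ck_on_continuous[OF Suc.prems(2)] gU openin_Euclidean_subset[OF U]
      by (intro continuous_on_vecI[of _ _ k]) auto
    then show "continuous_on V (\<lambda>x. f (g x))" using f(1) gU continuous_on_compose2[of U f V g] by simp
    show "has_pd i (\<lambda>x. f (g x)) x (\<Sum>j<k. pderiv_at j f (g x) * pderiv_at i (\<lambda>x. g x j) x)"
      if "i < l" "x \<in> V" for i x
    proof -
      have "((\<lambda>t. f (g (x(i := t)))) has_real_derivative
        (\<Sum>j<k. pderiv_at j f (g (x(i := x i))) * pderiv_at i (\<lambda>x. g x j) x)) (at (x i))"
      proof (rule chain_rule_curve[OF U])
        show "g (x(i := x i)) \<in> U" using that gU by auto
        show "eventually (\<lambda>t. g (x(i := t)) \<in> Rn k) (nhds (x i))"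
          using slice_eventually[OF V that(2,1)] gU openin_Euclidean_subset[OF U]
          by (auto elim!: eventually_mono)
        show "((\<lambda>t. g (x(i := t)) j) has_real_derivative pderiv_at i (\<lambda>x. g x j) x) (at (x i))"
          if "j < k" for j
          using Ck_on_SucD(2)[OF Suc.prems(2)[OF that] \<open>i < l\<close> \<open>x \<in> V\<close>] by (simp add: has_pd_def)
        show "has_pd j f z (pderiv_at j f z)" if "j < k" "z \<in> U" for j z using f(2) that .
        show "continuous_on U (pderiv_at j f)" if "j < k" for j
          using f(3)[OF that] by (rule Ck_on_continuous)
      qed
      then show ?thesis by (simp add: has_pd_def)
    qed
    show "Ck_on m l V (\<lambda>x. \<Sum>j<k. pderiv_at j f (g x) * pderiv_at i (\<lambda>x. g x j) x)" if i: "i < l" for i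
    proof (rule Ck_on_sum[OF V], rule Ck_on_mult[OF V])
      fix j assume "j \<in> {..<k}"
      then have j: "j < k" by simp
      show "Ck_on m l V (\<lambda>x. pderiv_at j f (g x))"
        by (rule Suc.IH[OF f(3)[OF j]]) (rule Ck_on_less[OF Suc.prems(2)])
      show "Ck_on m l V (pderiv_at i (\<lambda>x. g x j))"
        by (rule Ck_on_SucD(3)[OF Suc.prems(2)[OF j] i])
    qed
  qed
qed

subsection \<open>Symmetry of second derivatives\<close>

text \<open>The mean value theorem in direction \<open>i\<close>, applied to the increment
  \<open>?\<phi>\<close> in direction \<open>j\<close>, and then once more in direction
  \<open>j\<close>.\<close>

lemma second_difference:
  assumes U: "openin (Euclidean_space k) U" "obox k x r \<subseteq> U" "x \<in> Rn k" and f: "Ck_on 2 k U f"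
    and ij: "i < k" "j < k" "i \<noteq> j" and h: "0 < h" "h < r"
  shows "\<exists>\<xi>\<in>obox k x r. f (x(i := x i + h, j := x j + h)) - f (x(i := x i + h)) - f (x(j := x j + h)) + f x
    = h^2 * pderiv_at j (pderiv_at i f) \<xi>"
proof -
  have in_box: "x(i := s, j := t) \<in> obox k x r" if "s \<in> {x i..x i + h}" "t \<in> {x j..x j + h}" for s t
    using that U(3) ij h by (auto simp: obox_def Rn_iff)
  note f1 = Ck_on_SucD[OF f[unfolded numeral_2_eq_2]]
  note f2 = Ck_on_SucD[OF f1(3)[OF ij(1)]]
  let ?\<phi> = "\<lambda>s. f (x(i := s, j := x j + h)) - f (x(i := s, j := x j))"
  let ?\<phi>' = "\<lambda>s. pderiv_at i f (x(i := s, j := x j + h)) - pderiv_at i f (x(i := s, j := x j))"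
  have d1: "((\<lambda>s. f (x(i := s, j := t))) has_real_derivative pderiv_at i f (x(i := s, j := t))) (at s)"
    if "s \<in> {x i..x i + h}" "t \<in> {x j..x j + h}" for s t
  proof -
    have "x(i := s, j := t) \<in> U" using in_box[OF that] U(2) by blast
    then have "has_pd i f (x(i := s, j := t)) (pderiv_at i f (x(i := s, j := t)))" by (intro f1(2) ij)
    moreover have "(\<lambda>u. f ((x(i := s, j := t))(i := u))) = (\<lambda>u. f (x(i := u, j := t)))"
      using ij(3) by (simp add: fun_upd_twist)
    ultimately show ?thesis using ij(3) by (simp add: has_pd_def)
  qed
  have seg: "closed_segment a (a + h) = {a..a + h}" for a
    using h by (simp add: closed_segment_eq_real_ivl)
  have "(?\<phi> has_real_derivative ?\<phi>' s) (at s)" if "s \<in> {x i..x i + h}" for s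
    using that h by (intro DERIV_diff d1) auto
  then obtain s where s: "s \<in> {x i..x i + h}" "?\<phi> (x i + h) - ?\<phi> (x i) = h * ?\<phi>' s"
    using mvt_segment[of "x i" "x i + h" ?\<phi> ?\<phi>', unfolded seg] by (auto simp: mult.commute)
  have "((\<lambda>t. pderiv_at i f (x(i := s, j := t))) has_real_derivative
      pderiv_at j (pderiv_at i f) (x(i := s, j := t))) (at t)" if "t \<in> {x j..x j + h}" for t
  proof -
    have "x(i := s, j := t) \<in> U" using in_box[OF s(1) that] U(2) by blast
    then have "has_pd j (pderiv_at i f) (x(i := s, j := t)) (pderiv_at j (pderiv_at i f) (x(i := s, j := t)))"
      by (intro f2(2) ij)
    then show ?thesis by (simp add: has_pd_def)
  qed
  then obtain t where t: "t \<in> {x j..x j + h}"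
    "?\<phi>' s = h * pderiv_at j (pderiv_at i f) (x(i := s, j := t))"
    using mvt_segment[of "x j" "x j + h" "\<lambda>t. pderiv_at i f (x(i := s, j := t))"
        "\<lambda>t. pderiv_at j (pderiv_at i f) (x(i := s, j := t))", unfolded seg] by (auto simp: mult.commute)
  have "?\<phi> (x i + h) - ?\<phi> (x i) = h^2 * pderiv_at j (pderiv_at i f) (x(i := s, j := t))"
    unfolding s(2) t(2) by (simp add: power2_eq_square)
  moreover have "x(i := x i + h, j := x j) = x(i := x i + h)" "x(i := x i, j := x j + h) = x(j := x j + h)"
    "x(i := x i, j := x j) = x" using ij(3) by auto
  ultimately show ?thesis using in_box[OF s(1) t(1)] by (intro bexI) auto
qed

text \<open>Both mixed derivatives, taken at points close to \<open>x\<close>, equal the same second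
  difference quotient; continuity transfers the equality to \<open>x\<close>.\<close>

lemma pderiv_commute:
  assumes U: "openin (Euclidean_space k) U" "x \<in> U" and f: "Ck_on 2 k U f" and ij: "i < k" "j < k"
  shows "pderiv_at i (pderiv_at j f) x = pderiv_at j (pderiv_at i f) x"
proof (cases "i = j")
  case False
  have x: "x \<in> Rn k" using U openin_Euclidean_subset by blast
  let ?A = "pderiv_at i (pderiv_at j f)" and ?B = "pderiv_at j (pderiv_at i f)"
  note f1 = Ck_on_SucD(3)[OF f[unfolded numeral_2_eq_2]]
  have cont: "continuous_on U ?A" "continuous_on U ?B"
    using Ck_on_SucD(3)[OF f1] ij by auto
  have "\<bar>?A x - ?B x\<bar> \<le> e" if "e > 0" for e
  proof -
    have e: "e / 2 > 0" using that by simp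
    obtain r0 where r0: "r0 > 0" "obox k x r0 \<subseteq> U" using openin_EuclideanE[OF U] .
    obtain r1 where r1: "r1 > 0" "\<forall>y\<in>U \<inter> obox k x r1. \<bar>?A y - ?A x\<bar> < e / 2"
      using cont(1) U(2) e continuous_on_Rn_iff[OF openin_Euclidean_subset[OF U(1)], of ?A] by metis
    obtain r2 where r2: "r2 > 0" "\<forall>y\<in>U \<inter> obox k x r2. \<bar>?B y - ?B x\<bar> < e / 2"
      using cont(2) U(2) e continuous_on_Rn_iff[OF openin_Euclidean_subset[OF U(1)], of ?B] by metis
    define r where "r = min r0 (min r1 r2)"
    have r: "r > 0" "r \<le> r0" "r \<le> r1" "r \<le> r2" using r0 r1 r2 by (auto simp: r_def)
    have sub: "obox k x r \<subseteq> U" using obox_mono[OF r(2)] r0(2) by blast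
    obtain \<xi> where \<xi>: "\<xi> \<in> obox k x r" "f (x(i := x i + r/2, j := x j + r/2)) - f (x(i := x i + r/2))
      - f (x(j := x j + r/2)) + f x = (r/2)^2 * ?B \<xi>"
      using second_difference[OF U(1) sub x f ij False, of "r/2"] r(1) by auto
    obtain \<zeta> where \<zeta>: "\<zeta> \<in> obox k x r" "f (x(j := x j + r/2, i := x i + r/2)) - f (x(j := x j + r/2))
      - f (x(i := x i + r/2)) + f x = (r/2)^2 * ?A \<zeta>"
      using second_difference[OF U(1) sub x f ij(2,1), of "r/2"] r(1) False by auto
    \<comment> \<open>The second difference is symmetric in the two directions.\<close>
    have eq: "x(j := x j + r/2, i := x i + r/2) = x(i := x i + r/2, j := x j + r/2)"
      using False by (rule fun_upd_twist[symmetric])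
    have "(r/2)^2 * ?B \<xi> = (r/2)^2 * ?A \<zeta>" using \<xi>(2) \<zeta>(2) unfolding eq by linarith
    then have "?B \<xi> = ?A \<zeta>" using r(1) by simp
    moreover have "\<bar>?B \<xi> - ?B x\<bar> < e / 2"
      using r2(2) \<xi>(1) sub obox_mono[OF r(4)] by blast
    moreover have "\<bar>?A \<zeta> - ?A x\<bar> < e / 2"
      using r1(2) \<zeta>(1) sub obox_mono[OF r(3)] by blast
    ultimately show ?thesis by linarith
  qed
  then have "\<bar>?A x - ?B x\<bar> \<le> 0" using field_le_epsilon[of "\<bar>?A x - ?B x\<bar>" 0] by simp
  then show ?thesis by simp
qed simp

subsection \<open>Iterated partial derivatives\<close>

text \<open>\<open>Csmooth\<close> without extensionality, so that plain lambda terms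
  qualify.\<close>

definition smooth_on :: "nat \<Rightarrow> rvec set \<Rightarrow> rfun \<Rightarrow> bool" where
  "smooth_on k U f \<longleftrightarrow> (\<forall>m. Ck_on m k U f)"

lemma Csmooth_iff: "f \<in> Csmooth k U \<longleftrightarrow> f \<in> extensional U \<and> smooth_on k U f"
  by (simp add: Csmooth_def smooth_on_def)

lemma smooth_on_cong:
  "openin (Euclidean_space k) U \<Longrightarrow> (\<And>y. y \<in> U \<Longrightarrow> f y = g y) \<Longrightarrow> smooth_on k U f \<Longrightarrow> smooth_on k U g"
  unfolding smooth_on_def using Ck_on_cong by blast

lemma restrict_Csmooth:
  assumes "openin (Euclidean_space k) U"
  shows "restrict f U \<in> Csmooth k U \<longleftrightarrow> smooth_on k U f"
  using smooth_on_cong[OF assms, of f "restrict f U"] smooth_on_cong[OF assms, of "restrict f U" f]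
  by (auto simp: Csmooth_iff)

lemma smooth_on_continuous: "smooth_on k U f \<Longrightarrow> continuous_on U f"
  unfolding smooth_on_def using Ck_on_continuous by blast

lemma smooth_on_subset: "smooth_on k U f \<Longrightarrow> W \<subseteq> U \<Longrightarrow> smooth_on k W f"
  unfolding smooth_on_def using Ck_on_subset by blast

lemma smooth_on_local:
  assumes "openin (Euclidean_space k) U"
    "\<And>x. x \<in> U \<Longrightarrow> \<exists>W. openin (Euclidean_space k) W \<and> x \<in> W \<and> smooth_on k W f"
  shows "smooth_on k U f"
  unfolding smooth_on_def
proof (intro allI Ck_on_local[OF assms(1)])
  fix m x assume "x \<in> U"
  then show "\<exists>W. openin (Euclidean_space k) W \<and> x \<in> W \<and> Ck_on m k W f"
    using assms(2)[of x] unfolding smooth_on_def by blast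
qed

context
  fixes k U assumes U: "openin (Euclidean_space k) U"
begin

lemma smooth_on_const: "smooth_on k U (\<lambda>_. c)"
  by (simp add: smooth_on_def Ck_on_const[OF U])

lemma smooth_on_coord: "smooth_on k U (\<lambda>x. x j)"
  by (simp add: smooth_on_def Ck_on_coord[OF U])

lemma smooth_on_add: "smooth_on k U f \<Longrightarrow> smooth_on k U g \<Longrightarrow> smooth_on k U (\<lambda>x. f x + g x)"
  by (simp add: smooth_on_def Ck_on_add[OF U])

lemma smooth_on_mult: "smooth_on k U f \<Longrightarrow> smooth_on k U g \<Longrightarrow> smooth_on k U (\<lambda>x. f x * g x)"
  by (simp add: smooth_on_def Ck_on_mult[OF U])

lemma smooth_on_cmult: "smooth_on k U f \<Longrightarrow> smooth_on k U (\<lambda>x. c * f x)"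
  by (intro smooth_on_mult smooth_on_const)

lemma smooth_on_diff: "smooth_on k U f \<Longrightarrow> smooth_on k U g \<Longrightarrow> smooth_on k U (\<lambda>x. f x - g x)"
  using smooth_on_add[of f "\<lambda>x. - 1 * g x"] smooth_on_cmult[of g "- 1"] by simp

lemma smooth_on_prod: "(\<And>j. j \<in> J \<Longrightarrow> smooth_on k U (f j)) \<Longrightarrow> smooth_on k U (\<lambda>x. \<Prod>j\<in>J. f j x)"
  by (simp add: smooth_on_def Ck_on_prod[OF U])

lemma smooth_on_real_comp:
  "(\<And>m t. (D m has_real_derivative D (Suc m) t) (at t)) \<Longrightarrow> smooth_on k U f \<Longrightarrow>
    smooth_on k U (\<lambda>x. D j (f x))"
  by (simp add: smooth_on_def Ck_on_real_comp[OF U])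

lemma smooth_on_exp: "smooth_on k U f \<Longrightarrow> smooth_on k U (\<lambda>x. exp (f x))"
  by (rule smooth_on_real_comp[of "\<lambda>_. exp" f 0]) (auto intro: DERIV_exp)

lemma smooth_on_inverse:
  "(\<And>x. x \<in> U \<Longrightarrow> f x \<noteq> 0) \<Longrightarrow> smooth_on k U f \<Longrightarrow> smooth_on k U (\<lambda>x. inverse (f x))"
  by (simp add: smooth_on_def Ck_on_inverse[OF U])

lemma has_pd_smooth: "smooth_on k U f \<Longrightarrow> i < k \<Longrightarrow> x \<in> U \<Longrightarrow> has_pd i f x (pderiv_at i f x)"
  using Ck_on_SucD(2) unfolding smooth_on_def by blast

lemma smooth_on_pderiv: "smooth_on k U f \<Longrightarrow> i < k \<Longrightarrow> smooth_on k U (pderiv_at i f)"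
  using Ck_on_SucD(3) unfolding smooth_on_def by blast

end

lemma smooth_on_compose:
  assumes "openin (Euclidean_space l) V" "openin (Euclidean_space k) U" "g ` V \<subseteq> U"
    "smooth_on k U f" "\<And>j. j < k \<Longrightarrow> smooth_on l V (\<lambda>x. g x j)"
  shows "smooth_on l V (\<lambda>x. f (g x))"
  unfolding smooth_on_def
proof
  fix m show "Ck_on m l V (\<lambda>x. f (g x))"
    by (rule Ck_on_compose[OF assms(1-3)]) (use assms(4,5) in \<open>auto simp: smooth_on_def\<close>)
qed

text \<open>Iterated derivatives along a list of directions. Lists can be extended at either end,
  which suits inductions better than multi-indices; on smooth functions only the number of
  occurrences of each direction matters.\<close>

primrec pd :: "nat list \<Rightarrow> rfun \<Rightarrow> rfun" where
  "pd [] f = f"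
| "pd (i # L) f = pderiv_at i (pd L f)"

lemma pd_append: "pd (L @ M) f = pd L (pd M f)"
  by (induction L) auto

lemma pd_replicate: "pd (replicate a i) f = (pderiv_at i ^^ a) f"
  by (induction a) auto

lemma smooth_on_pd:
  "openin (Euclidean_space k) U \<Longrightarrow> smooth_on k U f \<Longrightarrow> set L \<subseteq> {..<k} \<Longrightarrow> smooth_on k U (pd L f)"
  by (induction L) (auto intro: smooth_on_pderiv)

lemma pd_cong:
  assumes "openin (Euclidean_space k) U" "\<And>y. y \<in> U \<Longrightarrow> f y = g y" "set L \<subseteq> {..<k}" "x \<in> U"
  shows "pd L f x = pd L g x"
  using assms(3,4)
proof (induction L arbitrary: x)
  case (Cons i L)
  then show ?case using pderiv_at_cong[OF assms(1), of x i "pd L f" "pd L g"] by simp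
qed (use assms(2) in simp)

definition mi_list :: "nat \<Rightarrow> multi_index \<Rightarrow> nat list" where
  "mi_list n \<alpha> = concat (map (\<lambda>i. replicate (\<alpha> i) i) (rev [0..<n]))"

lemma mderiv_eq_pd: "mderiv n \<alpha> f = pd (mi_list n \<alpha>) f"
  by (induction n) (simp_all add: mi_list_def pd_append pd_replicate)

lemma set_mi_list: "set (mi_list n \<alpha>) \<subseteq> {..<n}"
  by (auto simp: mi_list_def)

lemma length_mi_list: "length (mi_list n \<alpha>) = mi_order n \<alpha>"
  by (induction n) (simp_all add: mi_list_def mi_order_def)

lemma pderiv_commute_pd:
  assumes U: "openin (Euclidean_space k) U" and f: "smooth_on k U f"
    and i: "i < k" and L: "set L \<subseteq> {..<k}" and x: "x \<in> U"
  shows "pderiv_at i (pd L f) x = pd L (pderiv_at i f) x"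
  using L x
proof (induction L arbitrary: x)
  case (Cons j L)
  have s: "smooth_on k U (pd L f)" using Cons.prems by (intro smooth_on_pd[OF U f]) auto
  have "pderiv_at i (pderiv_at j (pd L f)) x = pderiv_at j (pderiv_at i (pd L f)) x"
    using s Cons.prems i by (intro pderiv_commute[OF U]) (auto simp: smooth_on_def)
  also have "\<dots> = pderiv_at j (pd L (pderiv_at i f)) x"
    using Cons by (intro pderiv_at_cong[OF U]) auto
  finally show ?case by simp
qed simp

lemma mderiv_upd:
  assumes "n \<le> i" shows "mderiv n (\<alpha>(i := a)) f = mderiv n \<alpha> f"
  using assms by (induction n) auto

text \<open>\<open>mderiv\<close> applies the higher directions last, so a new derivative in
  direction \<open>i\<close> has to be moved inwards past all directions above
  \<open>i\<close>.\<close>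

lemma pderiv_mderiv:
  assumes U: "openin (Euclidean_space k) U" and f: "smooth_on k U f"
  shows "i < n \<Longrightarrow> n \<le> k \<Longrightarrow> x \<in> U \<Longrightarrow>
    pderiv_at i (mderiv n \<alpha> f) x = mderiv n (\<alpha>(i := Suc (\<alpha> i))) f x"
proof (induction n arbitrary: x)
  case (Suc n)
  show ?case
  proof (cases "i = n")
    case True
    then show ?thesis using mderiv_upd[of n n \<alpha> "Suc (\<alpha> n)" f] by (simp add: fun_upd_def)
  next
    case False
    have s: "smooth_on k U (mderiv n \<alpha> f)"
      unfolding mderiv_eq_pd using set_mi_list[of n \<alpha>] Suc.prems by (intro smooth_on_pd[OF U f]) auto
    let ?R = "replicate (\<alpha> n) n"
    have "pderiv_at i (pd ?R (mderiv n \<alpha> f)) x = pd ?R (pderiv_at i (mderiv n \<alpha> f)) x"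
      using Suc.prems by (intro pderiv_commute_pd[OF U s]) auto
    also have "\<dots> = pd ?R (mderiv n (\<alpha>(i := Suc (\<alpha> i))) f) x"
      using Suc False by (intro pd_cong[OF U]) (auto simp: fun_upd_def)
    finally show ?thesis using False by (simp add: pd_replicate fun_upd_def)
  qed
qed simp

lemma pd_eq_mderiv:
  assumes U: "openin (Euclidean_space n) U" and f: "smooth_on n U f" "set L \<subseteq> {..<n}" "x \<in> U"
  shows "pd L f x = mderiv n (count_list L) f x"
  using f(2,3)
proof (induction L arbitrary: x)
  case Nil
  have "mderiv m (\<lambda>_. 0) f = f" for m by (induction m) auto
  then show ?case by (simp add: fun_eq_iff)
next
  case (Cons i L)
  have "pderiv_at i (pd L f) x = pderiv_at i (mderiv n (count_list L) f) x"
    using Cons by (intro pderiv_at_cong[OF U]) auto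
  also have "\<dots> = mderiv n ((count_list L)(i := Suc (count_list L i))) f x"
    using Cons.prems by (intro pderiv_mderiv[OF U f(1)]) auto
  also have "(count_list L)(i := Suc (count_list L i)) = count_list (i # L)" by auto
  finally show ?case by simp
qed

lemma mi_order_count_list: "set L \<subseteq> {..<n} \<Longrightarrow> mi_order n (count_list L) = length L"
  unfolding mi_order_def
  by (metis finite_lessThan sum_count_set)

section \<open>Bounds for all derivatives up to a given order\<close>

text \<open>Quantifying over lists makes the passage from a function to its derivatives
  (\<open>bnd_Suc\<close>, \<open>bnd_pd\<close>) a matter of list operations, without any appeal to
  symmetry and hence to smoothness.\<close>

definition bnd :: "nat \<Rightarrow> nat \<Rightarrow> rvec set \<Rightarrow> rfun \<Rightarrow> real \<Rightarrow> bool" where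
  "bnd n m K f c \<longleftrightarrow> (\<forall>L. set L \<subseteq> {..<n} \<longrightarrow> length L \<le> m \<longrightarrow> (\<forall>x\<in>K. \<bar>pd L f x\<bar> \<le> c))"

lemma bndD: "bnd n m K f c \<Longrightarrow> set L \<subseteq> {..<n} \<Longrightarrow> length L \<le> m \<Longrightarrow> x \<in> K \<Longrightarrow> \<bar>pd L f x\<bar> \<le> c"
  by (simp add: bnd_def)

lemma bnd_0: "bnd n m K f c \<Longrightarrow> x \<in> K \<Longrightarrow> \<bar>f x\<bar> \<le> c"
  using bndD[of n m K f c "[]"] by simp

lemma bnd_mono: "bnd n m K f c \<Longrightarrow> m' \<le> m \<Longrightarrow> K' \<subseteq> K \<Longrightarrow> c \<le> c' \<Longrightarrow> bnd n m' K' f c'"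
  unfolding bnd_def by (meson order_trans subsetD)

lemma bnd_cong:
  assumes "openin (Euclidean_space n) U" "K \<subseteq> U" "\<And>y. y \<in> U \<Longrightarrow> f y = g y"
  shows "bnd n m K f c \<longleftrightarrow> bnd n m K g c"
proof -
  have "pd L f x = pd L g x" if "set L \<subseteq> {..<n}" "x \<in> K" for L x
    using that assms(2) by (intro pd_cong[OF assms(1,3)]) auto
  then show ?thesis by (simp add: bnd_def)
qed

lemma bnd_Suc:
  "bnd n (Suc m) K f c \<longleftrightarrow> (\<forall>x\<in>K. \<bar>f x\<bar> \<le> c) \<and> (\<forall>i<n. bnd n m K (pderiv_at i f) c)"
proof
  assume *: "bnd n (Suc m) K f c"
  have "bnd n m K (pderiv_at i f) c" if "i < n" for i
    unfolding bnd_def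
  proof (intro allI impI ballI)
    fix L x assume "set L \<subseteq> {..<n}" "length L \<le> m" "x \<in> K"
    then show "\<bar>pd L (pderiv_at i f) x\<bar> \<le> c"
      using bndD[OF *, of "L @ [i]" x] that by (simp add: pd_append)
  qed
  then show "(\<forall>x\<in>K. \<bar>f x\<bar> \<le> c) \<and> (\<forall>i<n. bnd n m K (pderiv_at i f) c)"
    using bnd_0[OF *] by blast
next
  assume *: "(\<forall>x\<in>K. \<bar>f x\<bar> \<le> c) \<and> (\<forall>i<n. bnd n m K (pderiv_at i f) c)"
  show "bnd n (Suc m) K f c"
    unfolding bnd_def
  proof (intro allI impI ballI)
    fix L x assume L: "set L \<subseteq> {..<n}" "length L \<le> Suc m" "x \<in> K"
    show "\<bar>pd L f x\<bar> \<le> c"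
    \<comment> \<open>The derivative applied first is the last element of the list.\<close>
    proof (cases L rule: rev_cases)
      case Nil
      then show ?thesis using * L(3) by simp
    next
      case (snoc M i)
      then have "bnd n m K (pderiv_at i f) c" using * L(1) by auto
      then show ?thesis using bndD[of n m K "pderiv_at i f" c M x] snoc L by (simp add: pd_append)
    qed
  qed
qed

lemma bnd_zero: "bnd n 0 K f c \<longleftrightarrow> (\<forall>x\<in>K. \<bar>f x\<bar> \<le> c)"
  by (auto simp: bnd_def)

lemma bnd_pd:
  assumes "bnd n (m + length M) K f c" "set M \<subseteq> {..<n}"
  shows "bnd n m K (pd M f) c"
  unfolding bnd_def
proof (intro allI impI ballI)
  fix L x assume "set L \<subseteq> {..<n}" "length L \<le> m" "x \<in> K"
  then show "\<bar>pd L (pd M f) x\<bar> \<le> c"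
    using bndD[OF assms(1), of "L @ M" x] assms(2) by (simp add: pd_append)
qed

context
  fixes n W K
  assumes W: "openin (Euclidean_space n) W" and K: "K \<subseteq> W"
begin

lemma bnd_add:
  "smooth_on n W f \<Longrightarrow> smooth_on n W g \<Longrightarrow> bnd n m K f a \<Longrightarrow> bnd n m K g b \<Longrightarrow>
    bnd n m K (\<lambda>x. f x + g x) (a + b)"
proof (induction m arbitrary: f g)
  case 0
  then show ?case unfolding bnd_zero by (meson abs_triangle_ineq add_mono order_trans)
next
  case (Suc m)
  have "\<bar>f x + g x\<bar> \<le> a + b" if "x \<in> K" for x
    using bnd_0[OF Suc.prems(3) that] bnd_0[OF Suc.prems(4) that] by linarith
  moreover have "bnd n m K (pderiv_at i (\<lambda>x. f x + g x)) (a + b)" if i: "i < n" for i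
  proof -
    have eq: "pderiv_at i f x + pderiv_at i g x = pderiv_at i (\<lambda>x. f x + g x) x" if "x \<in> W" for x
      by (intro has_pd_pderiv[symmetric] has_pd_add has_pd_smooth[OF W _ i that] Suc.prems)
    have "bnd n m K (\<lambda>x. pderiv_at i f x + pderiv_at i g x) (a + b)"
      using Suc.prems i by (intro Suc.IH smooth_on_pderiv[OF W]) (auto simp: bnd_Suc)
    moreover have "bnd n m K (\<lambda>x. pderiv_at i f x + pderiv_at i g x) (a + b) \<longleftrightarrow>
        bnd n m K (pderiv_at i (\<lambda>x. f x + g x)) (a + b)"
      by (rule bnd_cong[OF W K]) (rule eq)
    ultimately show ?thesis by simp
  qed
  ultimately show ?case by (simp add: bnd_Suc)
qed

lemma bnd_cmult:
  "smooth_on n W f \<Longrightarrow> bnd n m K f a \<Longrightarrow> bnd n m K (\<lambda>x. c * f x) (\<bar>c\<bar> * a)"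
proof (induction m arbitrary: f)
  case 0
  then show ?case by (auto simp: bnd_zero abs_mult intro: mult_left_mono)
next
  case (Suc m)
  have "\<bar>c * f x\<bar> \<le> \<bar>c\<bar> * a" if "x \<in> K" for x
    using bnd_0[OF Suc.prems(2) that] by (simp add: abs_mult mult_left_mono)
  moreover have "bnd n m K (pderiv_at i (\<lambda>x. c * f x)) (\<bar>c\<bar> * a)" if i: "i < n" for i
  proof -
    have eq: "c * pderiv_at i f x = pderiv_at i (\<lambda>x. c * f x) x" if "x \<in> W" for x
      by (intro has_pd_pderiv[symmetric] has_pd_cmult has_pd_smooth[OF W _ i that] Suc.prems)
    have "bnd n m K (\<lambda>x. c * pderiv_at i f x) (\<bar>c\<bar> * a)"
      using Suc.prems i by (intro Suc.IH smooth_on_pderiv[OF W]) (auto simp: bnd_Suc)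
    moreover have "bnd n m K (\<lambda>x. c * pderiv_at i f x) (\<bar>c\<bar> * a) \<longleftrightarrow>
        bnd n m K (pderiv_at i (\<lambda>x. c * f x)) (\<bar>c\<bar> * a)"
      by (rule bnd_cong[OF W K]) (rule eq)
    ultimately show ?thesis by simp
  qed
  ultimately show ?case by (simp add: bnd_Suc)
qed

text \<open>The factor \<open>2 ^ m\<close> counts the terms of the Leibniz rule: each
  differentiation doubles their number.\<close>

lemma bnd_mult:
  "smooth_on n W f \<Longrightarrow> smooth_on n W g \<Longrightarrow> bnd n m K f a \<Longrightarrow> bnd n m K g b \<Longrightarrow> 0 \<le> a \<Longrightarrow> 0 \<le> b \<Longrightarrow>
    bnd n m K (\<lambda>x. f x * g x) (2 ^ m * a * b)"
proof (induction m arbitrary: f g)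
  case 0
  then show ?case by (auto simp: bnd_zero abs_mult intro!: mult_mono)
next
  case (Suc m)
  have "\<bar>f x * g x\<bar> \<le> 2 ^ Suc m * a * b" if "x \<in> K" for x
  proof -
    have "\<bar>f x * g x\<bar> \<le> 1 * (a * b)"
      using bnd_0[OF Suc.prems(3) that] bnd_0[OF Suc.prems(4) that] Suc.prems(5)
      by (simp add: abs_mult mult_mono)
    also have "\<dots> \<le> 2 ^ Suc m * (a * b)"
      using Suc.prems(5,6) one_le_power[of "2::real" "Suc m"] by (intro mult_right_mono) auto
    finally show ?thesis by (simp only: mult.assoc)
  qed
  moreover have "bnd n m K (pderiv_at i (\<lambda>x. f x * g x)) (2 ^ Suc m * a * b)" if i: "i < n" for i
  proof -
    have eq: "pderiv_at i f x * g x + f x * pderiv_at i g x = pderiv_at i (\<lambda>x. f x * g x) x" if "x \<in> W" for x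
      by (intro has_pd_pderiv[symmetric] has_pd_mult has_pd_smooth[OF W _ i that] Suc.prems)
    have "bnd n m K (\<lambda>x. pderiv_at i f x * g x + f x * pderiv_at i g x) (2 ^ m * a * b + 2 ^ m * a * b)"
    proof (rule bnd_add)
      have f: "bnd n m K f a" "bnd n m K g b"
        using bnd_mono[OF Suc.prems(3)] bnd_mono[OF Suc.prems(4)] by auto
      have f': "bnd n m K (pderiv_at i f) a" "bnd n m K (pderiv_at i g) b"
        using Suc.prems i by (auto simp: bnd_Suc)
      show "bnd n m K (\<lambda>x. pderiv_at i f x * g x) (2 ^ m * a * b)"
        by (rule Suc.IH[OF smooth_on_pderiv[OF W Suc.prems(1) i] Suc.prems(2) f'(1) f(2) Suc.prems(5,6)])
      show "bnd n m K (\<lambda>x. f x * pderiv_at i g x) (2 ^ m * a * b)"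
        by (rule Suc.IH[OF Suc.prems(1) smooth_on_pderiv[OF W Suc.prems(2) i] f(1) f'(2) Suc.prems(5,6)])
    qed (intro smooth_on_mult[OF W] smooth_on_pderiv[OF W] Suc.prems i)+
    moreover have "2 ^ m * a * b + 2 ^ m * a * b = 2 ^ Suc m * a * b" by simp
    ultimately have "bnd n m K (\<lambda>x. pderiv_at i f x * g x + f x * pderiv_at i g x) (2 ^ Suc m * a * b)"
      by (simp only:)
    moreover have "bnd n m K (\<lambda>x. pderiv_at i f x * g x + f x * pderiv_at i g x) (2 ^ Suc m * a * b) \<longleftrightarrow>
        bnd n m K (pderiv_at i (\<lambda>x. f x * g x)) (2 ^ Suc m * a * b)"
      by (rule bnd_cong[OF W K]) (rule eq)
    ultimately show ?thesis by simp
  qed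
  ultimately show ?case by (simp add: bnd_Suc)
qed

end

lemma finite_lists: "finite {L. set L \<subseteq> {..<n::nat} \<and> length L \<le> m}"
  by (rule finite_lists_length_le) simp

lemma bnd_exists:
  assumes "openin (Euclidean_space n) W" "compact K" "K \<subseteq> W" "smooth_on n W f"
  shows "\<exists>c\<ge>0. bnd n m K f c"
proof -
  have "\<exists>c. \<forall>x\<in>K. \<bar>pd L f x\<bar> \<le> c" if "set L \<subseteq> {..<n}" for L
  proof -
    have "continuous_on K (pd L f)"
      using smooth_on_continuous[OF smooth_on_pd[OF assms(1,4) that]] assms(3) continuous_on_subset by blast
    then have "bounded (pd L f ` K)" using assms(2) compact_continuous_image compact_imp_bounded by blast
    then show ?thesis by (auto simp: bounded_iff)
  qed
  then obtain c where c: "\<And>L x. set L \<subseteq> {..<n} \<Longrightarrow> x \<in> K \<Longrightarrow> \<bar>pd L f x\<bar> \<le> c L" by metis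
  let ?S = "{L. set L \<subseteq> {..<n::nat} \<and> length L \<le> m}"
  \<comment> \<open>The sum over the finitely many lists dominates every single bound.\<close>
  have "bnd n m K f (\<Sum>L\<in>?S. \<bar>c L\<bar>)"
    unfolding bnd_def
  proof (intro allI impI ballI)
    fix L x assume L: "set L \<subseteq> {..<n}" "length L \<le> m" "x \<in> K"
    have "\<bar>pd L f x\<bar> \<le> \<bar>c L\<bar>" using c[OF L(1,3)] by linarith
    also have "\<dots> \<le> (\<Sum>L\<in>?S. \<bar>c L\<bar>)" using L finite_lists by (intro member_le_sum) auto
    finally show "\<bar>pd L f x\<bar> \<le> (\<Sum>L\<in>?S. \<bar>c L\<bar>)" .
  qed
  moreover have "(\<Sum>L\<in>?S. \<bar>c L\<bar>) \<ge> 0" by (intro sum_nonneg) simp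
  ultimately show ?thesis by blast
qed

section \<open>Suprema, Landau symbols and pointwise bounds\<close>

lemma sup_abs_le: "(\<And>x. x \<in> K \<Longrightarrow> \<bar>f x\<bar> \<le> c) \<Longrightarrow> 0 \<le> c \<Longrightarrow> sup_abs K f \<le> c"
  unfolding sup_abs_def by (intro cSup_least) auto

text \<open>A bound has to be known beforehand: \<open>Sup\<close> of an unbounded set of reals
  carries no information.\<close>

lemma le_sup_abs:
  assumes "\<And>x. x \<in> K \<Longrightarrow> \<bar>f x\<bar> \<le> c" "x \<in> K" shows "\<bar>f x\<bar> \<le> sup_abs K f"
  unfolding sup_abs_def using assms
  by (intro cSup_upper) (auto simp: bdd_above_def intro!: exI[of _ "max 0 c"] le_max_iff_disj[THEN iffD2])

lemma sup_abs_nonneg: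
  assumes "\<And>x. x \<in> K \<Longrightarrow> \<bar>f x\<bar> \<le> c" shows "0 \<le> sup_abs K f"
  unfolding sup_abs_def using assms
  by (intro cSup_upper) (auto simp: bdd_above_def intro!: exI[of _ "max 0 c"] le_max_iff_disj[THEN iffD2])

text \<open>The set \<open>K\<close> lies in the domain \<open>D \<epsilon>\<close> only for small
  \<epsilon>; from then on the derivative is bounded on the compact \<open>K\<close> and the
  supremum is a genuine one.\<close>

lemma sup_abs_bigo_iff:
  fixes u :: "real \<Rightarrow> rfun" and g :: "real \<Rightarrow> real"
  assumes K: "compact K"
    and ev: "eventually (\<lambda>\<epsilon>. openin (Euclidean_space n) (D \<epsilon>) \<and> K \<subseteq> D \<epsilon> \<and> smooth_on n (D \<epsilon>) (u \<epsilon>)) (at_right 0)"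
    and g: "eventually (\<lambda>\<epsilon>. g \<epsilon> > 0) (at_right 0)" and L: "set L \<subseteq> {..<n}"
  shows "(\<lambda>\<epsilon>. sup_abs K (pd L (u \<epsilon>))) \<in> O[at_right 0](g) \<longleftrightarrow>
    (\<exists>C. eventually (\<lambda>\<epsilon>. \<forall>x\<in>K. \<bar>pd L (u \<epsilon>) x\<bar> \<le> C * g \<epsilon>) (at_right 0))"
proof -
  have bd: "eventually (\<lambda>\<epsilon>. \<exists>c. \<forall>x\<in>K. \<bar>pd L (u \<epsilon>) x\<bar> \<le> c) (at_right 0)"
    using ev
  proof eventually_elim
    case (elim \<epsilon>)
    then obtain c where "bnd n (length L) K (u \<epsilon>) c" using bnd_exists[OF _ K] by blast
    then show ?case using L unfolding bnd_def by blast
  qed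
  show ?thesis
  proof
    assume "(\<lambda>\<epsilon>. sup_abs K (pd L (u \<epsilon>))) \<in> O[at_right 0](g)"
    then obtain C where "eventually (\<lambda>\<epsilon>. norm (sup_abs K (pd L (u \<epsilon>))) \<le> C * norm (g \<epsilon>)) (at_right 0)"
      by (elim landau_o.bigE)
    then have "eventually (\<lambda>\<epsilon>. \<forall>x\<in>K. \<bar>pd L (u \<epsilon>) x\<bar> \<le> C * g \<epsilon>) (at_right 0)"
      using bd g
    proof eventually_elim
      case (elim \<epsilon>)
      show ?case
      proof
        fix x assume "x \<in> K"
        then have "\<bar>pd L (u \<epsilon>) x\<bar> \<le> sup_abs K (pd L (u \<epsilon>))" using elim(2) le_sup_abs by metis
        then show "\<bar>pd L (u \<epsilon>) x\<bar> \<le> C * g \<epsilon>" using elim(1,3) by simp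
      qed
    qed
    then show "\<exists>C. eventually (\<lambda>\<epsilon>. \<forall>x\<in>K. \<bar>pd L (u \<epsilon>) x\<bar> \<le> C * g \<epsilon>) (at_right 0)" by blast
  next
    assume "\<exists>C. eventually (\<lambda>\<epsilon>. \<forall>x\<in>K. \<bar>pd L (u \<epsilon>) x\<bar> \<le> C * g \<epsilon>) (at_right 0)"
    then obtain C where C: "eventually (\<lambda>\<epsilon>. \<forall>x\<in>K. \<bar>pd L (u \<epsilon>) x\<bar> \<le> C * g \<epsilon>) (at_right 0)" by blast
    show "(\<lambda>\<epsilon>. sup_abs K (pd L (u \<epsilon>))) \<in> O[at_right 0](g)"
    proof (rule bigoI[of _ "\<bar>C\<bar>"])
      show "eventually (\<lambda>\<epsilon>. norm (sup_abs K (pd L (u \<epsilon>))) \<le> \<bar>C\<bar> * norm (g \<epsilon>)) (at_right 0)"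
        using C g
      proof eventually_elim
        case (elim \<epsilon>)
        have *: "\<bar>pd L (u \<epsilon>) x\<bar> \<le> \<bar>C\<bar> * g \<epsilon>" if "x \<in> K" for x
        proof -
          have "C * g \<epsilon> \<le> \<bar>C\<bar> * g \<epsilon>" using elim(2) by (intro mult_right_mono) auto
          then show ?thesis using elim(1) that by force
        qed
        have "sup_abs K (pd L (u \<epsilon>)) \<le> \<bar>C\<bar> * g \<epsilon>" using * elim(2) by (intro sup_abs_le) auto
        moreover have "0 \<le> sup_abs K (pd L (u \<epsilon>))" using * by (rule sup_abs_nonneg)
        ultimately show ?case using elim(2) by simp
      qed
    qed
  qed
qed

text \<open>There are finitely many lists up to length \<open>m\<close>, so thresholds and constants
  can be merged.\<close>

lemma eventually_bnd_iff:
  fixes u :: "real \<Rightarrow> rfun"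
  assumes g: "eventually (\<lambda>\<epsilon>. g \<epsilon> > 0) (at_right (0::real))"
  shows "(\<exists>C\<ge>0. eventually (\<lambda>\<epsilon>. bnd n m K (u \<epsilon>) (C * g \<epsilon>)) (at_right 0)) \<longleftrightarrow>
    (\<forall>L. set L \<subseteq> {..<n} \<longrightarrow> length L \<le> m \<longrightarrow>
      (\<exists>C. eventually (\<lambda>\<epsilon>. \<forall>x\<in>K. \<bar>pd L (u \<epsilon>) x\<bar> \<le> C * g \<epsilon>) (at_right 0)))"
  (is "?l \<longleftrightarrow> ?r")
proof
  assume ?l
  then obtain C where C: "eventually (\<lambda>\<epsilon>. bnd n m K (u \<epsilon>) (C * g \<epsilon>)) (at_right 0)" by blast
  show ?r
  proof (intro allI impI exI)
    fix L assume L: "set L \<subseteq> {..<n}" "length L \<le> m"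
    show "eventually (\<lambda>\<epsilon>. \<forall>x\<in>K. \<bar>pd L (u \<epsilon>) x\<bar> \<le> C * g \<epsilon>) (at_right 0)"
      using C by eventually_elim (use L in \<open>simp add: bnd_def\<close>)
  qed
next
  assume ?r
  then have "\<forall>L. \<exists>C. set L \<subseteq> {..<n} \<longrightarrow> length L \<le> m \<longrightarrow>
      eventually (\<lambda>\<epsilon>. \<forall>x\<in>K. \<bar>pd L (u \<epsilon>) x\<bar> \<le> C * g \<epsilon>) (at_right 0)" by blast
  from choice[OF this] obtain C where C: "\<And>L. set L \<subseteq> {..<n} \<Longrightarrow> length L \<le> m \<Longrightarrow>
      eventually (\<lambda>\<epsilon>. \<forall>x\<in>K. \<bar>pd L (u \<epsilon>) x\<bar> \<le> C L * g \<epsilon>) (at_right 0)" by blast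
  let ?S = "{L. set L \<subseteq> {..<n::nat} \<and> length L \<le> m}"
  have "eventually (\<lambda>\<epsilon>. \<forall>L\<in>?S. \<forall>x\<in>K. \<bar>pd L (u \<epsilon>) x\<bar> \<le> C L * g \<epsilon>) (at_right 0)"
    using C by (intro eventually_ball_finite finite_lists) auto
  then have "eventually (\<lambda>\<epsilon>. bnd n m K (u \<epsilon>) ((\<Sum>L\<in>?S. \<bar>C L\<bar>) * g \<epsilon>)) (at_right 0)"
    using g
  proof eventually_elim
    case (elim \<epsilon>)
    show ?case unfolding bnd_def
    proof (intro allI impI ballI)
      fix L x assume L: "set L \<subseteq> {..<n}" "length L \<le> m" "x \<in> K"
      have "\<bar>pd L (u \<epsilon>) x\<bar> \<le> C L * g \<epsilon>" using elim(1) L by blast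
      also have "\<dots> \<le> \<bar>C L\<bar> * g \<epsilon>" using elim(2) by (intro mult_right_mono) auto
      also have "\<bar>C L\<bar> \<le> (\<Sum>L\<in>?S. \<bar>C L\<bar>)" using L finite_lists by (intro member_le_sum) auto
      finally show "\<bar>pd L (u \<epsilon>) x\<bar> \<le> (\<Sum>L\<in>?S. \<bar>C L\<bar>) * g \<epsilon>" using elim(2) by (simp add: mult_right_mono)
    qed
  qed
  moreover have "(\<Sum>L\<in>?S. \<bar>C L\<bar>) \<ge> 0" by (intro sum_nonneg) simp
  ultimately show ?l by blast
qed

lemma mderiv_bounds_iff:
  fixes u :: "real \<Rightarrow> rfun"
  assumes K: "compact K"
    and ev: "eventually (\<lambda>\<epsilon>. openin (Euclidean_space n) (D \<epsilon>) \<and> K \<subseteq> D \<epsilon> \<and> smooth_on n (D \<epsilon>) (u \<epsilon>)) (at_right 0)"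
    and g: "eventually (\<lambda>\<epsilon>. g \<epsilon> > 0) (at_right 0)"
  shows "(\<exists>C\<ge>0. eventually (\<lambda>\<epsilon>. bnd n m K (u \<epsilon>) (C * g \<epsilon>)) (at_right 0)) \<longleftrightarrow>
    (\<forall>\<alpha>. mi_order n \<alpha> \<le> m \<longrightarrow> (\<lambda>\<epsilon>. sup_abs K (mderiv n \<alpha> (u \<epsilon>))) \<in> O[at_right 0](g))"
  (is "?l \<longleftrightarrow> ?r")
proof
  assume ?l
  then have *: "\<forall>L. set L \<subseteq> {..<n} \<longrightarrow> length L \<le> m \<longrightarrow>
      (\<exists>C. eventually (\<lambda>\<epsilon>. \<forall>x\<in>K. \<bar>pd L (u \<epsilon>) x\<bar> \<le> C * g \<epsilon>) (at_right 0))"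
    unfolding eventually_bnd_iff[OF g] .
  show ?r
    unfolding mderiv_eq_pd using *
    by (auto simp: sup_abs_bigo_iff[OF K ev g set_mi_list] set_mi_list length_mi_list)
next
  assume r: ?r
  have "\<exists>C. eventually (\<lambda>\<epsilon>. \<forall>x\<in>K. \<bar>pd L (u \<epsilon>) x\<bar> \<le> C * g \<epsilon>) (at_right 0)"
    if L: "set L \<subseteq> {..<n}" "length L \<le> m" for L
  proof -
    have "(\<lambda>\<epsilon>. sup_abs K (mderiv n (count_list L) (u \<epsilon>))) \<in> O[at_right 0](g)"
      using r mi_order_count_list[OF L(1)] L(2) by simp
    then obtain C where C: "eventually (\<lambda>\<epsilon>. \<forall>x\<in>K. \<bar>mderiv n (count_list L) (u \<epsilon>) x\<bar> \<le> C * g \<epsilon>) (at_right 0)"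
      unfolding mderiv_eq_pd sup_abs_bigo_iff[OF K ev g set_mi_list] by blast
    have "eventually (\<lambda>\<epsilon>. \<forall>x\<in>K. \<bar>pd L (u \<epsilon>) x\<bar> \<le> C * g \<epsilon>) (at_right 0)"
      using C ev
    proof eventually_elim
      case (elim \<epsilon>)
      show ?case
      proof
        fix x assume x: "x \<in> K"
        then have "pd L (u \<epsilon>) x = mderiv n (count_list L) (u \<epsilon>) x"
          using elim(2) L(1) by (intro pd_eq_mderiv[of n "D \<epsilon>"]) auto
        then show "\<bar>pd L (u \<epsilon>) x\<bar> \<le> C * g \<epsilon>" using elim(1) x by simp
      qed
    qed
    then show ?thesis by blast
  qed
  then show ?l unfolding eventually_bnd_iff[OF g] by blast
qed

section \<open>Diffeological spaces\<close>

lemma eucl_plot_iff: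
  "p \<in> plots (eucl_space n \<Omega>) k U \<longleftrightarrow>
    p \<in> U \<rightarrow>\<^sub>E \<Omega> \<and> openin (Euclidean_space k) U \<and> (\<forall>j<n. smooth_on k U (\<lambda>u. p u j))"
  by (auto simp: eucl_space_def restrict_Csmooth)

lemma points_eucl [simp]: "points (eucl_space n \<Omega>) = \<Omega>"
  by (simp add: eucl_space_def)

lemma real_plot_iff: "d \<in> plots real_space k U \<longleftrightarrow> openin (Euclidean_space k) U \<and> d \<in> Csmooth k U"
  by (simp add: real_space_def)

lemma points_real [simp]: "points real_space = UNIV"
  by (simp add: real_space_def)

lemma eucl_plotD:
  assumes "p \<in> plots (eucl_space n \<Omega>) k U"
  shows "openin (Euclidean_space k) U" "p \<in> U \<rightarrow>\<^sub>E \<Omega>" "\<And>u. u \<in> U \<Longrightarrow> p u \<in> \<Omega>" "p ` U \<subseteq> \<Omega>"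
    "\<And>j. j < n \<Longrightarrow> smooth_on k U (\<lambda>u. p u j)"
  using assms by (auto simp: eucl_plot_iff PiE_iff)

lemma eucl_plot_compose:
  assumes "p \<in> plots (eucl_space n \<Omega>) k U" "openin (Euclidean_space n) \<Omega>" "smooth_on n \<Omega> f"
  shows "smooth_on k U (\<lambda>u. f (p u))"
  using smooth_on_compose[OF eucl_plotD(1)[OF assms(1)] assms(2) eucl_plotD(4)[OF assms(1)] assms(3)]
    eucl_plotD(5)[OF assms(1)] by blast

lemma eucl_plot_continuous:
  assumes "p \<in> plots (eucl_space n \<Omega>) k U" "openin (Euclidean_space n) \<Omega>"
  shows "continuous_on U p"
  using eucl_plotD(4)[OF assms(1)] openin_Euclidean_subset[OF assms(2)]
    smooth_on_continuous[OF eucl_plotD(5)[OF assms(1)]]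
  by (intro continuous_on_vecI[of _ _ n]) auto

lemma eucl_plot_vimage:
  assumes "p \<in> plots (eucl_space n \<Omega>) k U" "openin (Euclidean_space n) \<Omega>" "openin (Euclidean_space n) W"
  shows "openin (Euclidean_space k) {u \<in> U. p u \<in> W}"
  using eucl_plotD(4)[OF assms(1)] openin_Euclidean_subset[OF assms(2)]
  by (intro openin_vimage_Euclidean[OF eucl_plotD(1)[OF assms(1)] eucl_plot_continuous[OF assms(1,2)] _ assms(3)])
    blast

lemma eucl_plot_restrict:
  assumes "p \<in> plots (eucl_space n \<Omega>) k U" "openin (Euclidean_space k) W" "W \<subseteq> U"
    "\<And>w. w \<in> W \<Longrightarrow> p w \<in> \<Omega>'"
  shows "restrict p W \<in> plots (eucl_space n \<Omega>') k W"
proof -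
  have "smooth_on k W (\<lambda>u. restrict p W u j)" if "j < n" for j
    using smooth_on_subset[OF eucl_plotD(5)[OF assms(1) that] assms(3)]
    by (rule smooth_on_cong[OF assms(2), rotated]) simp
  then show ?thesis using assms(2,4) by (simp add: eucl_plot_iff)
qed

lemma eucl_plot_comp:
  assumes "g \<in> plots (eucl_space k U) l V" "p \<in> plots (eucl_space n \<Omega>) k U" "openin (Euclidean_space k) U"
  shows "compose V p g \<in> plots (eucl_space n \<Omega>) l V"
proof -
  have "smooth_on l V (\<lambda>u. compose V p g u j)" if "j < n" for j
    using eucl_plot_compose[OF assms(1,3) eucl_plotD(5)[OF assms(2) that]]
    by (rule smooth_on_cong[OF eucl_plotD(1)[OF assms(1)], rotated]) (simp add: compose_def)
  then show ?thesis
    using eucl_plotD(1,3)[OF assms(1)] eucl_plotD(3)[OF assms(2)] by (simp add: eucl_plot_iff compose_def)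
qed

lemma eucl_plot_id: "openin (Euclidean_space n) U \<Longrightarrow> (\<lambda>u\<in>U. u) \<in> plots (eucl_space n U) n U"
proof -
  assume U: "openin (Euclidean_space n) U"
  have "smooth_on n U (\<lambda>u. restrict (\<lambda>u. u) U u j)" for j
    by (rule smooth_on_cong[OF U _ smooth_on_coord[OF U, of j]]) simp
  then show ?thesis using U by (simp add: eucl_plot_iff)
qed

lemma plot_domain_open:
  assumes "diffeological_space X" "d \<in> plots X k U"
  shows "openin (Euclidean_space k) U" "d \<in> U \<rightarrow>\<^sub>E points X"
  using assms(1)[unfolded diffeological_space_def, THEN conjunct1, rule_format, OF assms(2)] by auto

lemma plot_const:
  assumes "diffeological_space X" "a \<in> points X" "openin (Euclidean_space k) U"
  shows "(\<lambda>u\<in>U. a) \<in> plots X k U"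
  using assms(1)[unfolded diffeological_space_def, THEN conjunct2, THEN conjunct1, rule_format, OF assms(2,3)] .

lemma plot_compose:
  assumes "diffeological_space X" "d \<in> plots X k U" "g \<in> plots (eucl_space k U) l V"
  shows "compose V d g \<in> plots X l V"
  using assms(1)[unfolded diffeological_space_def, THEN conjunct2, THEN conjunct2, THEN conjunct1,
      rule_format, OF assms(2,3)] .

text \<open>Locality is built into the definition of the plots. For composition, a local lift is
  pulled back along \<open>g\<close>, whose continuity keeps the neighbourhood open.\<close>

lemma diffeological_quot_space:
  assumes X: "diffeological_space X" and r: "equiv (points X) r"
  shows "diffeological_space (quot_space X r)"
  unfolding diffeological_space_def
proof (intro conjI allI ballI impI)
  let ?Q = "quot_space X r"
  note plots_def = quot_space_def dspace.simps
  show "openin (Euclidean_space k) U" "d \<in> U \<rightarrow>\<^sub>E points ?Q" if "d \<in> plots ?Q k U" for k U d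
    using that by (auto simp: quot_space_def)
  show "(\<lambda>u\<in>U. a) \<in> plots ?Q k U" if a: "a \<in> points ?Q" and U: "openin (Euclidean_space k) U" for k U a
  proof -
    obtain b where b: "b \<in> points X" "a = r `` {b}" using a by (auto simp: quot_space_def quotient_def)
    have "(\<lambda>u\<in>U. b) \<in> plots X k U" using plot_const[OF X b(1) U] .
    then show ?thesis using b a U by (auto simp: quot_space_def intro!: exI[of _ U] bexI[of _ "\<lambda>u\<in>U. b"])
  qed
  show "compose V d g \<in> plots ?Q l V"
    if d: "d \<in> plots ?Q k U" and g: "g \<in> plots (eucl_space k U) l V" for k U l V d g
  proof -
    have U: "openin (Euclidean_space k) U" using d by (simp add: quot_space_def)
    have "\<exists>W. \<exists>p\<in>plots X l W. openin (Euclidean_space l) W \<and> v \<in> W \<and> W \<subseteq> V \<and>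
      (\<forall>w\<in>W. compose V d g w = r `` {p w})" if v: "v \<in> V" for v
    proof -
      obtain W p where W: "p \<in> plots X k W" "openin (Euclidean_space k) W" "g v \<in> W" "W \<subseteq> U"
        "\<forall>w\<in>W. d w = r `` {p w}"
        using d eucl_plotD(3)[OF g v] by (auto simp: quot_space_def)
      let ?W = "{v \<in> V. g v \<in> W}"
      have o: "openin (Euclidean_space l) ?W" by (rule eucl_plot_vimage[OF g U W(2)])
      have "restrict g ?W \<in> plots (eucl_space k W) l ?W" by (rule eucl_plot_restrict[OF g o]) auto
      then have "compose ?W p (restrict g ?W) \<in> plots X l ?W"
        by (rule plot_compose[OF X W(1)])
      then show ?thesis using o v W
        by (intro exI[of _ ?W] bexI[of _ "compose ?W p (restrict g ?W)"]) (auto simp: compose_def)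
    qed
    then show ?thesis
      using d eucl_plotD(1,3)[OF g] by (auto simp: quot_space_def compose_def PiE_iff)
  qed
  show "d \<in> plots ?Q k U"
    if d: "d \<in> U \<rightarrow>\<^sub>E points ?Q" and U: "openin (Euclidean_space k) U"
      and loc: "\<forall>u\<in>U. \<exists>W. openin (Euclidean_space k) W \<and> u \<in> W \<and> W \<subseteq> U \<and> restrict d W \<in> plots ?Q k W" for k U d
  proof -
    have "\<exists>W. \<exists>p\<in>plots X k W. openin (Euclidean_space k) W \<and> u \<in> W \<and> W \<subseteq> U \<and>
      (\<forall>w\<in>W. d w = r `` {p w})" if u: "u \<in> U" for u
    proof -
      obtain V where V: "u \<in> V" "V \<subseteq> U" "restrict d V \<in> plots ?Q k V" using loc u by blast
      then obtain W p where "p \<in> plots X k W" "openin (Euclidean_space k) W" "u \<in> W" "W \<subseteq> V"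
        "\<forall>w\<in>W. restrict d V w = r `` {p w}" by (auto simp: quot_space_def)
      then show ?thesis using V(2) by (metis restrict_apply' subsetD order_trans)
    qed
    then show ?thesis using d U by (simp add: quot_space_def)
  qed
qed

text \<open>Since \<open>f\<close> respects \<open>r\<close>, the union in \<open>lift1\<close> is a
  union of copies of one class.\<close>

lemma lift1_class:
  assumes "equiv E r" "\<And>u v. (u, v) \<in> r \<Longrightarrow> (f u, f v) \<in> r" "u \<in> E"
  shows "lift1 r f (r `` {u}) = r `` {f u}"
proof -
  have "r `` {f v} = r `` {f u}" if "v \<in> r `` {u}" for v
    using equiv_class_eq[OF assms(1) assms(2), of u v] that by simp
  moreover have "u \<in> r `` {u}" using equiv_class_self[OF assms(1,3)] .
  ultimately show ?thesis unfolding lift1_def by blast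
qed

lemma lift2_class:
  assumes "equiv E r" "\<And>u v u' v'. (u, u') \<in> r \<Longrightarrow> (v, v') \<in> r \<Longrightarrow> (f u v, f u' v') \<in> r" "u \<in> E" "v \<in> E"
  shows "lift2 r f (r `` {u}) (r `` {v}) = r `` {f u v}"
proof -
  have "r `` {f u' v'} = r `` {f u v}" if "u' \<in> r `` {u}" "v' \<in> r `` {v}" for u' v'
    using equiv_class_eq[OF assms(1) assms(2), of u u' v v'] that by simp
  moreover have "u \<in> r `` {u}" "v \<in> r `` {v}" using equiv_class_self[OF assms(1)] assms(3,4) by auto
  ultimately show ?thesis unfolding lift2_def by blast
qed

lemma plots_quotI:
  assumes "d \<in> extensional U" "openin (Euclidean_space k) U" "diffeological_space X"
    "\<And>u. u \<in> U \<Longrightarrow> \<exists>W. \<exists>p\<in>plots X k W. u \<in> W \<and> W \<subseteq> U \<and> (\<forall>w\<in>W. d w = r `` {p w})"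
  shows "d \<in> plots (quot_space X r) k U"
proof -
  have *: "\<exists>W. \<exists>p\<in>plots X k W. openin (Euclidean_space k) W \<and> u \<in> W \<and> W \<subseteq> U \<and> (\<forall>w\<in>W. d w = r `` {p w})"
    if "u \<in> U" for u
    using assms(4)[OF that] plot_domain_open(1)[OF assms(3)] by blast
  have "d u \<in> points X // r" if "u \<in> U" for u
  proof -
    obtain W p where "p \<in> plots X k W" "u \<in> W" "\<forall>w\<in>W. d w = r `` {p w}" using assms(4)[OF \<open>u \<in> U\<close>] by blast
    then show ?thesis using plot_domain_open(2)[OF assms(3), of p k W] by (auto intro: quotientI simp: PiE_iff)
  qed
  then show ?thesis using * assms(1,2) by (auto simp: quot_space_def PiE_iff)
qed

lemma plots_quotE:
  assumes "d \<in> plots (quot_space X r) k U" "u \<in> U"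
  obtains W p where "p \<in> plots X k W" "openin (Euclidean_space k) W" "u \<in> W" "W \<subseteq> U"
    "\<And>w. w \<in> W \<Longrightarrow> d w = r `` {p w}"
proof -
  obtain W p where *: "p \<in> plots X k W" "openin (Euclidean_space k) W" "u \<in> W" "W \<subseteq> U"
    "\<forall>w\<in>W. d w = r `` {p w}" using assms by (auto simp: quot_space_def)
  show ?thesis by (rule that[OF *(1-4)]) (use *(5) in blast)
qed

text \<open>Restriction is composition with the inclusion of \<open>W\<close> into \<open>U\<close>,
  which is a plot of \<open>U\<close>.\<close>

lemma plots_restrict:
  assumes "diffeological_space X" "d \<in> plots X k U" "openin (Euclidean_space k) W" "W \<subseteq> U"
  shows "restrict d W \<in> plots X k W"
proof -
  have "(\<lambda>w\<in>W. w) \<in> plots (eucl_space k U) k W"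
  proof -
    have "restrict (\<lambda>w\<in>W. w) W \<in> plots (eucl_space k U) k W"
      by (rule eucl_plot_restrict[OF eucl_plot_id[OF assms(3)] assms(3) order_refl]) (use assms(4) in auto)
    then show ?thesis by simp
  qed
  then have "compose W d (\<lambda>w\<in>W. w) \<in> plots X k W"
    by (rule plot_compose[OF assms(1,2)])
  moreover have "compose W d (\<lambda>w\<in>W. w) = restrict d W" by (auto simp: compose_def)
  ultimately show ?thesis by simp
qed

lemma smooth_map_lift1:
  assumes X: "diffeological_space X" and r: "equiv (points X) r"
    and resp: "\<And>u v. (u, v) \<in> r \<Longrightarrow> (f u, f v) \<in> r"
    and f: "\<And>k U d. d \<in> plots X k U \<Longrightarrow> (\<lambda>u\<in>U. f (d u)) \<in> plots X k U"
    and fX: "\<And>u. u \<in> points X \<Longrightarrow> f u \<in> points X"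
  shows "smooth_map (quot_space X r) (quot_space X r) (lift1 r f)"
  unfolding smooth_map_def
proof (intro conjI allI ballI)
  show "lift1 r f \<in> points (quot_space X r) \<rightarrow> points (quot_space X r)"
    using fX lift1_class[where f = f, OF r resp] by (auto simp: quot_space_def elim!: quotientE intro!: quotientI)
  fix k U d assume d: "d \<in> plots (quot_space X r) k U"
  have U: "openin (Euclidean_space k) U" using d by (simp add: quot_space_def)
  show "compose U (lift1 r f) d \<in> plots (quot_space X r) k U"
  proof (rule plots_quotI[OF _ U X])
    fix u assume "u \<in> U"
    then obtain W p where W: "p \<in> plots X k W" "u \<in> W" "W \<subseteq> U" "\<And>w. w \<in> W \<Longrightarrow> d w = r `` {p w}"
      using plots_quotE[OF d] by metis
    have "compose U (lift1 r f) d w = r `` {restrict (\<lambda>u. f (p u)) W w}" if "w \<in> W" for w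
      using that W(3,4) lift1_class[where f = f and u = "p w", OF r resp] plot_domain_open(2)[OF X W(1)]
      by (auto simp: compose_def PiE_iff subset_iff)
    then show "\<exists>W. \<exists>p\<in>plots X k W. u \<in> W \<and> W \<subseteq> U \<and> (\<forall>w\<in>W. compose U (lift1 r f) d w = r `` {p w})"
      using f[OF W(1)] W(2,3) by blast
  qed (simp add: compose_def)
qed

lemma smooth_map_lift2:
  assumes X: "diffeological_space X" and r: "equiv (points X) r"
    and resp: "\<And>u v u' v'. (u, u') \<in> r \<Longrightarrow> (v, v') \<in> r \<Longrightarrow> (f u v, f u' v') \<in> r"
    and f: "\<And>k U d e. d \<in> plots X k U \<Longrightarrow> e \<in> plots X k U \<Longrightarrow> (\<lambda>u\<in>U. f (d u) (e u)) \<in> plots X k U"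
    and fX: "\<And>u v. u \<in> points X \<Longrightarrow> v \<in> points X \<Longrightarrow> f u v \<in> points X"
  shows "smooth_map (prod_space (quot_space X r) (quot_space X r)) (quot_space X r) (\<lambda>(a, b). lift2 r f a b)"
  unfolding smooth_map_def
proof (intro conjI allI ballI)
  let ?Q = "quot_space X r"
  show "(\<lambda>(a, b). lift2 r f a b) \<in> points (prod_space ?Q ?Q) \<rightarrow> points ?Q"
    using fX lift2_class[where f = f, OF r resp]
    by (auto simp: quot_space_def prod_space_def elim!: quotientE intro!: quotientI)
  fix k U d assume d: "d \<in> plots (prod_space ?Q ?Q) k U"
  have d1: "(\<lambda>u\<in>U. fst (d u)) \<in> plots ?Q k U" and d2: "(\<lambda>u\<in>U. snd (d u)) \<in> plots ?Q k U"
    using d by (auto simp: prod_space_def)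
  have U: "openin (Euclidean_space k) U" using d1 by (simp add: quot_space_def)
  show "compose U (\<lambda>(a, b). lift2 r f a b) d \<in> plots ?Q k U"
  proof (rule plots_quotI[OF _ U X])
    fix u assume u: "u \<in> U"
    obtain V p where V: "p \<in> plots X k V" "openin (Euclidean_space k) V" "u \<in> V" "V \<subseteq> U"
      "\<And>w. w \<in> V \<Longrightarrow> (\<lambda>u\<in>U. fst (d u)) w = r `` {p w}" using plots_quotE[OF d1 u] by metis
    obtain W q where W: "q \<in> plots X k W" "openin (Euclidean_space k) W" "u \<in> W" "W \<subseteq> U"
      "\<And>w. w \<in> W \<Longrightarrow> (\<lambda>u\<in>U. snd (d u)) w = r `` {q w}" using plots_quotE[OF d2 u] by metis
    \<comment> \<open>The two components are lifted on different neighbourhoods; both lifts are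
      restricted to the common part.\<close>
    let ?T = "V \<inter> W"
    have T: "openin (Euclidean_space k) ?T" using V(2) W(2) by (rule openin_Int)
    have pq: "restrict p ?T \<in> plots X k ?T" "restrict q ?T \<in> plots X k ?T"
      by (rule plots_restrict[OF X V(1) T], simp) (rule plots_restrict[OF X W(1) T], simp)
    have "compose U (\<lambda>(a, b). lift2 r f a b) d w =
        r `` {restrict (\<lambda>u. f (restrict p ?T u) (restrict q ?T u)) ?T w}" if w: "w \<in> ?T" for w
    proof -
      have "w \<in> U" using w V(4) by blast
      then have "fst (d w) = r `` {p w}" "snd (d w) = r `` {q w}" using V(5)[of w] W(5)[of w] w by auto
      moreover have "p w \<in> points X" "q w \<in> points X"
        using plot_domain_open(2)[OF X V(1)] plot_domain_open(2)[OF X W(1)] w by (auto simp: PiE_iff)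
      ultimately show ?thesis using lift2_class[where f = f and u = "p w" and v = "q w", OF r resp] w \<open>w \<in> U\<close>
        by (simp add: compose_def case_prod_unfold)
    qed
    then show "\<exists>W. \<exists>p\<in>plots X k W. u \<in> W \<and> W \<subseteq> U \<and> (\<forall>w\<in>W. compose U (\<lambda>(a, b). lift2 r f a b) d w = r `` {p w})"
      using f[OF pq] V(3,4) W(3) by (intro exI[of _ ?T] bexI) auto
  qed (simp add: compose_def)
qed

text \<open>A map into the quotient is smooth if representatives \<open>w\<close> can be chosen
  globally so that plots go to plots. Both embeddings and both maps \<sigma> have this form.\<close>

lemma smooth_map_class:
  assumes X: "diffeological_space X"
    and Y: "\<And>k U d. d \<in> plots Y k U \<Longrightarrow> openin (Euclidean_space k) U \<and> d \<in> U \<rightarrow> points Y"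
    and w: "\<And>y. y \<in> points Y \<Longrightarrow> w y \<in> points X" "\<And>y. y \<in> points Y \<Longrightarrow> f y = r `` {w y}"
    and pl: "\<And>k U d. d \<in> plots Y k U \<Longrightarrow> (\<lambda>u\<in>U. w (d u)) \<in> plots X k U"
  shows "smooth_map Y (quot_space X r) f"
  unfolding smooth_map_def
proof (intro conjI allI ballI)
  show "f \<in> points Y \<rightarrow> points (quot_space X r)"
    using w by (auto simp: quot_space_def intro!: quotientI)
  fix k U d assume d: "d \<in> plots Y k U"
  show "compose U f d \<in> plots (quot_space X r) k U"
  proof (rule plots_quotI[OF _ _ X])
    fix u assume "u \<in> U"
    have "\<forall>v\<in>U. compose U f d v = r `` {(\<lambda>u\<in>U. w (d u)) v}"
      using Y[OF d] w(2) by (auto simp: compose_def)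
    then show "\<exists>W. \<exists>p\<in>plots X k W. u \<in> W \<and> W \<subseteq> U \<and> (\<forall>w\<in>W. compose U f d w = r `` {p w})"
      using pl[OF d] \<open>u \<in> U\<close> by blast
  qed (use Y[OF d] in \<open>simp_all add: compose_def\<close>)
qed

lemma topspace_D_topology:
  assumes "diffeological_space X" shows "topspace (D_topology X) = points X"
proof -
  have "openin (D_topology X) (points X)"
  proof -
    have "{u \<in> U. d u \<in> points X} = U" if "d \<in> plots X k U" for k U d
      using plot_domain_open(2)[OF assms that] by (auto simp: PiE_iff)
    then show ?thesis by (simp add: openin_D_topology)
  qed
  then show ?thesis
    by (metis openin_D_topology openin_subset openin_topspace subset_antisym)
qed

lemma continuous_map_D_topology:
  assumes "diffeological_space X" "diffeological_space Y" "smooth_map X Y f"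
  shows "continuous_map (D_topology X) (D_topology Y) f"
  unfolding continuous_map_def topspace_D_topology[OF assms(1)] topspace_D_topology[OF assms(2)]
proof (intro conjI allI impI)
  show "f \<in> points X \<rightarrow> points Y" using assms(3) by (simp add: smooth_map_def)
  fix V assume V: "openin (D_topology Y) V"
  show "openin (D_topology X) {x \<in> points X. f x \<in> V}"
    unfolding openin_D_topology
  proof (intro conjI allI ballI impI)
    fix k U d assume d: "d \<in> plots X k U" and U: "openin (Euclidean_space k) U"
    have "compose U f d \<in> plots Y k U" using assms(3) d by (simp add: smooth_map_def)
    then have "openin (Euclidean_space k) {u \<in> U. compose U f d u \<in> V}"
      using V U unfolding openin_D_topology by blast
    moreover have "{u \<in> U. compose U f d u \<in> V} = {u \<in> U. d u \<in> {x \<in> points X. f x \<in> V}}"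
      using plot_domain_open(2)[OF assms(1) d] by (auto simp: compose_def PiE_iff)
    ultimately show "openin (Euclidean_space k) {u \<in> U. d u \<in> {x \<in> points X. f x \<in> V}}" by simp
  qed auto
qed

section \<open>Jointly smooth families\<close>

text \<open>Smoothness of (u, x) -> \<open>H u x\<close> on the product, tested by pairs of
  Euclidean plots. The product set need not be realized in a higher-dimensional space, and
  substitution of plots is immediate.\<close>

definition joint :: "nat \<Rightarrow> rvec set \<Rightarrow> nat \<Rightarrow> rvec set \<Rightarrow> (rvec \<Rightarrow> rfun) \<Rightarrow> bool" where
  "joint k U n D H \<longleftrightarrow> (\<forall>l W. \<forall>p\<in>plots (eucl_space k U) l W. \<forall>q\<in>plots (eucl_space n D) l W.
     smooth_on l W (\<lambda>z. H (p z) (q z)))"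

lemma jointD:
  "joint k U n D H \<Longrightarrow> p \<in> plots (eucl_space k U) l W \<Longrightarrow> q \<in> plots (eucl_space n D) l W \<Longrightarrow>
    smooth_on l W (\<lambda>z. H (p z) (q z))"
  unfolding joint_def by blast

lemma jointI:
  "(\<And>l W p q. openin (Euclidean_space l) W \<Longrightarrow> p \<in> plots (eucl_space k U) l W \<Longrightarrow>
    q \<in> plots (eucl_space n D) l W \<Longrightarrow> smooth_on l W (\<lambda>z. H (p z) (q z))) \<Longrightarrow> joint k U n D H"
  unfolding joint_def by (metis eucl_plotD(1))

lemma joint_cong:
  assumes "joint k U n D H" "\<And>u x. u \<in> U \<Longrightarrow> x \<in> D \<Longrightarrow> H u x = H' u x"
  shows "joint k U n D H'"
proof (rule jointI)
  fix l W p q assume *: "openin (Euclidean_space l) W" "p \<in> plots (eucl_space k U) l W"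
    "q \<in> plots (eucl_space n D) l W"
  show "smooth_on l W (\<lambda>z. H' (p z) (q z))"
    by (rule smooth_on_cong[OF *(1) _ jointD[OF assms(1) *(2,3)]])
      (rule assms(2)[OF eucl_plotD(3)[OF *(2)] eucl_plotD(3)[OF *(3)]])
qed

lemma joint_add: "joint k U n D H \<Longrightarrow> joint k U n D H' \<Longrightarrow> joint k U n D (\<lambda>u x. H u x + H' u x)"
  by (rule jointI) (rule smooth_on_add; assumption?; rule jointD[of k U n D]; assumption)

lemma joint_mult: "joint k U n D H \<Longrightarrow> joint k U n D H' \<Longrightarrow> joint k U n D (\<lambda>u x. H u x * H' u x)"
  by (rule jointI) (rule smooth_on_mult; assumption?; rule jointD[of k U n D]; assumption)

lemma joint_space:
  assumes "openin (Euclidean_space n) D" "smooth_on n D f"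
  shows "joint k U n D (\<lambda>u. f)"
  by (rule jointI) (rule eucl_plot_compose[OF _ assms])

lemma joint_param:
  assumes "openin (Euclidean_space k) U" "smooth_on k U f"
  shows "joint k U n D (\<lambda>u x. f u)"
  by (rule jointI) (rule eucl_plot_compose[OF _ assms])

text \<open>A jointly smooth family is a smooth function on the open subset \<open>U \<times> D\<close> of \<open>Rn (k + n)\<close>, where
  the partial derivatives in the second argument are the last \<open>n\<close> partial derivatives.\<close>

lemma joint_pderiv:
  assumes U: "openin (Euclidean_space k) U" and D: "openin (Euclidean_space n) D"
    and H: "joint k U n D H" and i: "i < n"
  shows "joint k U n D (\<lambda>u. pderiv_at i (H u))"
proof -
  \<comment> \<open>The two projections of \<open>Rn (k + n)\<close>, padded with zeros to points of
    \<open>Rn k\<close> and \<open>Rn n\<close>.\<close>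
  define P where "P v = (\<lambda>j. if j < k then v j else 0 :: real)" for v :: rvec
  define Q where "Q v = (\<lambda>j. if j < n then v (k + j) else 0 :: real)" for v :: rvec
  define T where "T = {v \<in> {v \<in> Rn (k + n). P v \<in> U}. Q v \<in> D}"
  have P: "P v \<in> Rn k" and Q: "Q v \<in> Rn n" for v by (auto simp: P_def Q_def Rn_iff)
  have cP: "continuous_on S P" for S
  proof (rule continuous_on_vecI[of _ _ k])
    show "continuous_on S (\<lambda>v. P v j)" if "j < k" for j using that by (simp add: P_def continuous_on_coord)
  qed (use P in auto)
  have cQ: "continuous_on S Q" for S
  proof (rule continuous_on_vecI[of _ _ n])
    show "continuous_on S (\<lambda>v. Q v j)" if "j < n" for j using that by (simp add: Q_def continuous_on_coord)
  qed (use Q in auto)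
  have oT: "openin (Euclidean_space (k + n)) T"
    unfolding T_def
    using P Q by (intro openin_vimage_Euclidean[OF _ cQ _ D] openin_vimage_Euclidean[OF _ cP _ U] openin_Rn)
      auto
  have pP: "restrict P T \<in> plots (eucl_space k U) (k + n) T"
  proof -
    have "smooth_on (k + n) T (\<lambda>v. restrict P T v j)" if "j < k" for j
      by (rule smooth_on_cong[OF oT _ smooth_on_coord[OF oT, of j]]) (use that in \<open>simp add: P_def\<close>)
    then show ?thesis using oT by (auto simp: eucl_plot_iff T_def)
  qed
  have pQ: "restrict Q T \<in> plots (eucl_space n D) (k + n) T"
  proof -
    have "smooth_on (k + n) T (\<lambda>v. restrict Q T v j)" if "j < n" for j
      by (rule smooth_on_cong[OF oT _ smooth_on_coord[OF oT, of "k + j"]]) (use that in \<open>simp add: Q_def\<close>)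
    then show ?thesis using oT by (auto simp: eucl_plot_iff T_def)
  qed
  define h where "h v = H (P v) (Q v)" for v
  have h: "smooth_on (k + n) T h"
    by (rule smooth_on_cong[OF oT _ jointD[OF H pP pQ]]) (simp add: h_def)
  have dh: "pderiv_at (k + i) h v = pderiv_at i (H (P v)) (Q v)" for v
  proof -
    have "P (v(k + i := t)) = P v" "Q (v(k + i := t)) = (Q v)(i := t)" for t
      using i by (auto simp: P_def Q_def)
    moreover have "v (k + i) = Q v i" using i by (simp add: Q_def)
    ultimately show ?thesis by (simp add: pderiv_at_def h_def)
  qed
  show ?thesis
  proof (rule jointI)
    fix l W p q assume W: "openin (Euclidean_space l) W" and p: "p \<in> plots (eucl_space k U) l W"
      and q: "q \<in> plots (eucl_space n D) l W"
    \<comment> \<open>The pairing inverse to \<open>P\<close> and \<open>Q\<close>; it turns two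
      plots into one map into \<open>T\<close>.\<close>
    define J where "J z = (\<lambda>j. if j < k then p z j else if j < k + n then q z (j - k) else 0)" for z
    have PJ: "P (J z) = p z" and QJ: "Q (J z) = q z" if "z \<in> W" for z
    proof -
      have "p z \<in> Rn k" "q z \<in> Rn n"
        using that eucl_plotD(3)[OF p] eucl_plotD(3)[OF q] openin_Euclidean_subset U D by blast+
      then show "P (J z) = p z" "Q (J z) = q z" by (auto simp: P_def Q_def J_def Rn_iff)
    qed
    have "smooth_on l W (\<lambda>z. pderiv_at (k + i) h (J z))"
    proof (rule smooth_on_compose[where g = J and f = "pderiv_at (k + i) h", OF W oT])
      show "J ` W \<subseteq> T"
        using PJ QJ eucl_plotD(3)[OF p] eucl_plotD(3)[OF q] by (auto simp: T_def J_def Rn_iff)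
      show "smooth_on (k + n) T (pderiv_at (k + i) h)" using i by (intro smooth_on_pderiv[OF oT h]) simp
      show "smooth_on l W (\<lambda>z. J z j)" if "j < k + n" for j
        using that eucl_plotD(5)[OF p, of j] eucl_plotD(5)[OF q, of "j - k"]
        by (cases "j < k") (simp_all add: J_def)
    qed
    then show "smooth_on l W (\<lambda>z. pderiv_at i (H (p z)) (q z))"
      by (rule smooth_on_cong[OF W, rotated]) (simp add: dh PJ QJ)
  qed
qed

lemma joint_pd:
  assumes "openin (Euclidean_space k) U" "openin (Euclidean_space n) D" "joint k U n D H"
  shows "set L \<subseteq> {..<n} \<Longrightarrow> joint k U n D (\<lambda>u. pd L (H u))"
  by (induction L) (use assms in \<open>auto intro: joint_pderiv\<close>)

text \<open>A plot of the product is a pair of plots; extensionality is what recovers the components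
  exactly from the pair. Besides Euclidean domains this is applied to test functions and to
  \<open>U_space\<close>.\<close>

lemma prod_smooth_real_iff:
  assumes X: "\<And>l W p. p \<in> plots X l W \<Longrightarrow> openin (Euclidean_space l) W \<and> p \<in> extensional W"
    and Y: "\<And>l W q. q \<in> plots Y l W \<Longrightarrow> q \<in> extensional W"
  shows "smooth_map (prod_space X Y) real_space (\<lambda>(u, x). H u x) \<longleftrightarrow>
    (\<forall>l W. \<forall>p\<in>plots X l W. \<forall>q\<in>plots Y l W. smooth_on l W (\<lambda>z. H (p z) (q z)))"
proof
  assume *: "smooth_map (prod_space X Y) real_space (\<lambda>(u, x). H u x)"
  show "\<forall>l W. \<forall>p\<in>plots X l W. \<forall>q\<in>plots Y l W. smooth_on l W (\<lambda>z. H (p z) (q z))"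
  proof (intro allI ballI)
    fix l W p q assume p: "p \<in> plots X l W" and q: "q \<in> plots Y l W"
    have W: "openin (Euclidean_space l) W" using X[OF p] by blast
    let ?c = "\<lambda>z\<in>W. (p z, q z)"
    have "(\<lambda>z\<in>W. fst (?c z)) = p" "(\<lambda>z\<in>W. snd (?c z)) = q"
      using X[OF p] Y[OF q] by (auto simp: fun_eq_iff extensional_def)
    then have "?c \<in> plots (prod_space X Y) l W" using p q by (simp add: prod_space_def)
    then have "compose W (\<lambda>(u, x). H u x) ?c \<in> plots real_space l W" using * unfolding smooth_map_def by blast
    then have "smooth_on l W (compose W (\<lambda>(u, x). H u x) ?c)" by (simp add: real_plot_iff Csmooth_iff)
    then show "smooth_on l W (\<lambda>z. H (p z) (q z))"
      by (rule smooth_on_cong[OF W, rotated]) (simp add: compose_def)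
  qed
next
  assume *: "\<forall>l W. \<forall>p\<in>plots X l W. \<forall>q\<in>plots Y l W. smooth_on l W (\<lambda>z. H (p z) (q z))"
  show "smooth_map (prod_space X Y) real_space (\<lambda>(u, x). H u x)"
    unfolding smooth_map_def
  proof (intro conjI allI ballI)
    fix l W c assume "c \<in> plots (prod_space X Y) l W"
    then have p: "(\<lambda>z\<in>W. fst (c z)) \<in> plots X l W" and q: "(\<lambda>z\<in>W. snd (c z)) \<in> plots Y l W"
      by (auto simp: prod_space_def)
    have W: "openin (Euclidean_space l) W" using X[OF p] by blast
    have "smooth_on l W (\<lambda>z. H ((\<lambda>z\<in>W. fst (c z)) z) ((\<lambda>z\<in>W. snd (c z)) z))" using * p q by blast
    then have "smooth_on l W (compose W (\<lambda>(u, x). H u x) c)"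
      by (rule smooth_on_cong[OF W, rotated]) (simp add: compose_def case_prod_unfold)
    then show "compose W (\<lambda>(u, x). H u x) c \<in> plots real_space l W"
      using W by (simp add: real_plot_iff Csmooth_iff compose_def)
  qed auto
qed

lemma joint_iff_smooth_map:
  "joint k U n D H \<longleftrightarrow> smooth_map (prod_space (eucl_space k U) (eucl_space n D)) real_space (\<lambda>(u, x). H u x)"
  unfolding joint_def
  by (rule prod_smooth_real_iff[symmetric]) (auto simp: eucl_plot_iff PiE_iff)

text \<open>From left to right the identity of \<Omega> is used as a plot; the converse is the chain
  rule.\<close>

lemma smooth_map_eucl_real_iff:
  assumes "openin (Euclidean_space n) \<Omega>"
  shows "smooth_map (eucl_space n \<Omega>) real_space f \<longleftrightarrow> smooth_on n \<Omega> f"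
proof
  assume "smooth_map (eucl_space n \<Omega>) real_space f"
  then have "compose \<Omega> f (\<lambda>u\<in>\<Omega>. u) \<in> plots real_space n \<Omega>"
    using eucl_plot_id[OF assms] unfolding smooth_map_def by blast
  then have "smooth_on n \<Omega> (compose \<Omega> f (\<lambda>u\<in>\<Omega>. u))" by (simp add: real_plot_iff Csmooth_iff)
  then show "smooth_on n \<Omega> f" by (rule smooth_on_cong[OF assms, rotated]) (simp add: compose_def)
next
  assume f: "smooth_on n \<Omega> f"
  show "smooth_map (eucl_space n \<Omega>) real_space f"
    unfolding smooth_map_def
  proof (intro conjI allI ballI)
    fix k U p assume p: "p \<in> plots (eucl_space n \<Omega>) k U"
    have "smooth_on k U (compose U f p)"
      using eucl_plot_compose[OF p assms f]
      by (rule smooth_on_cong[OF eucl_plotD(1)[OF p], rotated]) (simp add: compose_def)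
    then show "compose U f p \<in> plots real_space k U"
      using eucl_plotD(1)[OF p] by (simp add: real_plot_iff Csmooth_iff compose_def)
  qed auto
qed

lemma points_Csmooth_space:
  "openin (Euclidean_space n) \<Omega> \<Longrightarrow> points (Csmooth_space n \<Omega>) = Csmooth n \<Omega>"
  by (auto simp: Csmooth_space_def fun_space_def smooth_map_eucl_real_iff Csmooth_iff)

lemma Csmooth_plot_iff:
  assumes "openin (Euclidean_space n) \<Omega>"
  shows "d \<in> plots (Csmooth_space n \<Omega>) k U \<longleftrightarrow>
    d \<in> U \<rightarrow>\<^sub>E Csmooth n \<Omega> \<and> openin (Euclidean_space k) U \<and> joint k U n \<Omega> d"
  using points_Csmooth_space[OF assms]
  by (simp add: Csmooth_space_def fun_space_def joint_iff_smooth_map)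

section \<open>Generalized functions on an abstract index set\<close>

text \<open>Both Colombeau algebras are quotients of families of smooth functions \<open>F a\<close> on open sets
  \<open>D a\<close>, where moderateness and negligibility are tested along curves \<open>\<gamma>\<close> of indices as
  \<open>\<epsilon> \<rightarrow> 0\<close>; higher orders of vanishing are only required for curves in smaller classes \<open>\<Phi> q\<close>.
  In the special algebra the index is \<open>\<epsilon>\<close> itself, in the full algebra it is a test function and
  the curves are \<open>\<epsilon> \<mapsto> \<epsilon> \<odot> \<phi>\<close> with \<open>\<phi> \<in> \<A>\<^sub>q\<close>. The maps \<open>app\<close> and \<open>mk\<close> translate between the
  extensional encodings of the two algebras and plain families.\<close>

lemma eventually_unit: "eventually (\<lambda>\<epsilon>::real. 0 < \<epsilon> \<and> \<epsilon> \<le> 1) (at_right 0)"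
  unfolding eventually_at_right_field by (intro exI[of _ 1]) auto

lemma mderiv_unit: "i < n \<Longrightarrow> mderiv n (mi_unit i) f = pderiv_at i f"
proof -
  have *: "mderiv m (mi_unit i) f = f" if "m \<le> i" for m
    using that by (induction m) (auto simp: mi_unit_def)
  have "mderiv m (mi_unit i) f = pderiv_at i f" if "i < m" for m
    using that
  proof (induction m)
    case (Suc m)
    then show ?case using *[of m] by (cases "i = m") (auto simp: mi_unit_def)
  qed simp
  then show "i < n \<Longrightarrow> mderiv n (mi_unit i) f = pderiv_at i f" .
qed

lemma pderiv_const: "pderiv_at i (\<lambda>_. c) = (\<lambda>_. 0)"
  by (simp add: fun_eq_iff has_pd_pderiv[OF has_pd_const])

lemma bnd_const: "\<bar>c\<bar> \<le> b \<Longrightarrow> bnd n m K (\<lambda>_. c) b"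
proof (induction m arbitrary: c)
  case (Suc m)
  then have "bnd n m K (\<lambda>_. 0) b" by simp
  then show ?case using Suc.prems by (simp add: bnd_Suc pderiv_const)
qed (simp add: bnd_zero)

locale generalized_functions =
  fixes n :: nat and \<Omega> :: "rvec set" and A :: "'a set" and D :: "'a \<Rightarrow> rvec set"
    and app :: "'e \<Rightarrow> 'a \<Rightarrow> rfun" and mk :: "('a \<Rightarrow> rfun) \<Rightarrow> 'e" and E :: "'e set"
    and \<Phi> :: "nat \<Rightarrow> (real \<Rightarrow> 'a) set"
  assumes open_\<Omega>: "openin (Euclidean_space n) \<Omega>"
    and open_D: "a \<in> A \<Longrightarrow> openin (Euclidean_space n) (D a)"
    and D_subset: "a \<in> A \<Longrightarrow> D a \<subseteq> \<Omega>"
    and app_mk: "a \<in> A \<Longrightarrow> x \<in> D a \<Longrightarrow> app (mk F) a x = F a x"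
    and mk_E: "mk F \<in> E"
    and E_eqI: "u \<in> E \<Longrightarrow> v \<in> E \<Longrightarrow> (\<And>a x. a \<in> A \<Longrightarrow> x \<in> D a \<Longrightarrow> app u a x = app v a x) \<Longrightarrow> u = v"
    and \<Phi>_mono: "q \<le> q' \<Longrightarrow> \<Phi> q' \<subseteq> \<Phi> q"
    \<comment> \<open>The members of a family live on \<open>D a\<close> only. Along every
      admissible curve these domains eventually cover a given compact set, which gives bounds on
      that set a meaning.\<close>
    and approach: "\<gamma> \<in> \<Phi> 0 \<Longrightarrow> compact K \<Longrightarrow> K \<subseteq> \<Omega> \<Longrightarrow>
      eventually (\<lambda>\<epsilon>. \<gamma> \<epsilon> \<in> A \<and> K \<subseteq> D (\<gamma> \<epsilon>)) (at_right 0)"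
begin

section \<open>Asymptotic bounds along curves of indices\<close>

definition smooth_fam :: "('a \<Rightarrow> rfun) \<Rightarrow> bool" where
  "smooth_fam F \<longleftrightarrow> (\<forall>a\<in>A. smooth_on n (D a) (F a))"

definition grows :: "('a \<Rightarrow> rfun) \<Rightarrow> rvec set \<Rightarrow> nat \<Rightarrow> nat \<Rightarrow> (real \<Rightarrow> real) \<Rightarrow> bool" where
  "grows F K m q g \<longleftrightarrow>
    (\<forall>\<gamma>\<in>\<Phi> q. \<exists>C\<ge>0. eventually (\<lambda>\<epsilon>. bnd n m K (F (\<gamma> \<epsilon>)) (C * g \<epsilon>)) (at_right 0))"

text \<open>One number \<open>N\<close> serves both as exponent and as class of curves, as in the
  definition of the full algebra. It may be increased (\<open>grows_mono\<close>), which is how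
  estimates with different \<open>N\<close> are combined.\<close>

definition moderate :: "('a \<Rightarrow> rfun) \<Rightarrow> bool" where
  "moderate F \<longleftrightarrow> smooth_fam F \<and>
    (\<forall>K. compact K \<and> K \<subseteq> \<Omega> \<longrightarrow> (\<forall>m. \<exists>N. grows F K m N (\<lambda>\<epsilon>. 1 / \<epsilon> ^ N)))"

definition negligible :: "('a \<Rightarrow> rfun) \<Rightarrow> bool" where
  "negligible F \<longleftrightarrow> smooth_fam F \<and>
    (\<forall>K. compact K \<and> K \<subseteq> \<Omega> \<longrightarrow> (\<forall>m p. \<exists>q. grows F K m q (\<lambda>\<epsilon>. \<epsilon> ^ p)))"

lemma smooth_famD: "smooth_fam F \<Longrightarrow> a \<in> A \<Longrightarrow> smooth_on n (D a) (F a)"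
  by (simp add: smooth_fam_def)

lemma smooth_fam_cong:
  assumes "\<And>a x. a \<in> A \<Longrightarrow> x \<in> D a \<Longrightarrow> F a x = G a x" "smooth_fam F"
  shows "smooth_fam G"
  unfolding smooth_fam_def
proof
  fix a assume a: "a \<in> A"
  show "smooth_on n (D a) (G a)"
    by (rule smooth_on_cong[OF open_D[OF a] _ smooth_famD[OF assms(2) a]]) (rule assms(1)[OF a])
qed

lemma smooth_fam_add: "smooth_fam F \<Longrightarrow> smooth_fam G \<Longrightarrow> smooth_fam (\<lambda>a x. F a x + G a x)"
  unfolding smooth_fam_def by (intro ballI smooth_on_add open_D) auto

lemma smooth_fam_mult: "smooth_fam F \<Longrightarrow> smooth_fam G \<Longrightarrow> smooth_fam (\<lambda>a x. F a x * G a x)"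
  unfolding smooth_fam_def by (intro ballI smooth_on_mult open_D) auto

lemma smooth_fam_index: "smooth_fam (\<lambda>a x. c a)"
  unfolding smooth_fam_def by (intro ballI smooth_on_const open_D)

lemma smooth_fam_pd: "smooth_fam F \<Longrightarrow> set L \<subseteq> {..<n} \<Longrightarrow> smooth_fam (\<lambda>a. pd L (F a))"
  unfolding smooth_fam_def by (intro ballI smooth_on_pd open_D) auto

lemma \<Phi>_0: "\<gamma> \<in> \<Phi> q \<Longrightarrow> \<gamma> \<in> \<Phi> 0"
  using \<Phi>_mono[of 0 q] by blast

text \<open>Every estimate for sums, products, comparisons and congruences is a statement about
  single indices; the merging of the conditions that hold for small \<epsilon> is done here once and
  for all.\<close>

lemma grows_combine:
  assumes K: "compact K" "K \<subseteq> \<Omega>" and F: "grows F K m q g" and G: "grows G K m q h"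
    and step: "\<And>a \<epsilon> C C'. a \<in> A \<Longrightarrow> K \<subseteq> D a \<Longrightarrow> 0 < \<epsilon> \<Longrightarrow> \<epsilon> \<le> 1 \<Longrightarrow> 0 \<le> C \<Longrightarrow> 0 \<le> C' \<Longrightarrow>
      bnd n m K (F a) (C * g \<epsilon>) \<Longrightarrow> bnd n m K (G a) (C' * h \<epsilon>) \<Longrightarrow> bnd n m' K (H a) (c C C' * k \<epsilon>)"
    and c: "\<And>C C'. 0 \<le> C \<Longrightarrow> 0 \<le> C' \<Longrightarrow> 0 \<le> c C C'"
  shows "grows H K m' q k"
  unfolding grows_def
proof
  fix \<gamma> assume \<gamma>: "\<gamma> \<in> \<Phi> q"
  obtain C where C: "C \<ge> 0" "eventually (\<lambda>\<epsilon>. bnd n m K (F (\<gamma> \<epsilon>)) (C * g \<epsilon>)) (at_right 0)"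
    using F \<gamma> unfolding grows_def by blast
  obtain C' where C': "C' \<ge> 0" "eventually (\<lambda>\<epsilon>. bnd n m K (G (\<gamma> \<epsilon>)) (C' * h \<epsilon>)) (at_right 0)"
    using G \<gamma> unfolding grows_def by blast
  have "eventually (\<lambda>\<epsilon>. bnd n m' K (H (\<gamma> \<epsilon>)) (c C C' * k \<epsilon>)) (at_right 0)"
    using C(2) C'(2) approach[OF \<Phi>_0[OF \<gamma>] K] eventually_unit
    by eventually_elim (use step C(1) C'(1) in blast)
  then show "\<exists>C\<ge>0. eventually (\<lambda>\<epsilon>. bnd n m' K (H (\<gamma> \<epsilon>)) (C * k \<epsilon>)) (at_right 0)"
    using c[OF C(1) C'(1)] by blast
qed

text \<open>A larger \<open>q'\<close> admits fewer curves, and a larger \<open>h\<close> weakens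
  the bound.\<close>

lemma grows_mono:
  assumes "grows F K m q g" "compact K" "K \<subseteq> \<Omega>" "q \<le> q'" "m' \<le> m"
    "\<And>\<epsilon>. 0 < \<epsilon> \<Longrightarrow> \<epsilon> \<le> 1 \<Longrightarrow> g \<epsilon> \<le> h \<epsilon>"
  shows "grows F K m' q' h"
proof -
  have "grows F K m q' g" using assms(1) \<Phi>_mono[OF assms(4)] unfolding grows_def by blast
  then show ?thesis
    using assms(5,6)
    by (intro grows_combine[OF assms(2,3), of F m q' g F g m' F "\<lambda>C C'. C" h])
      (auto intro: bnd_mono mult_left_mono)
qed

lemma grows_cong:
  assumes K: "compact K" "K \<subseteq> \<Omega>" and eq: "\<And>a x. a \<in> A \<Longrightarrow> x \<in> D a \<Longrightarrow> F a x = G a x"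
    and F: "grows F K m q g"
  shows "grows G K m q g"
proof (rule grows_combine[OF K F F])
  show "bnd n m K (G a) ((\<lambda>C C'. C) C C' * g \<epsilon>)"
    if "a \<in> A" "K \<subseteq> D a" "bnd n m K (F a) (C * g \<epsilon>)" for a \<epsilon> C C'
    using bnd_cong[where f = "F a" and g = "G a" and m = m and c = "C * g \<epsilon>",
        OF open_D[OF that(1)] that(2) eq[OF that(1)]] that(3) by simp
qed auto

lemma grows_add:
  assumes "compact K" "K \<subseteq> \<Omega>" "smooth_fam F" "smooth_fam G" "grows F K m q g" "grows G K m q g"
  shows "grows (\<lambda>a x. F a x + G a x) K m q g"
proof (rule grows_combine[OF assms(1,2,5,6)])
  show "bnd n m K (\<lambda>x. F a x + G a x) ((\<lambda>C C'. C + C') C C' * g \<epsilon>)"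
    if "a \<in> A" "K \<subseteq> D a" "bnd n m K (F a) (C * g \<epsilon>)" "bnd n m K (G a) (C' * g \<epsilon>)" for a \<epsilon> C C'
    using bnd_add[OF open_D[OF that(1)] that(2) smooth_famD[OF assms(3) that(1)]
        smooth_famD[OF assms(4) that(1)] that(3,4)] by (simp add: distrib_right)
qed auto

lemma grows_mult:
  assumes "compact K" "K \<subseteq> \<Omega>" "smooth_fam F" "smooth_fam G" "grows F K m q g" "grows G K m q h"
    and pos: "\<And>\<epsilon>. 0 < \<epsilon> \<Longrightarrow> 0 \<le> g \<epsilon>" "\<And>\<epsilon>. 0 < \<epsilon> \<Longrightarrow> 0 \<le> h \<epsilon>"
  shows "grows (\<lambda>a x. F a x * G a x) K m q (\<lambda>\<epsilon>. g \<epsilon> * h \<epsilon>)"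
proof (rule grows_combine[OF assms(1,2,5,6)])
  show "bnd n m K (\<lambda>x. F a x * G a x) ((\<lambda>C C'. 2 ^ m * C * C') C C' * (g \<epsilon> * h \<epsilon>))"
    if "a \<in> A" "K \<subseteq> D a" "0 < \<epsilon>" "0 \<le> C" "0 \<le> C'"
      "bnd n m K (F a) (C * g \<epsilon>)" "bnd n m K (G a) (C' * h \<epsilon>)" for a \<epsilon> C C'
  proof -
    have "bnd n m K (\<lambda>x. F a x * G a x) (2 ^ m * (C * g \<epsilon>) * (C' * h \<epsilon>))"
      using that pos by (intro bnd_mult[OF open_D[OF that(1)] that(2) smooth_famD[OF assms(3) that(1)]
        smooth_famD[OF assms(4) that(1)] that(6,7)]) auto
    moreover have "2 ^ m * (C * g \<epsilon>) * (C' * h \<epsilon>) = 2 ^ m * C * C' * (g \<epsilon> * h \<epsilon>)" by simp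
    ultimately show ?thesis by (simp only:)
  qed
qed auto

lemma grows_pd:
  assumes "grows F K (m + length M) q g" "set M \<subseteq> {..<n}"
  shows "grows (\<lambda>a. pd M (F a)) K m q g"
  unfolding grows_def
proof
  fix \<gamma> assume "\<gamma> \<in> \<Phi> q"
  then obtain C where C: "C \<ge> 0" "eventually (\<lambda>\<epsilon>. bnd n (m + length M) K (F (\<gamma> \<epsilon>)) (C * g \<epsilon>)) (at_right 0)"
    using assms(1) unfolding grows_def by blast
  have "eventually (\<lambda>\<epsilon>. bnd n m K (pd M (F (\<gamma> \<epsilon>))) (C * g \<epsilon>)) (at_right 0)"
    using C(2) by eventually_elim (rule bnd_pd[OF _ assms(2)])
  then show "\<exists>C\<ge>0. eventually (\<lambda>\<epsilon>. bnd n m K (pd M (F (\<gamma> \<epsilon>))) (C * g \<epsilon>)) (at_right 0)"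
    using C(1) by blast
qed

lemma grows_index:
  assumes "\<And>\<gamma>. \<gamma> \<in> \<Phi> q \<Longrightarrow> \<exists>C\<ge>0. eventually (\<lambda>\<epsilon>. \<bar>c (\<gamma> \<epsilon>)\<bar> \<le> C * g \<epsilon>) (at_right 0)"
  shows "grows (\<lambda>a x. c a) K m q g"
  unfolding grows_def
proof
  fix \<gamma> assume "\<gamma> \<in> \<Phi> q"
  then obtain C where C: "C \<ge> 0" "eventually (\<lambda>\<epsilon>. \<bar>c (\<gamma> \<epsilon>)\<bar> \<le> C * g \<epsilon>) (at_right 0)"
    using assms by blast
  have "eventually (\<lambda>\<epsilon>. bnd n m K (\<lambda>x. c (\<gamma> \<epsilon>)) (C * g \<epsilon>)) (at_right 0)"
    using C(2) by eventually_elim (rule bnd_const)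
  then show "\<exists>C\<ge>0. eventually (\<lambda>\<epsilon>. bnd n m K (\<lambda>x. c (\<gamma> \<epsilon>)) (C * g \<epsilon>)) (at_right 0)" using C(1) by blast
qed

lemma inverse_power_mono: "0 < \<epsilon> \<Longrightarrow> \<epsilon> \<le> 1 \<Longrightarrow> N \<le> M \<Longrightarrow> 1 / \<epsilon> ^ N \<le> 1 / (\<epsilon>::real) ^ M"
  by (intro divide_left_mono power_decreasing mult_pos_pos) auto

lemma moderate_cong:
  assumes "\<And>a x. a \<in> A \<Longrightarrow> x \<in> D a \<Longrightarrow> F a x = G a x" "moderate F"
  shows "moderate G"
  unfolding moderate_def
proof (intro conjI allI impI)
  show "smooth_fam G" using assms by (intro smooth_fam_cong[of F G]) (auto simp: moderate_def)
  fix K m assume "compact K \<and> K \<subseteq> \<Omega>"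
  then have K: "compact K" "K \<subseteq> \<Omega>" by auto
  obtain N where "grows F K m N (\<lambda>\<epsilon>. 1 / \<epsilon> ^ N)"
    using assms(2) K unfolding moderate_def by blast
  then show "\<exists>N. grows G K m N (\<lambda>\<epsilon>. 1 / \<epsilon> ^ N)" using grows_cong[where F = F and G = G, OF K assms(1)] by blast
qed

lemma negligible_cong:
  assumes "\<And>a x. a \<in> A \<Longrightarrow> x \<in> D a \<Longrightarrow> F a x = G a x" "negligible F"
  shows "negligible G"
  unfolding negligible_def
proof (intro conjI allI impI)
  show "smooth_fam G" using assms by (intro smooth_fam_cong[of F G]) (auto simp: negligible_def)
  fix K m p assume "compact K \<and> K \<subseteq> \<Omega>"
  then have K: "compact K" "K \<subseteq> \<Omega>" by auto
  obtain q where "grows F K m q (\<lambda>\<epsilon>. \<epsilon> ^ p)"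
    using assms(2) K unfolding negligible_def by blast
  then show "\<exists>q. grows G K m q (\<lambda>\<epsilon>. \<epsilon> ^ p)" using grows_cong[where F = F and G = G, OF K assms(1)] by blast
qed

lemma moderateD:
  "moderate F \<Longrightarrow> compact K \<Longrightarrow> K \<subseteq> \<Omega> \<Longrightarrow> \<exists>N. grows F K m N (\<lambda>\<epsilon>. 1 / \<epsilon> ^ N)"
  "moderate F \<Longrightarrow> smooth_fam F"
  by (simp_all add: moderate_def)

lemma negligibleD:
  "negligible F \<Longrightarrow> compact K \<Longrightarrow> K \<subseteq> \<Omega> \<Longrightarrow> \<exists>q. grows F K m q (\<lambda>\<epsilon>. \<epsilon> ^ p)"
  "negligible F \<Longrightarrow> smooth_fam F"
  by (simp_all add: negligible_def)

lemma moderate_add: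
  assumes F: "moderate F" and G: "moderate G"
  shows "moderate (\<lambda>a x. F a x + G a x)"
  unfolding moderate_def
proof (intro conjI allI impI)
  show "smooth_fam (\<lambda>a x. F a x + G a x)" using moderateD(2)[OF F] moderateD(2)[OF G] by (rule smooth_fam_add)
  fix K m assume "compact K \<and> K \<subseteq> \<Omega>"
  then have K: "compact K" "K \<subseteq> \<Omega>" by auto
  obtain N where N: "grows F K m N (\<lambda>\<epsilon>. 1 / \<epsilon> ^ N)" using moderateD(1)[OF F K] by blast
  obtain M where M: "grows G K m M (\<lambda>\<epsilon>. 1 / \<epsilon> ^ M)" using moderateD(1)[OF G K] by blast
  have "grows (\<lambda>a x. F a x + G a x) K m (max N M) (\<lambda>\<epsilon>. 1 / \<epsilon> ^ max N M)"
  proof (rule grows_add[OF K moderateD(2)[OF F] moderateD(2)[OF G]])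
    show "grows F K m (max N M) (\<lambda>\<epsilon>. 1 / \<epsilon> ^ max N M)"
      by (rule grows_mono[OF N K _ order_refl]) (auto intro: inverse_power_mono)
    show "grows G K m (max N M) (\<lambda>\<epsilon>. 1 / \<epsilon> ^ max N M)"
      by (rule grows_mono[OF M K _ order_refl]) (auto intro: inverse_power_mono)
  qed
  then show "\<exists>N. grows (\<lambda>a x. F a x + G a x) K m N (\<lambda>\<epsilon>. 1 / \<epsilon> ^ N)" ..
qed

lemma moderate_mult:
  assumes F: "moderate F" and G: "moderate G"
  shows "moderate (\<lambda>a x. F a x * G a x)"
  unfolding moderate_def
proof (intro conjI allI impI)
  show "smooth_fam (\<lambda>a x. F a x * G a x)" using moderateD(2)[OF F] moderateD(2)[OF G] by (rule smooth_fam_mult)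
  fix K m assume "compact K \<and> K \<subseteq> \<Omega>"
  then have K: "compact K" "K \<subseteq> \<Omega>" by auto
  obtain N where N: "grows F K m N (\<lambda>\<epsilon>. 1 / \<epsilon> ^ N)" using moderateD(1)[OF F K] by blast
  obtain M where M: "grows G K m M (\<lambda>\<epsilon>. 1 / \<epsilon> ^ M)" using moderateD(1)[OF G K] by blast
  have "grows (\<lambda>a x. F a x * G a x) K m (N + M) (\<lambda>\<epsilon>. 1 / \<epsilon> ^ N * (1 / \<epsilon> ^ M))"
  proof (rule grows_mult[OF K moderateD(2)[OF F] moderateD(2)[OF G]])
    show "grows F K m (N + M) (\<lambda>\<epsilon>. 1 / \<epsilon> ^ N)"
      by (rule grows_mono[OF N K _ order_refl]) auto
    show "grows G K m (N + M) (\<lambda>\<epsilon>. 1 / \<epsilon> ^ M)"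
      by (rule grows_mono[OF M K _ order_refl]) auto
  qed auto
  then have "grows (\<lambda>a x. F a x * G a x) K m (N + M) (\<lambda>\<epsilon>. 1 / \<epsilon> ^ (N + M))"
    by (simp add: power_add)
  then show "\<exists>N. grows (\<lambda>a x. F a x * G a x) K m N (\<lambda>\<epsilon>. 1 / \<epsilon> ^ N)" by blast
qed

lemma negligible_add:
  assumes F: "negligible F" and G: "negligible G"
  shows "negligible (\<lambda>a x. F a x + G a x)"
  unfolding negligible_def
proof (intro conjI allI impI)
  show "smooth_fam (\<lambda>a x. F a x + G a x)" using negligibleD(2)[OF F] negligibleD(2)[OF G] by (rule smooth_fam_add)
  fix K m p assume "compact K \<and> K \<subseteq> \<Omega>"
  then have K: "compact K" "K \<subseteq> \<Omega>" by auto
  obtain q where q: "grows F K m q (\<lambda>\<epsilon>. \<epsilon> ^ p)" using negligibleD(1)[OF F K] by blast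
  obtain q' where q': "grows G K m q' (\<lambda>\<epsilon>. \<epsilon> ^ p)" using negligibleD(1)[OF G K] by blast
  have "grows (\<lambda>a x. F a x + G a x) K m (max q q') (\<lambda>\<epsilon>. \<epsilon> ^ p)"
  proof (rule grows_add[OF K negligibleD(2)[OF F] negligibleD(2)[OF G]])
    show "grows F K m (max q q') (\<lambda>\<epsilon>. \<epsilon> ^ p)" by (rule grows_mono[OF q K _ order_refl]) auto
    show "grows G K m (max q q') (\<lambda>\<epsilon>. \<epsilon> ^ p)" by (rule grows_mono[OF q' K _ order_refl]) auto
  qed
  then show "\<exists>q. grows (\<lambda>a x. F a x + G a x) K m q (\<lambda>\<epsilon>. \<epsilon> ^ p)" ..
qed

lemma negligible_mult:
  assumes F: "negligible F" and G: "moderate G"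
  shows "negligible (\<lambda>a x. F a x * G a x)"
  unfolding negligible_def
proof (intro conjI allI impI)
  show "smooth_fam (\<lambda>a x. F a x * G a x)" using negligibleD(2)[OF F] moderateD(2)[OF G] by (rule smooth_fam_mult)
  fix K m p assume "compact K \<and> K \<subseteq> \<Omega>"
  then have K: "compact K" "K \<subseteq> \<Omega>" by auto
  obtain M where M: "grows G K m M (\<lambda>\<epsilon>. 1 / \<epsilon> ^ M)" using moderateD(1)[OF G K] by blast
  \<comment> \<open>The additional order \<open>M\<close> of vanishing compensates the growth of the
    moderate factor.\<close>
  obtain q where q: "grows F K m q (\<lambda>\<epsilon>. \<epsilon> ^ (p + M))" using negligibleD(1)[OF F K] by blast
  have "grows (\<lambda>a x. F a x * G a x) K m (max q M) (\<lambda>\<epsilon>. \<epsilon> ^ (p + M) * (1 / \<epsilon> ^ M))"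
  proof (rule grows_mult[OF K negligibleD(2)[OF F] moderateD(2)[OF G]])
    show "grows F K m (max q M) (\<lambda>\<epsilon>. \<epsilon> ^ (p + M))" by (rule grows_mono[OF q K _ order_refl]) auto
    show "grows G K m (max q M) (\<lambda>\<epsilon>. 1 / \<epsilon> ^ M)" by (rule grows_mono[OF M K _ order_refl]) auto
  qed auto
  then have "grows (\<lambda>a x. F a x * G a x) K m (max q M) (\<lambda>\<epsilon>. \<epsilon> ^ p)"
    by (rule grows_mono[OF _ K order_refl order_refl]) (simp add: power_add)
  then show "\<exists>q. grows (\<lambda>a x. F a x * G a x) K m q (\<lambda>\<epsilon>. \<epsilon> ^ p)" ..
qed

lemma moderate_pd:
  assumes F: "moderate F" and L: "set L \<subseteq> {..<n}"
  shows "moderate (\<lambda>a. pd L (F a))"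
  unfolding moderate_def
proof (intro conjI allI impI)
  show "smooth_fam (\<lambda>a. pd L (F a))" by (rule smooth_fam_pd[OF moderateD(2)[OF F] L])
  fix K m assume "compact K \<and> K \<subseteq> \<Omega>"
  then have K: "compact K" "K \<subseteq> \<Omega>" by auto
  obtain N where "grows F K (m + length L) N (\<lambda>\<epsilon>. 1 / \<epsilon> ^ N)"
    using moderateD(1)[OF F K] by blast
  then show "\<exists>N. grows (\<lambda>a. pd L (F a)) K m N (\<lambda>\<epsilon>. 1 / \<epsilon> ^ N)" using grows_pd[where F = F, OF _ L] by blast
qed

lemma negligible_pd:
  assumes F: "negligible F" and L: "set L \<subseteq> {..<n}"
  shows "negligible (\<lambda>a. pd L (F a))"
  unfolding negligible_def
proof (intro conjI allI impI)
  show "smooth_fam (\<lambda>a. pd L (F a))" by (rule smooth_fam_pd[OF negligibleD(2)[OF F] L])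
  fix K m p assume "compact K \<and> K \<subseteq> \<Omega>"
  then have K: "compact K" "K \<subseteq> \<Omega>" by auto
  obtain q where "grows F K (m + length L) q (\<lambda>\<epsilon>. \<epsilon> ^ p)"
    using negligibleD(1)[OF F K] by blast
  then show "\<exists>q. grows (\<lambda>a. pd L (F a)) K m q (\<lambda>\<epsilon>. \<epsilon> ^ p)" using grows_pd[where F = F, OF _ L] by blast
qed

lemma moderate_index:
  assumes "\<And>a. \<bar>c a\<bar> \<le> B"
  shows "moderate (\<lambda>a x. c a)"
  unfolding moderate_def
proof (intro conjI allI impI smooth_fam_index)
  fix K m
  have "\<bar>c a\<bar> \<le> \<bar>B\<bar>" for a using assms[of a] by linarith
  then have "grows (\<lambda>a x. c a) K m 0 (\<lambda>\<epsilon>. 1 / \<epsilon> ^ 0)"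
    by (intro grows_index exI[of _ "\<bar>B\<bar>"]) simp
  then show "\<exists>N. grows (\<lambda>a x. c a) K m N (\<lambda>\<epsilon>. 1 / \<epsilon> ^ N)" ..
qed

lemma moderate_const: "moderate (\<lambda>a x. c)"
  by (rule moderate_index[of "\<lambda>_. c" "\<bar>c\<bar>"]) simp

lemma negligible_cmult: "negligible F \<Longrightarrow> negligible (\<lambda>a x. c * F a x)"
  using negligible_mult[OF _ moderate_const[of c], of F] by (simp add: mult.commute)

lemma negligible_zero: "negligible (\<lambda>a x. 0)"
  unfolding negligible_def
proof (intro conjI allI impI smooth_fam_index)
  fix K m p
  have "grows (\<lambda>a x. 0) K m 0 (\<lambda>\<epsilon>. \<epsilon> ^ p)" by (intro grows_index exI[of _ 0]) auto
  then show "\<exists>q. grows (\<lambda>a x. 0) K m q (\<lambda>\<epsilon>. \<epsilon> ^ p)" ..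
qed

lemma moderate_cmult: "moderate F \<Longrightarrow> moderate (\<lambda>a x. c * F a x)"
  by (rule moderate_mult[OF moderate_const])

lemma moderate_diff: "moderate F \<Longrightarrow> moderate G \<Longrightarrow> moderate (\<lambda>a x. F a x - G a x)"
  using moderate_add[OF _ moderate_cmult[of G "-1"], of F] by simp

lemma moderate_space:
  assumes "smooth_on n \<Omega> f" shows "moderate (\<lambda>a. f)"
  unfolding moderate_def
proof (intro conjI allI impI)
  show "smooth_fam (\<lambda>a. f)" unfolding smooth_fam_def using smooth_on_subset[OF assms D_subset] by blast
  fix K m assume "compact K \<and> K \<subseteq> \<Omega>"
  then obtain c where c: "c \<ge> 0" "bnd n m K f c" using bnd_exists[OF open_\<Omega> _ _ assms] by blast
  then have "grows (\<lambda>a. f) K m 0 (\<lambda>\<epsilon>. 1 / \<epsilon> ^ 0)"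
    unfolding grows_def by (intro ballI exI[of _ c]) simp
  then show "\<exists>N. grows (\<lambda>a. f) K m N (\<lambda>\<epsilon>. 1 / \<epsilon> ^ N)" ..
qed

end

lemma pd_lin:
  assumes "openin (Euclidean_space n) W" "smooth_on n W f" "smooth_on n W g"
  shows "set L \<subseteq> {..<n} \<Longrightarrow> x \<in> W \<Longrightarrow> pd L (\<lambda>x. c * f x + d * g x) x = c * pd L f x + d * pd L g x"
proof (induction L arbitrary: x)
  case (Cons i L)
  have L: "set L \<subseteq> {..<n}" and i: "i < n" using Cons.prems by auto
  have "pderiv_at i (pd L (\<lambda>x. c * f x + d * g x)) x = pderiv_at i (\<lambda>x. c * pd L f x + d * pd L g x) x"
    by (rule pderiv_at_cong[OF assms(1) Cons.prems(2) i]) (rule Cons.IH[OF L])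
  also have "\<dots> = c * pderiv_at i (pd L f) x + d * pderiv_at i (pd L g) x"
    by (intro has_pd_pderiv has_pd_add has_pd_cmult has_pd_smooth[OF assms(1) _ i Cons.prems(2)]
        smooth_on_pd[OF assms(1) _ L] assms)
  finally show ?case by simp
qed simp

context generalized_functions
begin

section \<open>The quotient algebra and its diffeology\<close>

definition EM :: "'e set" where
  "EM = {u \<in> E. moderate (app u)}"

definition rel :: "('e \<times> 'e) set" where
  "rel = {(u, v). u \<in> EM \<and> v \<in> EM \<and> negligible (\<lambda>a x. app u a x - app v a x)}"

text \<open>Joint smoothness is required for each index separately, without uniformity; this is what
  the functional diffeologies over discrete index sets amount to in both algebras
  (\<open>X_s_S\<close>, \<open>X_e_E\<close>).\<close>

definition X :: "'e dspace" where
  "X = \<lparr>points = EM, plots = (\<lambda>k U. {d \<in> U \<rightarrow>\<^sub>E EM. openin (Euclidean_space k) U \<and>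
     (\<forall>a\<in>A. joint k U n (D a) (\<lambda>u. app (d u) a))})\<rparr>"

definition G :: "'e set dspace" where
  "G = quot_space X rel"

definition Alg :: "(real, 'e set) module" where
  "Alg = \<lparr>carrier = EM // rel,
     mult = lift2 rel (\<lambda>u v. mk (\<lambda>a x. app u a x * app v a x)),
     one = rel `` {mk (\<lambda>a x. 1)},
     zero = rel `` {mk (\<lambda>a x. 0)},
     add = lift2 rel (\<lambda>u v. mk (\<lambda>a x. app u a x + app v a x)),
     smult = (\<lambda>c. lift1 rel (\<lambda>u. mk (\<lambda>a x. c * app u a x)))\<rparr>"

definition der :: "multi_index \<Rightarrow> 'e set \<Rightarrow> 'e set" where
  "der \<alpha> = lift1 rel (\<lambda>u. mk (\<lambda>a x. mderiv n \<alpha> (app u a) x))"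

lemma EM_D: "u \<in> EM \<Longrightarrow> moderate (app u)" "u \<in> EM \<Longrightarrow> u \<in> E"
  by (auto simp: EM_def)

lemma mk_EM: "moderate F \<Longrightarrow> mk F \<in> EM"
  unfolding EM_def using moderate_cong[of F "app (mk F)"] app_mk mk_E by auto

lemma relI:
  assumes "u \<in> EM" "v \<in> EM" "negligible F" "\<And>a x. a \<in> A \<Longrightarrow> x \<in> D a \<Longrightarrow> F a x = app u a x - app v a x"
  shows "(u, v) \<in> rel"
  using assms(1,2) negligible_cong[OF assms(4,3)] by (simp add: rel_def)

lemma relD: "(u, v) \<in> rel \<Longrightarrow> negligible (\<lambda>a x. app u a x - app v a x)"
  "(u, v) \<in> rel \<Longrightarrow> u \<in> EM" "(u, v) \<in> rel \<Longrightarrow> v \<in> EM"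
  by (auto simp: rel_def)

lemma equiv_rel: "equiv EM rel"
proof (rule equivI)
  show "rel \<subseteq> EM \<times> EM" by (auto simp: rel_def)
  show "refl_on EM rel"
    by (rule refl_onI) (rule relI[OF _ _ negligible_zero], auto)
  show "sym rel"
  proof (rule symI)
    fix u v assume *: "(u, v) \<in> rel"
    show "(v, u) \<in> rel"
      by (rule relI[OF relD(3,2)[OF *] negligible_cmult[OF relD(1)[OF *], of "-1"]]) simp
  qed
  show "trans rel"
  proof (rule transI)
    fix u v w assume *: "(u, v) \<in> rel" "(v, w) \<in> rel"
    show "(u, w) \<in> rel"
      by (rule relI[OF relD(2)[OF *(1)] relD(3)[OF *(2)] negligible_add[OF relD(1)[OF *(1)] relD(1)[OF *(2)]]]) simp
  qed
qed

lemma points_X [simp]: "points X = EM"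
  by (simp add: X_def)

lemma plots_X_iff: "d \<in> plots X k U \<longleftrightarrow> d \<in> U \<rightarrow>\<^sub>E EM \<and> openin (Euclidean_space k) U \<and>
    (\<forall>a\<in>A. joint k U n (D a) (\<lambda>u. app (d u) a))"
  by (simp add: X_def)

lemma plots_X_D:
  assumes "d \<in> plots X k U"
  shows "\<And>u. u \<in> U \<Longrightarrow> d u \<in> EM" "openin (Euclidean_space k) U"
    "\<And>a. a \<in> A \<Longrightarrow> joint k U n (D a) (\<lambda>u. app (d u) a)"
  using assms by (auto simp: plots_X_iff)

lemma diffeological_X: "diffeological_space X"
  unfolding diffeological_space_def
proof (intro conjI allI ballI impI)
  show "openin (Euclidean_space k) U" "d \<in> U \<rightarrow>\<^sub>E points X" if "d \<in> plots X k U" for k U d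
    using that by (simp_all add: plots_X_iff)
  show "(\<lambda>u\<in>U. e) \<in> plots X k U" if e: "e \<in> points X" and U: "openin (Euclidean_space k) U" for k U e
  proof -
    have "joint k U n (D a) (\<lambda>u. app ((\<lambda>u\<in>U. e) u) a)" if a: "a \<in> A" for a
    proof (rule joint_cong)
      show "joint k U n (D a) (\<lambda>u. app e a)"
        using smooth_famD[OF moderateD(2)[OF EM_D(1)] a, of e] e by (intro joint_space open_D a) simp
    qed simp
    then show ?thesis using e U by (simp add: plots_X_iff)
  qed
  show "compose V d g \<in> plots X l V"
    if d: "d \<in> plots X k U" and g: "g \<in> plots (eucl_space k U) l V" for k U l V d g
  proof -
    have "joint l V n (D a) (\<lambda>v. app (compose V d g v) a)" if a: "a \<in> A" for a
    proof (rule jointI)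
      fix l' W p q assume W: "openin (Euclidean_space l') W" and p: "p \<in> plots (eucl_space l V) l' W"
        and q: "q \<in> plots (eucl_space n (D a)) l' W"
      have "compose W g p \<in> plots (eucl_space k U) l' W" by (rule eucl_plot_comp[OF p g eucl_plotD(1)[OF g]])
      from jointD[OF plots_X_D(3)[OF d a] this q]
      show "smooth_on l' W (\<lambda>z. app (compose V d g (p z)) a (q z))"
        by (rule smooth_on_cong[OF W, rotated]) (simp add: compose_def eucl_plotD(3)[OF p])
    qed
    then show ?thesis
      using eucl_plotD(1,3)[OF g] plots_X_D(1)[OF d] by (simp add: plots_X_iff compose_def)
  qed
  show "d \<in> plots X k U"
    if d: "d \<in> U \<rightarrow>\<^sub>E points X" and U: "openin (Euclidean_space k) U"
      and loc: "\<forall>u\<in>U. \<exists>W. openin (Euclidean_space k) W \<and> u \<in> W \<and> W \<subseteq> U \<and> restrict d W \<in> plots X k W" for k U d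
  proof -
    have "joint k U n (D a) (\<lambda>u. app (d u) a)" if a: "a \<in> A" for a
    proof (rule jointI)
      fix l W p q assume W: "openin (Euclidean_space l) W" and p: "p \<in> plots (eucl_space k U) l W"
        and q: "q \<in> plots (eucl_space n (D a)) l W"
      show "smooth_on l W (\<lambda>z. app (d (p z)) a (q z))"
      proof (rule smooth_on_local[OF W])
        fix z assume z: "z \<in> W"
        obtain V where V: "openin (Euclidean_space k) V" "p z \<in> V" "restrict d V \<in> plots X k V"
          using loc eucl_plotD(3)[OF p z] by blast
        let ?W = "{z \<in> W. p z \<in> V}"
        have o: "openin (Euclidean_space l) ?W" by (rule eucl_plot_vimage[OF p U V(1)])
        have p': "restrict p ?W \<in> plots (eucl_space k V) l ?W" by (rule eucl_plot_restrict[OF p o]) auto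
        have q': "restrict q ?W \<in> plots (eucl_space n (D a)) l ?W"
          by (rule eucl_plot_restrict[OF q o]) (use eucl_plotD(3)[OF q] in auto)
        have "smooth_on l ?W (\<lambda>z. app (d (p z)) a (q z))"
          using jointD[OF plots_X_D(3)[OF V(3) a] p' q'] by (rule smooth_on_cong[OF o, rotated]) simp
        then show "\<exists>W. openin (Euclidean_space l) W \<and> z \<in> W \<and> smooth_on l W (\<lambda>z. app (d (p z)) a (q z))"
          using o z V(2) by blast
      qed
    qed
    then show ?thesis using d U by (simp add: plots_X_iff)
  qed
qed

lemma diffeological_G: "diffeological_space G"
  unfolding G_def by (rule diffeological_quot_space[OF diffeological_X]) (simp add: equiv_rel)

lemma points_G: "points G = EM // rel"
  by (simp add: G_def quot_space_def)

lemma plots_mk: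
  assumes "openin (Euclidean_space k) U" "\<And>u. u \<in> U \<Longrightarrow> moderate (F u)"
    "\<And>a. a \<in> A \<Longrightarrow> joint k U n (D a) (\<lambda>u. F u a)"
  shows "(\<lambda>u\<in>U. mk (F u)) \<in> plots X k U"
proof -
  have "joint k U n (D a) (\<lambda>u. app ((\<lambda>u\<in>U. mk (F u)) u) a)" if "a \<in> A" for a
    by (rule joint_cong[OF assms(3)[OF that]]) (simp add: app_mk[OF that])
  then show ?thesis using assms(1,2) mk_EM by (simp add: plots_X_iff)
qed

lemma add_EM: "u \<in> EM \<Longrightarrow> v \<in> EM \<Longrightarrow> mk (\<lambda>a x. app u a x + app v a x) \<in> EM"
  by (intro mk_EM moderate_add EM_D)

lemma mult_EM: "u \<in> EM \<Longrightarrow> v \<in> EM \<Longrightarrow> mk (\<lambda>a x. app u a x * app v a x) \<in> EM"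
  by (intro mk_EM moderate_mult EM_D)

lemma smult_EM: "u \<in> EM \<Longrightarrow> mk (\<lambda>a x. c * app u a x) \<in> EM"
  by (intro mk_EM moderate_cmult EM_D)

lemma const_EM: "mk (\<lambda>a x. c) \<in> EM"
  by (intro mk_EM moderate_const)

lemma der_EM: "u \<in> EM \<Longrightarrow> mk (\<lambda>a x. mderiv n \<alpha> (app u a) x) \<in> EM"
  unfolding mderiv_eq_pd by (intro mk_EM moderate_pd EM_D set_mi_list)

lemma add_rel:
  assumes "(u, u') \<in> rel" "(v, v') \<in> rel"
  shows "(mk (\<lambda>a x. app u a x + app v a x), mk (\<lambda>a x. app u' a x + app v' a x)) \<in> rel"
  by (rule relI[OF add_EM add_EM negligible_add[OF relD(1)[OF assms(1)] relD(1)[OF assms(2)]]])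
    (use assms relD in \<open>simp_all add: app_mk\<close>)

lemma mult_rel:
  assumes "(u, u') \<in> rel" "(v, v') \<in> rel"
  shows "(mk (\<lambda>a x. app u a x * app v a x), mk (\<lambda>a x. app u' a x * app v' a x)) \<in> rel"
  \<comment> \<open>The decomposition u v - u' v' = (u - u') v + (v - v') u'.\<close>
  by (rule relI[OF mult_EM mult_EM negligible_add[OF
        negligible_mult[OF relD(1)[OF assms(1)] EM_D(1)[OF relD(2)[OF assms(2)]]]
        negligible_mult[OF relD(1)[OF assms(2)] EM_D(1)[OF relD(3)[OF assms(1)]]]]])
    (use assms relD in \<open>simp_all add: app_mk algebra_simps\<close>)

lemma smult_rel:
  assumes "(u, u') \<in> rel"
  shows "(mk (\<lambda>a x. c * app u a x), mk (\<lambda>a x. c * app u' a x)) \<in> rel"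
  by (rule relI[OF smult_EM smult_EM negligible_cmult[OF relD(1)[OF assms], of c]])
    (use assms relD in \<open>simp_all add: app_mk algebra_simps\<close>)

lemma der_rel:
  assumes "(u, u') \<in> rel"
  shows "(mk (\<lambda>a x. mderiv n \<alpha> (app u a) x), mk (\<lambda>a x. mderiv n \<alpha> (app u' a) x)) \<in> rel"
proof (rule relI[OF der_EM der_EM])
  show "negligible (\<lambda>a. pd (mi_list n \<alpha>) (\<lambda>x. app u a x - app u' a x))"
    by (rule negligible_pd[OF relD(1)[OF assms] set_mi_list])
  fix a x assume a: "a \<in> A" "x \<in> D a"
  show "pd (mi_list n \<alpha>) (\<lambda>x. app u a x - app u' a x) x =
      app (mk (\<lambda>a x. mderiv n \<alpha> (app u a) x)) a x - app (mk (\<lambda>a x. mderiv n \<alpha> (app u' a) x)) a x"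
    using pd_lin[where c = 1 and d = "- 1", OF open_D[OF a(1)] smooth_famD[OF moderateD(2)[OF EM_D(1)[OF relD(2)[OF assms]]] a(1)]
      smooth_famD[OF moderateD(2)[OF EM_D(1)[OF relD(3)[OF assms]]] a(1)] set_mi_list a(2)]
    by (simp add: app_mk a mderiv_eq_pd)
qed (use assms relD in auto)

lemma add_class: "u \<in> EM \<Longrightarrow> v \<in> EM \<Longrightarrow>
    rel `` {u} \<oplus>\<^bsub>Alg\<^esub> rel `` {v} = rel `` {mk (\<lambda>a x. app u a x + app v a x)}"
  by (simp add: Alg_def lift2_class[where f = "\<lambda>u v. mk (\<lambda>a x. app u a x + app v a x)", OF equiv_rel add_rel])

lemma mult_class: "u \<in> EM \<Longrightarrow> v \<in> EM \<Longrightarrow>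
    rel `` {u} \<otimes>\<^bsub>Alg\<^esub> rel `` {v} = rel `` {mk (\<lambda>a x. app u a x * app v a x)}"
  by (simp add: Alg_def lift2_class[where f = "\<lambda>u v. mk (\<lambda>a x. app u a x * app v a x)", OF equiv_rel mult_rel])

lemma smult_class: "u \<in> EM \<Longrightarrow> c \<odot>\<^bsub>Alg\<^esub> rel `` {u} = rel `` {mk (\<lambda>a x. c * app u a x)}"
  by (simp add: Alg_def lift1_class[where f = "\<lambda>u. mk (\<lambda>a x. c * app u a x)", OF equiv_rel smult_rel])

lemma der_class: "u \<in> EM \<Longrightarrow> der \<alpha> (rel `` {u}) = rel `` {mk (\<lambda>a x. mderiv n \<alpha> (app u a) x)}"
  by (simp add: der_def lift1_class[where f = "\<lambda>u. mk (\<lambda>a x. mderiv n \<alpha> (app u a) x)", OF equiv_rel der_rel])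

lemma carrier_Alg: "carrier Alg = EM // rel"
  by (simp add: Alg_def)

lemma one_Alg: "\<one>\<^bsub>Alg\<^esub> = rel `` {mk (\<lambda>a x. 1)}" and zero_Alg: "\<zero>\<^bsub>Alg\<^esub> = rel `` {mk (\<lambda>a x. 0)}"
  by (simp_all add: Alg_def)

lemma class_carrier: "u \<in> EM \<Longrightarrow> rel `` {u} \<in> carrier Alg"
  by (simp add: carrier_Alg quotientI)

lemma carrier_cases:
  assumes "x \<in> carrier Alg" obtains u where "u \<in> EM" "x = rel `` {u}"
  using assms by (auto simp: carrier_Alg quotient_def)

text \<open>\<open>mk\<close> normalizes representatives. The algebra laws and the Leibniz rule then
  hold as equations between representatives, and no negligible difference has to be
  estimated.\<close>

lemma mk_eqI: "u \<in> E \<Longrightarrow> (\<And>a x. a \<in> A \<Longrightarrow> x \<in> D a \<Longrightarrow> F a x = app u a x) \<Longrightarrow> mk F = u"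
  by (rule E_eqI) (auto simp: mk_E app_mk)

lemmas class_ops = add_class mult_class smult_class add_EM mult_EM smult_EM const_EM class_carrier
  one_Alg zero_Alg

lemma class_cong: "u \<in> E \<Longrightarrow> (\<And>a x. a \<in> A \<Longrightarrow> x \<in> D a \<Longrightarrow> F a x = app u a x) \<Longrightarrow> rel `` {mk F} = rel `` {u}"
  using mk_eqI by simp

section \<open>Algebra laws and the Leibniz rule\<close>

lemma cring_real: "cring real_ring"
proof (rule cringI)
  show "abelian_group real_ring"
    by (rule abelian_groupI) (auto simp: real_ring_def intro: exI[of _ "- x" for x :: real] add.left_inverse)
  show "comm_monoid real_ring" by (rule comm_monoidI) (auto simp: real_ring_def)
qed (auto simp: real_ring_def distrib_right)

lemma cring_Alg: "cring Alg"
proof (rule cringI)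
  show "abelian_group Alg"
  proof (rule abelian_groupI)
    fix x y assume "x \<in> carrier Alg" "y \<in> carrier Alg"
    then obtain u v where [simp]: "u \<in> EM" "v \<in> EM" "x = rel `` {u}" "y = rel `` {v}" by (metis carrier_cases)
    show "x \<oplus>\<^bsub>Alg\<^esub> y \<in> carrier Alg" by (simp add: class_ops)
    show "x \<oplus>\<^bsub>Alg\<^esub> y = y \<oplus>\<^bsub>Alg\<^esub> x" by (simp add: class_ops add.commute)
  next
    show "\<zero>\<^bsub>Alg\<^esub> \<in> carrier Alg" by (simp add: class_ops)
  next
    fix x y z assume "x \<in> carrier Alg" "y \<in> carrier Alg" "z \<in> carrier Alg"
    then obtain u v w where [simp]: "u \<in> EM" "v \<in> EM" "w \<in> EM" "x = rel `` {u}" "y = rel `` {v}" "z = rel `` {w}"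
      by (metis carrier_cases)
    show "x \<oplus>\<^bsub>Alg\<^esub> y \<oplus>\<^bsub>Alg\<^esub> z = x \<oplus>\<^bsub>Alg\<^esub> (y \<oplus>\<^bsub>Alg\<^esub> z)"
      by (simp add: class_ops) (rule class_cong[OF mk_E], simp add: app_mk)
  next
    fix x assume "x \<in> carrier Alg"
    then obtain u where [simp]: "u \<in> EM" "x = rel `` {u}" by (metis carrier_cases)
    show "\<zero>\<^bsub>Alg\<^esub> \<oplus>\<^bsub>Alg\<^esub> x = x"
      by (simp add: class_ops) (rule class_cong, simp_all add: app_mk EM_D)
    \<comment> \<open>The additive inverse is the multiple by -1.\<close>
    have "rel `` {mk (\<lambda>a x. - 1 * app u a x)} \<oplus>\<^bsub>Alg\<^esub> x = \<zero>\<^bsub>Alg\<^esub>"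
      unfolding \<open>x = rel `` {u}\<close> zero_Alg add_class[OF smult_EM[OF \<open>u \<in> EM\<close>] \<open>u \<in> EM\<close>]
      by (rule class_cong[OF mk_E]) (simp add: app_mk)
    then show "\<exists>y\<in>carrier Alg. y \<oplus>\<^bsub>Alg\<^esub> x = \<zero>\<^bsub>Alg\<^esub>"
      using class_carrier[OF smult_EM[OF \<open>u \<in> EM\<close>]] by blast
  qed
  show "comm_monoid Alg"
  proof (rule comm_monoidI)
    fix x y assume "x \<in> carrier Alg" "y \<in> carrier Alg"
    then obtain u v where [simp]: "u \<in> EM" "v \<in> EM" "x = rel `` {u}" "y = rel `` {v}" by (metis carrier_cases)
    show "x \<otimes>\<^bsub>Alg\<^esub> y \<in> carrier Alg" by (simp add: class_ops)
    show "x \<otimes>\<^bsub>Alg\<^esub> y = y \<otimes>\<^bsub>Alg\<^esub> x" by (simp add: class_ops mult.commute)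
  next
    show "\<one>\<^bsub>Alg\<^esub> \<in> carrier Alg" by (simp add: class_ops)
  next
    fix x y z assume "x \<in> carrier Alg" "y \<in> carrier Alg" "z \<in> carrier Alg"
    then obtain u v w where [simp]: "u \<in> EM" "v \<in> EM" "w \<in> EM" "x = rel `` {u}" "y = rel `` {v}" "z = rel `` {w}"
      by (metis carrier_cases)
    show "x \<otimes>\<^bsub>Alg\<^esub> y \<otimes>\<^bsub>Alg\<^esub> z = x \<otimes>\<^bsub>Alg\<^esub> (y \<otimes>\<^bsub>Alg\<^esub> z)"
      by (simp add: class_ops) (rule class_cong[OF mk_E], simp add: app_mk)
  next
    fix x assume "x \<in> carrier Alg"
    then obtain u where [simp]: "u \<in> EM" "x = rel `` {u}" by (metis carrier_cases)
    show "\<one>\<^bsub>Alg\<^esub> \<otimes>\<^bsub>Alg\<^esub> x = x"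
      by (simp add: class_ops) (rule class_cong, simp_all add: app_mk EM_D)
  qed
next
  fix x y z assume "x \<in> carrier Alg" "y \<in> carrier Alg" "z \<in> carrier Alg"
  then obtain u v w where [simp]: "u \<in> EM" "v \<in> EM" "w \<in> EM" "x = rel `` {u}" "y = rel `` {v}" "z = rel `` {w}"
    by (metis carrier_cases)
  show "(x \<oplus>\<^bsub>Alg\<^esub> y) \<otimes>\<^bsub>Alg\<^esub> z = x \<otimes>\<^bsub>Alg\<^esub> z \<oplus>\<^bsub>Alg\<^esub> y \<otimes>\<^bsub>Alg\<^esub> z"
    by (simp add: class_ops) (rule class_cong[OF mk_E], simp add: app_mk distrib_right)
qed

lemma algebra_Alg: "Module.algebra real_ring Alg"
proof (rule algebraI[OF cring_real cring_Alg])
  fix a b :: real and x y assume "x \<in> carrier Alg" "y \<in> carrier Alg"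
  then obtain u v where [simp]: "u \<in> EM" "v \<in> EM" "x = rel `` {u}" "y = rel `` {v}" by (metis carrier_cases)
  show "a \<odot>\<^bsub>Alg\<^esub> x \<in> carrier Alg" by (simp add: class_ops)
  show "(a \<oplus>\<^bsub>real_ring\<^esub> b) \<odot>\<^bsub>Alg\<^esub> x = a \<odot>\<^bsub>Alg\<^esub> x \<oplus>\<^bsub>Alg\<^esub> b \<odot>\<^bsub>Alg\<^esub> x"
    by (simp add: class_ops real_ring_def) (rule class_cong[OF mk_E], simp add: app_mk distrib_right)
  show "a \<odot>\<^bsub>Alg\<^esub> (x \<oplus>\<^bsub>Alg\<^esub> y) = a \<odot>\<^bsub>Alg\<^esub> x \<oplus>\<^bsub>Alg\<^esub> a \<odot>\<^bsub>Alg\<^esub> y"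
    by (simp add: class_ops) (rule class_cong[OF mk_E], simp add: app_mk distrib_left)
  show "(a \<otimes>\<^bsub>real_ring\<^esub> b) \<odot>\<^bsub>Alg\<^esub> x = a \<odot>\<^bsub>Alg\<^esub> (b \<odot>\<^bsub>Alg\<^esub> x)"
    by (simp add: class_ops real_ring_def) (rule class_cong[OF mk_E], simp add: app_mk)
  show "\<one>\<^bsub>real_ring\<^esub> \<odot>\<^bsub>Alg\<^esub> x = x"
    by (simp add: class_ops real_ring_def) (rule class_cong, simp_all add: EM_D)
  show "a \<odot>\<^bsub>Alg\<^esub> x \<otimes>\<^bsub>Alg\<^esub> y = a \<odot>\<^bsub>Alg\<^esub> (x \<otimes>\<^bsub>Alg\<^esub> y)"
    by (simp add: class_ops) (rule class_cong[OF mk_E], simp add: app_mk)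
qed

lemma derivation_der:
  assumes i: "i < n" shows "derivation Alg (der (mi_unit i))"
  unfolding derivation_def
proof (intro conjI allI ballI)
  have sm: "smooth_on n (D a) (app u a)" if "u \<in> EM" "a \<in> A" for u a
    using smooth_famD[OF moderateD(2)[OF EM_D(1)[OF that(1)]] that(2)] .
  have hp: "has_pd i (app u a) x (pderiv_at i (app u a) x)" if "u \<in> EM" "a \<in> A" "x \<in> D a" for u a x
    by (rule has_pd_smooth[OF open_D[OF that(2)] sm[OF that(1,2)] i that(3)])
  \<comment> \<open>\<open>mk\<close> changes a family only off its domains, and these are
    open.\<close>
  have dmk: "pderiv_at i (app (mk F) a) x = pderiv_at i (F a) x" if "a \<in> A" "x \<in> D a" for F a x
    by (rule pderiv_at_cong[OF open_D[OF that(1)] that(2) i]) (rule app_mk[OF that(1)])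
  note dc = der_class[of _ "mi_unit i", unfolded mderiv_unit[OF i]]
  have dEM: "mk (\<lambda>a x. pderiv_at i (app u a) x) \<in> EM" if "u \<in> EM" for u
    using der_EM[OF that, of "mi_unit i"] by (simp only: mderiv_unit[OF i])
  show "der (mi_unit i) \<in> carrier Alg \<rightarrow> carrier Alg"
  proof
    fix x assume "x \<in> carrier Alg"
    then obtain u where "u \<in> EM" "x = rel `` {u}" by (metis carrier_cases)
    then show "der (mi_unit i) x \<in> carrier Alg" by (simp add: dc dEM class_carrier)
  qed
  fix x assume "x \<in> carrier Alg"
  then obtain u where u [simp]: "u \<in> EM" "x = rel `` {u}" by (metis carrier_cases)
  show "der (mi_unit i) (c \<odot>\<^bsub>Alg\<^esub> x) = c \<odot>\<^bsub>Alg\<^esub> der (mi_unit i) x" for c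
  proof -
    have "pderiv_at i (\<lambda>x. c * app u a x) x = c * pderiv_at i (app u a) x" if "a \<in> A" "x \<in> D a" for a x
      by (intro has_pd_pderiv has_pd_cmult hp u that)
    then show ?thesis
      by (simp add: class_ops dc dEM) (rule class_cong[OF mk_E], simp add: app_mk dmk)
  qed
  fix y assume "y \<in> carrier Alg"
  then obtain v where v [simp]: "v \<in> EM" "y = rel `` {v}" by (metis carrier_cases)
  show "der (mi_unit i) (x \<oplus>\<^bsub>Alg\<^esub> y) = der (mi_unit i) x \<oplus>\<^bsub>Alg\<^esub> der (mi_unit i) y"
  proof -
    have "pderiv_at i (\<lambda>x. app u a x + app v a x) x = pderiv_at i (app u a) x + pderiv_at i (app v a) x"
      if "a \<in> A" "x \<in> D a" for a x
      by (intro has_pd_pderiv has_pd_add hp u v that)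
    then show ?thesis
      by (simp add: class_ops dc dEM) (rule class_cong[OF mk_E], simp add: app_mk dmk)
  qed
  show "der (mi_unit i) (x \<otimes>\<^bsub>Alg\<^esub> y) =
      (der (mi_unit i) x \<otimes>\<^bsub>Alg\<^esub> y) \<oplus>\<^bsub>Alg\<^esub> (x \<otimes>\<^bsub>Alg\<^esub> der (mi_unit i) y)"
  proof -
    have "pderiv_at i (\<lambda>x. app u a x * app v a x) x =
        pderiv_at i (app u a) x * app v a x + app u a x * pderiv_at i (app v a) x"
      if "a \<in> A" "x \<in> D a" for a x
      by (intro has_pd_pderiv has_pd_mult hp u v that)
    then show ?thesis
      by (simp add: class_ops dc dEM) (rule class_cong[OF mk_E], simp add: app_mk dmk)
  qed
qed

section \<open>Smoothness of the operations and the D-topology\<close>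

lemma smooth_add: "smooth_map (prod_space G G) G (\<lambda>(x, y). x \<oplus>\<^bsub>Alg\<^esub> y)"
proof -
  have "smooth_map (prod_space G G) G (\<lambda>(x, y). lift2 rel (\<lambda>u v. mk (\<lambda>a x. app u a x + app v a x)) x y)"
    unfolding G_def
  proof (rule smooth_map_lift2[OF diffeological_X])
    show "(\<lambda>u\<in>U. mk (\<lambda>a x. app (d u) a x + app (e u) a x)) \<in> plots X k U"
      if "d \<in> plots X k U" "e \<in> plots X k U" for k U d e
      using that by (intro plots_mk moderate_add joint_add plots_X_D EM_D) auto
  qed (use equiv_rel add_rel add_EM in simp_all)
  then show ?thesis by (simp add: Alg_def)
qed

lemma smooth_mult: "smooth_map (prod_space G G) G (\<lambda>(x, y). x \<otimes>\<^bsub>Alg\<^esub> y)"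
proof -
  have "smooth_map (prod_space G G) G (\<lambda>(x, y). lift2 rel (\<lambda>u v. mk (\<lambda>a x. app u a x * app v a x)) x y)"
    unfolding G_def
  proof (rule smooth_map_lift2[OF diffeological_X])
    show "(\<lambda>u\<in>U. mk (\<lambda>a x. app (d u) a x * app (e u) a x)) \<in> plots X k U"
      if "d \<in> plots X k U" "e \<in> plots X k U" for k U d e
      using that by (intro plots_mk moderate_mult joint_mult plots_X_D EM_D) auto
  qed (use equiv_rel mult_rel mult_EM in simp_all)
  then show ?thesis by (simp add: Alg_def)
qed

lemma smooth_der: "smooth_map G G (der \<alpha>)"
  unfolding der_def G_def
proof (rule smooth_map_lift1[OF diffeological_X])
  show "(\<lambda>u\<in>U. mk (\<lambda>a x. mderiv n \<alpha> (app (d u) a) x)) \<in> plots X k U" if d: "d \<in> plots X k U" for k U d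
    unfolding mderiv_eq_pd
  proof (rule plots_mk[OF plots_X_D(2)[OF d]])
    show "moderate (\<lambda>a. pd (mi_list n \<alpha>) (app (d u) a))" if "u \<in> U" for u
      by (rule moderate_pd[OF EM_D(1)[OF plots_X_D(1)[OF d that]] set_mi_list])
    show "joint k U n (D a) (\<lambda>u. pd (mi_list n \<alpha>) (app (d u) a))" if "a \<in> A" for a
      by (rule joint_pd[OF plots_X_D(2)[OF d] open_D[OF that] plots_X_D(3)[OF d that] set_mi_list])
  qed
qed (use equiv_rel der_rel der_EM in simp_all)

lemma continuous_der: "continuous_map (D_topology G) (D_topology G) (der \<alpha>)"
  by (rule continuous_map_D_topology[OF diffeological_G diffeological_G smooth_der])

text \<open>Stated for any \<open>s\<close> given by families that do not depend on the index, so
  that it applies to \<open>sigma_s\<close> and \<open>sigma_e\<close> alike.\<close>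

lemma smooth_sigma:
  assumes "\<And>f. f \<in> Csmooth n \<Omega> \<Longrightarrow> s f = rel `` {mk (\<lambda>a. f)}"
  shows "smooth_map (Csmooth_space n \<Omega>) G s"
  unfolding G_def
proof (rule smooth_map_class[where w = "\<lambda>f. mk (\<lambda>a. f)", OF diffeological_X])
  show "openin (Euclidean_space k) U \<and> d \<in> U \<rightarrow> points (Csmooth_space n \<Omega>)"
    if "d \<in> plots (Csmooth_space n \<Omega>) k U" for k U d
    using that by (auto simp: Csmooth_plot_iff[OF open_\<Omega>] points_Csmooth_space[OF open_\<Omega>])
  show "mk (\<lambda>a. f) \<in> points X" if "f \<in> points (Csmooth_space n \<Omega>)" for f
    using that mk_EM[OF moderate_space, of f] by (simp add: points_Csmooth_space[OF open_\<Omega>] Csmooth_iff)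
  show "s f = rel `` {mk (\<lambda>a. f)}" if "f \<in> points (Csmooth_space n \<Omega>)" for f
    using that assms by (simp add: points_Csmooth_space[OF open_\<Omega>])
  show "(\<lambda>u\<in>U. mk (\<lambda>a. d u)) \<in> plots X k U" if d: "d \<in> plots (Csmooth_space n \<Omega>) k U" for k U d
  proof (rule plots_mk)
    note d' = d[unfolded Csmooth_plot_iff[OF open_\<Omega>]]
    show "openin (Euclidean_space k) U" using d' by simp
    show "moderate (\<lambda>a. d u)" if "u \<in> U" for u
    proof (rule moderate_space)
      have "d u \<in> Csmooth n \<Omega>" using d' that by auto
      then show "smooth_on n \<Omega> (d u)" by (simp add: Csmooth_iff)
    qed
    show "joint k U n (D a) d" if a: "a \<in> A" for a
    proof (rule jointI)
      fix l W p q assume W: "openin (Euclidean_space l) W" and p: "p \<in> plots (eucl_space k U) l W"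
        and q: "q \<in> plots (eucl_space n (D a)) l W"
      have "restrict q W \<in> plots (eucl_space n \<Omega>) l W"
        by (rule eucl_plot_restrict[OF q W order_refl]) (use eucl_plotD(3)[OF q] D_subset[OF a] in blast)
      moreover have "restrict q W = q" using eucl_plotD(2)[OF q] by (auto simp: PiE_def extensional_restrict)
      ultimately have "q \<in> plots (eucl_space n \<Omega>) l W" by simp
      then show "smooth_on l W (\<lambda>z. d (p z) (q z))" using d' p by (intro jointD) auto
    qed
  qed
qed

text \<open>With \<open>c t = exp (- (t \<rho>)\<^sup>2)\<close>, the classes of \<open>u + c t (v - u)\<close> form a plot that is the class of
  \<open>v\<close> at \<open>t = 0\<close> and the class of \<open>u\<close> elsewhere.\<close>

lemma D_topology_indiscrete:
  fixes \<rho> :: "'a \<Rightarrow> real"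
  assumes \<rho>: "\<And>\<gamma> s p. \<gamma> \<in> \<Phi> 0 \<Longrightarrow> s \<noteq> 0 \<Longrightarrow>
      \<exists>C\<ge>0. eventually (\<lambda>\<epsilon>. exp (- (s * \<rho> (\<gamma> \<epsilon>))\<^sup>2) \<le> C * \<epsilon> ^ p) (at_right 0)"
    and V: "openin (D_topology G) V" and V0: "V \<noteq> {}"
  shows "V = topspace (D_topology G)"
proof -
  have VG: "V \<subseteq> EM // rel" using V by (simp add: openin_D_topology points_G)
  obtain v where v: "v \<in> EM" "rel `` {v} \<in> V" using V0 VG by (auto simp: quotient_def)
  have "rel `` {u} \<in> V" if u: "u \<in> EM" for u
  proof -
    define c where "c t a = exp (- (t * \<rho> a)\<^sup>2)" for t a
    define F where "F t a x = app u a x + c t a * (app v a x - app u a x)" for t a x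
    have diff: "moderate (\<lambda>a x. app v a x - app u a x)" by (intro moderate_diff EM_D u v)
    \<comment> \<open>The factor \<open>c\<close> takes values between 0 and 1, hence preserves
      moderateness.\<close>
    have modF: "moderate (F t)" for t
      unfolding F_def
      by (intro moderate_add moderate_mult diff EM_D u moderate_index[of _ 1]) (simp add: c_def)
    let ?d = "\<lambda>t\<in>Rn 1. mk (F (t 0))"
    have d: "?d \<in> plots X 1 (Rn 1)"
    proof (rule plots_mk[OF openin_Rn modF])
      \<comment> \<open>Only smoothness in \<open>t\<close> and \<open>x\<close> for a fixed index
        is at stake; the collapse of \<open>c t a\<close> as \<epsilon> tends to 0 is not seen
        here.\<close>
      fix a assume a: "a \<in> A"
      have "smooth_on 1 (Rn 1) (\<lambda>t. - ((t 0 * \<rho> a) * (t 0 * \<rho> a)))"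
        using smooth_on_cmult[OF openin_Rn, of 1 "\<lambda>t. (t 0 * \<rho> a) * (t 0 * \<rho> a)" "-1"]
          smooth_on_mult[OF openin_Rn smooth_on_mult[OF openin_Rn smooth_on_coord[OF openin_Rn] smooth_on_const[OF openin_Rn]]
            smooth_on_mult[OF openin_Rn smooth_on_coord[OF openin_Rn] smooth_on_const[OF openin_Rn]], of 1 0 "\<rho> a" 0 "\<rho> a"]
        by simp
      then have c: "smooth_on 1 (Rn 1) (\<lambda>t. c (t 0) a)"
        unfolding c_def power2_eq_square by (rule smooth_on_exp[OF openin_Rn])
      have "smooth_on n (D a) (\<lambda>x. app v a x - app u a x)" "smooth_on n (D a) (app u a)"
        using smooth_famD[OF moderateD(2)[OF diff] a] smooth_famD[OF moderateD(2)[OF EM_D(1)[OF u]] a] .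
      then show "joint 1 (Rn 1) n (D a) (\<lambda>t. F (t 0) a)"
        unfolding F_def by (intro joint_add joint_mult joint_space open_D a joint_param[OF openin_Rn c])
    qed
    let ?D = "\<lambda>t\<in>Rn 1. rel `` {mk (F (t 0))}"
    have "?D \<in> plots G 1 (Rn 1)"
      unfolding G_def
    proof (rule plots_quotI[OF _ openin_Rn diffeological_X])
      show "\<exists>W. \<exists>p\<in>plots X 1 W. t \<in> W \<and> W \<subseteq> Rn 1 \<and> (\<forall>w\<in>W. ?D w = rel `` {p w})" if "t \<in> Rn 1" for t
        using that by (intro exI[of _ "Rn 1"] bexI[OF _ d]) simp
    qed simp
    then have "openin (Euclidean_space 1) {t \<in> Rn 1. ?D t \<in> V}"
      using V openin_Rn unfolding openin_D_topology by blast
    moreover have "(\<lambda>_. 0) \<in> {t \<in> Rn 1. ?D t \<in> V}"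
    proof -
      have "mk (F 0) = v" by (rule mk_eqI[OF EM_D(2)[OF v(1)]]) (simp add: F_def c_def)
      then show ?thesis using v(2) by (simp add: Rn_iff)
    qed
    ultimately obtain r where r: "r > 0" "obox 1 (\<lambda>_. 0) r \<subseteq> {t \<in> Rn 1. ?D t \<in> V}"
      by (rule openin_EuclideanE)
    \<comment> \<open>A nonzero parameter inside the box, where \<open>c\<close> is
      negligible.\<close>
    define t :: rvec where "t = (\<lambda>i. if i = 0 then r / 2 else 0)"
    have "t \<in> obox 1 (\<lambda>_. 0) r" using r(1) by (simp add: t_def obox_def Rn_iff)
    then have "rel `` {mk (F (r / 2))} \<in> V" using r(2) by (auto simp: t_def)
    moreover have "(mk (F (r / 2)), u) \<in> rel"
    proof (rule relI[OF mk_EM[OF modF] u negligible_mult[OF _ diff]])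
      show "negligible (\<lambda>a x. c (r / 2) a)"
        unfolding negligible_def
      proof (intro conjI allI impI smooth_fam_index)
        fix K m p
        have "grows (\<lambda>a x. c (r / 2) a) K m 0 (\<lambda>\<epsilon>. \<epsilon> ^ p)"
          using \<rho>[of _ "r / 2" p] r(1) by (intro grows_index) (simp add: c_def)
        then show "\<exists>q. grows (\<lambda>a x. c (r / 2) a) K m q (\<lambda>\<epsilon>. \<epsilon> ^ p)" ..
      qed
      show "c (r / 2) a * (app v a x - app u a x) = app (mk (F (r / 2))) a x - app u a x"
        if "a \<in> A" "x \<in> D a" for a x
        using that by (simp add: app_mk F_def)
    qed
    ultimately show ?thesis using equiv_class_eq[OF equiv_rel] by metis
  qed
  then have "EM // rel \<subseteq> V" by (auto simp: quotient_def)
  then show ?thesis using VG by (simp add: topspace_D_topology[OF diffeological_G] points_G)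
qed

text \<open>Every map into an indiscrete space is continuous, so only closure under the operations
  remains.\<close>

lemma topological_algebra_indiscrete:
  assumes "\<And>V. openin (D_topology G) V \<Longrightarrow> V \<noteq> {} \<Longrightarrow> V = topspace (D_topology G)"
  shows "topological_algebra (D_topology G) Alg"
proof -
  let ?T = "D_topology G"
  have T: "topspace ?T = carrier Alg" by (simp add: topspace_D_topology[OF diffeological_G] points_G carrier_Alg)
  have *: "continuous_map S ?T f" if f: "f \<in> topspace S \<rightarrow> topspace ?T" for f and S :: "'z topology"
    unfolding continuous_map_def
  proof (intro conjI allI impI)
    fix V assume V: "openin ?T V"
    show "openin S {x \<in> topspace S. f x \<in> V}"
    proof (cases "V = {}")
      case False
      then have "{x \<in> topspace S. f x \<in> V} = topspace S" using assms[OF V] f by auto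
      then show ?thesis by simp
    qed simp
  qed (rule f)
  interpret Module.algebra real_ring Alg by (rule algebra_Alg)
  have cl: "x \<oplus>\<^bsub>Alg\<^esub> y \<in> carrier Alg" "x \<otimes>\<^bsub>Alg\<^esub> y \<in> carrier Alg" "c \<odot>\<^bsub>Alg\<^esub> x \<in> carrier Alg"
    if "x \<in> carrier Alg" "y \<in> carrier Alg" for x y c
    using that by (auto intro: smult_closed simp: real_ring_def)
  show ?thesis
    unfolding topological_algebra_def
    by (intro conjI algebra_Alg T *) (auto simp: T cl)
qed

end

text \<open>Merges the orders obtained for the finitely many derivatives up to a given
  order.\<close>

lemma finite_choice_mono:
  fixes R :: "nat \<Rightarrow> 'b \<Rightarrow> bool"
  assumes "finite S" "\<And>s. s \<in> S \<Longrightarrow> \<exists>N. R N s" "\<And>N M s. N \<le> M \<Longrightarrow> R N s \<Longrightarrow> R M s"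
  shows "\<exists>N. \<forall>s\<in>S. R N s"
  using assms(1,2)
proof (induction S)
  case (insert s S)
  obtain N where N: "\<forall>s\<in>S. R N s" using insert by auto
  obtain M where M: "R M s" using insert by auto
  show ?case
    using assms(3)[of N "max N M"] assms(3)[of M "max N M"] N M by (intro exI[of _ "max N M"]) auto
qed simp

section \<open>Agreement with the conditions on single multi-indices\<close>

lemma pd_bound_bigo:
  fixes u :: "real \<Rightarrow> rfun"
  assumes K: "compact K"
    and ev: "eventually (\<lambda>\<epsilon>. openin (Euclidean_space n) (D \<epsilon>) \<and> K \<subseteq> D \<epsilon> \<and> smooth_on n (D \<epsilon>) (u \<epsilon>)) (at_right 0)"
    and g: "eventually (\<lambda>\<epsilon>. g \<epsilon> > 0) (at_right 0)"
    and L: "set L \<subseteq> {..<n}"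
    and O: "(\<lambda>\<epsilon>. sup_abs K (mderiv n (count_list L) (u \<epsilon>))) \<in> O[at_right 0](g)"
  shows "\<exists>C. eventually (\<lambda>\<epsilon>. \<forall>x\<in>K. \<bar>pd L (u \<epsilon>) x\<bar> \<le> C * g \<epsilon>) (at_right 0)"
proof -
  obtain C where C: "eventually (\<lambda>\<epsilon>. \<forall>x\<in>K. \<bar>mderiv n (count_list L) (u \<epsilon>) x\<bar> \<le> C * g \<epsilon>) (at_right 0)"
    using O unfolding mderiv_eq_pd sup_abs_bigo_iff[OF K ev g set_mi_list] by blast
  have "eventually (\<lambda>\<epsilon>. \<forall>x\<in>K. \<bar>pd L (u \<epsilon>) x\<bar> \<le> C * g \<epsilon>) (at_right 0)"
    using C ev
  proof eventually_elim
    case (elim \<epsilon>)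
    show ?case
    proof
      fix x assume x: "x \<in> K"
      then have "pd L (u \<epsilon>) x = mderiv n (count_list L) (u \<epsilon>) x"
        using elim(2) L by (intro pd_eq_mderiv[of n "D \<epsilon>"]) auto
      then show "\<bar>pd L (u \<epsilon>) x\<bar> \<le> C * g \<epsilon>" using elim(1) x by simp
    qed
  qed
  then show ?thesis by blast
qed

context generalized_functions
begin

text \<open>The definitions choose an order for each multi-index, while \<open>grows\<close> treats
  all derivatives up to order \<open>m\<close> together. These are finitely many, and both \<Phi>
  and \<open>g\<close> are monotone in \<open>N\<close>, so a common \<open>N\<close> exists.
  Moderateness has a bound that varies with \<open>N\<close>, negligibility one that does not;
  \<open>g N\<close> covers both.\<close>

lemma grows_iff:
  assumes K: "compact K" "K \<subseteq> \<Omega>" and F: "smooth_fam F"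
    and pos: "\<And>N \<epsilon>. 0 < \<epsilon> \<Longrightarrow> 0 < g N \<epsilon>"
    and mono: "\<And>N M \<epsilon>. N \<le> M \<Longrightarrow> 0 < \<epsilon> \<Longrightarrow> \<epsilon> \<le> 1 \<Longrightarrow> g N \<epsilon> \<le> g M \<epsilon>"
  shows "(\<forall>m. \<exists>N. grows F K m N (g N)) \<longleftrightarrow>
    (\<forall>\<alpha>. \<exists>N. \<forall>\<gamma>\<in>\<Phi> N. (\<lambda>\<epsilon>. sup_abs K (mderiv n \<alpha> (F (\<gamma> \<epsilon>)))) \<in> O[at_right 0](g N))"
    (is "?l \<longleftrightarrow> ?r")
proof -
  have ev: "eventually (\<lambda>\<epsilon>. openin (Euclidean_space n) (D (\<gamma> \<epsilon>)) \<and> K \<subseteq> D (\<gamma> \<epsilon>) \<and>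
      smooth_on n (D (\<gamma> \<epsilon>)) (F (\<gamma> \<epsilon>))) (at_right 0)" if "\<gamma> \<in> \<Phi> N" for \<gamma> N
    using approach[OF \<Phi>_0[OF that] K] by eventually_elim (use open_D smooth_famD[OF F] in blast)
  have pos': "eventually (\<lambda>\<epsilon>. g N \<epsilon> > 0) (at_right 0)" for N
    using eventually_unit by eventually_elim (simp add: pos)
  show ?thesis
  proof
    assume l: ?l
    show ?r
    proof
      fix \<alpha>
      obtain N where N: "grows F K (mi_order n \<alpha>) N (g N)" using l by blast
      have "(\<lambda>\<epsilon>. sup_abs K (mderiv n \<alpha> (F (\<gamma> \<epsilon>)))) \<in> O[at_right 0](g N)" if \<gamma>: "\<gamma> \<in> \<Phi> N" for \<gamma>
        using N \<gamma> mderiv_bounds_iff[OF K(1) ev[OF \<gamma>] pos'[of N], of "mi_order n \<alpha>"]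
        unfolding grows_def by blast
      then show "\<exists>N. \<forall>\<gamma>\<in>\<Phi> N. (\<lambda>\<epsilon>. sup_abs K (mderiv n \<alpha> (F (\<gamma> \<epsilon>)))) \<in> O[at_right 0](g N)" by blast
    qed
  next
    assume r: ?r
    show ?l
    proof
      fix m
      let ?R = "\<lambda>N L. \<forall>\<gamma>\<in>\<Phi> N. (\<lambda>\<epsilon>. sup_abs K (mderiv n (count_list L) (F (\<gamma> \<epsilon>)))) \<in> O[at_right 0](g N)"
      have "\<exists>N. \<forall>L\<in>{L. set L \<subseteq> {..<n} \<and> length L \<le> m}. ?R N L"
      proof (rule finite_choice_mono[OF finite_lists])
        show "\<exists>N. ?R N L" for L using r by blast
        fix N M L assume NM: "N \<le> M" and R: "?R N L"
        have "g N \<in> O[at_right 0](g M)"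
        proof (rule bigoI[of _ 1])
          show "eventually (\<lambda>\<epsilon>. norm (g N \<epsilon>) \<le> 1 * norm (g M \<epsilon>)) (at_right 0)"
            using eventually_unit by eventually_elim (use mono[OF NM] pos in \<open>simp add: less_imp_le abs_of_pos\<close>)
        qed
        then show "?R M L" using R \<Phi>_mono[OF NM] landau_o.big_trans by blast
      qed
      then obtain N where N: "\<And>L. set L \<subseteq> {..<n} \<Longrightarrow> length L \<le> m \<Longrightarrow> ?R N L" by blast
      have "grows F K m N (g N)"
        unfolding grows_def
      proof
        fix \<gamma> assume \<gamma>: "\<gamma> \<in> \<Phi> N"
        show "\<exists>C\<ge>0. eventually (\<lambda>\<epsilon>. bnd n m K (F (\<gamma> \<epsilon>)) (C * g N \<epsilon>)) (at_right 0)"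
          unfolding eventually_bnd_iff[OF pos']
        proof (intro allI impI)
          fix L assume L: "set L \<subseteq> {..<n}" "length L \<le> m"
          show "\<exists>C. eventually (\<lambda>\<epsilon>. \<forall>x\<in>K. \<bar>pd L (F (\<gamma> \<epsilon>)) x\<bar> \<le> C * g N \<epsilon>) (at_right 0)"
            by (rule pd_bound_bigo[OF K(1) ev[OF \<gamma>] pos' L(1)]) (use N[OF L] \<gamma> in blast)
        qed
      qed
      then show "\<exists>N. grows F K m N (g N)" ..
    qed
  qed
qed

lemma moderate_iff:
  "moderate F \<longleftrightarrow> smooth_fam F \<and> (\<forall>K. compact K \<and> K \<subseteq> \<Omega> \<longrightarrow> (\<forall>\<alpha>. \<exists>N. \<forall>\<gamma>\<in>\<Phi> N.
    (\<lambda>\<epsilon>. sup_abs K (mderiv n \<alpha> (F (\<gamma> \<epsilon>)))) \<in> O[at_right 0](\<lambda>\<epsilon>. 1 / \<epsilon> ^ N)))"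
proof -
  have "(\<forall>m. \<exists>N. grows F K m N (\<lambda>\<epsilon>. 1 / \<epsilon> ^ N)) \<longleftrightarrow> (\<forall>\<alpha>. \<exists>N. \<forall>\<gamma>\<in>\<Phi> N.
      (\<lambda>\<epsilon>. sup_abs K (mderiv n \<alpha> (F (\<gamma> \<epsilon>)))) \<in> O[at_right 0](\<lambda>\<epsilon>. 1 / \<epsilon> ^ N))"
    if "smooth_fam F" "compact K" "K \<subseteq> \<Omega>" for K
    by (rule grows_iff[OF that(2,3,1)]) (auto intro: inverse_power_mono)
  then show ?thesis unfolding moderate_def by auto
qed

lemma negligible_iff:
  "negligible F \<longleftrightarrow> smooth_fam F \<and> (\<forall>K. compact K \<and> K \<subseteq> \<Omega> \<longrightarrow> (\<forall>\<alpha> p. \<exists>q. \<forall>\<gamma>\<in>\<Phi> q.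
    (\<lambda>\<epsilon>. sup_abs K (mderiv n \<alpha> (F (\<gamma> \<epsilon>)))) \<in> O[at_right 0](\<lambda>\<epsilon>. \<epsilon> ^ p)))"
proof -
  have "(\<forall>m. \<exists>q. grows F K m q (\<lambda>\<epsilon>. \<epsilon> ^ p)) \<longleftrightarrow> (\<forall>\<alpha>. \<exists>q. \<forall>\<gamma>\<in>\<Phi> q.
      (\<lambda>\<epsilon>. sup_abs K (mderiv n \<alpha> (F (\<gamma> \<epsilon>)))) \<in> O[at_right 0](\<lambda>\<epsilon>. \<epsilon> ^ p))"
    if "smooth_fam F" "compact K" "K \<subseteq> \<Omega>" for K p
    by (rule grows_iff[OF that(2,3,1)]) auto
  note * = this
  have "(\<forall>m p. \<exists>q. grows F K m q (\<lambda>\<epsilon>. \<epsilon> ^ p)) \<longleftrightarrow> (\<forall>\<alpha> p. \<exists>q. \<forall>\<gamma>\<in>\<Phi> q.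
      (\<lambda>\<epsilon>. sup_abs K (mderiv n \<alpha> (F (\<gamma> \<epsilon>)))) \<in> O[at_right 0](\<lambda>\<epsilon>. \<epsilon> ^ p))"
    if "smooth_fam F" "compact K" "K \<subseteq> \<Omega>" for K
    using *[OF that] by metis
  then show ?thesis unfolding negligible_def by auto
qed

end

text \<open>Plots of a discrete space are locally constant. Near a point the index can be frozen, so
  smoothness for each fixed index suffices.\<close>

lemma joint_locally_const:
  assumes W: "openin (Euclidean_space l) W"
    and e: "\<And>w. w \<in> W \<Longrightarrow> \<exists>V. openin (Euclidean_space l) V \<and> w \<in> V \<and> V \<subseteq> W \<and> (\<forall>v\<in>V. e v = e w)"
    and h: "\<And>w. w \<in> W \<Longrightarrow> joint l W n D (h (e w))"
  shows "joint l W n D (\<lambda>w. h (e w) w)"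
proof (rule jointI)
  fix l' Y p q assume Y: "openin (Euclidean_space l') Y" and p: "p \<in> plots (eucl_space l W) l' Y"
    and q: "q \<in> plots (eucl_space n D) l' Y"
  show "smooth_on l' Y (\<lambda>z. h (e (p z)) (p z) (q z))"
  proof (rule smooth_on_local[OF Y])
    fix z assume z: "z \<in> Y"
    then have pz: "p z \<in> W" by (rule eucl_plotD(3)[OF p])
    obtain V where V: "openin (Euclidean_space l) V" "p z \<in> V" "\<forall>v\<in>V. e v = e (p z)"
      using e[OF pz] by blast
    have o: "openin (Euclidean_space l') {y \<in> Y. p y \<in> V}" by (rule eucl_plot_vimage[OF p W V(1)])
    have "smooth_on l' {y \<in> Y. p y \<in> V} (\<lambda>y. h (e (p z)) (p y) (q y))"
      by (rule smooth_on_subset[OF jointD[OF h[OF pz] p q]]) auto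
    then have "smooth_on l' {y \<in> Y. p y \<in> V} (\<lambda>z. h (e (p z)) (p z) (q z))"
      by (rule smooth_on_cong[OF o, rotated]) (use V(3) in simp)
    then show "\<exists>V. openin (Euclidean_space l') V \<and> z \<in> V \<and> smooth_on l' V (\<lambda>z. h (e (p z)) (p z) (q z))"
      using o z V(2) by blast
  qed
qed

lemma discrete_plotD:
  assumes "e \<in> plots (discrete_space S) k U"
  shows "e \<in> U \<rightarrow>\<^sub>E S" "openin (Euclidean_space k) U"
    "\<And>u. u \<in> U \<Longrightarrow> \<exists>W. openin (Euclidean_space k) W \<and> u \<in> W \<and> W \<subseteq> U \<and> (\<forall>w\<in>W. e w = e u)"
  using assms by (auto simp: discrete_space_def)

lemma discrete_plot_const: "s \<in> S \<Longrightarrow> openin (Euclidean_space k) U \<Longrightarrow> (\<lambda>u\<in>U. s) \<in> plots (discrete_space S) k U"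
  by (auto simp: discrete_space_def)

section \<open>The special algebra\<close>

definition mk_s :: "rvec set \<Rightarrow> (real \<Rightarrow> rfun) \<Rightarrow> net" where
  "mk_s \<Omega> F = (\<lambda>\<epsilon>\<in>eps_set. \<lambda>x\<in>\<Omega>. F \<epsilon> x)"

lemma exp_inverse_square_small:
  fixes t :: real
  assumes "t > 0"
  shows "eventually (\<lambda>\<epsilon>. exp (- (t / \<epsilon>\<^sup>2)) \<le> \<epsilon> ^ p) (at_right 0)"
proof -
  have "((\<lambda>\<epsilon>. exp (- (t / \<epsilon>\<^sup>2)) / \<epsilon> ^ p) \<longlongrightarrow> 0) (at_right 0)" using assms by real_asymp
  then have "eventually (\<lambda>\<epsilon>. \<bar>exp (- (t / \<epsilon>\<^sup>2)) / \<epsilon> ^ p\<bar> < 1) (at_right 0)"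
    by (auto simp: tendsto_iff dist_real_def)
  then show ?thesis using eventually_unit by eventually_elim (simp add: field_simps)
qed

context
  fixes n :: nat and \<Omega> :: "rvec set"
  assumes \<Omega>: "openin (Euclidean_space n) \<Omega>"
begin

lemma generalized_functions_s: "generalized_functions n \<Omega> eps_set (\<lambda>_. \<Omega>) (\<lambda>u. u) (mk_s \<Omega>)
  (eps_set \<rightarrow>\<^sub>E extensional \<Omega>) (\<lambda>_. {\<lambda>\<epsilon>. \<epsilon>})"
proof
  show "u = v" if "u \<in> eps_set \<rightarrow>\<^sub>E extensional \<Omega>" "v \<in> eps_set \<rightarrow>\<^sub>E extensional \<Omega>"
    "\<And>a x. a \<in> eps_set \<Longrightarrow> x \<in> \<Omega> \<Longrightarrow> u a x = v a x" for u v :: net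
  proof (rule PiE_ext[OF that(1,2)])
    show "u a = v a" if "a \<in> eps_set" for a
      using \<open>u \<in> _\<close> \<open>v \<in> _\<close> that \<open>\<And>a x. a \<in> eps_set \<Longrightarrow> x \<in> \<Omega> \<Longrightarrow> u a x = v a x\<close>[OF that]
      by (intro extensionalityI[of _ \<Omega>]) auto
  qed
  show "eventually (\<lambda>\<epsilon>. \<gamma> \<epsilon> \<in> eps_set \<and> K \<subseteq> \<Omega>) (at_right 0)"
    if "\<gamma> \<in> {\<lambda>\<epsilon>. \<epsilon>}" "compact K" "K \<subseteq> \<Omega>" for \<gamma> :: "real \<Rightarrow> real" and K
    using eventually_unit by eventually_elim (use that in \<open>simp add: eps_set_def\<close>)
qed (auto simp: mk_s_def \<Omega>)

interpretation S: generalized_functions n \<Omega> eps_set "\<lambda>_. \<Omega>" "\<lambda>u. u" "mk_s \<Omega>"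
  "eps_set \<rightarrow>\<^sub>E extensional \<Omega>" "\<lambda>_. {\<lambda>\<epsilon>. \<epsilon>}"
  by (rule generalized_functions_s)

lemma EM_s_S: "S.EM = EM_s n \<Omega>" and N_s_S: "u \<in> N_s n \<Omega> \<longleftrightarrow> u \<in> eps_set \<rightarrow>\<^sub>E extensional \<Omega> \<and> S.negligible u"
proof -
  have *: "u \<in> eps_set \<rightarrow>\<^sub>E Csmooth n \<Omega> \<longleftrightarrow> u \<in> eps_set \<rightarrow>\<^sub>E extensional \<Omega> \<and> S.smooth_fam u" for u
    by (auto simp: S.smooth_fam_def Csmooth_iff PiE_iff)
  show "S.EM = EM_s n \<Omega>"
    unfolding S.EM_def EM_s_def S.moderate_iff using * by (intro Collect_cong) simp
  show "u \<in> N_s n \<Omega> \<longleftrightarrow> u \<in> eps_set \<rightarrow>\<^sub>E extensional \<Omega> \<and> S.negligible u"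
    unfolding N_s_def S.negligible_iff using * by simp
qed

lemma rel_s_S: "S.rel = rel_s n \<Omega>"
proof -
  have "(\<lambda>\<epsilon>\<in>eps_set. \<lambda>x\<in>\<Omega>. u \<epsilon> x - v \<epsilon> x) \<in> N_s n \<Omega> \<longleftrightarrow> S.negligible (\<lambda>\<epsilon> x. u \<epsilon> x - v \<epsilon> x)" for u v
    using S.negligible_cong[of "\<lambda>\<epsilon>\<in>eps_set. \<lambda>x\<in>\<Omega>. u \<epsilon> x - v \<epsilon> x" "\<lambda>\<epsilon> x. u \<epsilon> x - v \<epsilon> x"]
      S.negligible_cong[of "\<lambda>\<epsilon> x. u \<epsilon> x - v \<epsilon> x" "\<lambda>\<epsilon>\<in>eps_set. \<lambda>x\<in>\<Omega>. u \<epsilon> x - v \<epsilon> x"]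
    by (auto simp: N_s_S)
  then show ?thesis unfolding S.rel_def rel_s_def EM_s_S by simp
qed

text \<open>The functional diffeology tests with plots whose \<epsilon>-component is locally
  constant; by \<open>joint_locally_const\<close> and by constant test plots this is the same as
  joint smoothness for each \<epsilon>.\<close>

lemma X_s_S: "S.X = sub_space (EM_s n \<Omega>) (fun_space (discrete_space eps_set) (Csmooth_space n \<Omega>))"
proof -
  let ?C = "Csmooth_space n \<Omega>" and ?I = "discrete_space eps_set"
  have EMC: "u \<epsilon> \<in> Csmooth n \<Omega>" if "u \<in> EM_s n \<Omega>" "\<epsilon> \<in> eps_set" for u \<epsilon>
    using that by (auto simp: EM_s_def)
  have pI: "points ?I = eps_set" by (simp add: discrete_space_def)
  have "d \<in> plots S.X k U \<longleftrightarrow> d \<in> plots (sub_space (EM_s n \<Omega>) (fun_space ?I ?C)) k U" for d k U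
  proof
    assume "d \<in> plots S.X k U"
    then have d: "d \<in> U \<rightarrow>\<^sub>E EM_s n \<Omega>" and U: "openin (Euclidean_space k) U"
      and j: "\<And>\<epsilon>. \<epsilon> \<in> eps_set \<Longrightarrow> joint k U n \<Omega> (\<lambda>u. d u \<epsilon>)"
      by (auto simp: S.plots_X_iff EM_s_S)
    have dE: "d u \<in> EM_s n \<Omega>" if "u \<in> U" for u using d that by auto
    have sm1: "smooth_map ?I ?C f" if f: "f \<in> EM_s n \<Omega>" for f
      unfolding smooth_map_def
    proof (intro conjI allI ballI)
      show "f \<in> points ?I \<rightarrow> points ?C" using EMC[OF f] by (simp add: pI points_Csmooth_space[OF \<Omega>])
      fix l W e assume "e \<in> plots ?I l W"
      note e = discrete_plotD[OF this]
      have eW: "e w \<in> eps_set" if "w \<in> W" for w using e(1) that by auto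
      have "joint l W n \<Omega> (\<lambda>w. (\<lambda>\<epsilon> w. f \<epsilon>) (e w) w)"
        by (rule joint_locally_const[OF e(2,3)])
          (use EMC[OF f eW] in \<open>auto intro!: joint_space[OF \<Omega>] simp: Csmooth_iff\<close>)
      then have "joint l W n \<Omega> (compose W f e)" by (rule joint_cong) (simp add: compose_def)
      then show "compose W f e \<in> plots ?C l W"
        using EMC[OF f eW] e(2) by (simp add: Csmooth_plot_iff[OF \<Omega>] compose_def)
    qed
    have sm2: "smooth_map (prod_space (eucl_space k U) ?I) ?C (\<lambda>(u, x). d u x)"
      unfolding smooth_map_def
    proof (intro conjI allI ballI)
      show "(\<lambda>(u, x). d u x) \<in> points (prod_space (eucl_space k U) ?I) \<rightarrow> points ?C"
        using EMC dE by (auto simp: prod_space_def pI points_Csmooth_space[OF \<Omega>])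
      fix l W c assume "c \<in> plots (prod_space (eucl_space k U) ?I) l W"
      then have p: "(\<lambda>w\<in>W. fst (c w)) \<in> plots (eucl_space k U) l W" and "(\<lambda>w\<in>W. snd (c w)) \<in> plots ?I l W"
        by (auto simp: prod_space_def)
      note e = discrete_plotD[OF this(2)]
      let ?p = "\<lambda>w\<in>W. fst (c w)" and ?e = "\<lambda>w\<in>W. snd (c w)"
      have eW: "?e w \<in> eps_set" if "w \<in> W" for w using e(1) that by blast
      have "joint l W n \<Omega> (\<lambda>w. (\<lambda>\<epsilon> w. d (?p w) \<epsilon>) (?e w) w)"
      proof (rule joint_locally_const[OF e(2,3)])
        fix w assume w: "w \<in> W"
        show "joint l W n \<Omega> (\<lambda>v. d (?p v) (?e w))"
        proof (rule jointI)
          fix l' Y r q assume Y: "openin (Euclidean_space l') Y" and r: "r \<in> plots (eucl_space l W) l' Y"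
            and q: "q \<in> plots (eucl_space n \<Omega>) l' Y"
          have "smooth_on l' Y (\<lambda>z. d (compose Y ?p r z) (?e w) (q z))"
            by (rule jointD[OF j[OF eW[OF w]] eucl_plot_comp[OF r p e(2)] q])
          then show "smooth_on l' Y (\<lambda>z. d (?p (r z)) (?e w) (q z))"
            by (rule smooth_on_cong[OF Y, rotated]) (simp add: compose_def)
        qed
      qed
      then have "joint l W n \<Omega> (compose W (\<lambda>(u, x). d u x) c)"
        by (rule joint_cong) (simp add: compose_def case_prod_unfold)
      moreover have "d (fst (c w)) (snd (c w)) \<in> Csmooth n \<Omega>" if "w \<in> W" for w
        using EMC[OF dE, of "?p w" "?e w"] eucl_plotD(3)[OF p that] eW[OF that] that by simp
      ultimately show "compose W (\<lambda>(u, x). d u x) c \<in> plots ?C l W"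
        using e(2) by (simp add: Csmooth_plot_iff[OF \<Omega>] compose_def case_prod_unfold)
    qed
    have "d \<in> U \<rightarrow>\<^sub>E {f \<in> extensional (points ?I). smooth_map ?I ?C f}"
    proof (rule PiE_I)
      show "d u \<in> {f \<in> extensional (points ?I). smooth_map ?I ?C f}" if "u \<in> U" for u
        using sm1[OF dE[OF that]] dE[OF that] unfolding EM_s_def by (simp add: pI PiE_iff)
      show "d u = undefined" if "u \<notin> U" for u using d that by (simp add: PiE_iff extensional_def)
    qed
    then show "d \<in> plots (sub_space (EM_s n \<Omega>) (fun_space ?I ?C)) k U"
      using U sm2 dE by (simp add: sub_space_def fun_space_def image_subset_iff)
  next
    assume "d \<in> plots (sub_space (EM_s n \<Omega>) (fun_space ?I ?C)) k U"
    then have d: "d \<in> U \<rightarrow>\<^sub>E EM_s n \<Omega>" and U: "openin (Euclidean_space k) U"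
      and sm: "smooth_map (prod_space (eucl_space k U) ?I) ?C (\<lambda>(u, x). d u x)"
      by (auto simp: sub_space_def fun_space_def PiE_iff)
    have "joint k U n \<Omega> (\<lambda>u. d u \<epsilon>)" if \<epsilon>: "\<epsilon> \<in> eps_set" for \<epsilon>
    proof -
      \<comment> \<open>Pairing the identity with a constant index isolates a single
        \<epsilon>.\<close>
      let ?c = "\<lambda>u\<in>U. (u, \<epsilon>)"
      have "(\<lambda>u\<in>U. fst (?c u)) = (\<lambda>u\<in>U. u)" "(\<lambda>u\<in>U. snd (?c u)) = (\<lambda>u\<in>U. \<epsilon>)" by auto
      then have "?c \<in> plots (prod_space (eucl_space k U) ?I) k U"
        using eucl_plot_id[OF U] discrete_plot_const[OF \<epsilon> U] by (simp add: prod_space_def)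
      then have "compose U (\<lambda>(u, x). d u x) ?c \<in> plots ?C k U" using sm unfolding smooth_map_def by blast
      then have "joint k U n \<Omega> (compose U (\<lambda>(u, x). d u x) ?c)" by (simp add: Csmooth_plot_iff[OF \<Omega>])
      then show ?thesis by (rule joint_cong) (simp add: compose_def)
    qed
    then show "d \<in> plots S.X k U" using d U by (simp add: S.plots_X_iff EM_s_S)
  qed
  then have "plots S.X = plots (sub_space (EM_s n \<Omega>) (fun_space ?I ?C))" by (intro ext Set.set_eqI)
  then show ?thesis by (intro dspace.equality) (simp_all add: EM_s_S sub_space_def)
qed

lemma G_s_S: "S.G = G_s n \<Omega>"
  by (simp add: S.G_def G_s_def X_s_S rel_s_S)

lemma Alg_s_S: "S.Alg = Alg_s n \<Omega>"
  by (simp add: S.Alg_def Alg_s_def EM_s_S rel_s_S mk_s_def)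

lemma deriv_s_S: "S.der \<alpha> = deriv_s n \<Omega> \<alpha>"
  by (simp add: fun_eq_iff S.der_def deriv_s_def rel_s_S mk_s_def)

lemma D_topology_G_s_indiscrete:
  assumes "openin (D_topology (G_s n \<Omega>)) V" "V \<noteq> {}"
  shows "V = topspace (D_topology (G_s n \<Omega>))"
  using assms unfolding G_s_S[symmetric]
proof (rule S.D_topology_indiscrete[where \<rho> = "\<lambda>\<epsilon>. 1 / \<epsilon>", rotated])
  fix \<gamma> :: "real \<Rightarrow> real" and s :: real and p assume \<gamma>: "\<gamma> \<in> {\<lambda>\<epsilon>. \<epsilon>}" and s: "s \<noteq> 0"
  have "s\<^sup>2 > 0" using s by simp
  from exp_inverse_square_small[OF this, of p]
  have "eventually (\<lambda>\<epsilon>. exp (- (s * (1 / \<gamma> \<epsilon>))\<^sup>2) \<le> 1 * \<epsilon> ^ p) (at_right 0)"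
    by eventually_elim (use \<gamma> in \<open>simp add: power_divide\<close>)
  then show "\<exists>C\<ge>0. eventually (\<lambda>\<epsilon>. exp (- (s * (1 / \<gamma> \<epsilon>))\<^sup>2) \<le> C * \<epsilon> ^ p) (at_right 0)"
    by (intro exI[of _ 1]) simp
qed

lemma special_algebra:
  "diffeological_space (G_s n \<Omega>)"
  "smooth_map (prod_space (G_s n \<Omega>) (G_s n \<Omega>)) (G_s n \<Omega>) (\<lambda>(a, b). a \<oplus>\<^bsub>Alg_s n \<Omega>\<^esub> b)"
  "smooth_map (prod_space (G_s n \<Omega>) (G_s n \<Omega>)) (G_s n \<Omega>) (\<lambda>(a, b). a \<otimes>\<^bsub>Alg_s n \<Omega>\<^esub> b)"
  "smooth_map (G_s n \<Omega>) (G_s n \<Omega>) (deriv_s n \<Omega> \<alpha>)"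
  "topological_algebra (D_topology (G_s n \<Omega>)) (Alg_s n \<Omega>)"
  "continuous_map (D_topology (G_s n \<Omega>)) (D_topology (G_s n \<Omega>)) (deriv_s n \<Omega> \<alpha>)"
  "i < n \<Longrightarrow> derivation (Alg_s n \<Omega>) (deriv_s n \<Omega> (mi_unit i))"
  "smooth_map (Csmooth_space n \<Omega>) (G_s n \<Omega>) (sigma_s n \<Omega>)"
proof -
  show "diffeological_space (G_s n \<Omega>)" using S.diffeological_G by (simp add: G_s_S)
  show "smooth_map (prod_space (G_s n \<Omega>) (G_s n \<Omega>)) (G_s n \<Omega>) (\<lambda>(a, b). a \<oplus>\<^bsub>Alg_s n \<Omega>\<^esub> b)"
    using S.smooth_add by (simp add: G_s_S Alg_s_S)
  show "smooth_map (prod_space (G_s n \<Omega>) (G_s n \<Omega>)) (G_s n \<Omega>) (\<lambda>(a, b). a \<otimes>\<^bsub>Alg_s n \<Omega>\<^esub> b)"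
    using S.smooth_mult by (simp add: G_s_S Alg_s_S)
  show "smooth_map (G_s n \<Omega>) (G_s n \<Omega>) (deriv_s n \<Omega> \<alpha>)" using S.smooth_der by (simp add: G_s_S deriv_s_S)
  show "topological_algebra (D_topology (G_s n \<Omega>)) (Alg_s n \<Omega>)"
    using S.topological_algebra_indiscrete D_topology_G_s_indiscrete by (simp add: G_s_S Alg_s_S)
  show "continuous_map (D_topology (G_s n \<Omega>)) (D_topology (G_s n \<Omega>)) (deriv_s n \<Omega> \<alpha>)"
    using S.continuous_der by (simp add: G_s_S deriv_s_S)
  show "derivation (Alg_s n \<Omega>) (deriv_s n \<Omega> (mi_unit i))" if "i < n"
    using S.derivation_der[OF that] by (simp add: Alg_s_S deriv_s_S)
  have "sigma_s n \<Omega> f = S.rel `` {mk_s \<Omega> (\<lambda>a. f)}" if "f \<in> Csmooth n \<Omega>" for f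
    using that by (simp add: sigma_s_def rel_s_S mk_s_def Csmooth_iff extensional_restrict)
  then show "smooth_map (Csmooth_space n \<Omega>) (G_s n \<Omega>) (sigma_s n \<Omega>)"
    using S.smooth_sigma by (simp add: G_s_S)
qed

end

section \<open>Smooth cutoff functions\<close>

text \<open>With x = 1 / s one has dx/ds = - x^2, so the derivative of P(x) exp (- x) with respect
  to s is x^2 (P(x) - P'(x)) exp (- x).\<close>

primrec flat_poly :: "nat \<Rightarrow> real poly" where
  "flat_poly 0 = 1"
| "flat_poly (Suc m) = [:0, 0, 1:] * (flat_poly m - pderiv (flat_poly m))"

text \<open>The \<open>m\<close>-th derivative of \<open>s \<mapsto> exp (- 1 / s)\<close>, extended by 0.\<close>

definition flat :: "nat \<Rightarrow> real \<Rightarrow> real" where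
  "flat m s = (if s > 0 then poly (flat_poly m) (1 / s) * exp (- (1 / s)) else 0)"

text \<open>The power \<open>x ^ k\<close> is carried along because peeling off a coefficient of the
  polynomial leaves an additional factor \<open>x\<close>.\<close>

lemma power_poly_exp_tendsto_0:
  fixes p :: "real poly"
  shows "((\<lambda>x. x ^ k * poly p x * exp (- x)) \<longlongrightarrow> 0) at_top"
proof (induction p arbitrary: k)
  case (pCons a p)
  have "((\<lambda>x. a * (x ^ k / exp x) + x ^ Suc k * poly p x * exp (- x)) \<longlongrightarrow> a * 0 + 0) at_top"
    by (intro tendsto_intros tendsto_power_div_exp_0 pCons.IH)
  moreover have "a * (x ^ k / exp x) + x ^ Suc k * poly p x * exp (- x) = x ^ k * poly (pCons a p) x * exp (- x)" for x
    by (simp add: exp_minus field_simps)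
  ultimately show ?case by simp
qed simp

lemma flat_deriv: "(flat m has_real_derivative flat (Suc m) s) (at s)"
proof -
  consider "s > 0" | "s < 0" | "s = 0" by linarith
  then show ?thesis
  proof cases
    case 1
    let ?f = "\<lambda>s. poly (flat_poly m) (1 / s) * exp (- (1 / s))"
    have "(?f has_real_derivative flat (Suc m) s) (at s)"
      using 1 by (auto intro!: derivative_eq_intros DERIV_chain2[OF poly_DERIV]
          simp: flat_def power2_eq_square field_simps)
    moreover have "eventually (\<lambda>s. ?f s = flat m s) (nhds s)"
      using eventually_nhds_in_open[of "{0<..}" s] 1 by (auto elim!: eventually_mono simp: flat_def)
    ultimately show ?thesis by (subst (asm) DERIV_cong_ev[OF refl _ refl])
  next
    case 2
    have "((\<lambda>_. 0) has_real_derivative flat (Suc m) s) (at s)" using 2 by (simp add: flat_def)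
    moreover have "eventually (\<lambda>s. 0 = flat m s) (nhds s)"
      using eventually_nhds_in_open[of "{..<0}" s] 2 by (auto elim!: eventually_mono simp: flat_def)
    ultimately show ?thesis by (subst (asm) DERIV_cong_ev[OF refl _ refl])
  next
    \<comment> \<open>At 0 the difference quotient from the right is x P(x) exp (- x) with x = 1 / h
      tending to infinity; from the left it vanishes.\<close>
    case 3
    have r: "((\<lambda>h. flat m h / h) \<longlongrightarrow> 0) (at_right 0)"
    proof -
      have "((\<lambda>h. (inverse h) ^ 1 * poly (flat_poly m) (inverse h) * exp (- inverse h)) \<longlongrightarrow> 0) (at_right 0)"
        by (rule filterlim_compose[OF power_poly_exp_tendsto_0 filterlim_inverse_at_top_right])
      moreover have "eventually (\<lambda>h. (inverse h) ^ 1 * poly (flat_poly m) (inverse h) * exp (- inverse h) = flat m h / h) (at_right 0)"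
        using eventually_unit by eventually_elim (simp add: flat_def field_simps)
      ultimately show ?thesis by (rule Lim_transform_eventually)
    qed
    have l: "((\<lambda>h. flat m h / h) \<longlongrightarrow> 0) (at_left 0)"
    proof (rule Lim_transform_eventually[OF tendsto_const])
      show "eventually (\<lambda>h. 0 = flat m h / h) (at_left 0)"
        by (auto simp: flat_def eventually_at_filter)
    qed
    have "((\<lambda>h. flat m h / h) \<longlongrightarrow> 0) (at 0)" using l r by (simp add: filterlim_split_at)
    then show ?thesis unfolding 3 by (simp add: has_field_derivative_iff flat_def)
  qed
qed

text \<open>The usual smooth transition from 0 to 1 on the unit interval. The denominator is
  positive since \<open>s\<close> and \<open>1 - s\<close> are never both nonpositive.\<close>

definition step :: "real \<Rightarrow> real" where
  "step s = flat 0 s * inverse (flat 0 s + flat 0 (1 - s))"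

lemma flat_0: "flat 0 s = (if s > 0 then exp (- (1 / s)) else 0)"
  by (simp add: flat_def)

lemma step_1: "s \<ge> 1 \<Longrightarrow> step s = 1" and step_0: "s \<le> 0 \<Longrightarrow> step s = 0"
  by (auto simp: step_def flat_0)

lemma smooth_on_step:
  assumes U: "openin (Euclidean_space k) U" and f: "smooth_on k U f"
  shows "smooth_on k U (\<lambda>x. step (f x))"
proof -
  have f1: "smooth_on k U (\<lambda>x. 1 - f x)" by (intro smooth_on_diff[OF U] smooth_on_const[OF U] f)
  have "flat 0 s + flat 0 (1 - s) \<noteq> 0" for s
  proof -
    have "flat 0 s + flat 0 (1 - s) > 0"
      by (cases "s > 0") (auto simp: flat_0 intro!: add_pos_nonneg add_pos_pos)
    then show ?thesis by simp
  qed
  then show ?thesis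
    unfolding step_def
    by (intro smooth_on_mult[OF U] smooth_on_inverse[OF U] smooth_on_add[OF U]
        smooth_on_real_comp[where D = flat, OF U flat_deriv] f f1)
qed

text \<open>Put t = (x i - p i) / r. For |t| at most 1 both 2 + t and 2 - t are at least 1, and for
  |t| at least 2 one of them is nonpositive; so each factor is 1 up to distance \<open>r\<close> and
  0 from distance \<open>2 * r\<close> on.\<close>

definition plateau :: "nat \<Rightarrow> rvec \<Rightarrow> real \<Rightarrow> rfun" where
  "plateau n p r x = (\<Prod>i<n. step (2 + (x i - p i) / r) * step (2 - (x i - p i) / r))"

lemma smooth_on_plateau: "smooth_on n (Rn n) (plateau n p r)"
proof -
  note U = openin_Rn[of n]
  have c: "smooth_on n (Rn n) (\<lambda>x. (x i - p i) / r)" for i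
    using smooth_on_cmult[OF U smooth_on_diff[OF U smooth_on_coord[OF U, of i] smooth_on_const[OF U, of "p i"]], of "1 / r"]
    by simp
  have "smooth_on n (Rn n) (\<lambda>x. \<Prod>i<n. step (2 + (x i - p i) / r) * step (2 - (x i - p i) / r))"
    by (intro smooth_on_prod[OF U] smooth_on_mult[OF U] smooth_on_step[OF U] smooth_on_add[OF U]
        smooth_on_diff[OF U] smooth_on_const[OF U] c)
  then show ?thesis unfolding plateau_def[abs_def] .
qed

lemma plateau_1: "r > 0 \<Longrightarrow> (\<And>i. i < n \<Longrightarrow> \<bar>x i - p i\<bar> \<le> r) \<Longrightarrow> plateau n p r x = 1"
proof -
  assume r: "r > 0" and *: "\<And>i. i < n \<Longrightarrow> \<bar>x i - p i\<bar> \<le> r"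
  have "step (2 + (x i - p i) / r) * step (2 - (x i - p i) / r) = 1" if "i < n" for i
  proof -
    have "\<bar>(x i - p i) / r\<bar> \<le> 1" using *[OF that] r by (simp add: abs_divide)
    then have "2 + (x i - p i) / r \<ge> 1" "2 - (x i - p i) / r \<ge> 1" by linarith+
    then show ?thesis by (simp add: step_1)
  qed
  then show ?thesis unfolding plateau_def by (intro prod.neutral) simp
qed

lemma plateau_0: "r > 0 \<Longrightarrow> i < n \<Longrightarrow> \<bar>x i - p i\<bar> \<ge> 2 * r \<Longrightarrow> plateau n p r x = 0"
proof -
  assume r: "r > 0" "i < n" and *: "\<bar>x i - p i\<bar> \<ge> 2 * r"
  have "\<bar>(x i - p i) / r\<bar> \<ge> 2" using * r by (simp add: abs_divide field_simps)
  then have "2 + (x i - p i) / r \<le> 0 \<or> 2 - (x i - p i) / r \<le> 0" by linarith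
  then show ?thesis unfolding plateau_def using r(2) by (auto intro!: bexI[of _ i] simp: step_0)
qed

text \<open>One minus the product of the complements of finitely many plateaus: it is 1 where some
  plateau is 1 and 0 where all of them vanish. No normalization by a sum is involved.\<close>

lemma cutoff_exists:
  assumes C: "compact C" "C \<subseteq> V" and V: "openin (Euclidean_space n) V"
  obtains \<eta> K where "smooth_on n (Rn n) \<eta>" "\<And>x. x \<in> C \<Longrightarrow> \<eta> x = 1" "compact K" "K \<subseteq> V"
    "\<And>x. x \<in> Rn n \<Longrightarrow> x \<notin> K \<Longrightarrow> \<eta> x = 0"
proof -
  have CR: "C \<subseteq> Rn n" using C(2) openin_Euclidean_subset[OF V] by blast
  obtain r0 where r0: "r0 > 0" "thick n C r0 \<subseteq> V" using thick_subset_open[OF C V] .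
  \<comment> \<open>Half of \<open>r0\<close>, because a plateau reaches out to twice its
    radius.\<close>
  define r where "r = r0 / 2"
  have r: "r > 0" "2 * r = r0" using r0 by (auto simp: r_def)
  have "\<exists>S. open S \<and> obox n c r = Rn n \<inter> S" for c
    using openin_obox[of n c r] by (auto simp: openin_Euclidean_open)
  then obtain S where S: "\<And>c. open (S c)" "\<And>c. obox n c r = Rn n \<inter> S c" by metis
  have "c \<in> S c" if "c \<in> C" for c using S(2)[of c] obox_self[of c n r] CR r(1) that by blast
  then have "C \<subseteq> (\<Union>c\<in>C. S c)" by blast
  then obtain F where F: "F \<subseteq> C" "finite F" "C \<subseteq> (\<Union>c\<in>F. S c)"
    using compactE_image[OF C(1), of C S] S(1) by metis
  define \<eta> where "\<eta> x = 1 - (\<Prod>p\<in>F. 1 - plateau n p r x)" for x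
  show ?thesis
  proof (rule that[of \<eta> "thick n C r0"])
    note U = openin_Rn[of n]
    have "smooth_on n (Rn n) (\<lambda>x. 1 - (\<Prod>p\<in>F. 1 - plateau n p r x))"
      by (intro smooth_on_diff[OF U] smooth_on_prod[OF U] smooth_on_const[OF U] smooth_on_plateau)
    then show "smooth_on n (Rn n) \<eta>" unfolding \<eta>_def[abs_def] .
    show "\<eta> x = 1" if "x \<in> C" for x
    proof -
      obtain p where p: "p \<in> F" "x \<in> S p" using F(3) \<open>x \<in> C\<close> by blast
      then have "x \<in> obox n p r" using S(2) CR \<open>x \<in> C\<close> by blast
      then have "plateau n p r x = 1" by (intro plateau_1 r) (simp add: obox_def less_imp_le)
      then have "(\<Prod>p\<in>F. 1 - plateau n p r x) = 0" using F(2) p(1) by (intro prod_zero) auto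
      then show ?thesis by (simp add: \<eta>_def)
    qed
    show "compact (thick n C r0)" by (rule compact_thick[OF C(1) CR])
    show "thick n C r0 \<subseteq> V" by (rule r0(2))
    show "\<eta> x = 0" if x: "x \<in> Rn n" "x \<notin> thick n C r0" for x
    proof -
      have "plateau n p r x = 0" if "p \<in> F" for p
      proof -
        have "p \<in> C" using that F(1) by blast
        then obtain i where "i < n" "\<not> \<bar>x i - p i\<bar> \<le> r0" using x by (auto simp: thick_def)
        then show ?thesis using r by (intro plateau_0[of r i]) auto
      qed
      then show ?thesis by (simp add: \<eta>_def)
    qed
  qed
qed

section \<open>Test functions and distributions\<close>

text \<open>Replaces the support by vanishing off \<open>K\<close>, which is easy to check for
  restrictions, derivatives and translates. Closedness of the compact \<open>K\<close> takes care of
  the closure in the support.\<close>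

lemma test_funs_in_iff:
  assumes K: "compact K" "K \<subseteq> \<Omega>"
  shows "\<phi> \<in> test_funs_in n \<Omega> K \<longleftrightarrow> \<phi> \<in> extensional \<Omega> \<and> smooth_on n \<Omega> \<phi> \<and> (\<forall>x\<in>\<Omega> - K. \<phi> x = 0)"
proof
  assume *: "\<phi> \<in> test_funs_in n \<Omega> K"
  have "\<phi> x = 0" if "x \<in> \<Omega> - K" for x
  proof (rule ccontr)
    assume "\<phi> x \<noteq> 0"
    then have "x \<in> supp_in \<Omega> \<phi>" using that closure_subset[of "{x \<in> \<Omega>. \<phi> x \<noteq> 0}"] by (auto simp: supp_in_def)
    then show False using * that by (auto simp: test_funs_in_def)
  qed
  then show "\<phi> \<in> extensional \<Omega> \<and> smooth_on n \<Omega> \<phi> \<and> (\<forall>x\<in>\<Omega> - K. \<phi> x = 0)"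
    using * by (auto simp: test_funs_in_def test_funs_def Csmooth_iff)
next
  assume *: "\<phi> \<in> extensional \<Omega> \<and> smooth_on n \<Omega> \<phi> \<and> (\<forall>x\<in>\<Omega> - K. \<phi> x = 0)"
  have sub: "closure {x \<in> \<Omega>. \<phi> x \<noteq> 0} \<subseteq> K"
    by (rule closure_minimal) (use * K compact_imp_closed in auto)
  then have "supp_in \<Omega> \<phi> = K \<inter> closure {x \<in> \<Omega>. \<phi> x \<noteq> 0}" using K(2) by (auto simp: supp_in_def)
  then have "compact (supp_in \<Omega> \<phi>)" "supp_in \<Omega> \<phi> \<subseteq> K" using K(1) by (auto intro: compact_Int_closed)
  then show "\<phi> \<in> test_funs_in n \<Omega> K" using * by (auto simp: test_funs_in_def test_funs_def Csmooth_iff)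
qed

lemma test_funs_supp:
  assumes "\<phi> \<in> test_funs n \<Omega>"
  shows "compact (supp_in \<Omega> \<phi>)" "supp_in \<Omega> \<phi> \<subseteq> \<Omega>" "\<phi> \<in> test_funs_in n \<Omega> (supp_in \<Omega> \<phi>)"
  using assms by (auto simp: test_funs_in_def test_funs_def supp_in_def)

lemma test_funs_in_subset: "test_funs_in n \<Omega> K \<subseteq> test_funs n \<Omega>"
  by (auto simp: test_funs_in_def)

lemma test_funs_in_mono: "K \<subseteq> K' \<Longrightarrow> test_funs_in n \<Omega> K \<subseteq> test_funs_in n \<Omega> K'"
  by (auto simp: test_funs_in_def)

context
  fixes n :: nat and \<Omega> :: "rvec set"
  assumes \<Omega>: "openin (Euclidean_space n) \<Omega>"
begin

lemma test_funs_in_lin: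
  assumes K: "compact K" "K \<subseteq> \<Omega>" and "\<phi> \<in> test_funs_in n \<Omega> K" "\<psi> \<in> test_funs_in n \<Omega> K"
  shows "(\<lambda>x\<in>\<Omega>. c * \<phi> x + d * \<psi> x) \<in> test_funs_in n \<Omega> K"
proof -
  have "smooth_on n \<Omega> \<phi>" "smooth_on n \<Omega> \<psi>" using assms by (auto simp: test_funs_in_iff[OF K])
  then have "smooth_on n \<Omega> (\<lambda>x. c * \<phi> x + d * \<psi> x)" by (intro smooth_on_add[OF \<Omega>] smooth_on_cmult[OF \<Omega>])
  then have "smooth_on n \<Omega> (\<lambda>x\<in>\<Omega>. c * \<phi> x + d * \<psi> x)" by (rule smooth_on_cong[OF \<Omega>, rotated]) simp
  then show ?thesis using assms(3,4) by (auto simp: test_funs_in_iff[OF K])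
qed

lemma test_funs_lin:
  assumes "\<phi> \<in> test_funs n \<Omega>" "\<psi> \<in> test_funs n \<Omega>"
  shows "(\<lambda>x\<in>\<Omega>. c * \<phi> x + d * \<psi> x) \<in> test_funs n \<Omega>"
proof -
  note s = test_funs_supp[OF assms(1)] test_funs_supp[OF assms(2)]
  let ?K = "supp_in \<Omega> \<phi> \<union> supp_in \<Omega> \<psi>"
  have "\<phi> \<in> test_funs_in n \<Omega> ?K" "\<psi> \<in> test_funs_in n \<Omega> ?K"
    using s(3,6) test_funs_in_mono[of "supp_in \<Omega> \<phi>" ?K] test_funs_in_mono[of "supp_in \<Omega> \<psi>" ?K] by blast+
  moreover have "compact ?K" "?K \<subseteq> \<Omega>" using s by auto
  ultimately show ?thesis using test_funs_in_lin[of ?K \<phi> \<psi> c d] test_funs_in_subset by blast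
qed

lemma zero_test_funs_in: "compact K \<Longrightarrow> K \<subseteq> \<Omega> \<Longrightarrow> (\<lambda>x\<in>\<Omega>. 0) \<in> test_funs_in n \<Omega> K"
proof -
  assume K: "compact K" "K \<subseteq> \<Omega>"
  have "smooth_on n \<Omega> (\<lambda>x\<in>\<Omega>. 0)" by (rule smooth_on_cong[OF \<Omega> _ smooth_on_const[OF \<Omega>, of 0]]) simp
  then show ?thesis by (simp add: test_funs_in_iff[OF K])
qed

lemma zero_test_funs: "(\<lambda>x\<in>\<Omega>. 0) \<in> test_funs n \<Omega>"
  using zero_test_funs_in[of "{}"] test_funs_in_subset[of n \<Omega> "{}"] by auto

text \<open>Off \<open>K\<close> the function vanishes on an open set, together with all its
  derivatives, so the bounds on the compact \<open>K\<close> hold everywhere.\<close>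

lemma bnd_test_fun:
  assumes K: "compact K" "K \<subseteq> \<Omega>" and \<phi>: "\<phi> \<in> test_funs_in n \<Omega> K"
  shows "\<exists>c>0. bnd n m \<Omega> \<phi> c"
proof -
  note \<phi>' = \<phi>[unfolded test_funs_in_iff[OF K]]
  obtain c where c: "c \<ge> 0" "bnd n m K \<phi> c" using bnd_exists[OF \<Omega> K, of \<phi> m] \<phi>' by blast
  have W: "openin (Euclidean_space n) (\<Omega> - K)"
    by (metis \<Omega> K(1) compact_imp_closed openin_Euclidean_open Diff_eq Int_assoc open_Int open_Compl)
  have "bnd n m (\<Omega> - K) \<phi> 0"
    using bnd_cong[where f = "\<lambda>_. 0" and g = \<phi> and m = m and c = 0, OF W order_refl] \<phi>' bnd_const[of 0 0 n m "\<Omega> - K"] by simp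
  then have "bnd n m \<Omega> \<phi> c" using c unfolding bnd_def by (metis Diff_iff order_trans)
  \<comment> \<open>The 1 makes the bound strictly positive, as later divisions and scalings
    require.\<close>
  then have "bnd n m \<Omega> \<phi> (c + 1)" by (rule bnd_mono) auto
  then show ?thesis using c(1) by (intro exI[of _ "c + 1"]) simp
qed

section \<open>Continuity of distributions as a seminorm estimate\<close>

lemma topspace_test_topology: "topspace (test_topology n \<Omega>) = test_funs n \<Omega>"
proof -
  have "test_funs n \<Omega> \<in> test_nhds_0 n \<Omega>"
  proof -
    have 1: "(\<lambda>x\<in>\<Omega>. c * \<phi> x) \<in> test_funs n \<Omega>" if "\<phi> \<in> test_funs n \<Omega>" for c \<phi>
      using test_funs_lin[OF that that, of c 0] by simp
    have "frechet_open n \<Omega> K (test_funs n \<Omega> \<inter> test_funs_in n \<Omega> K)" for K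
      using test_funs_in_subset[of n \<Omega> K] by (auto simp: frechet_open_def intro!: exI[of _ 0] exI[of _ "1 :: real"])
    then show ?thesis
      unfolding test_nhds_0_def using 1 test_funs_lin zero_test_funs by simp
  qed
  moreover have "(\<lambda>x\<in>\<Omega>. \<phi> x + \<psi> x) \<in> test_funs n \<Omega>" if "\<phi> \<in> test_funs n \<Omega>" "\<psi> \<in> test_funs n \<Omega>" for \<phi> \<psi>
    using test_funs_lin[OF that, of 1 1] by simp
  ultimately have "openin (test_topology n \<Omega>) (test_funs n \<Omega>)" unfolding openin_test_topology by blast
  then show ?thesis by (metis openin_test_topology openin_subset openin_topspace subset_antisym)
qed

lemma distribution_lin:
  assumes T: "T \<in> distributions n \<Omega>" and "\<phi> \<in> test_funs n \<Omega>" "\<psi> \<in> test_funs n \<Omega>"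
  shows "T (\<lambda>x\<in>\<Omega>. c * \<phi> x + d * \<psi> x) = c * T \<phi> + d * T \<psi>"
proof -
  have c: "(\<lambda>x\<in>\<Omega>. e * \<theta> x) \<in> test_funs n \<Omega>" "T (\<lambda>x\<in>\<Omega>. e * \<theta> x) = e * T \<theta>" if "\<theta> \<in> test_funs n \<Omega>" for e \<theta>
    using test_funs_lin[OF that that, of e 0] T that by (simp_all add: distributions_def)
  have "(\<lambda>x\<in>\<Omega>. c * \<phi> x + d * \<psi> x) = (\<lambda>x\<in>\<Omega>. (\<lambda>x\<in>\<Omega>. c * \<phi> x) x + (\<lambda>x\<in>\<Omega>. d * \<psi> x) x)" by auto
  then have "T (\<lambda>x\<in>\<Omega>. c * \<phi> x + d * \<psi> x) = T (\<lambda>x\<in>\<Omega>. c * \<phi> x) + T (\<lambda>x\<in>\<Omega>. d * \<psi> x)"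
  proof -
    have "\<forall>\<phi>\<in>test_funs n \<Omega>. \<forall>\<psi>\<in>test_funs n \<Omega>. T (\<lambda>x\<in>\<Omega>. \<phi> x + \<psi> x) = T \<phi> + T \<psi>"
      using T by (simp add: distributions_def)
    then have "T (\<lambda>x\<in>\<Omega>. (\<lambda>x\<in>\<Omega>. c * \<phi> x) x + (\<lambda>x\<in>\<Omega>. d * \<psi> x) x) = T (\<lambda>x\<in>\<Omega>. c * \<phi> x) + T (\<lambda>x\<in>\<Omega>. d * \<psi> x)"
      using c(1)[OF assms(2), of c] c(1)[OF assms(3), of d] by blast
    then show ?thesis by (simp only: \<open>(\<lambda>x\<in>\<Omega>. c * \<phi> x + d * \<psi> x) = _\<close>)
  qed
  then show ?thesis using c(2) assms by simp
qed

text \<open>A neighbourhood of 0 on which |T| is less than 1 contains a seminorm ball of the test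
  functions supported in \<open>K\<close>; homogeneity turns this into an estimate. Any upper bound
  \<open>c\<close> may stand for the seminorm.\<close>

lemma distribution_estimate:
  assumes T: "T \<in> distributions n \<Omega>" and K: "compact K" "K \<subseteq> \<Omega>"
  shows "\<exists>N C. C > 0 \<and> (\<forall>\<phi>\<in>test_funs_in n \<Omega> K. \<forall>c>0. bnd n N \<Omega> \<phi> c \<longrightarrow> \<bar>T \<phi>\<bar> \<le> C * c)"
proof -
  let ?V = "{\<phi> \<in> test_funs n \<Omega>. T \<phi> \<in> {-1<..<1}}"
  have "\<forall>U. open U \<longrightarrow> openin (test_topology n \<Omega>) {\<phi> \<in> test_funs n \<Omega>. T \<phi> \<in> U}"
    using T unfolding distributions_def continuous_map_def topspace_test_topology by simp
  then have "openin (test_topology n \<Omega>) ?V" using open_greaterThanLessThan by blast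
  moreover have "T (\<lambda>x\<in>\<Omega>. 0) = 0" using distribution_lin[OF T zero_test_funs zero_test_funs, of 0 0] by simp
  ultimately obtain W where W: "W \<in> test_nhds_0 n \<Omega>" "\<forall>\<psi>\<in>W. (\<lambda>x\<in>\<Omega>. (\<lambda>x\<in>\<Omega>. 0) x + \<psi> x) \<in> ?V"
    unfolding openin_test_topology using zero_test_funs by fastforce
  have W0: "(\<lambda>x\<in>\<Omega>. 0) \<in> W" "W \<subseteq> test_funs n \<Omega>" and Wo: "frechet_open n \<Omega> K (W \<inter> test_funs_in n \<Omega> K)"
    using W(1) K unfolding test_nhds_0_def by auto
  have WT: "\<bar>T \<psi>\<bar> < 1" if "\<psi> \<in> W" for \<psi>
  proof -
    have "\<psi> \<in> extensional \<Omega>" using that W0(2) by (auto simp: test_funs_def Csmooth_iff)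
    then have "(\<lambda>x\<in>\<Omega>. (\<lambda>x\<in>\<Omega>. 0) x + \<psi> x) = \<psi>" by (auto simp: fun_eq_iff extensional_def)
    then show ?thesis using W(2) that by (auto simp: abs_less_iff)
  qed
  have "(\<lambda>x\<in>\<Omega>. 0) \<in> W \<inter> test_funs_in n \<Omega> K" using W0(1) zero_test_funs_in[OF K] by blast
  then obtain N \<delta> where \<delta>: "\<delta> > 0" "\<And>\<psi>. \<psi> \<in> test_funs_in n \<Omega> K \<Longrightarrow>
      (\<And>\<alpha>. mi_order n \<alpha> \<le> N \<Longrightarrow> sup_abs \<Omega> (mderiv n \<alpha> (\<lambda>x\<in>\<Omega>. \<psi> x - (\<lambda>x\<in>\<Omega>. 0) x)) < \<delta>) \<Longrightarrow> \<psi> \<in> W"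
    using Wo unfolding frechet_open_def by (metis IntD1)
  have "\<bar>T \<phi>\<bar> \<le> 2 / \<delta> * c" if \<phi>: "\<phi> \<in> test_funs_in n \<Omega> K" and c: "c > 0" "bnd n N \<Omega> \<phi> c" for \<phi> c
  proof -
    \<comment> \<open>Scales the seminorm bound to \<delta> / 2, strictly below \<delta>; this is
      the source of the constant 2 / \<delta>.\<close>
    define s where "s = \<delta> / (2 * c)"
    have s: "s > 0" using \<delta>(1) c(1) by (simp add: s_def)
    let ?\<psi> = "\<lambda>x\<in>\<Omega>. s * \<phi> x"
    have \<psi>: "?\<psi> \<in> test_funs_in n \<Omega> K" using test_funs_in_lin[OF K \<phi> \<phi>, of s 0] by simp
    have "smooth_on n \<Omega> \<phi>" using \<phi> by (simp add: test_funs_in_iff[OF K])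
    then have "bnd n N \<Omega> (\<lambda>x. s * \<phi> x) (\<bar>s\<bar> * c)" by (rule bnd_cmult[OF \<Omega> order_refl _ c(2)])
    then have b: "bnd n N \<Omega> ?\<psi> (\<delta> / 2)"
      using bnd_cong[where f = "\<lambda>x. s * \<phi> x" and g = ?\<psi> and m = N and c = "\<delta> / 2", OF \<Omega> order_refl] s c(1) \<delta>(1)
      by (simp add: s_def)
    have "?\<psi> \<in> W"
    proof (rule \<delta>(2)[OF \<psi>])
      fix \<alpha> assume "mi_order n \<alpha> \<le> N"
      then have "\<bar>pd (mi_list n \<alpha>) ?\<psi> x\<bar> \<le> \<delta> / 2" if "x \<in> \<Omega>" for x
        using bndD[OF b set_mi_list _ that] by (simp add: length_mi_list)
      then have "sup_abs \<Omega> (mderiv n \<alpha> ?\<psi>) \<le> \<delta> / 2"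
        using \<delta>(1) unfolding mderiv_eq_pd by (intro sup_abs_le) auto
      moreover have "(\<lambda>x\<in>\<Omega>. ?\<psi> x - (\<lambda>x\<in>\<Omega>. 0) x) = ?\<psi>" by auto
      ultimately show "sup_abs \<Omega> (mderiv n \<alpha> (\<lambda>x\<in>\<Omega>. ?\<psi> x - (\<lambda>x\<in>\<Omega>. 0) x)) < \<delta>" using \<delta>(1) by simp
    qed
    then have "\<bar>T ?\<psi>\<bar> < 1" by (rule WT)
    moreover have "T ?\<psi> = s * T \<phi>"
      using distribution_lin[OF T, of \<phi> \<phi> s 0] \<phi> test_funs_in_subset by force
    ultimately have "s * \<bar>T \<phi>\<bar> < 1" using s by (simp add: abs_mult)
    then show ?thesis using s \<delta>(1) c(1) by (simp add: s_def field_simps)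
  qed
  then show ?thesis using \<delta>(1) by (intro exI[of _ N] exI[of _ "2 / \<delta>"]) auto
qed

end

section \<open>Distributions applied to translated test functions\<close>

text \<open>One formula for both embeddings: \<open>a = 1\<close> gives the argument y - x of the
  full algebra, and \<open>a = - 1 / \<epsilon>\<close> the argument (x - y) / \<epsilon> of the
  special algebra.\<close>

definition aff :: "real \<Rightarrow> rvec \<Rightarrow> rvec \<Rightarrow> rvec" where
  "aff a x y = (\<lambda>i. a * (y i - x i))"

definition shift_kernel :: "rvec set \<Rightarrow> real \<Rightarrow> rfun \<Rightarrow> rvec \<Rightarrow> rfun" where
  "shift_kernel \<Omega> a g x = (\<lambda>y\<in>\<Omega>. g (aff a x y))"

text \<open>If \<open>g\<close> vanishes off \<open>S\<close>, then the kernel at \<open>x\<close>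
  vanishes off this set.\<close>

definition kset :: "nat \<Rightarrow> real \<Rightarrow> rvec set \<Rightarrow> rvec \<Rightarrow> rvec set" where
  "kset n a S x = {y \<in> Rn n. aff a x y \<in> S}"

lemma aff_Rn: "x \<in> Rn n \<Longrightarrow> y \<in> Rn n \<Longrightarrow> aff a x y \<in> Rn n"
  by (simp add: aff_def Rn_iff)

lemma aff_upd: "aff a x (y(i := t)) = (aff a x y)(i := a * (t - x i))"
  "aff a (x(i := t)) y = (aff a x y)(i := a * (y i - t))"
  by (auto simp: aff_def)

lemma has_pd_aff: "has_pd i H (aff a x y) D \<Longrightarrow> has_pd i (\<lambda>y. H (aff a x y)) y (a * D)"
proof -
  assume "has_pd i H (aff a x y) D"
  then have "((\<lambda>t. H ((aff a x y)(i := t))) has_real_derivative D) (at (a * (y i - x i)))"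
    by (simp add: has_pd_def aff_def)
  then have "((\<lambda>t. H ((aff a x y)(i := a * (t - x i)))) has_real_derivative D * a) (at (y i))"
    by (rule DERIV_chain2) (auto intro!: derivative_eq_intros)
  then show ?thesis by (simp add: has_pd_def aff_upd mult.commute)
qed

lemma pd_aff:
  assumes G: "smooth_on n (Rn n) G" and x: "x \<in> Rn n"
  shows "set L \<subseteq> {..<n} \<Longrightarrow> y \<in> Rn n \<Longrightarrow> pd L (\<lambda>y. G (aff a x y)) y = a ^ length L * pd L G (aff a x y)"
proof (induction L arbitrary: y)
  case (Cons i L)
  have L: "set L \<subseteq> {..<n}" and i: "i < n" using Cons.prems by auto
  have "pderiv_at i (pd L (\<lambda>y. G (aff a x y))) y = pderiv_at i (\<lambda>y. a ^ length L * pd L G (aff a x y)) y"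
    by (rule pderiv_at_cong[OF openin_Rn Cons.prems(2) i]) (rule Cons.IH[OF L])
  also have "\<dots> = a ^ length L * (a * pderiv_at i (pd L G) (aff a x y))"
    by (intro has_pd_pderiv has_pd_cmult has_pd_aff has_pd_smooth[OF openin_Rn _ i]
        smooth_on_pd[OF openin_Rn G L] aff_Rn x Cons.prems)
  finally show ?case by simp
qed simp

lemma smooth_on_aff:
  assumes "openin (Euclidean_space n) \<Omega>" "smooth_on n (Rn n) G" "x \<in> Rn n"
  shows "smooth_on n \<Omega> (\<lambda>y. G (aff a x y))"
proof (rule smooth_on_compose[where g = "aff a x" and f = G, OF assms(1) openin_Rn])
  show "aff a x ` \<Omega> \<subseteq> Rn n" using assms(3) openin_Euclidean_subset[OF assms(1)] by (auto intro: aff_Rn)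
  show "smooth_on n \<Omega> (\<lambda>y. aff a x y j)" for j
    unfolding aff_def
    by (intro smooth_on_cmult[OF assms(1)] smooth_on_diff[OF assms(1)] smooth_on_coord[OF assms(1)]
        smooth_on_const[OF assms(1)])
qed (rule assms(2))

lemma compact_kset:
  assumes "a \<noteq> 0" "compact S" "S \<subseteq> Rn n" "x \<in> Rn n"
  shows "compact (kset n a S x)"
proof -
  have "kset n a S x = (\<lambda>s i. x i + s i / a) ` S"
  proof (intro equalityI subsetI)
    fix y assume "y \<in> kset n a S x"
    then show "y \<in> (\<lambda>s i. x i + s i / a) ` S"
      using assms(1) by (intro image_eqI[of _ _ "aff a x y"]) (auto simp: kset_def aff_def)
  next
    fix y assume "y \<in> (\<lambda>s i. x i + s i / a) ` S"
    then obtain s where s: "s \<in> S" "y = (\<lambda>i. x i + s i / a)" by blast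
    have "aff a x y = s" using assms(1) s(2) by (simp add: aff_def)
    moreover have "y \<in> Rn n" using s assms(3,4) by (auto simp: Rn_iff)
    ultimately show "y \<in> kset n a S x" using s(1) by (simp add: kset_def)
  qed
  moreover have "continuous_on S (\<lambda>s i. x i + s i / a)"
    by (intro continuous_on_coordinatewise_then_product continuous_intros continuous_on_coord)
      (simp add: assms(1))
  ultimately show ?thesis using assms(2) by (simp add: compact_continuous_image)
qed

text \<open>Moving \<open>x\<close> translates the set by the same vector.\<close>

lemma kset_thick:
  assumes "x \<in> Rn n" "x' \<in> Rn n" "\<And>i. i < n \<Longrightarrow> \<bar>x' i - x i\<bar> \<le> r"
  shows "kset n a S x' \<subseteq> thick n (kset n a S x) r"
proof
  fix y assume y: "y \<in> kset n a S x'"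
  let ?c = "\<lambda>i. y i - x' i + x i"
  have "?c \<in> Rn n" using y assms(1,2) by (simp add: kset_def Rn_iff)
  moreover have "aff a x ?c = aff a x' y" by (simp add: aff_def)
  ultimately have "?c \<in> kset n a S x" using y by (simp add: kset_def)
  moreover have "\<bar>y i - ?c i\<bar> \<le> r" if "i < n" for i using assms(3)[OF that] by simp
  ultimately have "\<exists>c\<in>kset n a S x. \<forall>i<n. \<bar>y i - c i\<bar> \<le> r" by (intro bexI[of _ ?c]) auto
  moreover have "y \<in> Rn n" using y by (simp add: kset_def)
  ultimately show "y \<in> thick n (kset n a S x) r" by (simp add: thick_def)
qed

text \<open>The derivative in extensional form, so that it is again a test function and can be put
  back into the kernel.\<close>

definition dfun :: "nat \<Rightarrow> nat list \<Rightarrow> rfun \<Rightarrow> rfun" where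
  "dfun n L g = restrict (pd L g) (Rn n)"

lemma pd_dfun:
  assumes "set M \<subseteq> {..<n}" "z \<in> Rn n"
  shows "pd M (dfun n L g) z = pd (M @ L) g z"
proof -
  have "pd M (dfun n L g) z = pd M (pd L g) z"
    by (rule pd_cong[OF openin_Rn _ assms]) (simp add: dfun_def)
  then show ?thesis by (simp add: pd_append)
qed

lemma bnd_dfun:
  assumes "bnd n (m + length L) (Rn n) g B" "set L \<subseteq> {..<n}"
  shows "bnd n m (Rn n) (dfun n L g) B"
  using bnd_cong[where f = "pd L g" and g = "dfun n L g" and m = m and c = B, OF openin_Rn order_refl]
    bnd_pd[OF assms] by (simp add: dfun_def)

lemma dfun_test:
  assumes S: "compact S" "S \<subseteq> Rn n" and g: "g \<in> test_funs_in n (Rn n) S" and L: "set L \<subseteq> {..<n}"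
  shows "dfun n L g \<in> test_funs_in n (Rn n) S"
proof -
  note g' = g[unfolded test_funs_in_iff[OF S]]
  have "smooth_on n (Rn n) (dfun n L g)"
  proof (rule smooth_on_cong[where f = "pd L g", OF openin_Rn])
    show "smooth_on n (Rn n) (pd L g)" using g' by (intro smooth_on_pd[OF openin_Rn _ L]) simp
  qed (simp add: dfun_def)
  moreover have "dfun n L g z = 0" if z: "z \<in> Rn n - S" for z
  proof -
    have W: "openin (Euclidean_space n) (Rn n - S)"
      using compact_imp_closed[OF S(1)] unfolding openin_Euclidean_open by (metis Diff_eq open_Compl)
    have "pd L g z = pd L (\<lambda>_. 0) z"
      using g' by (intro pd_cong[OF W _ L z]) auto
    moreover have "pd L (\<lambda>_. 0) z = 0"
      using bndD[OF bnd_const[of 0 0 n "length L" UNIV] L] by simp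
    ultimately show ?thesis using z by (simp add: dfun_def)
  qed
  ultimately show ?thesis by (simp add: test_funs_in_iff[OF S] dfun_def)
qed

context
  fixes n :: nat and \<Omega> :: "rvec set" and a :: real and S :: "rvec set"
  assumes \<Omega>: "openin (Euclidean_space n) \<Omega>" and a: "a \<noteq> 0" and S: "compact S" "S \<subseteq> Rn n"
begin

lemma kernel_test:
  assumes "g \<in> test_funs_in n (Rn n) S" "x \<in> Rn n" "kset n a S x \<subseteq> K" "compact K" "K \<subseteq> \<Omega>"
  shows "shift_kernel \<Omega> a g x \<in> test_funs_in n \<Omega> K"
proof -
  note g = assms(1)[unfolded test_funs_in_iff[OF S]]
  have "smooth_on n \<Omega> (shift_kernel \<Omega> a g x)"
  proof (rule smooth_on_cong[where f = "\<lambda>y. g (aff a x y)", OF \<Omega>])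
    show "smooth_on n \<Omega> (\<lambda>y. g (aff a x y))" using g by (intro smooth_on_aff[OF \<Omega> _ assms(2)]) simp
  qed (simp add: shift_kernel_def)
  moreover have "shift_kernel \<Omega> a g x y = 0" if y: "y \<in> \<Omega> - K" for y
  proof -
    have "y \<in> Rn n" using y openin_Euclidean_subset[OF \<Omega>] by blast
    moreover have "y \<notin> kset n a S x" using y assms(3) by blast
    ultimately have "aff a x y \<in> Rn n - S" using aff_Rn[OF assms(2)] by (simp add: kset_def)
    then show ?thesis using g y by (simp add: shift_kernel_def)
  qed
  ultimately show ?thesis by (simp add: test_funs_in_iff[OF assms(4,5)] shift_kernel_def)
qed

lemma pd_kernel:
  assumes "g \<in> test_funs_in n (Rn n) S" "x \<in> Rn n" "y \<in> \<Omega>" "set L \<subseteq> {..<n}"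
  shows "pd L (shift_kernel \<Omega> a g x) y = a ^ length L * pd L g (aff a x y)"
proof -
  have "pd L (shift_kernel \<Omega> a g x) y = pd L (\<lambda>y. g (aff a x y)) y"
    by (rule pd_cong[OF \<Omega> _ assms(4,3)]) (simp add: shift_kernel_def)
  also have "\<dots> = a ^ length L * pd L g (aff a x y)"
    using assms openin_Euclidean_subset[OF \<Omega>] by (intro pd_aff) (auto simp: test_funs_in_iff[OF S])
  finally show ?thesis .
qed

text \<open>For \<open>g\<close> supported in \<open>S\<close>, the kernel at these points is a test
  function on \<Omega>.\<close>

definition kdom :: "rvec set" where
  "kdom = {x \<in> \<Omega>. kset n a S x \<subseteq> \<Omega>}"

lemma kdom_Rn: "x \<in> kdom \<Longrightarrow> x \<in> Rn n"
  using openin_Euclidean_subset[OF \<Omega>] by (auto simp: kdom_def)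

text \<open>The seminorm estimate of a distribution concerns one compact set at a time; a single
  such set has to contain the supports of all kernels at nearby points.\<close>

lemma kdom_local:
  assumes x: "x \<in> kdom"
  obtains r where "r > 0" "obox n x r \<subseteq> kdom" "compact (thick n (kset n a S x) r)"
    "thick n (kset n a S x) r \<subseteq> \<Omega>" "\<forall>x'\<in>obox n x r. kset n a S x' \<subseteq> thick n (kset n a S x) r"
proof -
  let ?K = "kset n a S x"
  have K: "compact ?K" "?K \<subseteq> \<Omega>" using x compact_kset[OF a S kdom_Rn[OF x]] by (auto simp: kdom_def)
  obtain r1 where r1: "r1 > 0" "thick n ?K r1 \<subseteq> \<Omega>" using thick_subset_open[OF K \<Omega>] .
  have "x \<in> \<Omega>" using x by (simp add: kdom_def)
  then obtain r2 where r2: "r2 > 0" "obox n x r2 \<subseteq> \<Omega>" using openin_EuclideanE[OF \<Omega>] by metis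
  define r where "r = min r1 r2"
  have r: "r > 0" "r \<le> r1" "r \<le> r2" using r1 r2 by (auto simp: r_def)
  have sub: "thick n ?K r \<subseteq> \<Omega>" using thick_mono[OF r(2)] r1(2) by blast
  have k: "kset n a S x' \<subseteq> thick n ?K r" if "x' \<in> obox n x r" for x'
    using that by (intro kset_thick[OF kdom_Rn[OF x]]) (auto simp: obox_def less_imp_le)
  have "obox n x r \<subseteq> kdom"
  proof
    fix x' assume "x' \<in> obox n x r"
    then show "x' \<in> kdom" using k[of x'] sub r2(2) obox_mono[OF r(3), of n x] unfolding kdom_def by blast
  qed
  moreover have "?K \<subseteq> Rn n" by (auto simp: kset_def)
  ultimately show ?thesis
    using compact_thick[OF K(1)] k by (intro that[OF r(1) _ _ sub]) auto
qed

lemma open_kdom: "openin (Euclidean_space n) kdom"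
  unfolding openin_Euclidean_iff
proof (intro conjI ballI subsetI kdom_Rn)
  show "\<exists>r>0. obox n x r \<subseteq> kdom" if "x \<in> kdom" for x
    by (rule kdom_local[OF that]) blast
qed

context
  fixes T assumes T: "T \<in> distributions n \<Omega>"
begin

text \<open>Carries no information outside \<open>kdom\<close>, where the kernel need not be a test
  function.\<close>

definition conv :: "rfun \<Rightarrow> rfun" where
  "conv g x = T (shift_kernel \<Omega> a g x)"

text \<open>By the mean value theorem two kernels at nearby points differ little in every seminorm,
  so the seminorm estimate applies to their difference.\<close>

lemma conv_continuous:
  assumes g: "g \<in> test_funs_in n (Rn n) S"
  shows "continuous_on kdom (conv g)"
proof -
  have "\<exists>\<rho>>0. \<forall>x'\<in>kdom \<inter> obox n x \<rho>. \<bar>conv g x' - conv g x\<bar> < e" if x: "x \<in> kdom" and e: "e > 0" for x e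
  proof -
    obtain r where r: "r > 0" "obox n x r \<subseteq> kdom" "compact (thick n (kset n a S x) r)"
      "thick n (kset n a S x) r \<subseteq> \<Omega>" "\<forall>x'\<in>obox n x r. kset n a S x' \<subseteq> thick n (kset n a S x) r"
      using kdom_local[OF x] by metis
    let ?K = "thick n (kset n a S x) r"
    obtain N C where C: "C > 0" "\<And>\<phi> c. \<phi> \<in> test_funs_in n \<Omega> ?K \<Longrightarrow> c > 0 \<Longrightarrow> bnd n N \<Omega> \<phi> c \<Longrightarrow> \<bar>T \<phi>\<bar> \<le> C * c"
      using distribution_estimate[OF \<Omega> T r(3,4)] by blast
    \<comment> \<open>One order beyond \<open>N\<close>, because differences of derivatives of order
      \<open>N\<close> are estimated by the mean value theorem.\<close>
    obtain B where B: "B > 0" "bnd n (N + 1) (Rn n) g B" using bnd_test_fun[OF openin_Rn S g] by blast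
    define A where "A = max 1 \<bar>a\<bar>"
    have A: "A \<ge> 1" "\<bar>a\<bar> \<le> A" by (auto simp: A_def)
    \<comment> \<open>\<open>A ^ N\<close> comes from the chain rule in \<open>y\<close>; the rest
      bounds \<open>n\<close> terms, each a partial derivative times a displacement of at most
      \<open>A * \<rho>\<close>. Taking \<open>n + 1\<close> keeps \<open>M\<close> positive in
      dimension 0.\<close>
    define M where "M = A ^ N * (real (n + 1) * B * A)"
    have M: "M > 0" using A B by (simp add: M_def)
    \<comment> \<open>The bound \<open>r\<close> keeps all supports in \<open>?K\<close>, and the
      factor 2 makes the final inequality strict.\<close>
    define \<rho> where "\<rho> = min r (e / (2 * (C * M)))"
    have \<rho>: "\<rho> > 0" "\<rho> \<le> r" "C * (M * \<rho>) < e"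
    proof -
      show "\<rho> > 0" "\<rho> \<le> r" using r(1) e C(1) M by (auto simp: \<rho>_def)
      have "C * M * \<rho> \<le> C * M * (e / (2 * (C * M)))" using C(1) M by (intro mult_left_mono) (auto simp: \<rho>_def)
      then show "C * (M * \<rho>) < e" using C(1) M e by (simp add: mult.assoc)
    qed
    have "\<bar>conv g x' - conv g x\<bar> < e" if x': "x' \<in> obox n x \<rho>" for x'
    proof -
      have x'r: "x' \<in> obox n x r" using x' obox_mono[OF \<rho>(2)] by blast
      have xR: "x \<in> Rn n" "x' \<in> Rn n" using kdom_Rn[OF x] x' by (auto simp: obox_def)
      have xr: "x \<in> obox n x r" using obox_self[OF xR(1) r(1)] .
      let ?k = "shift_kernel \<Omega> a g"
      have k: "?k x' \<in> test_funs_in n \<Omega> ?K" "?k x \<in> test_funs_in n \<Omega> ?K"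
        using kernel_test[OF g xR(2) r(5)[rule_format, OF x'r] r(3,4)] kernel_test[OF g xR(1) r(5)[rule_format, OF xr] r(3,4)] .
      let ?\<psi> = "\<lambda>y\<in>\<Omega>. 1 * ?k x' y + - 1 * ?k x y"
      have \<psi>: "?\<psi> \<in> test_funs_in n \<Omega> ?K" by (rule test_funs_in_lin[OF \<Omega> r(3,4) k])
      have "bnd n N \<Omega> ?\<psi> (M * \<rho>)"
        unfolding bnd_def
      proof (intro allI impI ballI)
        fix L y assume L: "set L \<subseteq> {..<n}" "length L \<le> N" and y: "y \<in> \<Omega>"
        have yR: "y \<in> Rn n" using y openin_Euclidean_subset[OF \<Omega>] by blast
        let ?p = "aff a x y" and ?q = "aff a x' y" and ?h = "pd L g"
        have pq: "?p \<in> Rn n" "?q \<in> Rn n" using aff_Rn xR yR by auto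
        have "pd L ?\<psi> y = pd L (\<lambda>y. 1 * ?k x' y + - 1 * ?k x y) y"
          by (rule pd_cong[OF \<Omega> _ L(1) y]) simp
        also have "\<dots> = 1 * pd L (?k x') y + - 1 * pd L (?k x) y"
          using k by (intro pd_lin[OF \<Omega> _ _ L(1) y]) (auto simp: test_funs_in_iff[OF r(3,4)])
        also have "\<dots> = a ^ length L * (?h ?q - ?h ?p)"
          by (simp add: pd_kernel[OF g xR(1) y L(1)] pd_kernel[OF g xR(2) y L(1)] right_diff_distrib)
        finally have eq: "pd L ?\<psi> y = a ^ length L * (?h ?q - ?h ?p)" .
        have sh: "smooth_on n (Rn n) ?h" using g L by (intro smooth_on_pd[OF openin_Rn]) (auto simp: test_funs_in_iff[OF S])
        have "\<exists>\<xi>. (\<forall>j<n. \<forall>i. \<xi> j i \<in> closed_segment (?p i) (?q i)) \<and>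
            ?h ?q - ?h ?p = (\<Sum>j<n. pderiv_at j ?h (\<xi> j) * (?q j - ?p j))"
        proof (rule mvt_telescope[OF pq, where U = "Rn n"])
          show "z \<in> Rn n" if "\<And>i. z i \<in> closed_segment (?p i) (?q i)" for z
            unfolding Rn_iff
          proof (intro allI impI)
            fix i assume "n \<le> i"
            then show "z i = 0" using that[of i] pq by (simp add: Rn_iff)
          qed
        qed (rule has_pd_smooth[OF openin_Rn sh])
        then obtain \<xi> where \<xi>: "\<And>j i. j < n \<Longrightarrow> \<xi> j i \<in> closed_segment (?p i) (?q i)"
          "?h ?q - ?h ?p = (\<Sum>j<n. pderiv_at j ?h (\<xi> j) * (?q j - ?p j))" by blast
        have "\<bar>pderiv_at j ?h (\<xi> j) * (?q j - ?p j)\<bar> \<le> B * (A * \<rho>)" if j: "j < n" for j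
        proof -
          have "\<xi> j \<in> Rn n"
            unfolding Rn_iff
          proof (intro allI impI)
            fix i assume "n \<le> i"
            then show "\<xi> j i = 0" using \<xi>(1)[OF j, of i] pq by (simp add: Rn_iff)
          qed
          then have "\<bar>pderiv_at j ?h (\<xi> j)\<bar> \<le> B" using bndD[OF B(2), of "j # L" "\<xi> j"] L j by simp
          moreover have "\<bar>?q j - ?p j\<bar> \<le> A * \<rho>"
          proof -
            have "?q j - ?p j = - a * (x' j - x j)" by (simp add: aff_def algebra_simps)
            moreover have "\<bar>x' j - x j\<bar> \<le> \<rho>" using x' j by (simp add: obox_def less_imp_le)
            ultimately show ?thesis using A by (simp add: abs_mult mult_mono)
          qed
          ultimately show ?thesis using B(1) by (simp add: abs_mult mult_mono)
        qed
        then have "\<bar>?h ?q - ?h ?p\<bar> \<le> (\<Sum>j<n. B * (A * \<rho>))"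
          unfolding \<xi>(2) by (intro order_trans[OF sum_abs] sum_mono) simp
        also have "\<dots> \<le> real (n + 1) * B * A * \<rho>"
          using B(1) A \<rho>(1) by (simp add: algebra_simps)
        finally have h: "\<bar>?h ?q - ?h ?p\<bar> \<le> real (n + 1) * B * A * \<rho>" .
        have "\<bar>a ^ length L\<bar> \<le> A ^ N"
        proof -
          have "\<bar>a\<bar> ^ length L \<le> A ^ length L" using A by (intro power_mono) auto
          also have "\<dots> \<le> A ^ N" using A L(2) by (intro power_increasing) auto
          finally show ?thesis by (simp add: power_abs)
        qed
        then show "\<bar>pd L ?\<psi> y\<bar> \<le> M * \<rho>"
          unfolding eq abs_mult M_def using h mult_mono[of "\<bar>a ^ length L\<bar>" "A ^ N" "\<bar>?h ?q - ?h ?p\<bar>" "real (n + 1) * B * A * \<rho>"] A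
          by (simp add: mult.assoc)
      qed
      then have "\<bar>T ?\<psi>\<bar> \<le> C * (M * \<rho>)" using C(2)[OF \<psi>] M \<rho>(1) by simp
      moreover have "T ?\<psi> = 1 * T (?k x') + - 1 * T (?k x)"
        using k test_funs_in_subset by (intro distribution_lin[OF \<Omega> T]) blast+
      ultimately show ?thesis using \<rho>(3) by (simp add: conv_def)
    qed
    then show ?thesis using \<rho>(1) by blast
  qed
  then show ?thesis using kdom_Rn by (subst continuous_on_Rn_iff[of _ n]) auto
qed

text \<open>The mean value theorem for \<open>h\<close> and then for its derivative.\<close>

lemma difference_quotient_bound:
  assumes h: "smooth_on n (Rn n) h" and i: "i < n" and z: "z \<in> Rn n" and s: "s \<noteq> 0"
    and B: "\<And>w. w \<in> Rn n \<Longrightarrow> \<bar>pderiv_at i (pderiv_at i h) w\<bar> \<le> B"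
  shows "\<bar>(h (z(i := z i + s)) - h z) / s - pderiv_at i h z\<bar> \<le> B * \<bar>s\<bar>"
proof -
  have d: "((\<lambda>t. f (z(i := t))) has_real_derivative pderiv_at i f (z(i := t))) (at t)"
    if "smooth_on n (Rn n) f" for f t
    using has_pd_smooth[OF openin_Rn that i Rn_upd[OF z i, of t]] by (simp add: has_pd_def)
  obtain t where t: "t \<in> closed_segment (z i) (z i + s)"
    "h (z(i := z i + s)) - h (z(i := z i)) = pderiv_at i h (z(i := t)) * (z i + s - z i)"
    using mvt_segment[of "z i" "z i + s" "\<lambda>t. h (z(i := t))" "\<lambda>t. pderiv_at i h (z(i := t))", OF d[OF h]]
    by blast
  obtain t' where t': "pderiv_at i h (z(i := t)) - pderiv_at i h (z(i := z i)) =
      pderiv_at i (pderiv_at i h) (z(i := t')) * (t - z i)"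
    using mvt_segment[of "z i" t "\<lambda>t. pderiv_at i h (z(i := t))"
        "\<lambda>t. pderiv_at i (pderiv_at i h) (z(i := t))", OF d[OF smooth_on_pderiv[OF openin_Rn h i]]] by blast
  have "(h (z(i := z i + s)) - h z) / s - pderiv_at i h z = pderiv_at i (pderiv_at i h) (z(i := t')) * (t - z i)"
    using t(2) t' s by simp
  moreover have "\<bar>t - z i\<bar> \<le> \<bar>s\<bar>" using t(1) by (auto simp: closed_segment_eq_real_ivl split: if_splits)
  ultimately show ?thesis
    using B[OF Rn_upd[OF z i, of t']] by (simp add: abs_mult mult_mono')
qed

lemma conv_has_pd:
  assumes g: "g \<in> test_funs_in n (Rn n) S" and i: "i < n" and x: "x \<in> kdom"
  shows "has_pd i (conv g) x (- a * conv (dfun n [i] g) x)"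
proof -
  obtain r where r: "r > 0" "obox n x r \<subseteq> kdom" "compact (thick n (kset n a S x) r)"
    "thick n (kset n a S x) r \<subseteq> \<Omega>" "\<forall>x'\<in>obox n x r. kset n a S x' \<subseteq> thick n (kset n a S x) r"
    using kdom_local[OF x] by metis
  let ?K = "thick n (kset n a S x) r"
  obtain N C where C: "C > 0" "\<And>\<phi> c. \<phi> \<in> test_funs_in n \<Omega> ?K \<Longrightarrow> c > 0 \<Longrightarrow> bnd n N \<Omega> \<phi> c \<Longrightarrow> \<bar>T \<phi>\<bar> \<le> C * c"
    using distribution_estimate[OF \<Omega> T r(3,4)] by blast
  \<comment> \<open>Two orders beyond \<open>N\<close>, because second derivatives measure the error
    of a difference quotient.\<close>
  obtain B where B: "B > 0" "bnd n (N + 2) (Rn n) g B" using bnd_test_fun[OF openin_Rn S g] by blast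
  define A where "A = max 1 \<bar>a\<bar>"
  have A: "A \<ge> 1" "\<bar>a\<bar> \<le> A" by (auto simp: A_def)
  \<comment> \<open>\<open>A ^ N\<close> comes from the chain rule in \<open>y\<close>, the next
    \<open>A\<close> from the factor \<open>- a\<close>, and \<open>B * A\<close> from a difference
    quotient with step \<open>- (a * \<tau>)\<close>.\<close>
  define M where "M = A ^ N * (A * (B * A))"
  have M: "M > 0" using A B by (simp add: M_def)
  let ?k = "shift_kernel \<Omega> a g" and ?dg = "dfun n [i] g"
  let ?k' = "shift_kernel \<Omega> a ?dg"
  have dg: "?dg \<in> test_funs_in n (Rn n) S" using i by (intro dfun_test[OF S g]) simp
  have gs: "smooth_on n (Rn n) g" using g by (simp add: test_funs_in_iff[OF S])
  have xR: "x \<in> Rn n" using kdom_Rn[OF x] .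
  have bound: "\<bar>(conv g (x(i := x i + \<tau>)) - conv g x) / \<tau> - - a * conv ?dg x\<bar> \<le> C * (M * \<bar>\<tau>\<bar>)"
    if \<tau>: "\<tau> \<noteq> 0" "\<bar>\<tau>\<bar> < r" for \<tau>
  proof -
    let ?x = "x(i := x i + \<tau>)"
    have x'R: "?x \<in> Rn n" using Rn_upd[OF xR i] .
    have x'r: "?x \<in> obox n x r" using x'R \<tau> r(1) by (simp add: obox_def)
    have xr: "x \<in> obox n x r" using obox_self[OF xR r(1)] .
    have k: "?k ?x \<in> test_funs_in n \<Omega> ?K" "?k x \<in> test_funs_in n \<Omega> ?K" "?k' x \<in> test_funs_in n \<Omega> ?K"
      using kernel_test[OF g x'R r(5)[rule_format, OF x'r] r(3,4)] kernel_test[OF g xR r(5)[rule_format, OF xr] r(3,4)]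
        kernel_test[OF dg xR r(5)[rule_format, OF xr] r(3,4)] .
    let ?\<psi>1 = "\<lambda>y\<in>\<Omega>. 1 / \<tau> * ?k ?x y + - 1 / \<tau> * ?k x y"
    \<comment> \<open>The difference quotient of the kernel minus the expected derivative
      \<open>- a * ?k' x\<close>, in the form that the linearity lemmas match.\<close>
    let ?\<psi> = "\<lambda>y\<in>\<Omega>. 1 * ?\<psi>1 y + a * ?k' x y"
    have \<psi>1: "?\<psi>1 \<in> test_funs_in n \<Omega> ?K" by (rule test_funs_in_lin[OF \<Omega> r(3,4) k(1,2)])
    have \<psi>: "?\<psi> \<in> test_funs_in n \<Omega> ?K" by (rule test_funs_in_lin[OF \<Omega> r(3,4) \<psi>1 k(3)])
    note smooth = test_funs_in_iff[OF r(3,4), THEN iffD1, THEN conjunct2, THEN conjunct1]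
    have "bnd n N \<Omega> ?\<psi> (M * \<bar>\<tau>\<bar>)"
      unfolding bnd_def
    proof (intro allI impI ballI)
      fix L y assume L: "set L \<subseteq> {..<n}" "length L \<le> N" and y: "y \<in> \<Omega>"
      have yR: "y \<in> Rn n" using y openin_Euclidean_subset[OF \<Omega>] by blast
      let ?z = "aff a x y" and ?h = "pd L g"
      have z: "?z \<in> Rn n" using aff_Rn xR yR by auto
      have zt: "aff a ?x y = ?z(i := ?z i + - (a * \<tau>))" by (simp add: aff_upd) (simp add: aff_def algebra_simps)
      have sh: "smooth_on n (Rn n) ?h" by (rule smooth_on_pd[OF openin_Rn gs L(1)])
      have "pd L ?\<psi> y = pd L (\<lambda>y. 1 * ?\<psi>1 y + a * ?k' x y) y"
        by (rule pd_cong[OF \<Omega> _ L(1) y]) simp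
      also have "\<dots> = 1 * pd L ?\<psi>1 y + a * pd L (?k' x) y"
        by (rule pd_lin[OF \<Omega> smooth[OF \<psi>1] smooth[OF k(3)] L(1) y])
      also have "pd L ?\<psi>1 y = pd L (\<lambda>y. 1 / \<tau> * ?k ?x y + - 1 / \<tau> * ?k x y) y"
        by (rule pd_cong[OF \<Omega> _ L(1) y]) simp
      also have "\<dots> = 1 / \<tau> * pd L (?k ?x) y + - 1 / \<tau> * pd L (?k x) y"
        by (rule pd_lin[OF \<Omega> smooth[OF k(1)] smooth[OF k(2)] L(1) y])
      finally have e: "pd L ?\<psi> y = 1 * (1 / \<tau> * pd L (?k ?x) y + - 1 / \<tau> * pd L (?k x) y) + a * pd L (?k' x) y" .
      have lincomb: "p = u * ((h1 - h2) / \<tau> + a * h3)"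
        if "p = 1 * (1 / \<tau> * (u * h1) + - 1 / \<tau> * (u * h2)) + a * (u * h3)" for p u h1 h2 h3 :: real
        using that \<tau>(1) by (simp add: field_simps)
      have "pd L ?\<psi> y = a ^ length L * ((?h (?z(i := ?z i + - (a * \<tau>))) - ?h ?z) / \<tau> + a * pd L ?dg ?z)"
        by (rule lincomb)
          (rule e[unfolded pd_kernel[OF g xR y L(1)] pd_kernel[OF g x'R y L(1)] pd_kernel[OF dg xR y L(1)] zt])
      also have "pd L ?dg ?z = pd L (pderiv_at i g) ?z" using pd_dfun[OF L(1) z, of "[i]" g] by (simp add: pd_append)
      also have "\<dots> = pderiv_at i ?h ?z" by (rule pderiv_commute_pd[OF openin_Rn gs i L(1) z, symmetric])
      also have "(?h (?z(i := ?z i + - (a * \<tau>))) - ?h ?z) / \<tau> + a * pderiv_at i ?h ?z =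
          - a * ((?h (?z(i := ?z i + - (a * \<tau>))) - ?h ?z) / (- (a * \<tau>)) - pderiv_at i ?h ?z)"
        using a \<tau>(1) by (simp add: field_simps)
      finally have eq: "pd L ?\<psi> y = a ^ length L *
        (- a * ((?h (?z(i := ?z i + - (a * \<tau>))) - ?h ?z) / (- (a * \<tau>)) - pderiv_at i ?h ?z))" .
      have "\<bar>(?h (?z(i := ?z i + - (a * \<tau>))) - ?h ?z) / (- (a * \<tau>)) - pderiv_at i ?h ?z\<bar> \<le> B * \<bar>- (a * \<tau>)\<bar>"
      proof (rule difference_quotient_bound[OF sh i z])
        show "\<bar>pderiv_at i (pderiv_at i ?h) w\<bar> \<le> B" if "w \<in> Rn n" for w
          using bndD[OF B(2), of "i # i # L" w] L i that by simp
      qed (use a \<tau> in simp)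
      also have "\<dots> \<le> B * A * \<bar>\<tau>\<bar>" using B(1) A by (simp add: abs_mult mult_right_mono)
      finally have h: "\<bar>(?h (?z(i := ?z i + - (a * \<tau>))) - ?h ?z) / (- (a * \<tau>)) - pderiv_at i ?h ?z\<bar> \<le> B * A * \<bar>\<tau>\<bar>" .
      have "\<bar>a ^ length L\<bar> \<le> A ^ N"
      proof -
        have "\<bar>a\<bar> ^ length L \<le> A ^ length L" using A by (intro power_mono) auto
        also have "\<dots> \<le> A ^ N" using A L(2) by (intro power_increasing) auto
        finally show ?thesis by (simp add: power_abs)
      qed
      then have "\<bar>pd L ?\<psi> y\<bar> \<le> A ^ N * (A * (B * A * \<bar>\<tau>\<bar>))"
        unfolding eq abs_mult abs_minus_cancel using h A by (intro mult_mono) auto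
      then show "\<bar>pd L ?\<psi> y\<bar> \<le> M * \<bar>\<tau>\<bar>" by (simp add: M_def mult.assoc)
    qed
    then have "\<bar>T ?\<psi>\<bar> \<le> C * (M * \<bar>\<tau>\<bar>)" using C(2)[OF \<psi>] M \<tau>(1) by simp
    moreover have "T ?\<psi> = 1 * T ?\<psi>1 + a * T (?k' x)"
      using k \<psi>1 test_funs_in_subset by (intro distribution_lin[OF \<Omega> T]) blast+
    moreover have "T ?\<psi>1 = 1 / \<tau> * T (?k ?x) + - 1 / \<tau> * T (?k x)"
      using k test_funs_in_subset by (intro distribution_lin[OF \<Omega> T]) blast+
    ultimately show ?thesis by (simp add: conv_def diff_divide_distrib)
  qed
  have "((\<lambda>t. (conv g (x(i := t)) - conv g x) / (t - x i) - - a * conv ?dg x) \<longlongrightarrow> 0) (at (x i))"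
  proof (rule Lim_null_comparison)
    show "eventually (\<lambda>t. norm ((conv g (x(i := t)) - conv g x) / (t - x i) - - a * conv ?dg x) \<le> C * (M * \<bar>t - x i\<bar>)) (at (x i))"
      unfolding eventually_at
    proof (intro exI[of _ r] conjI r(1) ballI impI)
      fix t assume "t \<noteq> x i \<and> dist t (x i) < r"
      then show "norm ((conv g (x(i := t)) - conv g x) / (t - x i) - - a * conv ?dg x) \<le> C * (M * \<bar>t - x i\<bar>)"
        using bound[of "t - x i"] by (simp add: dist_real_def)
    qed
    have "((\<lambda>t. C * (M * \<bar>t - x i\<bar>)) \<longlongrightarrow> C * (M * \<bar>x i - x i\<bar>)) (at (x i))" by (intro tendsto_intros)
    then show "((\<lambda>t. C * (M * \<bar>t - x i\<bar>)) \<longlongrightarrow> 0) (at (x i))" by simp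
  qed
  then have "((\<lambda>t. (conv g (x(i := t)) - conv g x) / (t - x i)) \<longlongrightarrow> - a * conv ?dg x) (at (x i))"
    by (rule LIM_zero_cancel)
  then show ?thesis by (simp add: has_pd_def has_field_derivative_iff)
qed

text \<open>The partial derivatives are multiples of \<open>conv\<close> of another test function
  with support in the same \<open>S\<close>, so the induction on the order closes.\<close>

lemma conv_smooth:
  assumes "g \<in> test_funs_in n (Rn n) S" shows "smooth_on n kdom (conv g)"
proof -
  have "Ck_on m n kdom (conv g)" if "g \<in> test_funs_in n (Rn n) S" for m g
    using that
  proof (induction m arbitrary: g)
    case 0
    then show ?case by (simp add: conv_continuous)
  next
    case (Suc m)
    show ?case
    proof (rule Ck_on_SucI[OF open_kdom conv_continuous[OF Suc.prems] conv_has_pd[OF Suc.prems]])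
      show "Ck_on m n kdom (\<lambda>x. - a * conv (dfun n [i] g) x)" if "i < n" for i
        using that by (intro Ck_on_mult[OF open_kdom] Ck_on_const[OF open_kdom] Suc.IH dfun_test[OF S Suc.prems]) simp
    qed
  qed
  then show ?thesis using assms by (simp add: smooth_on_def)
qed

lemma pd_conv:
  assumes g: "g \<in> test_funs_in n (Rn n) S"
  shows "set L \<subseteq> {..<n} \<Longrightarrow> x \<in> kdom \<Longrightarrow> pd L (conv g) x = (- a) ^ length L * conv (dfun n L g) x"
proof (induction L arbitrary: x)
  case Nil
  have "dfun n [] g = g" using g by (auto simp: dfun_def test_funs_in_iff[OF S] extensional_restrict)
  then show ?case by simp
next
  case (Cons i L)
  have L: "set L \<subseteq> {..<n}" and i: "i < n" using Cons.prems by auto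
  have "pderiv_at i (pd L (conv g)) x = pderiv_at i (\<lambda>x. (- a) ^ length L * conv (dfun n L g) x) x"
    by (rule pderiv_at_cong[OF open_kdom Cons.prems(2) i]) (rule Cons.IH[OF L])
  also have "\<dots> = (- a) ^ length L * (- a * conv (dfun n [i] (dfun n L g)) x)"
    by (intro has_pd_pderiv has_pd_cmult conv_has_pd dfun_test[OF S g L] i Cons.prems(2))
  also have "dfun n [i] (dfun n L g) = dfun n (i # L) g"
  proof -
    have "pd [i] (dfun n L g) z = pd (i # L) g z" if "z \<in> Rn n" for z
      using pd_dfun[of "[i]" n z L g] i that by simp
    then show ?thesis unfolding dfun_def[of n "[i]"] dfun_def[of n "i # L"] by (intro restrict_ext)
  qed
  finally show ?case by simp
qed

end

end

text \<open>\<open>N\<close> and \<open>C\<close> depend only on \<open>T\<close> and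
  \<open>K\<close>, not on \<open>a\<close>, \<open>S\<close>, \<open>g\<close> and
  \<open>x\<close>, all of which may vary with \<epsilon>. Of the exponent, \<open>N\<close> stems
  from derivatives of the kernel in \<open>y\<close> and \<open>m\<close> from derivatives in
  \<open>x\<close>.\<close>

lemma conv_bound:
  assumes \<Omega>: "openin (Euclidean_space n) \<Omega>" and T: "T \<in> distributions n \<Omega>" and K: "compact K" "K \<subseteq> \<Omega>"
  shows "\<exists>N C. C > 0 \<and> (\<forall>a S g x m B. a \<noteq> 0 \<and> compact S \<and> S \<subseteq> Rn n \<and> g \<in> test_funs_in n (Rn n) S \<and>
    x \<in> \<Omega> \<and> kset n a S x \<subseteq> K \<and> bnd n (N + m) (Rn n) g B \<and> B > 0 \<longrightarrow>
    bnd n m {x} (conv \<Omega> a T g) (C * (max 1 \<bar>a\<bar> ^ (N + m) * B)))"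
proof -
  obtain N C where C: "C > 0" "\<And>\<phi> c. \<phi> \<in> test_funs_in n \<Omega> K \<Longrightarrow> c > 0 \<Longrightarrow> bnd n N \<Omega> \<phi> c \<Longrightarrow> \<bar>T \<phi>\<bar> \<le> C * c"
    using distribution_estimate[OF \<Omega> T K] by blast
  have *: "bnd n m {x} (conv \<Omega> a T g) (C * (max 1 \<bar>a\<bar> ^ (N + m) * B))"
    if a: "a \<noteq> 0" and S: "compact S" "S \<subseteq> Rn n" and g: "g \<in> test_funs_in n (Rn n) S"
      and x: "x \<in> \<Omega>" "kset n a S x \<subseteq> K" and B: "bnd n (N + m) (Rn n) g B" "B > 0" for a S g x m B
    unfolding bnd_def
  proof (intro allI impI ballI)
    fix L x' assume L: "set L \<subseteq> {..<n}" "length L \<le> m" and "x' \<in> {x}"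
    then have [simp]: "x' = x" by simp
    define A where "A = max 1 \<bar>a\<bar>"
    have A: "A \<ge> 1" "\<bar>a\<bar> \<le> A" by (auto simp: A_def)
    have xR: "x \<in> Rn n" using x(1) openin_Euclidean_subset[OF \<Omega>] by blast
    have xd: "x \<in> kdom n \<Omega> a S" using x K(2) by (auto simp: kdom_def[OF \<Omega> a S])
    let ?d = "dfun n L g"
    have d: "?d \<in> test_funs_in n (Rn n) S" by (rule dfun_test[OF S g L(1)])
    have Bd: "bnd n N (Rn n) ?d B"
      using L B(1) by (intro bnd_dfun) (auto intro: bnd_mono)
    have "bnd n N \<Omega> (shift_kernel \<Omega> a ?d x) (A ^ N * B)"
      unfolding bnd_def
    proof (intro allI impI ballI)
      fix M y assume M: "set M \<subseteq> {..<n}" "length M \<le> N" and y: "y \<in> \<Omega>"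
      have "y \<in> Rn n" using y openin_Euclidean_subset[OF \<Omega>] by blast
      then have "\<bar>pd M ?d (aff a x y)\<bar> \<le> B" by (intro bndD[OF Bd M] aff_Rn xR)
      moreover have "\<bar>a\<bar> ^ length M \<le> A ^ N"
        by (rule order_trans[OF power_mono[OF A(2)] power_increasing[OF M(2) A(1)]]) simp
      ultimately show "\<bar>pd M (shift_kernel \<Omega> a ?d x) y\<bar> \<le> A ^ N * B"
        unfolding pd_kernel[OF \<Omega> a S d xR y M(1)] abs_mult power_abs
        using A(1) by (intro mult_mono) auto
    qed
    then have "\<bar>conv \<Omega> a T ?d x\<bar> \<le> C * (A ^ N * B)"
      unfolding conv_def[OF \<Omega> a S T]
      using A(1) B(2) by (intro C(2) kernel_test[OF \<Omega> a S d xR x(2) K]) auto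
    moreover have "\<bar>- a\<bar> ^ length L \<le> A ^ m"
      using order_trans[OF power_mono[OF A(2)] power_increasing[OF L(2) A(1)]] by simp
    ultimately have "\<bar>- a\<bar> ^ length L * \<bar>conv \<Omega> a T ?d x\<bar> \<le> A ^ m * (C * (A ^ N * B))"
      using A(1) by (intro mult_mono) auto
    then show "\<bar>pd L (conv \<Omega> a T g) x'\<bar> \<le> C * (max 1 \<bar>a\<bar> ^ (N + m) * B)"
      by (simp add: pd_conv[OF \<Omega> a S T g L(1) xd] abs_mult power_abs power_add A_def mult_ac)
  qed
  show ?thesis
    by (intro exI[of _ N] exI[of _ C] conjI allI impI C(1)) (elim conjE, rule *)
qed

text \<open>A dilation acts factor by factor, and a product measure is determined by its values on
  boxes; so the one-dimensional transformation of Lebesgue measure suffices.\<close>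

lemma integral_Rn_rescale_aux:
  fixes c :: real and h :: "rvec \<Rightarrow> real"
  assumes c: "c > 0" and h: "h \<in> borel_measurable (\<Pi>\<^sub>M i\<in>{..<n}. (lborel :: real measure))"
  shows "(\<integral>x. c ^ n * h (\<lambda>i\<in>{..<n}. c * x i) \<partial>(\<Pi>\<^sub>M i\<in>{..<n}. (lborel :: real measure))) =
    (\<integral>x. h x \<partial>(\<Pi>\<^sub>M i\<in>{..<n}. (lborel :: real measure)))"
proof -
  let ?P = "\<Pi>\<^sub>M i\<in>{..<n}. (lborel :: real measure)"
  interpret product_sigma_finite "\<lambda>_::nat. lborel :: real measure" by standard
  define S where "S x = (\<lambda>i\<in>{..<n}. c * x i)" for x :: rvec
  have S [measurable]: "S \<in> ?P \<rightarrow>\<^sub>M ?P" unfolding S_def by measurable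
  let ?Q = "density (distr ?P ?P S) (\<lambda>_. ennreal (c ^ n))"
  have one: "emeasure lborel A = ennreal c * emeasure lborel (times c -` A)" if "A \<in> sets lborel" for A :: "real set"
  proof -
    have [measurable]: "A \<in> sets borel" using that by simp
    have "emeasure lborel A = emeasure (density (distr lborel borel (times c)) (\<lambda>_. \<bar>c\<bar>)) A"
      using lborel_distr_mult'[of c] c by simp
    also have "\<dots> = ennreal c * emeasure (distr lborel borel (times c)) A"
      using c by (simp add: emeasure_density_const)
    also have "emeasure (distr lborel borel (times c)) A = emeasure lborel (times c -` A)"
      by (subst emeasure_distr) auto
    finally show ?thesis .
  qed
  have "?Q = ?P"
  proof (rule PiM_eqI)
    fix A :: "nat \<Rightarrow> real set" assume A: "\<And>i. i \<in> {..<n} \<Longrightarrow> A i \<in> sets lborel"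
    have m: "times c -` A i \<in> sets lborel" if "i \<in> {..<n}" for i
    proof -
      have [measurable]: "A i \<in> sets borel" using A[OF that] by simp
      have "times c -` A i \<inter> space borel \<in> sets borel" by measurable
      then show ?thesis by simp
    qed
    have "emeasure ?Q (Pi\<^sub>E {..<n} A) = ennreal (c ^ n) * emeasure (distr ?P ?P S) (Pi\<^sub>E {..<n} A)"
      using A by (intro emeasure_density_const) (auto intro!: sets_PiM_I_finite)
    also have "emeasure (distr ?P ?P S) (Pi\<^sub>E {..<n} A) = emeasure ?P (S -` Pi\<^sub>E {..<n} A \<inter> space ?P)"
      using A by (intro emeasure_distr S) (auto intro!: sets_PiM_I_finite)
    also have "S -` Pi\<^sub>E {..<n} A \<inter> space ?P = Pi\<^sub>E {..<n} (\<lambda>i. times c -` A i)"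
      by (auto simp: S_def space_PiM PiE_iff)
    also have "emeasure ?P \<dots> = (\<Prod>i<n. emeasure lborel (times c -` A i))"
      using m by (intro emeasure_PiM) auto
    also have "ennreal (c ^ n) * \<dots> = (\<Prod>i<n. ennreal c * emeasure lborel (times c -` A i))"
      using c by (simp add: prod.distrib ennreal_power)
    also have "\<dots> = (\<Prod>i<n. emeasure lborel (A i))"
      using A one by (intro prod.cong) auto
    finally show "emeasure ?Q (Pi\<^sub>E {..<n} A) = (\<Prod>i<n. emeasure lborel (A i))" .
  qed auto
  then have "(\<integral>x. h x \<partial>?P) = (\<integral>x. h x \<partial>?Q)" by simp
  also have "\<dots> = (\<integral>x. c ^ n *\<^sub>R h x \<partial>distr ?P ?P S)"
    using c h by (intro integral_density) auto
  also have "\<dots> = (\<integral>x. c ^ n *\<^sub>R h (S x) \<partial>?P)"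
    using h by (intro integral_distr) auto
  finally show ?thesis by (simp add: S_def)
qed

definition to_Rn :: "nat \<Rightarrow> rvec \<Rightarrow> rvec" where
  "to_Rn n x = (\<lambda>i. if i < n then x i else 0)"

lemma to_Rn_measurable: "to_Rn n \<in> borel_measurable (\<Pi>\<^sub>M i\<in>{..<n}. (lborel :: real measure))"
proof (rule measurable_coordinatewise_then_product)
  fix i show "(\<lambda>x. to_Rn n x i) \<in> borel_measurable (\<Pi>\<^sub>M i\<in>{..<n}. (lborel :: real measure))"
    by (cases "i < n") (simp_all add: to_Rn_def)
qed

text \<open>Composed with the idempotent \<open>to_Rn n\<close>, a continuous function on
  \<open>Rn n\<close> becomes continuous on all sequences, hence Borel; a second use of
  \<open>to_Rn n\<close> carries the product measure space there.\<close>

lemma measurable_on_Rn: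
  assumes f: "continuous_on (Rn n) f"
  shows "(\<lambda>x. f (to_Rn n x)) \<in> borel_measurable (\<Pi>\<^sub>M i\<in>{..<n}. (lborel :: real measure))"
proof -
  have "continuous_on UNIV (to_Rn n)"
    by (rule continuous_on_vecI[of _ _ n]) (auto simp: to_Rn_def Rn_iff continuous_on_coord)
  then have "continuous_on UNIV (\<lambda>x. f (to_Rn n x))"
    by (rule continuous_on_compose2[OF f]) (auto simp: to_Rn_def Rn_iff)
  then have "(\<lambda>x. f (to_Rn n x)) \<in> borel_measurable borel" by (rule borel_measurable_continuous_onI)
  from measurable_compose[OF to_Rn_measurable this]
  have "(\<lambda>x. f (to_Rn n (to_Rn n x))) \<in> borel_measurable (\<Pi>\<^sub>M i\<in>{..<n}. (lborel :: real measure))" .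
  moreover have "to_Rn n (to_Rn n x) = to_Rn n x" for x by (auto simp: to_Rn_def)
  ultimately show ?thesis by simp
qed

lemma integral_Rn_rescale:
  assumes "\<epsilon> > 0" "continuous_on (Rn n) \<phi>"
  shows "integral_Rn n (rescale n \<epsilon> \<phi>) = integral_Rn n \<phi>"
proof -
  let ?P = "\<Pi>\<^sub>M i\<in>{..<n}. (lborel :: real measure)"
  have "integral_Rn n (rescale n \<epsilon> \<phi>) = (\<integral>x. (1 / \<epsilon>) ^ n * \<phi> (to_Rn n (\<lambda>i\<in>{..<n}. 1 / \<epsilon> * x i)) \<partial>?P)"
    unfolding integral_Rn_def
  proof (rule Bochner_Integration.integral_cong[OF refl])
    fix x :: rvec
    have "(\<lambda>i. (if i < n then x i else 0) / \<epsilon>) = to_Rn n (\<lambda>i\<in>{..<n}. 1 / \<epsilon> * x i)" by (auto simp: to_Rn_def)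
    moreover have "(\<lambda>i. if i < n then x i else 0) \<in> Rn n" by (simp add: Rn_iff)
    ultimately show "rescale n \<epsilon> \<phi> (\<lambda>i. if i < n then x i else 0) =
        (1 / \<epsilon>) ^ n * \<phi> (to_Rn n (\<lambda>i\<in>{..<n}. 1 / \<epsilon> * x i))"
      by (simp add: rescale_def power_divide)
  qed
  also have "\<dots> = integral_Rn n \<phi>"
    using integral_Rn_rescale_aux[OF _ measurable_on_Rn[OF assms(2)], of "1 / \<epsilon>"] assms(1)
    by (simp add: integral_Rn_def to_Rn_def[abs_def])
  finally show ?thesis .
qed

section \<open>Embedding of distributions into the special algebra\<close>

text \<open>Plots of test functions are tested by single distributions, and for these the claim is
  the smoothness of \<open>conv\<close>.\<close>

lemma shift_kernel_plot:
  assumes \<Omega>: "openin (Euclidean_space n) \<Omega>" and a: "a \<noteq> 0" and S: "compact S" "S \<subseteq> Rn n"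
    and g: "g \<in> test_funs_in n (Rn n) S" and q: "q \<in> plots (eucl_space n (kdom n \<Omega> a S)) l W"
  shows "(\<lambda>z\<in>W. shift_kernel \<Omega> a g (q z)) \<in> plots (test_space n \<Omega>) l W"
proof -
  note W = eucl_plotD(1)[OF q] and qD = eucl_plotD(3)[OF q]
  have "shift_kernel \<Omega> a g x \<in> test_funs n \<Omega>" if x: "x \<in> kdom n \<Omega> a S" for x
  proof -
    have xR: "x \<in> Rn n" by (rule kdom_Rn[OF \<Omega> a S x])
    have "kset n a S x \<subseteq> \<Omega>" using x by (simp add: kdom_def[OF \<Omega> a S])
    then show ?thesis
      using kernel_test[OF \<Omega> a S g xR order_refl compact_kset[OF a S xR]] test_funs_in_subset by blast
  qed
  moreover have "compose W T (\<lambda>z\<in>W. shift_kernel \<Omega> a g (q z)) \<in> Csmooth l W" if T: "T \<in> distributions n \<Omega>" for T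
  proof -
    have "smooth_on l W (\<lambda>z. conv \<Omega> a T g (q z))"
      by (rule eucl_plot_compose[OF q open_kdom[OF \<Omega> a S] conv_smooth[OF \<Omega> a S T g]])
    then have "smooth_on l W (compose W T (\<lambda>z\<in>W. shift_kernel \<Omega> a g (q z)))"
      by (rule smooth_on_cong[OF W, rotated]) (simp add: conv_def[OF \<Omega> a S T] compose_def)
    then show ?thesis by (simp add: Csmooth_iff compose_def)
  qed
  ultimately show ?thesis using W qD by (simp add: test_space_def)
qed

lemma distribution_plotD:
  assumes "d \<in> plots (distribution_space n \<Omega>) k U"
  shows "openin (Euclidean_space k) U" "\<And>u. u \<in> U \<Longrightarrow> d u \<in> distributions n \<Omega>"
    "smooth_map (prod_space (eucl_space k U) (test_space n \<Omega>)) real_space (\<lambda>(u, x). d u x)"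
  using assms by (auto simp: distribution_space_def sub_space_def fun_space_def)

text \<open>The functional diffeology makes the evaluation of a plot of distributions on a plot of
  test functions smooth, and the kernels form such a plot.\<close>

lemma distribution_plot_conv:
  assumes \<Omega>: "openin (Euclidean_space n) \<Omega>" and a: "a \<noteq> 0" and S: "compact S" "S \<subseteq> Rn n"
    and g: "g \<in> test_funs_in n (Rn n) S" and d: "d \<in> plots (distribution_space n \<Omega>) k U"
    and p: "p \<in> plots (eucl_space k U) l W" and q: "q \<in> plots (eucl_space n (kdom n \<Omega> a S)) l W"
  shows "smooth_on l W (\<lambda>z. conv \<Omega> a (d (p z)) g (q z))"
proof -
  have "\<forall>l W. \<forall>p\<in>plots (eucl_space k U) l W. \<forall>q\<in>plots (test_space n \<Omega>) l W. smooth_on l W (\<lambda>z. d (p z) (q z))"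
    by (rule prod_smooth_real_iff[THEN iffD1, OF _ _ distribution_plotD(3)[OF d]])
      (auto simp: eucl_plot_iff test_space_def PiE_iff)
  then have "smooth_on l W (\<lambda>z. d (p z) ((\<lambda>z\<in>W. shift_kernel \<Omega> a g (q z)) z))"
    using p shift_kernel_plot[OF \<Omega> a S g q] by blast
  then show ?thesis
  proof (rule smooth_on_cong[OF eucl_plotD(1)[OF q], rotated])
    fix z assume "z \<in> W"
    then show "d (p z) ((\<lambda>z\<in>W. shift_kernel \<Omega> a g (q z)) z) = conv \<Omega> a (d (p z)) g (q z)"
      by (simp add: conv_def[OF \<Omega> a S distribution_plotD(2)[OF d eucl_plotD(3)[OF p]]])
  qed
qed

text \<open>Points that are not too large and keep a distance from the complement of \<Omega>. The
  kernel at scale \<epsilon> reaches less than \<epsilon> in each coordinate, so at these points it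
  stays inside \<Omega>.\<close>

definition exhaustion :: "nat \<Rightarrow> rvec set \<Rightarrow> real \<Rightarrow> rvec set" where
  "exhaustion n \<Omega> \<epsilon> = {x \<in> Rn n. (\<forall>i<n. \<bar>x i\<bar> \<le> 1 / \<epsilon>) \<and> obox n x (2 * \<epsilon>) \<subseteq> \<Omega>}"

text \<open>Read as a condition on the points outside \<Omega>, the inclusion of a box is an
  intersection of finite unions of closed sets.\<close>

lemma compact_exhaustion: "compact (exhaustion n \<Omega> \<epsilon>)"
proof -
  have "obox n x (2 * \<epsilon>) \<subseteq> \<Omega> \<longleftrightarrow> (\<forall>z\<in>Rn n - \<Omega>. \<exists>i\<in>{..<n}. 2 * \<epsilon> \<le> \<bar>z i - x i\<bar>)" for x
    unfolding obox_def subset_iff Ball_def Bex_def mem_Collect_eq Diff_iff lessThan_iff not_less[symmetric]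
    by blast
  then have "exhaustion n \<Omega> \<epsilon> = {x \<in> Rn n. \<forall>i<n. \<bar>x i\<bar> \<le> 1 / \<epsilon>} \<inter>
      (\<Inter>z\<in>Rn n - \<Omega>. \<Union>i\<in>{..<n}. {x. 2 * \<epsilon> \<le> \<bar>z i - x i\<bar>})"
    by (auto simp: exhaustion_def)
  moreover have "closed (\<Inter>z\<in>Rn n - \<Omega>. \<Union>i\<in>{..<n}. {x :: rvec. 2 * \<epsilon> \<le> \<bar>z i - x i\<bar>})"
    by (intro closed_INT ballI closed_UN closed_Collect_le continuous_intros continuous_on_coord) simp
  ultimately show ?thesis using compact_cbox_Rn[of n "1 / \<epsilon>"] by (simp add: compact_Int_closed)
qed

lemma compact_coordinate_bound:
  assumes "compact (K :: rvec set)"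
  obtains M where "M > 0" "\<And>x i. x \<in> K \<Longrightarrow> i < n \<Longrightarrow> \<bar>x i\<bar> \<le> M"
proof -
  have "continuous_on K (\<lambda>x. \<Sum>i<n. \<bar>x i\<bar>)" by (intro continuous_intros continuous_on_coord)
  then have "bounded ((\<lambda>x. \<Sum>i<n. \<bar>x i\<bar>) ` K)" using assms compact_continuous_image compact_imp_bounded by blast
  then obtain M where M: "M > 0" "\<And>x. x \<in> K \<Longrightarrow> \<bar>\<Sum>i<n. \<bar>x i\<bar>\<bar> \<le> M" by (auto simp: bounded_pos)
  have "\<bar>x i\<bar> \<le> M" if "x \<in> K" "i < n" for x i
  proof -
    have "\<bar>x i\<bar> \<le> (\<Sum>i<n. \<bar>x i\<bar>)" using that(2) by (intro member_le_sum) auto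
    then show ?thesis using M(2)[OF that(1)] by linarith
  qed
  then show ?thesis using that[OF M(1)] by blast
qed

lemma exhaustion_eventually:
  assumes \<Omega>: "openin (Euclidean_space n) \<Omega>" and K: "compact K" "K \<subseteq> \<Omega>"
  shows "\<exists>\<epsilon>0\<in>eps_set. \<forall>\<epsilon>\<in>{0<..\<epsilon>0}. K \<subseteq> exhaustion n \<Omega> \<epsilon>"
proof -
  have KR: "K \<subseteq> Rn n" using K openin_Euclidean_subset[OF \<Omega>] by blast
  obtain r where r: "r > 0" "thick n K r \<subseteq> \<Omega>" using thick_subset_open[OF K \<Omega>] .
  obtain M where M: "M > 0" and xM: "\<And>x i. x \<in> K \<Longrightarrow> i < n \<Longrightarrow> \<bar>x i\<bar> \<le> M"
    using compact_coordinate_bound[OF K(1), of n] by metis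
  \<comment> \<open>\<open>r / 2\<close> keeps boxes of radius \<open>2 * \<epsilon>\<close> inside
    \<open>thick n K r\<close>, and \<open>1 / M\<close> admits coordinates up to
    \<open>M\<close>.\<close>
  define \<epsilon>0 where "\<epsilon>0 = min 1 (min (r / 2) (1 / M))"
  have "K \<subseteq> exhaustion n \<Omega> \<epsilon>" if \<epsilon>: "\<epsilon> \<in> {0<..\<epsilon>0}" for \<epsilon>
  proof
    fix x assume x: "x \<in> K"
    have "obox n x (2 * \<epsilon>) \<subseteq> thick n K r"
    proof
      fix y assume y: "y \<in> obox n x (2 * \<epsilon>)"
      have "2 * \<epsilon> \<le> r" using \<epsilon> by (simp add: \<epsilon>0_def)
      then have "\<forall>i<n. \<bar>y i - x i\<bar> \<le> r" using y unfolding obox_def by force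
      then show "y \<in> thick n K r" using x y unfolding thick_def obox_def by blast
    qed
    moreover have "M \<le> 1 / \<epsilon>"
    proof -
      have "\<epsilon> \<le> 1 / M" "\<epsilon> > 0" using \<epsilon> by (auto simp: \<epsilon>0_def)
      then show ?thesis using M by (simp add: field_simps)
    qed
    then have "\<forall>i<n. \<bar>x i\<bar> \<le> 1 / \<epsilon>" using xM[OF x] by force
    ultimately show "x \<in> exhaustion n \<Omega> \<epsilon>" using r(2) x KR unfolding exhaustion_def by blast
  qed
  moreover have "\<epsilon>0 \<in> eps_set" using r(1) M by (simp add: \<epsilon>0_def eps_set_def)
  ultimately show ?thesis by blast
qed

lemma eventually_eps: "\<exists>\<epsilon>0\<in>eps_set. \<forall>\<epsilon>\<in>{0<..\<epsilon>0}. P \<epsilon> \<Longrightarrow> eventually P (at_right 0)"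
proof -
  assume "\<exists>\<epsilon>0\<in>eps_set. \<forall>\<epsilon>\<in>{0<..\<epsilon>0}. P \<epsilon>"
  then obtain \<epsilon>0 where "\<epsilon>0 > 0" "\<forall>\<epsilon>\<in>{0<..\<epsilon>0}. P \<epsilon>" by (auto simp: eps_set_def)
  then show ?thesis unfolding eventually_at_right_field by (intro exI[of _ \<epsilon>0]) auto
qed

lemma bnd_pointwise: "(\<And>x. x \<in> K \<Longrightarrow> bnd n m {x} f c) \<Longrightarrow> bnd n m K f c"
  unfolding bnd_def by blast

text \<open>Agreement of functions on \<open>K\<close> alone does not control their derivatives; an
  open neighbourhood inside the compact \<open>thick n K r\<close> does.\<close>

lemma open_box_nbhd:
  assumes "K \<subseteq> Rn n" "r > 0"
  obtains W where "openin (Euclidean_space n) W" "K \<subseteq> W" "W \<subseteq> thick n K r"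
proof (rule that[of "\<Union>c\<in>K. obox n c r"])
  show "openin (Euclidean_space n) (\<Union>c\<in>K. obox n c r)" by (intro openin_Union) (auto simp: openin_obox)
  show "K \<subseteq> (\<Union>c\<in>K. obox n c r)" using obox_self assms by blast
  show "(\<Union>c\<in>K. obox n c r) \<subseteq> thick n K r"
  proof
    fix y assume "y \<in> (\<Union>c\<in>K. obox n c r)"
    then obtain c where "c \<in> K" "y \<in> Rn n" "\<forall>i<n. \<bar>y i - c i\<bar> \<le> r" by (force simp: obox_def)
    then show "y \<in> thick n K r" unfolding thick_def by blast
  qed
qed

text \<open>The suprema run over all of \<open>Rn n\<close>; they are finite because each
  \<psi>_\<epsilon> has compact support. Finitely many derivatives again admit a common
  exponent.\<close>

lemma bounded_derivs_test_net:
  assumes \<psi>: "\<And>\<epsilon>. \<epsilon> \<in> eps_set \<Longrightarrow> \<psi> \<epsilon> \<in> test_funs n (Rn n)"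
    and O: "\<forall>\<alpha>. \<exists>N::nat. (\<lambda>\<epsilon>. sup_abs (Rn n) (mderiv n \<alpha> (\<psi> \<epsilon>))) \<in> O[at_right 0](\<lambda>\<epsilon>. 1 / \<epsilon> ^ N)"
  shows "\<exists>N C. C > 0 \<and> eventually (\<lambda>\<epsilon>. bnd n m (Rn n) (\<psi> \<epsilon>) (C * (1 / \<epsilon> ^ N))) (at_right 0)"
proof -
  let ?R = "\<lambda>N L. \<exists>C. eventually (\<lambda>\<epsilon>. \<forall>x\<in>Rn n. \<bar>pd L (\<psi> \<epsilon>) x\<bar> \<le> C * (1 / \<epsilon> ^ N)) (at_right 0)"
  have "\<exists>N. \<forall>L\<in>{L. set L \<subseteq> {..<n} \<and> length L \<le> m}. ?R N L"
  proof (rule finite_choice_mono[OF finite_lists])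
    fix L assume "L \<in> {L. set L \<subseteq> {..<n} \<and> length L \<le> m}"
    then have L: "set L \<subseteq> {..<n}" by simp
    obtain N where N: "(\<lambda>\<epsilon>. sup_abs (Rn n) (mderiv n (count_list L) (\<psi> \<epsilon>))) \<in> O[at_right 0](\<lambda>\<epsilon>. 1 / \<epsilon> ^ N)"
      using O by blast
    then obtain C where "eventually (\<lambda>\<epsilon>. norm (sup_abs (Rn n) (mderiv n (count_list L) (\<psi> \<epsilon>))) \<le> C * norm (1 / \<epsilon> ^ N)) (at_right 0)"
      by (elim landau_o.bigE)
    then have "eventually (\<lambda>\<epsilon>. \<forall>x\<in>Rn n. \<bar>pd L (\<psi> \<epsilon>) x\<bar> \<le> C * (1 / \<epsilon> ^ N)) (at_right 0)"
      using eventually_unit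
    proof eventually_elim
      case (elim \<epsilon>)
      then have \<epsilon>: "\<epsilon> \<in> eps_set" by (simp add: eps_set_def)
      note s = test_funs_supp[OF \<psi>[OF \<epsilon>]]
      obtain B where B: "bnd n (length L) (Rn n) (\<psi> \<epsilon>) B" using bnd_test_fun[OF openin_Rn s] by blast
      have sm: "smooth_on n (Rn n) (\<psi> \<epsilon>)" using s(3) by (simp add: test_funs_in_iff[OF s(1,2)])
      have eq: "pd L (\<psi> \<epsilon>) x = mderiv n (count_list L) (\<psi> \<epsilon>) x" if "x \<in> Rn n" for x
        by (rule pd_eq_mderiv[OF openin_Rn sm L that])
      show ?case
      proof
        fix x assume x: "x \<in> Rn n"
        have "\<bar>mderiv n (count_list L) (\<psi> \<epsilon>) x\<bar> \<le> sup_abs (Rn n) (mderiv n (count_list L) (\<psi> \<epsilon>))"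
          by (rule le_sup_abs[OF _ x, of _ B]) (use bndD[OF B L] eq in simp)
        then show "\<bar>pd L (\<psi> \<epsilon>) x\<bar> \<le> C * (1 / \<epsilon> ^ N)" using elim eq[OF x] by simp
      qed
    qed
    then show "\<exists>N. ?R N L" by blast
  next
    fix N M L assume NM: "N \<le> M" and "?R N L"
    then obtain C where C: "eventually (\<lambda>\<epsilon>. \<forall>x\<in>Rn n. \<bar>pd L (\<psi> \<epsilon>) x\<bar> \<le> C * (1 / \<epsilon> ^ N)) (at_right 0)" by blast
    have "eventually (\<lambda>\<epsilon>. \<forall>x\<in>Rn n. \<bar>pd L (\<psi> \<epsilon>) x\<bar> \<le> \<bar>C\<bar> * (1 / \<epsilon> ^ M)) (at_right 0)"
      using C eventually_unit
    proof eventually_elim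
      case (elim \<epsilon>)
      have "C * (1 / \<epsilon> ^ N) \<le> \<bar>C\<bar> * (1 / \<epsilon> ^ M)"
        using elim(2) NM by (intro mult_mono divide_left_mono power_decreasing mult_pos_pos) auto
      then show ?case using elim(1) by force
    qed
    then show "?R M L" by blast
  qed
  then obtain N where N: "\<And>L. set L \<subseteq> {..<n} \<Longrightarrow> length L \<le> m \<Longrightarrow> ?R N L" by blast
  have "eventually (\<lambda>\<epsilon>. 1 / \<epsilon> ^ N > 0) (at_right (0::real))" using eventually_unit by eventually_elim simp
  from eventually_bnd_iff[OF this, of n m "Rn n" \<psi>] N
  obtain C where C: "C \<ge> 0" "eventually (\<lambda>\<epsilon>. bnd n m (Rn n) (\<psi> \<epsilon>) (C * (1 / \<epsilon> ^ N))) (at_right 0)" by blast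
  have "eventually (\<lambda>\<epsilon>. bnd n m (Rn n) (\<psi> \<epsilon>) ((C + 1) * (1 / \<epsilon> ^ N))) (at_right 0)"
    using C(2) eventually_unit
  proof eventually_elim
    case (elim \<epsilon>)
    have "C * (1 / \<epsilon> ^ N) \<le> (C + 1) * (1 / \<epsilon> ^ N)" using elim(2) by (intro mult_right_mono) auto
    then show ?case by (rule bnd_mono[OF elim(1) order_refl order_refl])
  qed
  then show ?thesis using C(1) by (intro exI[of _ N] exI[of _ "C + 1"]) simp
qed

text \<open>\<open>iota_s\<close> is a union over all admissible nets; once their classes are known
  to agree, it is that class.\<close>

lemma Union_constant_image:
  assumes "P w" "\<And>v. P v \<Longrightarrow> f v = f w"
  shows "\<Union>{f v | v. P v} = f w"
proof -
  have "{f v | v. P v} = {f w}"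
  proof (intro equalityI subsetI)
    fix c assume "c \<in> {f v | v. P v}"
    then obtain v where "c = f v" "P v" by blast
    then show "c \<in> {f w}" using assms(2)[of v] by simp
  qed (use assms(1) in blast)
  then show ?thesis by (simp only: cSup_singleton)
qed

context
  fixes n :: nat and \<Omega> :: "rvec set" and \<psi> :: net
  assumes \<Omega>: "openin (Euclidean_space n) \<Omega>" and \<psi>: "mollifier_net n \<psi>"
begin

interpretation S: generalized_functions n \<Omega> eps_set "\<lambda>_. \<Omega>" "\<lambda>u. u" "mk_s \<Omega>"
  "eps_set \<rightarrow>\<^sub>E extensional \<Omega>" "\<lambda>_. {\<lambda>\<epsilon>. \<epsilon>}"
  by (rule generalized_functions_s[OF \<Omega>])

section \<open>The regularized net of a distribution\<close>

definition msupp :: "real \<Rightarrow> rvec set" where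
  "msupp \<epsilon> = supp_in (Rn n) (\<psi> \<epsilon>)"

text \<open>The factor \<open>1 / \<epsilon> ^ n\<close> is absorbed here, so that the dilation by
  \<open>- 1 / \<epsilon>\<close> is left to \<open>aff\<close>.\<close>

definition mol :: "real \<Rightarrow> rfun" where
  "mol \<epsilon> = (\<lambda>z\<in>Rn n. 1 / \<epsilon> ^ n * \<psi> \<epsilon> z)"

definition dom :: "real \<Rightarrow> rvec set" where
  "dom \<epsilon> = kdom n \<Omega> (- 1 / \<epsilon>) (msupp \<epsilon>)"

lemma mol_facts:
  assumes "\<epsilon> \<in> eps_set"
  shows "- 1 / \<epsilon> \<noteq> 0" "compact (msupp \<epsilon>)" "msupp \<epsilon> \<subseteq> Rn n" "mol \<epsilon> \<in> test_funs_in n (Rn n) (msupp \<epsilon>)"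
    "\<And>s i. s \<in> msupp \<epsilon> \<Longrightarrow> i < n \<Longrightarrow> \<bar>s i\<bar> < 1"
proof -
  have t: "\<psi> \<epsilon> \<in> test_funs n (Rn n)" using \<psi> assms by (simp add: mollifier_net_def)
  note s = test_funs_supp[OF t, folded msupp_def]
  show "- 1 / \<epsilon> \<noteq> 0" using assms by (simp add: eps_set_def)
  show "compact (msupp \<epsilon>)" "msupp \<epsilon> \<subseteq> Rn n" using s by auto
  show "mol \<epsilon> \<in> test_funs_in n (Rn n) (msupp \<epsilon>)"
    using test_funs_in_lin[OF openin_Rn s(1,2,3,3), of "1 / \<epsilon> ^ n" 0] by (simp add: mol_def)
  show "\<bar>s i\<bar> < 1" if "s \<in> msupp \<epsilon>" "i < n" for s i
  proof -
    have "\<bar>s i\<bar> \<le> L2_set s {..<n}"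
      using member_le_L2_set[of "{..<n}" i "\<lambda>i. \<bar>s i\<bar>"] that(2) by (simp add: L2_set_def)
    also have "\<dots> < 1" using \<psi> assms that(1) unfolding mollifier_net_def msupp_def by blast
    finally show ?thesis .
  qed
qed

lemma open_dom: "\<epsilon> \<in> eps_set \<Longrightarrow> openin (Euclidean_space n) (dom \<epsilon>)"
  unfolding dom_def using open_kdom[OF \<Omega> mol_facts(1-3)] .

lemma kset_mol:
  assumes \<epsilon>: "\<epsilon> \<in> eps_set" and y: "y \<in> kset n (- 1 / \<epsilon>) (msupp \<epsilon>) x"
  shows "y \<in> obox n x \<epsilon>"
proof -
  have "\<bar>y i - x i\<bar> < \<epsilon>" if "i < n" for i
  proof -
    have "\<bar>aff (- 1 / \<epsilon>) x y i\<bar> < 1" using mol_facts(5)[OF \<epsilon> _ that] y by (simp add: kset_def)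
    then show ?thesis using \<epsilon> by (simp add: aff_def abs_mult eps_set_def field_simps)
  qed
  then show ?thesis using y by (simp add: kset_def obox_def)
qed

lemma exhaustion_dom:
  assumes \<epsilon>: "\<epsilon> \<in> eps_set" shows "exhaustion n \<Omega> \<epsilon> \<subseteq> dom \<epsilon>"
proof
  fix x assume x: "x \<in> exhaustion n \<Omega> \<epsilon>"
  have e: "\<epsilon> > 0" using \<epsilon> by (simp add: eps_set_def)
  have sub: "obox n x (2 * \<epsilon>) \<subseteq> \<Omega>" and xR: "x \<in> Rn n" using x by (auto simp: exhaustion_def)
  have "x \<in> \<Omega>" using sub obox_self[OF xR, of "2 * \<epsilon>"] e by auto
  moreover have "kset n (- 1 / \<epsilon>) (msupp \<epsilon>) x \<subseteq> \<Omega>"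
  proof
    fix y assume "y \<in> kset n (- 1 / \<epsilon>) (msupp \<epsilon>) x"
    then have "y \<in> obox n x \<epsilon>" by (rule kset_mol[OF \<epsilon>])
    then have "y \<in> obox n x (2 * \<epsilon>)" using obox_mono[of \<epsilon> "2 * \<epsilon>" n x] e by auto
    then show "y \<in> \<Omega>" using sub by blast
  qed
  ultimately show "x \<in> dom \<epsilon>"
    unfolding dom_def kdom_def[OF \<Omega> mol_facts(1-3)[OF \<epsilon>]] by blast
qed

definition is_cutoff :: "real \<Rightarrow> rfun \<Rightarrow> rvec set \<Rightarrow> bool" where
  "is_cutoff \<epsilon> \<eta> K \<longleftrightarrow> smooth_on n (Rn n) \<eta> \<and> (\<forall>x\<in>exhaustion n \<Omega> \<epsilon>. \<eta> x = 1) \<and> compact K \<and> K \<subseteq> dom \<epsilon> \<and>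
     (\<forall>x\<in>Rn n - K. \<eta> x = 0)"

text \<open>Chosen for every \<epsilon> on its own; the discrete diffeology of the index set imposes
  no relation between different \<epsilon>.\<close>

definition cut :: "real \<Rightarrow> rfun" where
  "cut \<epsilon> = fst (SOME p. is_cutoff \<epsilon> (fst p) (snd p))"

definition cut_supp :: "real \<Rightarrow> rvec set" where
  "cut_supp \<epsilon> = snd (SOME p. is_cutoff \<epsilon> (fst p) (snd p))"

lemma cut: assumes \<epsilon>: "\<epsilon> \<in> eps_set" shows "is_cutoff \<epsilon> (cut \<epsilon>) (cut_supp \<epsilon>)"
proof -
  obtain \<eta> K where "is_cutoff \<epsilon> \<eta> K"
    using cutoff_exists[OF compact_exhaustion exhaustion_dom[OF \<epsilon>] open_dom[OF \<epsilon>]]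
    unfolding is_cutoff_def by (metis Diff_iff)
  then have "\<exists>p. is_cutoff \<epsilon> (fst p) (snd p)" by (intro exI[of _ "(\<eta>, K)"]) simp
  then show ?thesis unfolding cut_def cut_supp_def by (rule someI_ex)
qed

text \<open>The convolution makes sense on \<open>dom \<epsilon>\<close> only. The support of the
  cutoff is compact inside this open set, so the product extends by 0 to a smooth function on
  \<Omega>.\<close>

definition reg :: "(rfun \<Rightarrow> real) \<Rightarrow> real \<Rightarrow> rfun" where
  "reg T \<epsilon> x = (if x \<in> dom \<epsilon> then cut \<epsilon> x * conv \<Omega> (- 1 / \<epsilon>) T (mol \<epsilon>) x else 0)"

lemma reg_eq_conv:
  assumes "\<epsilon> \<in> eps_set" "x \<in> exhaustion n \<Omega> \<epsilon>"
  shows "reg T \<epsilon> x = conv \<Omega> (- 1 / \<epsilon>) T (mol \<epsilon>) x"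
  using cut[OF assms(1)] exhaustion_dom[OF assms(1)] assms(2) by (auto simp: reg_def is_cutoff_def)

lemma conv_mol:
  assumes \<epsilon>: "\<epsilon> \<in> eps_set" and T: "T \<in> distributions n \<Omega>" and x: "x \<in> \<Omega>"
  shows "conv \<Omega> (- 1 / \<epsilon>) T (mol \<epsilon>) x = T (\<lambda>y\<in>\<Omega>. rescale n \<epsilon> (\<psi> \<epsilon>) (\<lambda>i. x i - y i))"
proof -
  have "shift_kernel \<Omega> (- 1 / \<epsilon>) (mol \<epsilon>) x = (\<lambda>y\<in>\<Omega>. rescale n \<epsilon> (\<psi> \<epsilon>) (\<lambda>i. x i - y i))"
    unfolding shift_kernel_def
  proof (rule restrict_ext)
    fix y assume y: "y \<in> \<Omega>"
    have R: "x \<in> Rn n" "y \<in> Rn n" using x y openin_Euclidean_subset[OF \<Omega>] by auto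
    have "aff (- 1 / \<epsilon>) x y = (\<lambda>i. (x i - y i) / \<epsilon>)" by (simp add: aff_def diff_divide_distrib)
    moreover have "(\<lambda>i. x i - y i) \<in> Rn n" using R by (simp add: Rn_iff)
    ultimately show "mol \<epsilon> (aff (- 1 / \<epsilon>) x y) = rescale n \<epsilon> (\<psi> \<epsilon>) (\<lambda>i. x i - y i)"
      using aff_Rn[OF R, of "- 1 / \<epsilon>"] by (simp add: mol_def rescale_def)
  qed
  then show ?thesis unfolding conv_def[OF \<Omega> mol_facts(1-3)[OF \<epsilon>] T] by (rule arg_cong)
qed

text \<open>Two open sets cover \<Omega>: on \<open>dom \<epsilon>\<close> the net is a product of
  smooth families, and off \<open>cut_supp \<epsilon>\<close> it is 0.\<close>

lemma joint_reg:
  assumes d: "d \<in> plots (distribution_space n \<Omega>) k U" and \<epsilon>: "\<epsilon> \<in> eps_set"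
  shows "joint k U n \<Omega> (\<lambda>u. reg (d u) \<epsilon>)"
proof (rule jointI)
  fix l W p q assume W: "openin (Euclidean_space l) W" and p: "p \<in> plots (eucl_space k U) l W"
    and q: "q \<in> plots (eucl_space n \<Omega>) l W"
  note c = cut[OF \<epsilon>, unfolded is_cutoff_def]
  have U: "openin (Euclidean_space k) U" using distribution_plotD(1)[OF d] .
  show "smooth_on l W (\<lambda>z. reg (d (p z)) \<epsilon> (q z))"
  proof (rule smooth_on_local[OF W])
    fix z assume z: "z \<in> W"
    show "\<exists>V. openin (Euclidean_space l) V \<and> z \<in> V \<and> smooth_on l V (\<lambda>z. reg (d (p z)) \<epsilon> (q z))"
    proof (cases "q z \<in> dom \<epsilon>")
      case True
      let ?V = "{z \<in> W. q z \<in> dom \<epsilon>}"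
      have V: "openin (Euclidean_space l) ?V" by (rule eucl_plot_vimage[OF q \<Omega> open_dom[OF \<epsilon>]])
      have p': "restrict p ?V \<in> plots (eucl_space k U) l ?V"
        by (rule eucl_plot_restrict[OF p V]) (use eucl_plotD(3)[OF p] in auto)
      have q': "restrict q ?V \<in> plots (eucl_space n (dom \<epsilon>)) l ?V"
        by (rule eucl_plot_restrict[OF q V]) auto
      have q'': "restrict q ?V \<in> plots (eucl_space n (kdom n \<Omega> (- 1 / \<epsilon>) (msupp \<epsilon>))) l ?V"
        using q' unfolding dom_def .
      have "smooth_on l ?V (\<lambda>z. conv \<Omega> (- 1 / \<epsilon>) (d (restrict p ?V z)) (mol \<epsilon>) (restrict q ?V z))"
        by (rule distribution_plot_conv[OF \<Omega> mol_facts(1-4)[OF \<epsilon>] d p' q''])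
      moreover have "smooth_on n (dom \<epsilon>) (cut \<epsilon>)"
        using c smooth_on_subset openin_Euclidean_subset[OF open_dom[OF \<epsilon>]] by blast
      then have "smooth_on l ?V (\<lambda>z. cut \<epsilon> (restrict q ?V z))"
        by (rule eucl_plot_compose[OF q' open_dom[OF \<epsilon>]])
      ultimately have "smooth_on l ?V (\<lambda>z. cut \<epsilon> (restrict q ?V z) *
          conv \<Omega> (- 1 / \<epsilon>) (d (restrict p ?V z)) (mol \<epsilon>) (restrict q ?V z))"
        by (intro smooth_on_mult[OF V])
      then have "smooth_on l ?V (\<lambda>z. reg (d (p z)) \<epsilon> (q z))"
        by (rule smooth_on_cong[OF V, rotated]) (simp add: reg_def)
      then show ?thesis using V True z by blast
    next
      case False
      \<comment> \<open>A point outside \<open>dom \<epsilon>\<close> is outside the support of the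
        cutoff, together with a neighbourhood.\<close>
      let ?V = "{z \<in> W. q z \<in> Rn n - cut_supp \<epsilon>}"
      have "openin (Euclidean_space n) (Rn n - cut_supp \<epsilon>)"
        using c compact_imp_closed unfolding openin_Euclidean_open by (metis Diff_eq open_Compl)
      then have V: "openin (Euclidean_space l) ?V" by (rule eucl_plot_vimage[OF q \<Omega>])
      have "smooth_on l ?V (\<lambda>z. reg (d (p z)) \<epsilon> (q z))"
        by (rule smooth_on_cong[OF V _ smooth_on_const[OF V, of 0]]) (use c in \<open>auto simp: reg_def\<close>)
      moreover have "q z \<in> Rn n - cut_supp \<epsilon>"
        using c False eucl_plotD(3)[OF q z] openin_Euclidean_subset[OF \<Omega>] by blast
      ultimately show ?thesis using V z by blast
    qed
  qed
qed

lemma smooth_on_reg: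
  assumes T: "T \<in> distributions n \<Omega>" and \<epsilon>: "\<epsilon> \<in> eps_set"
  shows "smooth_on n \<Omega> (reg T \<epsilon>)"
proof (rule smooth_on_local[OF \<Omega>])
  note c = cut[OF \<epsilon>, unfolded is_cutoff_def]
  fix x assume x: "x \<in> \<Omega>"
  show "\<exists>V. openin (Euclidean_space n) V \<and> x \<in> V \<and> smooth_on n V (reg T \<epsilon>)"
  proof (cases "x \<in> dom \<epsilon>")
    case True
    note V = open_dom[OF \<epsilon>]
    have "smooth_on n (dom \<epsilon>) (cut \<epsilon>)"
      using c smooth_on_subset openin_Euclidean_subset[OF V] by blast
    then have "smooth_on n (dom \<epsilon>) (\<lambda>x. cut \<epsilon> x * conv \<Omega> (- 1 / \<epsilon>) T (mol \<epsilon>) x)"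
      using conv_smooth[OF \<Omega> mol_facts(1-3)[OF \<epsilon>] T mol_facts(4)[OF \<epsilon>]]
      by (intro smooth_on_mult[OF V]) (simp_all add: dom_def)
    then have "smooth_on n (dom \<epsilon>) (reg T \<epsilon>)"
      by (rule smooth_on_cong[OF V, rotated]) (simp add: reg_def)
    then show ?thesis using V True by blast
  next
    case False
    have V: "openin (Euclidean_space n) (Rn n - cut_supp \<epsilon>)"
      using c compact_imp_closed unfolding openin_Euclidean_open by (metis Diff_eq open_Compl)
    have "smooth_on n (Rn n - cut_supp \<epsilon>) (reg T \<epsilon>)"
      by (rule smooth_on_cong[OF V _ smooth_on_const[OF V, of 0]]) (use c in \<open>auto simp: reg_def\<close>)
    moreover have "x \<in> Rn n - cut_supp \<epsilon>"
      using c False x openin_Euclidean_subset[OF \<Omega>] by blast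
    ultimately show ?thesis using V by blast
  qed
qed

lemma moderate_reg:
  assumes T: "T \<in> distributions n \<Omega>"
  shows "S.moderate (reg T)"
  unfolding S.moderate_def
proof (intro conjI allI impI)
  show "S.smooth_fam (reg T)" unfolding S.smooth_fam_def using smooth_on_reg[OF T] by blast
  fix K m assume "compact K \<and> K \<subseteq> \<Omega>"
  then have K: "compact K" "K \<subseteq> \<Omega>" by auto
  have KR: "K \<subseteq> Rn n" using K openin_Euclidean_subset[OF \<Omega>] by blast
  obtain r where r: "r > 0" "thick n K r \<subseteq> \<Omega>" using thick_subset_open[OF K \<Omega>] .
  let ?K = "thick n K r"
  have cK: "compact ?K" by (rule compact_thick[OF K(1) KR])
  obtain N C where C: "C > 0" "\<forall>a S g x m B. a \<noteq> 0 \<and> compact S \<and> S \<subseteq> Rn n \<and> g \<in> test_funs_in n (Rn n) S \<and>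
    x \<in> \<Omega> \<and> kset n a S x \<subseteq> ?K \<and> bnd n (N + m) (Rn n) g B \<and> B > 0 \<longrightarrow>
    bnd n m {x} (conv \<Omega> a T g) (C * (max 1 \<bar>a\<bar> ^ (N + m) * B))"
    using conv_bound[OF \<Omega> T cK r(2)] by (elim exE conjE) (rule that)
  have net: "\<psi> \<epsilon> \<in> test_funs n (Rn n)" if "\<epsilon> \<in> eps_set" for \<epsilon>
    using \<psi> that by (simp add: mollifier_net_def)
  have deriv_net: "\<forall>\<alpha>. \<exists>N::nat. (\<lambda>\<epsilon>. sup_abs (Rn n) (mderiv n \<alpha> (\<psi> \<epsilon>))) \<in> O[at_right 0](\<lambda>\<epsilon>. 1 / \<epsilon> ^ N)"
    using \<psi> by (simp add: mollifier_net_def)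
  have "\<exists>M C'. C' > 0 \<and> eventually (\<lambda>\<epsilon>. bnd n (N + m) (Rn n) (\<psi> \<epsilon>) (C' * (1 / \<epsilon> ^ M))) (at_right 0)"
    by (rule bounded_derivs_test_net[OF net deriv_net])
  then obtain M C' where M: "C' > 0" "eventually (\<lambda>\<epsilon>. bnd n (N + m) (Rn n) (\<psi> \<epsilon>) (C' * (1 / \<epsilon> ^ M))) (at_right 0)"
    by (elim exE conjE) (rule that)
  obtain W where W: "openin (Euclidean_space n) W" "K \<subseteq> W" "W \<subseteq> ?K" using open_box_nbhd[OF KR r(1)] by metis
  have "eventually (\<lambda>\<epsilon>. \<epsilon> \<le> r) (at_right 0)"
    unfolding eventually_at_right_field using r(1) by (intro exI[of _ r]) auto
  \<comment> \<open>Of the exponent, \<open>N + m\<close> comes from the dilation, \<open>M\<close>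
    from the derivatives of the mollifier and \<open>n\<close> from its normalization.\<close>
  then have "eventually (\<lambda>\<epsilon>. bnd n m K (reg T \<epsilon>) (C * C' * (1 / \<epsilon> ^ (N + m + M + n)))) (at_right 0)"
    using M(2) eventually_unit eventually_eps[OF exhaustion_eventually[OF \<Omega> cK r(2)]]
  proof eventually_elim
    case (elim \<epsilon>)
    then have \<epsilon>: "\<epsilon> \<in> eps_set" "\<epsilon> > 0" by (auto simp: eps_set_def)
    note mf = mol_facts[OF \<epsilon>(1)]
    have sm: "smooth_on n (Rn n) (\<psi> \<epsilon>)"
      using \<psi> \<epsilon>(1) by (auto simp: mollifier_net_def test_funs_def Csmooth_iff)
    let ?B = "1 / \<epsilon> ^ n * (C' * (1 / \<epsilon> ^ M))"
    have "bnd n (N + m) (Rn n) (\<lambda>z. 1 / \<epsilon> ^ n * \<psi> \<epsilon> z) (\<bar>1 / \<epsilon> ^ n\<bar> * (C' * (1 / \<epsilon> ^ M)))"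
      by (rule bnd_cmult[OF openin_Rn order_refl sm elim(2)])
    moreover have "\<bar>1 / \<epsilon> ^ n\<bar> = 1 / \<epsilon> ^ n" using \<epsilon>(2) by simp
    ultimately have B: "bnd n (N + m) (Rn n) (mol \<epsilon>) ?B"
      using bnd_cong[where f = "\<lambda>z. 1 / \<epsilon> ^ n * \<psi> \<epsilon> z" and g = "mol \<epsilon>" and m = "N + m" and c = ?B,
          OF openin_Rn order_refl] by (simp add: mol_def)
    have "bnd n m {x} (conv \<Omega> (- 1 / \<epsilon>) T (mol \<epsilon>)) (C * (max 1 \<bar>- 1 / \<epsilon>\<bar> ^ (N + m) * ?B))" if x: "x \<in> K" for x
    proof (rule C(2)[rule_format, of "- 1 / \<epsilon>" "msupp \<epsilon>" "mol \<epsilon>" x m ?B], intro conjI mf(1-4) B)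
      show "x \<in> \<Omega>" using x K by blast
      show "kset n (- 1 / \<epsilon>) (msupp \<epsilon>) x \<subseteq> ?K"
      proof
        fix y assume "y \<in> kset n (- 1 / \<epsilon>) (msupp \<epsilon>) x"
        then have "y \<in> obox n x \<epsilon>" by (rule kset_mol[OF \<epsilon>(1)])
        then have "y \<in> Rn n" "\<forall>i<n. \<bar>y i - x i\<bar> \<le> r" using elim(1) by (auto simp: obox_def)
        then show "y \<in> ?K" using x unfolding thick_def by blast
      qed
      show "?B > 0" using \<epsilon>(2) M(1) by simp
    qed
    then have "bnd n m K (conv \<Omega> (- 1 / \<epsilon>) T (mol \<epsilon>)) (C * (max 1 \<bar>- 1 / \<epsilon>\<bar> ^ (N + m) * ?B))"
      by (rule bnd_pointwise)
    \<comment> \<open>For small \<epsilon> the cutoff is 1 on the neighbourhood \<open>W\<close> of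
      \<open>K\<close>, so it leaves no trace in the derivatives on \<open>K\<close>.\<close>
    moreover have "bnd n m K (conv \<Omega> (- 1 / \<epsilon>) T (mol \<epsilon>)) c = bnd n m K (reg T \<epsilon>) c" for c
      by (rule bnd_cong[OF W(1,2)]) (use reg_eq_conv[OF \<epsilon>(1), of _ T] W(3) elim(4) in auto)
    moreover have "max 1 \<bar>- 1 / \<epsilon>\<bar> = 1 / \<epsilon>" using \<epsilon> by (simp add: eps_set_def max_def field_simps)
    moreover have "C * ((1 / \<epsilon>) ^ (N + m) * ?B) = C * C' * (1 / \<epsilon> ^ (N + m + M + n))"
      by (simp add: power_add power_divide field_simps)
    ultimately show ?case by simp
  qed
  then have "S.grows (reg T) K m (N + m + M + n) (\<lambda>\<epsilon>. 1 / \<epsilon> ^ (N + m + M + n))"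
    unfolding S.grows_def using C(1) M(1) by (intro ballI exI[of _ "C * C'"]) simp
  then show "\<exists>N. S.grows (reg T) K m N (\<lambda>\<epsilon>. 1 / \<epsilon> ^ N)" by blast
qed

text \<open>Any two admissible nets agree near a given compact set once \<epsilon> is small, so
  their difference is negligible with constant 0.\<close>

lemma iota_s_eq:
  assumes T: "T \<in> distributions n \<Omega>"
  shows "iota_s n \<Omega> \<psi> T = S.rel `` {mk_s \<Omega> (reg T)}"
proof -
  let ?P = "\<lambda>w. w \<in> EM_s n \<Omega> \<and> (\<forall>K. compact K \<and> K \<subseteq> \<Omega> \<longrightarrow> (\<exists>\<epsilon>0\<in>eps_set. \<forall>\<epsilon>\<in>{0<..\<epsilon>0}. \<forall>x\<in>K.
        w \<epsilon> x = T (\<lambda>y\<in>\<Omega>. rescale n \<epsilon> (\<psi> \<epsilon>) (\<lambda>i. x i - y i))))"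
  let ?w = "mk_s \<Omega> (reg T)"
  have w: "?P ?w"
  proof (intro conjI allI impI)
    show "?w \<in> EM_s n \<Omega>" using S.mk_EM[OF moderate_reg[OF T]] by (simp add: EM_s_S[OF \<Omega>])
    fix K assume K: "compact K \<and> K \<subseteq> \<Omega>"
    then obtain \<epsilon>0 where \<epsilon>0: "\<epsilon>0 \<in> eps_set" "\<forall>\<epsilon>\<in>{0<..\<epsilon>0}. K \<subseteq> exhaustion n \<Omega> \<epsilon>"
      using exhaustion_eventually[OF \<Omega>] by blast
    have "?w \<epsilon> x = T (\<lambda>y\<in>\<Omega>. rescale n \<epsilon> (\<psi> \<epsilon>) (\<lambda>i. x i - y i))" if "\<epsilon> \<in> {0<..\<epsilon>0}" "x \<in> K" for \<epsilon> x
    proof -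
      have \<epsilon>: "\<epsilon> \<in> eps_set" using that(1) \<epsilon>0(1) by (simp add: eps_set_def)
      have x: "x \<in> \<Omega>" "x \<in> exhaustion n \<Omega> \<epsilon>" using that K \<epsilon>0(2) by blast+
      show ?thesis using reg_eq_conv[OF \<epsilon> x(2), of T] conv_mol[OF \<epsilon> T x(1)] \<epsilon> x(1) by (simp add: mk_s_def)
    qed
    then show "\<exists>\<epsilon>0\<in>eps_set. \<forall>\<epsilon>\<in>{0<..\<epsilon>0}. \<forall>x\<in>K. ?w \<epsilon> x = T (\<lambda>y\<in>\<Omega>. rescale n \<epsilon> (\<psi> \<epsilon>) (\<lambda>i. x i - y i))"
      using \<epsilon>0(1) by blast
  qed
  have eq: "rel_s n \<Omega> `` {v} = rel_s n \<Omega> `` {?w}" if v: "?P v" for v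
  proof -
    have vw: "v \<in> S.EM" "?w \<in> S.EM" using v w by (simp_all add: EM_s_S[OF \<Omega>])
    have "S.negligible (\<lambda>\<epsilon> x. v \<epsilon> x - ?w \<epsilon> x)"
      unfolding S.negligible_def
    proof (intro conjI allI impI)
      show "S.smooth_fam (\<lambda>\<epsilon> x. v \<epsilon> x - ?w \<epsilon> x)"
        using S.moderateD(2)[OF S.moderate_diff[OF S.EM_D(1)[OF vw(1)] S.EM_D(1)[OF vw(2)]]] .
      fix K m p assume "compact K \<and> K \<subseteq> \<Omega>"
      then have K: "compact K" "K \<subseteq> \<Omega>" by auto
      have KR: "K \<subseteq> Rn n" using K openin_Euclidean_subset[OF \<Omega>] by blast
      \<comment> \<open>Agreement is used on a compact neighbourhood of \<open>K\<close>, since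
        derivatives on \<open>K\<close> are to be compared.\<close>
      obtain r where r: "r > 0" "thick n K r \<subseteq> \<Omega>" using thick_subset_open[OF K \<Omega>] .
      have cK: "compact (thick n K r)" by (rule compact_thick[OF K(1) KR])
      obtain W where W: "openin (Euclidean_space n) W" "K \<subseteq> W" "W \<subseteq> thick n K r"
        using open_box_nbhd[OF KR r(1)] by metis
      have "eventually (\<lambda>\<epsilon>. \<forall>x\<in>thick n K r. u \<epsilon> x = T (\<lambda>y\<in>\<Omega>. rescale n \<epsilon> (\<psi> \<epsilon>) (\<lambda>i. x i - y i))) (at_right 0)"
        if "?P u" for u
        by (rule eventually_eps) (use that cK r(2) in blast)
      from this[OF v] this[OF w] have "eventually (\<lambda>\<epsilon>. bnd n m K (\<lambda>x. v \<epsilon> x - ?w \<epsilon> x) (0 * \<epsilon> ^ p)) (at_right 0)"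
      proof eventually_elim
        case (elim \<epsilon>)
        have "v \<epsilon> y = ?w \<epsilon> y" if "y \<in> W" for y
        proof -
          have y: "y \<in> thick n K r" using W(3) that by blast
          show ?thesis by (rule trans[OF elim(1)[rule_format, OF y] elim(2)[rule_format, OF y, symmetric]])
        qed
        then have "bnd n m K (\<lambda>_. 0) (0 * \<epsilon> ^ p) = bnd n m K (\<lambda>x. v \<epsilon> x - ?w \<epsilon> x) (0 * \<epsilon> ^ p)"
          by (intro bnd_cong[OF W(1,2)]) simp
        then show ?case using bnd_const[of 0 "0 * \<epsilon> ^ p" n m K] by simp
      qed
      then have "S.grows (\<lambda>\<epsilon> x. v \<epsilon> x - ?w \<epsilon> x) K m 0 (\<lambda>\<epsilon>. \<epsilon> ^ p)"
        unfolding S.grows_def by (intro ballI exI[of _ "0 :: real"]) simp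
      then show "\<exists>q. S.grows (\<lambda>\<epsilon> x. v \<epsilon> x - ?w \<epsilon> x) K m q (\<lambda>\<epsilon>. \<epsilon> ^ p)" ..
    qed
    then have "(v, ?w) \<in> S.rel" using vw by (simp add: S.rel_def)
    then show ?thesis using equiv_class_eq[OF S.equiv_rel] by (simp add: rel_s_S[OF \<Omega>])
  qed
  show ?thesis
    unfolding iota_s_def rel_s_S[OF \<Omega>]
    by (rule Union_constant_image[where f = "\<lambda>v. rel_s n \<Omega> `` {v}" and P = ?P, OF w eq])
qed

lemma smooth_iota_s: "smooth_map (distribution_space n \<Omega>) (G_s n \<Omega>) (iota_s n \<Omega> \<psi>)"
  unfolding G_s_S[OF \<Omega>, symmetric] S.G_def
proof (rule smooth_map_class[where w = "\<lambda>T. mk_s \<Omega> (reg T)", OF S.diffeological_X])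
  have pt: "points (distribution_space n \<Omega>) = distributions n \<Omega>" by (simp add: distribution_space_def sub_space_def)
  show "openin (Euclidean_space k) U \<and> d \<in> U \<rightarrow> points (distribution_space n \<Omega>)"
    if "d \<in> plots (distribution_space n \<Omega>) k U" for k U d
    using distribution_plotD[OF that] by (simp add: pt)
  show "mk_s \<Omega> (reg T) \<in> points S.X" if "T \<in> points (distribution_space n \<Omega>)" for T
    using that S.mk_EM[OF moderate_reg] by (simp add: pt)
  show "iota_s n \<Omega> \<psi> T = S.rel `` {mk_s \<Omega> (reg T)}" if "T \<in> points (distribution_space n \<Omega>)" for T
    using that iota_s_eq by (simp add: pt)
  show "(\<lambda>u\<in>U. mk_s \<Omega> (reg (d u))) \<in> plots S.X k U" if d: "d \<in> plots (distribution_space n \<Omega>) k U" for k U d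
    using distribution_plotD[OF d] by (intro S.plots_mk moderate_reg joint_reg[OF d])
qed

end

section \<open>The full algebra\<close>

context generalized_functions
begin

text \<open>Evaluation at the point identifies the algebra and its topology with the real line.\<close>

lemma topological_algebra_point:
  assumes A: "A = {a}" and Da: "D a = {z}" and neg: "\<And>F. negligible F \<Longrightarrow> F a z = 0"
  shows "topological_algebra (D_topology G) Alg"
proof -
  let ?T = "D_topology G"
  define j where "j c = rel `` {mk (\<lambda>_ _. c)}" for c
  \<comment> \<open>A class is determined by its value at the point, so \<open>j\<close> is a
    bijection from the reals onto the classes and \<open>i\<close> is its inverse.\<close>
  define i where "i X = (THE c. X = j c)" for X
  have T: "topspace ?T = carrier Alg" by (simp add: topspace_D_topology[OF diffeological_G] points_G carrier_Alg)
  have val: "app (mk F) a z = F a z" for F using A Da by (simp add: app_mk)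
  have rel_val: "app u a z = app v a z" if "(u, v) \<in> rel" for u v
    using neg[OF relD(1)[OF that]] by simp
  have j_inj: "c = d" if "j c = j d" for c d
  proof -
    have "(mk (\<lambda>_ _. c), mk (\<lambda>_ _. d)) \<in> rel"
      using that eq_equiv_class[OF _ equiv_rel const_EM] unfolding j_def by blast
    from rel_val[OF this] show ?thesis by (simp only: val)
  qed
  have i_j: "i (j c) = c" for c
    unfolding i_def by (rule the_equality) (auto dest: j_inj)
  have cls: "rel `` {u} = j (app u a z)" if "u \<in> EM" for u
    unfolding j_def using A Da by (intro class_cong[OF EM_D(2)[OF that], symmetric]) auto
  have j_carrier: "j c \<in> carrier Alg" for c unfolding j_def by (intro class_carrier const_EM)
  have j_i: "j (i x) = x" if "x \<in> carrier Alg" for x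
    using that cls i_j by (metis carrier_cases)
  have j_add: "j c \<oplus>\<^bsub>Alg\<^esub> j d = j (c + d)" and j_mult: "j c \<otimes>\<^bsub>Alg\<^esub> j d = j (c * d)"
    and j_smult: "c \<odot>\<^bsub>Alg\<^esub> j d = j (c * d)" for c d
  proof -
    show "j c \<oplus>\<^bsub>Alg\<^esub> j d = j (c + d)" unfolding j_def add_class[OF const_EM const_EM]
      by (rule class_cong[OF mk_E]) (simp add: app_mk)
    show "j c \<otimes>\<^bsub>Alg\<^esub> j d = j (c * d)" unfolding j_def mult_class[OF const_EM const_EM]
      by (rule class_cong[OF mk_E]) (simp add: app_mk)
    show "c \<odot>\<^bsub>Alg\<^esub> j d = j (c * d)" unfolding j_def smult_class[OF const_EM]
      by (rule class_cong[OF mk_E]) (simp add: app_mk)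
  qed
  \<comment> \<open>The constants, parametrized by the real line, form a plot.\<close>
  have cont_j: "continuous_map euclideanreal ?T j"
    unfolding continuous_map_def
  proof (intro conjI allI impI)
    show "j \<in> topspace euclideanreal \<rightarrow> topspace ?T" using j_carrier T by simp
    fix V assume V: "openin ?T V"
    have d: "(\<lambda>t\<in>Rn 1. mk (\<lambda>_ _. t 0)) \<in> plots X 1 (Rn 1)"
      by (rule plots_mk[OF openin_Rn moderate_const])
        (rule joint_param[OF openin_Rn smooth_on_coord[OF openin_Rn]])
    have "(\<lambda>t\<in>Rn 1. j (t 0)) \<in> plots G 1 (Rn 1)"
      unfolding G_def
    proof (rule plots_quotI[OF _ openin_Rn diffeological_X])
      show "\<exists>W. \<exists>p\<in>plots X 1 W. t \<in> W \<and> W \<subseteq> Rn 1 \<and> (\<forall>w\<in>W. (\<lambda>t\<in>Rn 1. j (t 0)) w = rel `` {p w})"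
        if "t \<in> Rn 1" for t
        using that by (intro exI[of _ "Rn 1"] bexI[OF _ d]) (simp add: j_def)
    qed simp
    then have "openin (Euclidean_space 1) {t \<in> Rn 1. (\<lambda>t\<in>Rn 1. j (t 0)) t \<in> V}"
      using V openin_Rn unfolding openin_D_topology by blast
    then obtain B where B: "open B" "{t \<in> Rn 1. (\<lambda>t\<in>Rn 1. j (t 0)) t \<in> V} = Rn 1 \<inter> B"
      unfolding openin_Euclidean_open by blast
    let ?e = "\<lambda>c i. if i = (0::nat) then c else (0::real)"
    have "continuous_on UNIV ?e"
    proof (rule continuous_on_coordinatewise_then_product)
      show "continuous_on UNIV (\<lambda>c. ?e c i)" for i by (cases "i = 0") simp_all
    qed
    then have "open (?e -` B)" using B(1) by (simp add: open_vimage)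
    moreover have "?e -` B = {c. j c \<in> V}"
    proof (rule Set.set_eqI)
      fix c
      have "?e c \<in> Rn 1" by (simp add: Rn_iff)
      then have "?e c \<in> B \<longleftrightarrow> ?e c \<in> {t \<in> Rn 1. (\<lambda>t\<in>Rn 1. j (t 0)) t \<in> V}" unfolding B(2) by blast
      also have "\<dots> \<longleftrightarrow> j c \<in> V" using \<open>?e c \<in> Rn 1\<close> by simp
      finally show "c \<in> ?e -` B \<longleftrightarrow> c \<in> {c. j c \<in> V}" by simp
    qed
    ultimately show "openin euclideanreal {c \<in> topspace euclideanreal. j c \<in> V}" by simp
  qed
  \<comment> \<open>Locally a plot lifts to representatives, whose value at the point depends
    continuously on the parameter.\<close>
  have cont_i: "continuous_map ?T euclideanreal i"
    unfolding continuous_map_def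
  proof (intro conjI allI impI)
    fix B :: "real set" assume B: "openin euclideanreal B"
    show "openin ?T {x \<in> topspace ?T. i x \<in> B}"
      unfolding openin_D_topology
    proof (intro conjI allI ballI impI)
      show "{x \<in> topspace ?T. i x \<in> B} \<subseteq> points G" by (auto simp: topspace_D_topology[OF diffeological_G])
      fix k U d assume d: "d \<in> plots G k U" and U: "openin (Euclidean_space k) U"
      have dG: "d u \<in> topspace ?T" if "u \<in> U" for u
        using plot_domain_open(2)[OF diffeological_G d] that by (auto simp: topspace_D_topology[OF diffeological_G])
      show "openin (Euclidean_space k) {u \<in> U. d u \<in> {x \<in> topspace ?T. i x \<in> B}}"
      proof (subst openin_subopen, intro ballI)
        fix u assume u: "u \<in> {u \<in> U. d u \<in> {x \<in> topspace ?T. i x \<in> B}}"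
        then have "u \<in> U" by simp
        then obtain W p where W: "p \<in> plots X k W" "openin (Euclidean_space k) W" "u \<in> W" "W \<subseteq> U"
          "\<And>w. w \<in> W \<Longrightarrow> d w = rel `` {p w}"
          using plots_quotE[OF d[unfolded G_def]] by metis
        have iw: "i (d w) = app (p w) a z" if "w \<in> W" for w
          using W(5)[OF that] cls[OF plots_X_D(1)[OF W(1) that]] i_j by simp
        have "joint k W n {z} (\<lambda>w. app (p w) a)" using plots_X_D(3)[OF W(1), of a] A Da by simp
        moreover have "(\<lambda>w\<in>W. z) \<in> plots (eucl_space n {z}) k W"
        proof -
          have "smooth_on k W (\<lambda>u. (\<lambda>w\<in>W. z) u j)" for j
            by (rule smooth_on_cong[OF W(2) _ smooth_on_const[OF W(2), of "z j"]]) simp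
          then show ?thesis using W(2) by (simp add: eucl_plot_iff)
        qed
        ultimately have "smooth_on k W (\<lambda>w. app (p ((\<lambda>w\<in>W. w) w)) a ((\<lambda>w\<in>W. z) w))"
          using eucl_plot_id[OF W(2)] by (intro jointD)
        then have "continuous_on W (\<lambda>w. app (p ((\<lambda>w\<in>W. w) w)) a ((\<lambda>w\<in>W. z) w))" by (rule smooth_on_continuous)
        then have "continuous_on W (\<lambda>w. i (d w))"
          by (rule continuous_on_eq) (simp add: iw)
        then have "openin (top_of_set W) {w \<in> W. i (d w) \<in> B}"
          using continuous_openin_preimage_gen[of W "\<lambda>w. i (d w)" B] B by (simp add: vimage_def Int_def)
        then obtain R where R: "open R" "{w \<in> W. i (d w) \<in> B} = W \<inter> R" by (auto simp: openin_open)
        obtain R' where R': "open R'" "W = Rn k \<inter> R'" using W(2) by (auto simp: openin_Euclidean_open)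
        have "{w \<in> W. i (d w) \<in> B} = Rn k \<inter> (R' \<inter> R)" unfolding R(2) using R'(2) by blast
        then have "openin (Euclidean_space k) {w \<in> W. i (d w) \<in> B}"
          unfolding openin_Euclidean_open using R(1) R'(1) open_Int by blast
        moreover have "u \<in> {w \<in> W. i (d w) \<in> B}" using u W(3) by simp
        moreover have "{w \<in> W. i (d w) \<in> B} \<subseteq> {u \<in> U. d u \<in> {x \<in> topspace ?T. i x \<in> B}}"
          using W(4) dG by blast
        ultimately show "\<exists>T'. openin (Euclidean_space k) T' \<and> u \<in> T' \<and>
            T' \<subseteq> {u \<in> U. d u \<in> {x \<in> topspace ?T. i x \<in> B}}" by blast
      qed
    qed
  qed simp
  \<comment> \<open>The operations of the real line, transported by the homeomorphism
    \<open>j\<close>.\<close>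
  have "continuous_map (prod_topology ?T ?T) ?T (\<lambda>p. j (i (fst p) + i (snd p)))"
    "continuous_map (prod_topology ?T ?T) ?T (\<lambda>p. j (i (fst p) * i (snd p)))"
    "continuous_map (prod_topology euclideanreal ?T) ?T (\<lambda>p. j (fst p * i (snd p)))"
    by (intro continuous_map_compose[OF _ cont_j, unfolded o_def] continuous_map_add continuous_map_real_mult
        continuous_map_compose[OF _ cont_i, unfolded o_def] continuous_map_fst continuous_map_snd)+
  note cont = this
  have "continuous_map (prod_topology ?T ?T) ?T (\<lambda>(x, y). x \<oplus>\<^bsub>Alg\<^esub> y)"
    by (rule continuous_map_eq[OF cont(1)]) (auto simp: T j_add[symmetric] j_i)
  moreover have "continuous_map (prod_topology ?T ?T) ?T (\<lambda>(x, y). x \<otimes>\<^bsub>Alg\<^esub> y)"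
    by (rule continuous_map_eq[OF cont(2)]) (auto simp: T j_mult[symmetric] j_i)
  moreover have "continuous_map (prod_topology euclideanreal ?T) ?T (\<lambda>(c, x). c \<odot>\<^bsub>Alg\<^esub> x)"
    by (rule continuous_map_eq[OF cont(3)]) (auto simp: T j_smult[symmetric] j_i)
  ultimately show ?thesis unfolding topological_algebra_def using algebra_Alg T by blast
qed

end

section \<open>Rescaled test functions and their domains\<close>

definition mk_e :: "nat \<Rightarrow> rvec set \<Rightarrow> (rfun \<Rightarrow> rfun) \<Rightarrow> ffun" where
  "mk_e n \<Omega> F = (\<lambda>(\<phi>, x)\<in>U_set n \<Omega>. F \<phi> x)"

lemma U_set_iff: "(\<phi>, x) \<in> U_set n \<Omega> \<longleftrightarrow> \<phi> \<in> A0_set n \<and> x \<in> Omega_phi n \<Omega> \<phi>"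
  by (auto simp: U_set_def Omega_phi_def)

lemma A0_supp:
  assumes "\<phi> \<in> A0_set n"
  shows "compact (supp_in (Rn n) \<phi>)" "supp_in (Rn n) \<phi> \<subseteq> Rn n" "\<phi> \<in> test_funs_in n (Rn n) (supp_in (Rn n) \<phi>)"
  using assms test_funs_supp[of \<phi> n "Rn n"] by (simp_all add: A0_set_def)

lemma A_set_A0: "\<phi> \<in> A_set n q \<Longrightarrow> \<phi> \<in> A0_set n"
  by (simp add: A_set_def)

lemma A_set_mono: "q \<le> q' \<Longrightarrow> A_set n q' \<subseteq> A_set n q"
  by (auto simp: A_set_def)

definition scaled :: "nat \<Rightarrow> real \<Rightarrow> rfun \<Rightarrow> rfun" where
  "scaled n \<epsilon> \<phi> = (\<lambda>z\<in>Rn n. 1 / \<epsilon> ^ n * \<phi> z)"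

lemma rescale_eq_kernel: "rescale n \<epsilon> \<phi> = shift_kernel (Rn n) (1 / \<epsilon>) (scaled n \<epsilon> \<phi>) (\<lambda>_. 0)"
  unfolding rescale_def shift_kernel_def
proof (rule restrict_ext)
  fix x assume "x \<in> Rn n"
  then have "(\<lambda>i. x i / \<epsilon>) \<in> Rn n" by (simp add: Rn_iff)
  then show "\<phi> (\<lambda>i. x i / \<epsilon>) / \<epsilon> ^ n = scaled n \<epsilon> \<phi> (aff (1 / \<epsilon>) (\<lambda>_. 0) x)"
    by (simp add: scaled_def aff_def)
qed

lemma scaled_test:
  assumes "\<phi> \<in> A0_set n"
  shows "scaled n \<epsilon> \<phi> \<in> test_funs_in n (Rn n) (supp_in (Rn n) \<phi>)"
  using test_funs_in_lin[OF openin_Rn A0_supp[OF assms] A0_supp(3)[OF assms], of "1 / \<epsilon> ^ n" 0]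
  by (simp add: scaled_def)

lemma rescale_test:
  assumes \<phi>: "\<phi> \<in> A0_set n" and \<epsilon>: "\<epsilon> > 0"
  shows "rescale n \<epsilon> \<phi> \<in> test_funs_in n (Rn n) (kset n (1 / \<epsilon>) (supp_in (Rn n) \<phi>) (\<lambda>_. 0))"
proof -
  have z: "(\<lambda>_. 0) \<in> Rn n" by (simp add: Rn_iff)
  have e: "1 / \<epsilon> \<noteq> 0" using \<epsilon> by simp
  show ?thesis
    unfolding rescale_eq_kernel
    by (rule kernel_test[OF openin_Rn e A0_supp(1,2)[OF \<phi>] scaled_test[OF \<phi>] z order_refl
          compact_kset[OF e A0_supp(1,2)[OF \<phi>] z]]) (simp add: kset_def)
qed

text \<open>The factor in \<open>rescale\<close> is the Jacobian of the dilation, so the integral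
  stays 1.\<close>

lemma rescale_A0:
  assumes \<phi>: "\<phi> \<in> A0_set n" and \<epsilon>: "\<epsilon> > 0"
  shows "rescale n \<epsilon> \<phi> \<in> A0_set n"
proof -
  have "smooth_on n (Rn n) \<phi>" using A0_supp(3)[OF \<phi>] by (simp add: test_funs_in_iff[OF A0_supp(1,2)[OF \<phi>]])
  then have "continuous_on (Rn n) \<phi>" by (rule smooth_on_continuous)
  then have "integral_Rn n (rescale n \<epsilon> \<phi>) = 1"
    using integral_Rn_rescale[OF \<epsilon>] \<phi> by (simp add: A0_set_def)
  then show ?thesis using rescale_test[OF assms] test_funs_in_subset by (auto simp: A0_set_def)
qed

context
  fixes n :: nat and \<Omega> :: "rvec set"
  assumes \<Omega>: "openin (Euclidean_space n) \<Omega>"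
begin

text \<open>Links the condition on the translate \<Omega> - x with the convolution domain for
  \<open>a = 1\<close>; openness and smoothness of \<open>conv\<close> carry over.\<close>

lemma Omega_phi_kdom:
  assumes \<phi>: "\<phi> \<in> A0_set n"
  shows "Omega_phi n \<Omega> \<phi> = kdom n \<Omega> 1 (supp_in (Rn n) \<phi>)"
proof -
  let ?S = "supp_in (Rn n) \<phi>"
  have "?S \<subseteq> (\<lambda>y i. y i - x i) ` \<Omega> \<longleftrightarrow> kset n 1 ?S x \<subseteq> \<Omega>" if x: "x \<in> \<Omega>" for x
  proof
    assume *: "?S \<subseteq> (\<lambda>y i. y i - x i) ` \<Omega>"
    show "kset n 1 ?S x \<subseteq> \<Omega>"
    proof
      fix y assume "y \<in> kset n 1 ?S x"
      then have "(\<lambda>i. y i - x i) \<in> ?S" by (simp add: kset_def aff_def)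
      then obtain y' where y': "y' \<in> \<Omega>" "(\<lambda>i. y i - x i) = (\<lambda>i. y' i - x i)" using * by blast
      have "y i = y' i" for i using fun_cong[OF y'(2), of i] by simp
      then have "y = y'" by blast
      then show "y \<in> \<Omega>" using y'(1) by simp
    qed
  next
    assume *: "kset n 1 ?S x \<subseteq> \<Omega>"
    show "?S \<subseteq> (\<lambda>y i. y i - x i) ` \<Omega>"
    proof
      fix s assume s: "s \<in> ?S"
      let ?y = "\<lambda>i. x i + s i"
      have "?y \<in> Rn n" using s A0_supp(2)[OF \<phi>] x openin_Euclidean_subset[OF \<Omega>] by (auto simp: Rn_iff subset_iff)
      moreover have "aff 1 x ?y = s" by (simp add: aff_def)
      ultimately have "?y \<in> \<Omega>" using * s by (auto simp: kset_def)
      then show "s \<in> (\<lambda>y i. y i - x i) ` \<Omega>" by (rule rev_image_eqI) simp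
    qed
  qed
  then show ?thesis unfolding Omega_phi_def kdom_def[OF \<Omega> one_neq_zero A0_supp(1,2)[OF \<phi>]] by blast
qed

lemma open_Omega_phi: "\<phi> \<in> A0_set n \<Longrightarrow> openin (Euclidean_space n) (Omega_phi n \<Omega> \<phi>)"
  unfolding Omega_phi_kdom by (rule open_kdom[OF \<Omega> one_neq_zero A0_supp(1,2)])

lemma kset_rescale_eventually:
  assumes \<phi>: "\<phi> \<in> A0_set n" and r: "r > 0"
  shows "eventually (\<lambda>\<epsilon>. \<forall>x\<in>K. kset n (1 / \<epsilon>) (supp_in (Rn n) \<phi>) x \<subseteq> thick n K r) (at_right 0)"
proof -
  obtain M where M: "M > 0" "\<And>s i. s \<in> supp_in (Rn n) \<phi> \<Longrightarrow> i < n \<Longrightarrow> \<bar>s i\<bar> \<le> M"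
    using compact_coordinate_bound[OF A0_supp(1)[OF \<phi>], of n] by metis
  \<comment> \<open>The coordinates on the support are at most \<open>M\<close>, so after dilation
    they are at most \<open>\<epsilon> * M\<close>.\<close>
  have "eventually (\<lambda>\<epsilon>. 0 < \<epsilon> \<and> \<epsilon> \<le> r / M) (at_right 0)"
    unfolding eventually_at_right_field using r M(1) by (intro exI[of _ "r / M"]) auto
  then show ?thesis
  proof eventually_elim
    case (elim \<epsilon>)
    have "\<bar>y i - x i\<bar> \<le> r" if "y \<in> kset n (1 / \<epsilon>) (supp_in (Rn n) \<phi>) x" "i < n" for x y i
    proof -
      have "\<bar>aff (1 / \<epsilon>) x y i\<bar> \<le> M" using M(2)[OF _ that(2)] that(1) by (simp add: kset_def)
      then have "\<bar>y i - x i\<bar> \<le> \<epsilon> * M" using elim by (simp add: aff_def abs_mult field_simps)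
      also have "\<dots> \<le> r" using elim M(1) by (simp add: field_simps)
      finally show ?thesis .
    qed
    then show ?case unfolding thick_def kset_def by blast
  qed
qed

text \<open>The support of the rescaled function is contained in the dilated support, which shrinks
  to the origin.\<close>

lemma rescale_Omega_phi_eventually:
  assumes \<phi>: "\<phi> \<in> A0_set n" and K: "compact K" "K \<subseteq> \<Omega>"
  shows "eventually (\<lambda>\<epsilon>. rescale n \<epsilon> \<phi> \<in> A0_set n \<and> K \<subseteq> Omega_phi n \<Omega> (rescale n \<epsilon> \<phi>)) (at_right 0)"
proof -
  obtain r where r: "r > 0" "thick n K r \<subseteq> \<Omega>" using thick_subset_open[OF K \<Omega>] .
  show ?thesis
    using kset_rescale_eventually[OF \<phi> r(1), of K] eventually_unit
  proof eventually_elim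
    case (elim \<epsilon>)
    then have \<epsilon>: "\<epsilon> > 0" by simp
    note R = rescale_A0[OF \<phi> \<epsilon>]
    let ?S = "supp_in (Rn n) \<phi>" and ?S' = "supp_in (Rn n) (rescale n \<epsilon> \<phi>)"
    have S': "?S' \<subseteq> kset n (1 / \<epsilon>) ?S (\<lambda>_. 0)" using rescale_test[OF \<phi> \<epsilon>] by (simp add: test_funs_in_def)
    have "kset n 1 ?S' x \<subseteq> kset n (1 / \<epsilon>) ?S x" for x
    proof
      fix y assume y: "y \<in> kset n 1 ?S' x"
      then have "aff 1 x y \<in> kset n (1 / \<epsilon>) ?S (\<lambda>_. 0)" using S' by (auto simp: kset_def)
      then have "aff (1 / \<epsilon>) (\<lambda>_. 0) (aff 1 x y) \<in> ?S" by (simp add: kset_def)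
      moreover have "aff (1 / \<epsilon>) (\<lambda>_. 0) (aff 1 x y) = aff (1 / \<epsilon>) x y" by (simp add: aff_def)
      ultimately show "y \<in> kset n (1 / \<epsilon>) ?S x" using y by (simp add: kset_def)
    qed
    then have "K \<subseteq> kdom n \<Omega> 1 ?S'"
      unfolding kdom_def[OF \<Omega> one_neq_zero A0_supp(1,2)[OF R]] using elim(1) K(2) r(2) by blast
    then show ?case using R by (simp add: Omega_phi_kdom[OF R])
  qed
qed

lemma generalized_functions_e: "generalized_functions n \<Omega> (A0_set n) (Omega_phi n \<Omega>) (\<lambda>R \<phi> x. R (\<phi>, x))
  (mk_e n \<Omega>) (extensional (U_set n \<Omega>)) (\<lambda>q. (\<lambda>\<phi> \<epsilon>. rescale n \<epsilon> \<phi>) ` A_set n q)"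
proof
  show "u = v" if "u \<in> extensional (U_set n \<Omega>)" "v \<in> extensional (U_set n \<Omega>)"
    "\<And>a x. a \<in> A0_set n \<Longrightarrow> x \<in> Omega_phi n \<Omega> a \<Longrightarrow> u (a, x) = v (a, x)" for u v :: ffun
  proof (rule extensionalityI[OF that(1,2)])
    fix p assume "p \<in> U_set n \<Omega>"
    then show "u p = v p" using that(3) by (cases p) (simp add: U_set_iff)
  qed
  show "eventually (\<lambda>\<epsilon>. \<gamma> \<epsilon> \<in> A0_set n \<and> K \<subseteq> Omega_phi n \<Omega> (\<gamma> \<epsilon>)) (at_right 0)"
    if "\<gamma> \<in> (\<lambda>\<phi> \<epsilon>. rescale n \<epsilon> \<phi>) ` A_set n 0" "compact K" "K \<subseteq> \<Omega>" for \<gamma> K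
    using that rescale_Omega_phi_eventually[OF A_set_A0] by auto
  show "openin (Euclidean_space n) (Omega_phi n \<Omega> \<phi>)" if "\<phi> \<in> A0_set n" for \<phi>
    using that by (rule open_Omega_phi)
  show "Omega_phi n \<Omega> \<phi> \<subseteq> \<Omega>" for \<phi> by (auto simp: Omega_phi_def)
  show "mk_e n \<Omega> F (\<phi>, x) = F \<phi> x" if "\<phi> \<in> A0_set n" "x \<in> Omega_phi n \<Omega> \<phi>" for F \<phi> x
    using that by (simp add: mk_e_def U_set_iff)
  show "(\<lambda>\<phi> \<epsilon>. rescale n \<epsilon> \<phi>) ` A_set n q' \<subseteq> (\<lambda>\<phi> \<epsilon>. rescale n \<epsilon> \<phi>) ` A_set n q" if "q \<le> q'" for q q'
    using A_set_mono[OF that] by (rule image_mono)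
qed (auto simp: mk_e_def \<Omega>)

interpretation E: generalized_functions n \<Omega> "A0_set n" "Omega_phi n \<Omega>" "\<lambda>R \<phi> x. R (\<phi>, x)"
  "mk_e n \<Omega>" "extensional (U_set n \<Omega>)" "\<lambda>q. (\<lambda>\<phi> \<epsilon>. rescale n \<epsilon> \<phi>) ` A_set n q"
  by (rule generalized_functions_e)

section \<open>Identification with the full algebra\<close>

lemma E_e_iff: "R \<in> E_e n \<Omega> \<longleftrightarrow> R \<in> extensional (U_set n \<Omega>) \<and> E.smooth_fam (\<lambda>\<phi> x. R (\<phi>, x))"
  by (simp add: E_e_def E.smooth_fam_def restrict_Csmooth[OF open_Omega_phi])

lemma EM_e_E: "E.EM = EM_e n \<Omega>" and N_e_E: "R \<in> N_e n \<Omega> \<longleftrightarrow> R \<in> extensional (U_set n \<Omega>) \<and> E.negligible (\<lambda>\<phi> x. R (\<phi>, x))"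
proof -
  show "E.EM = EM_e n \<Omega>"
    unfolding E.EM_def EM_e_def E.moderate_iff by (intro Collect_cong) (simp add: E_e_iff)
  show "R \<in> N_e n \<Omega> \<longleftrightarrow> R \<in> extensional (U_set n \<Omega>) \<and> E.negligible (\<lambda>\<phi> x. R (\<phi>, x))"
    unfolding N_e_def E.negligible_iff by (simp add: E_e_iff)
qed

lemma rel_e_E: "E.rel = rel_e n \<Omega>"
proof -
  have "(\<lambda>p\<in>U_set n \<Omega>. R p - T p) \<in> N_e n \<Omega> \<longleftrightarrow> E.negligible (\<lambda>\<phi> x. R (\<phi>, x) - T (\<phi>, x))" for R T
  proof -
    have eq: "(\<lambda>p\<in>U_set n \<Omega>. R p - T p) (\<phi>, x) = R (\<phi>, x) - T (\<phi>, x)"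
      if "\<phi> \<in> A0_set n" "x \<in> Omega_phi n \<Omega> \<phi>" for \<phi> x using that by (simp add: U_set_iff)
    have "E.negligible (\<lambda>\<phi> x. (\<lambda>p\<in>U_set n \<Omega>. R p - T p) (\<phi>, x)) \<longleftrightarrow> E.negligible (\<lambda>\<phi> x. R (\<phi>, x) - T (\<phi>, x))"
      by (intro iffI; rule E.negligible_cong[rotated], assumption) (simp_all only: eq)
    then show ?thesis unfolding N_e_E by blast
  qed
  then show ?thesis unfolding E.rel_def rel_e_def EM_e_E by simp
qed

lemma points_U_space: "points (U_space n \<Omega>) = U_set n \<Omega>"
  by (simp add: U_space_def sub_space_def)

lemma U_plotD:
  assumes "c \<in> plots (U_space n \<Omega>) l W"
  shows "openin (Euclidean_space l) W" "c \<in> extensional W" "\<And>w. w \<in> W \<Longrightarrow> c w \<in> U_set n \<Omega>"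
    "(\<lambda>w\<in>W. fst (c w)) \<in> plots (discrete_space (A0_set n)) l W"
    "(\<lambda>w\<in>W. snd (c w)) \<in> plots (eucl_space n \<Omega>) l W"
proof -
  show "c \<in> extensional W" "\<And>w. w \<in> W \<Longrightarrow> c w \<in> U_set n \<Omega>"
    "(\<lambda>w\<in>W. fst (c w)) \<in> plots (discrete_space (A0_set n)) l W"
    "(\<lambda>w\<in>W. snd (c w)) \<in> plots (eucl_space n \<Omega>) l W"
    using assms by (auto simp: U_space_def sub_space_def prod_space_def)
  then show "openin (Euclidean_space l) W" using discrete_plotD(2) by blast
qed

text \<open>The first component of a plot of \<open>U_space\<close> is locally constant, so locally
  only one domain \<open>Omega_phi n \<Omega> \<phi>\<close> is involved.\<close>

lemma smooth_on_U_plot: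
  assumes c: "c \<in> plots (U_space n \<Omega>) l W"
    and h: "\<And>\<phi>. \<phi> \<in> A0_set n \<Longrightarrow> joint l W n (Omega_phi n \<Omega> \<phi>) (h \<phi>)"
  shows "smooth_on l W (\<lambda>w. h (fst (c w)) w (snd (c w)))"
proof (rule smooth_on_local[OF U_plotD(1)[OF c]])
  fix w assume w: "w \<in> W"
  let ?\<phi> = "fst (c w)"
  have \<phi>: "?\<phi> \<in> A0_set n" using U_plotD(3)[OF c w] by (cases "c w") (simp add: U_set_iff)
  obtain V where V: "openin (Euclidean_space l) V" "w \<in> V" "V \<subseteq> W" "\<forall>v\<in>V. fst (c v) = ?\<phi>"
  proof -
    obtain V where V: "openin (Euclidean_space l) V" "w \<in> V" "V \<subseteq> W"
      "\<forall>v\<in>V. (\<lambda>w\<in>W. fst (c w)) v = (\<lambda>w\<in>W. fst (c w)) w"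
      using discrete_plotD(3)[OF U_plotD(4)[OF c] w] by blast
    have "fst (c v) = ?\<phi>" if "v \<in> V" for v using V(4)[rule_format, OF that] V(3) that w by (simp add: subset_iff)
    then show ?thesis by (intro that[OF V(1-3)]) simp
  qed
  have p: "restrict (\<lambda>z\<in>W. z) V \<in> plots (eucl_space l W) l V"
    by (rule eucl_plot_restrict[OF eucl_plot_id[OF U_plotD(1)[OF c]] V(1,3)]) (use V(3) in auto)
  have q: "restrict (\<lambda>w\<in>W. snd (c w)) V \<in> plots (eucl_space n (Omega_phi n \<Omega> ?\<phi>)) l V"
  proof (rule eucl_plot_restrict[OF U_plotD(5)[OF c] V(1,3)])
    fix v assume v: "v \<in> V"
    then have "c v \<in> U_set n \<Omega>" "fst (c v) = ?\<phi>" using V(3,4) U_plotD(3)[OF c] by auto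
    then show "(\<lambda>w\<in>W. snd (c w)) v \<in> Omega_phi n \<Omega> ?\<phi>" using v V(3) by (cases "c v") (auto simp: U_set_iff)
  qed
  have "smooth_on l V (\<lambda>w. h (fst (c w)) w (snd (c w)))"
    using jointD[OF h[OF \<phi>] p q]
    by (rule smooth_on_cong[OF V(1), rotated]) (use V(3,4) in \<open>auto simp: subset_iff\<close>)
  then show "\<exists>V. openin (Euclidean_space l) V \<and> w \<in> V \<and> smooth_on l V (\<lambda>w. h (fst (c w)) w (snd (c w)))"
    using V(1,2) by blast
qed

lemma X_e_E: "E.X = sub_space (EM_e n \<Omega>) (E_e_space n \<Omega>)"
proof -
  have sm: "smooth_map (U_space n \<Omega>) real_space R" if R: "R \<in> E_e n \<Omega>" for R
    unfolding smooth_map_def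
  proof (intro conjI allI ballI)
    fix l W c assume c: "c \<in> plots (U_space n \<Omega>) l W"
    have *: "joint l W n (Omega_phi n \<Omega> \<phi>) (\<lambda>w x. R (\<phi>, x))" if "\<phi> \<in> A0_set n" for \<phi>
      using R that by (intro joint_space open_Omega_phi) (auto simp: E_e_iff E.smooth_fam_def)
    have eq: "R (fst (c y), snd (c y)) = compose W R c y" if "y \<in> W" for y using that by (simp add: compose_eq)
    have "smooth_on l W (\<lambda>w. R (fst (c w), snd (c w)))"
      by (rule smooth_on_U_plot[OF c, where h = "\<lambda>\<phi> w x. R (\<phi>, x)"]) (rule *)
    then have "smooth_on l W (compose W R c)"
      by (rule smooth_on_cong[OF U_plotD(1)[OF c], rotated]) (rule eq)
    then show "compose W R c \<in> plots real_space l W"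
      using U_plotD(1)[OF c] by (simp add: real_plot_iff Csmooth_iff compose_def)
  qed simp
  have EME: "R \<in> E_e n \<Omega>" if "R \<in> EM_e n \<Omega>" for R using that by (simp add: EM_e_def)
  have ext: "R \<in> extensional (points (U_space n \<Omega>))" if "R \<in> E_e n \<Omega>" for R
    using that by (simp add: E_e_iff points_U_space)
  have smooth_iff: "smooth_map (prod_space (eucl_space k U) (U_space n \<Omega>)) real_space (\<lambda>(u, x). d u x) \<longleftrightarrow>
      (\<forall>\<phi>\<in>A0_set n. joint k U n (Omega_phi n \<Omega> \<phi>) (\<lambda>u x. d u (\<phi>, x)))" for d k U
  proof -
    have "smooth_map (prod_space (eucl_space k U) (U_space n \<Omega>)) real_space (\<lambda>(u, x). d u x) \<longleftrightarrow>
      (\<forall>l W. \<forall>p\<in>plots (eucl_space k U) l W. \<forall>c\<in>plots (U_space n \<Omega>) l W. smooth_on l W (\<lambda>z. d (p z) (c z)))"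
      by (rule prod_smooth_real_iff) (auto simp: eucl_plot_iff PiE_iff U_plotD(2))
    also have "\<dots> \<longleftrightarrow> (\<forall>\<phi>\<in>A0_set n. joint k U n (Omega_phi n \<Omega> \<phi>) (\<lambda>u x. d u (\<phi>, x)))"
    proof
      assume *: "\<forall>l W. \<forall>p\<in>plots (eucl_space k U) l W. \<forall>c\<in>plots (U_space n \<Omega>) l W. smooth_on l W (\<lambda>z. d (p z) (c z))"
      show "\<forall>\<phi>\<in>A0_set n. joint k U n (Omega_phi n \<Omega> \<phi>) (\<lambda>u x. d u (\<phi>, x))"
      proof (intro ballI jointI)
        fix \<phi> l W p q assume \<phi>: "\<phi> \<in> A0_set n" and W: "openin (Euclidean_space l) W"
          and p: "p \<in> plots (eucl_space k U) l W" and q: "q \<in> plots (eucl_space n (Omega_phi n \<Omega> \<phi>)) l W"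
        \<comment> \<open>A plot with constant \<phi> isolates a single test function.\<close>
        let ?c = "\<lambda>z\<in>W. (\<phi>, q z)"
        have "restrict q W \<in> plots (eucl_space n \<Omega>) l W"
          by (rule eucl_plot_restrict[OF q W order_refl]) (use eucl_plotD(3)[OF q] in \<open>auto simp: Omega_phi_def\<close>)
        moreover have "(\<lambda>z\<in>W. fst (?c z)) = (\<lambda>z\<in>W. \<phi>)" "(\<lambda>z\<in>W. snd (?c z)) = restrict q W" by auto
        ultimately have "?c \<in> plots (U_space n \<Omega>) l W"
          using discrete_plot_const[OF \<phi> W] eucl_plotD(3)[OF q] \<phi>
          by (auto simp: U_space_def sub_space_def prod_space_def U_set_iff)
        then have "smooth_on l W (\<lambda>z. d (p z) (?c z))" using * p by blast
        then show "smooth_on l W (\<lambda>z. d (p z) (\<phi>, q z))" by (rule smooth_on_cong[OF W, rotated]) simp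
      qed
    next
      assume *: "\<forall>\<phi>\<in>A0_set n. joint k U n (Omega_phi n \<Omega> \<phi>) (\<lambda>u x. d u (\<phi>, x))"
      show "\<forall>l W. \<forall>p\<in>plots (eucl_space k U) l W. \<forall>c\<in>plots (U_space n \<Omega>) l W. smooth_on l W (\<lambda>z. d (p z) (c z))"
      proof (intro allI ballI)
        fix l W p c assume p: "p \<in> plots (eucl_space k U) l W" and c: "c \<in> plots (U_space n \<Omega>) l W"
        have "joint l W n (Omega_phi n \<Omega> \<phi>) (\<lambda>w x. d (p w) (\<phi>, x))" if \<phi>: "\<phi> \<in> A0_set n" for \<phi>
        proof (rule jointI)
          fix l' Y r q assume Y: "openin (Euclidean_space l') Y" and r: "r \<in> plots (eucl_space l W) l' Y"
            and q: "q \<in> plots (eucl_space n (Omega_phi n \<Omega> \<phi>)) l' Y"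
          have "smooth_on l' Y (\<lambda>z. d (compose Y p r z) (\<phi>, q z))"
            using jointD[OF *[rule_format, OF \<phi>] eucl_plot_comp[OF r p U_plotD(1)[OF c]] q] .
          then show "smooth_on l' Y (\<lambda>z. d (p (r z)) (\<phi>, q z))"
            by (rule smooth_on_cong[OF Y, rotated]) (simp add: compose_def)
        qed
        from smooth_on_U_plot[OF c this] show "smooth_on l W (\<lambda>z. d (p z) (c z))" by simp
      qed
    qed
    finally show ?thesis .
  qed
  have "d \<in> plots E.X k U \<longleftrightarrow> d \<in> plots (sub_space (EM_e n \<Omega>) (E_e_space n \<Omega>)) k U" for d k U
  proof
    assume d: "d \<in> plots E.X k U"
    have dE: "d u \<in> EM_e n \<Omega>" if "u \<in> U" for u using E.plots_X_D(1)[OF d that] by (simp add: EM_e_E)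
    have "d \<in> U \<rightarrow>\<^sub>E {f \<in> extensional (points (U_space n \<Omega>)). smooth_map (U_space n \<Omega>) real_space f}"
    proof (rule PiE_I)
      show "d u \<in> {f \<in> extensional (points (U_space n \<Omega>)). smooth_map (U_space n \<Omega>) real_space f}" if "u \<in> U" for u
        using sm[OF EME[OF dE[OF that]]] ext[OF EME[OF dE[OF that]]] by simp
      show "d u = undefined" if "u \<notin> U" for u
        using d[unfolded E.plots_X_iff PiE_iff] extensional_arb[OF _ that, of d] by blast
    qed
    moreover have "smooth_map (prod_space (eucl_space k U) (U_space n \<Omega>)) real_space (\<lambda>(u, x). d u x)"
      unfolding smooth_iff using E.plots_X_D(3)[OF d] by blast
    ultimately show "d \<in> plots (sub_space (EM_e n \<Omega>) (E_e_space n \<Omega>)) k U"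
      using E.plots_X_D(2)[OF d] dE EME by (simp add: sub_space_def E_e_space_def fun_space_def image_subset_iff)
  next
    assume "d \<in> plots (sub_space (EM_e n \<Omega>) (E_e_space n \<Omega>)) k U"
    then have d: "d \<in> extensional U" "d ` U \<subseteq> EM_e n \<Omega>" "openin (Euclidean_space k) U"
      "smooth_map (prod_space (eucl_space k U) (U_space n \<Omega>)) real_space (\<lambda>(u, x). d u x)"
      by (simp_all add: sub_space_def E_e_space_def fun_space_def PiE_iff)
    then show "d \<in> plots E.X k U"
      unfolding E.plots_X_iff EM_e_E smooth_iff PiE_iff by blast
  qed
  then have "plots E.X = plots (sub_space (EM_e n \<Omega>) (E_e_space n \<Omega>))" by (intro HOL.ext Set.set_eqI)
  then show ?thesis by (intro dspace.equality) (simp_all add: EM_e_E sub_space_def)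
qed

lemma G_e_E: "E.G = G_e n \<Omega>"
  by (simp add: E.G_def G_e_def X_e_E rel_e_E)

lemma mk_e_app: "mk_e n \<Omega> (\<lambda>\<phi> x. f (R (\<phi>, x)) (T (\<phi>, x))) = (\<lambda>p\<in>U_set n \<Omega>. f (R p) (T p))"
  unfolding mk_e_def by (intro restrict_ext) auto

lemma Alg_e_E: "E.Alg = Alg_e n \<Omega>"
  using mk_e_app[of "\<lambda>r t. r * t"] mk_e_app[of "\<lambda>r t. r + t"] mk_e_app[of "\<lambda>r t. c * r" for c]
    mk_e_app[of "\<lambda>r t. 1"] mk_e_app[of "\<lambda>r t. 0"]
  by (simp add: E.Alg_def Alg_e_def EM_e_E rel_e_E)

lemma deriv_e_E: "E.der \<alpha> = deriv_e n \<Omega> \<alpha>"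
  by (simp add: fun_eq_iff E.der_def deriv_e_def rel_e_E mk_e_def)

text \<open>Rescaling the test function amounts to dilating the kernel, so \<open>conv_bound\<close>
  with \<open>a = 1 / \<epsilon>\<close> applies: the dilation contributes \<open>N + m\<close> to
  the exponent and the normalization \<open>n\<close>.\<close>

lemma moderate_conv:
  assumes T: "T \<in> distributions n \<Omega>"
  shows "E.moderate (\<lambda>\<phi>. conv \<Omega> 1 T \<phi>)"
  unfolding E.moderate_def
proof (intro conjI allI impI)
  show "E.smooth_fam (\<lambda>\<phi>. conv \<Omega> 1 T \<phi>)"
    unfolding E.smooth_fam_def
    using conv_smooth[OF \<Omega> one_neq_zero A0_supp(1,2) T A0_supp(3)] by (simp add: Omega_phi_kdom)
  fix K m assume "compact K \<and> K \<subseteq> \<Omega>"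
  then have K: "compact K" "K \<subseteq> \<Omega>" by auto
  have KR: "K \<subseteq> Rn n" using K openin_Euclidean_subset[OF \<Omega>] by blast
  obtain r where r: "r > 0" "thick n K r \<subseteq> \<Omega>" using thick_subset_open[OF K \<Omega>] .
  let ?K = "thick n K r"
  have cK: "compact ?K" by (rule compact_thick[OF K(1) KR])
  obtain N C where C: "C > 0" "\<forall>a S g x m B. a \<noteq> 0 \<and> compact S \<and> S \<subseteq> Rn n \<and> g \<in> test_funs_in n (Rn n) S \<and>
    x \<in> \<Omega> \<and> kset n a S x \<subseteq> ?K \<and> bnd n (N + m) (Rn n) g B \<and> B > 0 \<longrightarrow>
    bnd n m {x} (conv \<Omega> a T g) (C * (max 1 \<bar>a\<bar> ^ (N + m) * B))"
    using conv_bound[OF \<Omega> T cK r(2)] by (elim exE conjE) (rule that)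
  have "\<exists>C'\<ge>0. eventually (\<lambda>\<epsilon>. bnd n m K (conv \<Omega> 1 T (rescale n \<epsilon> \<phi>)) (C' * (1 / \<epsilon> ^ (N + m + n)))) (at_right 0)"
    if \<phi>: "\<phi> \<in> A0_set n" for \<phi>
  proof -
    let ?S = "supp_in (Rn n) \<phi>"
    note S = A0_supp[OF \<phi>]
    obtain B where B: "B > 0" "bnd n (N + m) (Rn n) \<phi> B" using bnd_test_fun[OF openin_Rn S] by blast
    have sm: "smooth_on n (Rn n) \<phi>" using S(3) by (simp add: test_funs_in_iff[OF S(1,2)])
    have "eventually (\<lambda>\<epsilon>. bnd n m K (conv \<Omega> 1 T (rescale n \<epsilon> \<phi>)) (C * B * (1 / \<epsilon> ^ (N + m + n)))) (at_right 0)"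
      using kset_rescale_eventually[OF \<phi> r(1), of K] eventually_unit
    proof eventually_elim
      case (elim \<epsilon>)
      then have \<epsilon>: "\<epsilon> > 0" "1 / \<epsilon> \<noteq> 0" by auto
      let ?B = "1 / \<epsilon> ^ n * B"
      have "bnd n (N + m) (Rn n) (\<lambda>z. 1 / \<epsilon> ^ n * \<phi> z) (\<bar>1 / \<epsilon> ^ n\<bar> * B)"
        by (rule bnd_cmult[OF openin_Rn order_refl sm B(2)])
      moreover have "\<bar>1 / \<epsilon> ^ n\<bar> = 1 / \<epsilon> ^ n" using \<epsilon> by simp
      ultimately have Bs: "bnd n (N + m) (Rn n) (scaled n \<epsilon> \<phi>) ?B"
        using bnd_cong[where f = "\<lambda>z. 1 / \<epsilon> ^ n * \<phi> z" and g = "scaled n \<epsilon> \<phi>" and m = "N + m" and c = ?B,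
            OF openin_Rn order_refl] by (simp add: scaled_def)
      have "bnd n m {x} (conv \<Omega> (1 / \<epsilon>) T (scaled n \<epsilon> \<phi>)) (C * (max 1 \<bar>1 / \<epsilon>\<bar> ^ (N + m) * ?B))" if x: "x \<in> K" for x
        by (rule C(2)[rule_format, of "1 / \<epsilon>" ?S "scaled n \<epsilon> \<phi>" x m ?B], intro conjI \<epsilon>(2) S(1,2) scaled_test[OF \<phi>] Bs)
          (use x K(2) elim(1) B(1) \<epsilon>(1) in auto)
      then have "bnd n m K (conv \<Omega> (1 / \<epsilon>) T (scaled n \<epsilon> \<phi>)) (C * (max 1 \<bar>1 / \<epsilon>\<bar> ^ (N + m) * ?B))"
        by (rule bnd_pointwise)
      \<comment> \<open>The same function written with the dilation in the kernel instead of in the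
        test function.\<close>
      moreover have "bnd n m K (conv \<Omega> (1 / \<epsilon>) T (scaled n \<epsilon> \<phi>)) c = bnd n m K (conv \<Omega> 1 T (rescale n \<epsilon> \<phi>)) c" for c
      proof (rule bnd_cong[OF \<Omega> K(2)])
        fix x assume x: "x \<in> \<Omega>"
        have "shift_kernel \<Omega> (1 / \<epsilon>) (scaled n \<epsilon> \<phi>) x = shift_kernel \<Omega> 1 (rescale n \<epsilon> \<phi>) x"
          unfolding shift_kernel_def
        proof (rule restrict_ext)
          fix y assume y: "y \<in> \<Omega>"
          have R: "x \<in> Rn n" "y \<in> Rn n" using x y openin_Euclidean_subset[OF \<Omega>] by auto
          have "aff (1 / \<epsilon>) x y = (\<lambda>i. aff 1 x y i / \<epsilon>)" by (simp add: aff_def)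
          then show "scaled n \<epsilon> \<phi> (aff (1 / \<epsilon>) x y) = rescale n \<epsilon> \<phi> (aff 1 x y)"
            using aff_Rn[OF R, of 1] aff_Rn[OF R, of "1 / \<epsilon>"] by (simp add: scaled_def rescale_def)
        qed
        then show "conv \<Omega> (1 / \<epsilon>) T (scaled n \<epsilon> \<phi>) x = conv \<Omega> 1 T (rescale n \<epsilon> \<phi>) x"
          unfolding conv_def[OF \<Omega> \<epsilon>(2) S(1,2) T] conv_def[OF \<Omega> one_neq_zero S(1,2) T] by (rule arg_cong)
      qed
      moreover have "max 1 \<bar>1 / \<epsilon>\<bar> = 1 / \<epsilon>" using elim(2) by (simp add: max_def field_simps)
      moreover have "C * ((1 / \<epsilon>) ^ (N + m) * ?B) = C * B * (1 / \<epsilon> ^ (N + m + n))"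
        by (simp add: power_add power_divide field_simps)
      ultimately show ?case by simp
    qed
    then show ?thesis using C(1) B(1) by (intro exI[of _ "C * B"]) simp
  qed
  then have "E.grows (\<lambda>\<phi>. conv \<Omega> 1 T \<phi>) K m (N + m + n) (\<lambda>\<epsilon>. 1 / \<epsilon> ^ (N + m + n))"
    unfolding E.grows_def using A_set_A0 by blast
  then show "\<exists>N. E.grows (\<lambda>\<phi>. conv \<Omega> 1 T \<phi>) K m N (\<lambda>\<epsilon>. 1 / \<epsilon> ^ N)" by blast
qed

lemma iota_e_eq:
  assumes T: "T \<in> distributions n \<Omega>"
  shows "iota_e n \<Omega> T = E.rel `` {mk_e n \<Omega> (\<lambda>\<phi>. conv \<Omega> 1 T \<phi>)}"
proof -
  have "(\<lambda>(\<phi>, x)\<in>U_set n \<Omega>. T (\<lambda>y\<in>\<Omega>. \<phi> (\<lambda>i. y i - x i))) = mk_e n \<Omega> (\<lambda>\<phi>. conv \<Omega> 1 T \<phi>)"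
    unfolding mk_e_def
  proof (rule restrict_ext, clarify)
    fix \<phi> x assume "(\<phi>, x) \<in> U_set n \<Omega>"
    then have "\<phi> \<in> A0_set n" by (simp add: U_set_iff)
    note S = A0_supp[OF this]
    show "T (\<lambda>y\<in>\<Omega>. \<phi> (\<lambda>i. y i - x i)) = conv \<Omega> 1 T \<phi> x"
      by (simp add: conv_def[OF \<Omega> one_neq_zero S(1,2) T] shift_kernel_def aff_def)
  qed
  then show ?thesis by (simp add: iota_e_def rel_e_E)
qed

lemma smooth_iota_e: "smooth_map (distribution_space n \<Omega>) (G_e n \<Omega>) (iota_e n \<Omega>)"
  unfolding G_e_E[symmetric] E.G_def
proof (rule smooth_map_class[where w = "\<lambda>T. mk_e n \<Omega> (\<lambda>\<phi>. conv \<Omega> 1 T \<phi>)", OF E.diffeological_X])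
  have pt: "points (distribution_space n \<Omega>) = distributions n \<Omega>" by (simp add: distribution_space_def sub_space_def)
  show "openin (Euclidean_space k) U \<and> d \<in> U \<rightarrow> points (distribution_space n \<Omega>)"
    if "d \<in> plots (distribution_space n \<Omega>) k U" for k U d
    using distribution_plotD[OF that] by (simp add: pt)
  show "mk_e n \<Omega> (\<lambda>\<phi>. conv \<Omega> 1 T \<phi>) \<in> points E.X" if "T \<in> points (distribution_space n \<Omega>)" for T
    using that E.mk_EM[OF moderate_conv] by (simp add: pt)
  show "iota_e n \<Omega> T = E.rel `` {mk_e n \<Omega> (\<lambda>\<phi>. conv \<Omega> 1 T \<phi>)}" if "T \<in> points (distribution_space n \<Omega>)" for T
    using that iota_e_eq by (simp add: pt)
  show "(\<lambda>u\<in>U. mk_e n \<Omega> (\<lambda>\<phi>. conv \<Omega> 1 (d u) \<phi>)) \<in> plots E.X k U"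
    if d: "d \<in> plots (distribution_space n \<Omega>) k U" for k U d
  proof (rule E.plots_mk[OF distribution_plotD(1)[OF d] moderate_conv[OF distribution_plotD(2)[OF d]]])
    fix \<phi> assume \<phi>: "\<phi> \<in> A0_set n"
    show "joint k U n (Omega_phi n \<Omega> \<phi>) (\<lambda>u. conv \<Omega> 1 (d u) \<phi>)"
      unfolding Omega_phi_kdom[OF \<phi>]
      by (rule jointI) (rule distribution_plot_conv[OF \<Omega> one_neq_zero A0_supp[OF \<phi>] d])
  qed
qed

text \<open>The index is a test function and does not reveal \<epsilon>, but its supremum norm does
  so sufficiently well: along every curve it is at least a positive multiple of
  \<epsilon>^(-n).\<close>

lemma D_topology_G_e_indiscrete:
  assumes "n > 0" "openin (D_topology E.G) V" "V \<noteq> {}"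
  shows "V = topspace (D_topology E.G)"
  using assms(2,3)
proof (rule E.D_topology_indiscrete[where \<rho> = "sup_abs (Rn n)", rotated])
  fix \<gamma> :: "real \<Rightarrow> rfun" and s :: real and p
  assume "\<gamma> \<in> (\<lambda>\<phi> \<epsilon>. rescale n \<epsilon> \<phi>) ` A_set n 0" and s: "s \<noteq> 0"
  then obtain \<phi> where \<phi>: "\<phi> \<in> A0_set n" "\<gamma> = (\<lambda>\<epsilon>. rescale n \<epsilon> \<phi>)" using A_set_A0 by blast
  obtain z where z: "z \<in> Rn n" "\<phi> z \<noteq> 0"
  proof (rule ccontr)
    assume *: "\<not> thesis"
    have "\<phi> (\<lambda>i. if i < n then x i else 0) = 0" for x :: rvec
    proof -
      have "(\<lambda>i. if i < n then x i else 0) \<in> Rn n" by (simp add: Rn_iff)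
      then show ?thesis using * that by blast
    qed
    then have "integral_Rn n \<phi> = 0" by (simp add: integral_Rn_def)
    then show False using \<phi>(1) by (simp add: A0_set_def)
  qed
  have "s\<^sup>2 * (\<phi> z)\<^sup>2 > 0" using s z(2) by simp
  from exp_inverse_square_small[OF this, of p]
  have "eventually (\<lambda>\<epsilon>. exp (- (s * sup_abs (Rn n) (\<gamma> \<epsilon>))\<^sup>2) \<le> 1 * \<epsilon> ^ p) (at_right 0)"
    using eventually_unit
  proof eventually_elim
    case (elim \<epsilon>)
    then have \<epsilon>: "0 < \<epsilon>" "\<epsilon> \<le> 1" by auto
    note R = A0_supp[OF rescale_A0[OF \<phi>(1) \<epsilon>(1)]]
    obtain B where "bnd n 0 (Rn n) (rescale n \<epsilon> \<phi>) B" using bnd_test_fun[OF openin_Rn R] by blast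
    then have B: "\<bar>rescale n \<epsilon> \<phi> y\<bar> \<le> B" if "y \<in> Rn n" for y using that by (simp add: bnd_zero)
    let ?y = "\<lambda>i. \<epsilon> * z i"
    have y: "?y \<in> Rn n" using z(1) by (simp add: Rn_iff)
    \<comment> \<open>Here \<open>n > 0\<close> enters: for \<epsilon> at most 1, the power
      \<open>\<epsilon> ^ n\<close> is at most \<epsilon>.\<close>
    have "\<bar>\<phi> z\<bar> / \<epsilon> \<le> \<bar>\<phi> z\<bar> / \<epsilon> ^ n"
      using \<epsilon> power_decreasing[of 1 n \<epsilon>] assms(1) by (intro divide_left_mono) auto
    also have "\<dots> = \<bar>rescale n \<epsilon> \<phi> ?y\<bar>" using y \<epsilon> by (simp add: rescale_def)
    also have "\<dots> \<le> sup_abs (Rn n) (rescale n \<epsilon> \<phi>)" by (rule le_sup_abs[OF B y])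
    finally have "(\<bar>\<phi> z\<bar> / \<epsilon>)\<^sup>2 \<le> (sup_abs (Rn n) (rescale n \<epsilon> \<phi>))\<^sup>2"
      using \<epsilon> by (intro power_mono) auto
    then have "s\<^sup>2 * (\<bar>\<phi> z\<bar> / \<epsilon>)\<^sup>2 \<le> s\<^sup>2 * (sup_abs (Rn n) (rescale n \<epsilon> \<phi>))\<^sup>2" by (intro mult_left_mono) auto
    then have "s\<^sup>2 * (\<phi> z)\<^sup>2 / \<epsilon>\<^sup>2 \<le> (s * sup_abs (Rn n) (\<gamma> \<epsilon>))\<^sup>2"
      by (simp add: \<phi>(2) power_mult_distrib power_divide)
    then have "exp (- (s * sup_abs (Rn n) (\<gamma> \<epsilon>))\<^sup>2) \<le> exp (- (s\<^sup>2 * (\<phi> z)\<^sup>2 / \<epsilon>\<^sup>2))" by simp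
    also note elim(1)
    finally show ?case by simp
  qed
  then show "\<exists>C\<ge>0. eventually (\<lambda>\<epsilon>. exp (- (s * sup_abs (Rn n) (\<gamma> \<epsilon>))\<^sup>2) \<le> C * \<epsilon> ^ p) (at_right 0)"
    by (intro exI[of _ 1]) simp
qed

text \<open>An open set in dimension 0 is empty or the single point. At the point only one index
  exists and rescaling fixes it.\<close>

lemma topological_algebra_e_0:
  assumes n: "n = 0"
  shows "topological_algebra (D_topology E.G) E.Alg"
proof (cases "\<Omega> = {}")
  \<comment> \<open>On the empty set all representatives coincide, so there is a single
    class.\<close>
  case True
  show ?thesis
  proof (rule E.topological_algebra_indiscrete)
    fix V assume V: "openin (D_topology E.G) V" "V \<noteq> {}"
    have "u = v" if "u \<in> E.EM" "v \<in> E.EM" for u v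
      by (rule E.E_eqI[OF E.EM_D(2)[OF that(1)] E.EM_D(2)[OF that(2)]]) (use True in \<open>auto simp: Omega_phi_def\<close>)
    then have "x = y" if "x \<in> E.EM // E.rel" "y \<in> E.EM // E.rel" for x y
      using that by (auto elim!: quotientE)
    moreover have "V \<subseteq> E.EM // E.rel" using V(1) by (simp add: openin_D_topology E.points_G)
    ultimately show "V = topspace (D_topology E.G)"
      using V(2) by (auto simp: topspace_D_topology[OF E.diffeological_G] E.points_G)
  qed
next
  case False
  define z where "z = (\<lambda>_::nat. 0::real)"
  define \<phi>0 where "\<phi>0 = (\<lambda>x\<in>Rn 0. 1::real)"
  have R0: "Rn 0 = {z}" by (auto simp: Rn_iff z_def)
  have \<Omega>z: "\<Omega> = {z}" using False openin_Euclidean_subset[OF \<Omega>] unfolding n R0 by blast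
  \<comment> \<open>The product measure over no factors is a point mass; normalization then leaves
    \<phi>0 as the only index.\<close>
  have int: "integral_Rn 0 f = f z" for f
    unfolding integral_Rn_def z_def by (simp add: PiM_empty lebesgue_integral_count_space_finite)
  have A0: "A0_set n = {\<phi>0}"
  proof (intro equalityI subsetI)
    fix \<phi> assume "\<phi> \<in> A0_set n"
    then have "\<phi> \<in> extensional {z}" "\<phi> z = 1" using n R0 by (auto simp: A0_set_def test_funs_def Csmooth_iff int)
    then have "\<phi> = \<phi>0" unfolding \<phi>0_def R0 by (intro extensionalityI[of \<phi> "{z}"]) auto
    then show "\<phi> \<in> {\<phi>0}" by simp
  next
    fix \<phi> assume "\<phi> \<in> {\<phi>0}"
    then have \<phi>: "\<phi> = \<phi>0" by simp
    have c: "compact (Rn 0)" "Rn 0 \<subseteq> Rn 0" unfolding R0 by auto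
    have "smooth_on 0 (Rn 0) \<phi>0"
      unfolding \<phi>0_def by (rule smooth_on_cong[OF openin_Rn _ smooth_on_const[OF openin_Rn, of 0 1]]) simp
    then have "\<phi>0 \<in> test_funs_in 0 (Rn 0) (Rn 0)" unfolding test_funs_in_iff[OF c] by (simp add: \<phi>0_def)
    then show "\<phi> \<in> A0_set n" using \<phi> n test_funs_in_subset by (auto simp: A0_set_def int \<phi>0_def R0)
  qed
  have D0: "Omega_phi n \<Omega> \<phi>0 = {z}"
  proof -
    have "supp_in (Rn 0) \<phi>0 \<subseteq> {z}" using R0 by (auto simp: supp_in_def)
    moreover have "(\<lambda>i. z i - z i) = z" by (simp add: z_def)
    ultimately show ?thesis using n \<Omega>z by (auto simp: Omega_phi_def)
  qed
  have rescale: "rescale n \<epsilon> \<phi>0 = \<phi>0" for \<epsilon>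
    unfolding rescale_def \<phi>0_def n by (rule restrict_ext) (simp add: R0 z_def)
  show ?thesis
  proof (rule E.topological_algebra_point[OF A0 D0])
    fix F assume "E.negligible F"
    moreover have "compact \<Omega>" unfolding \<Omega>z by simp
    ultimately obtain q where q: "E.grows F \<Omega> 0 q (\<lambda>\<epsilon>. \<epsilon> ^ 1)" using E.negligibleD(1)[of F \<Omega> 0 1] by blast
    \<comment> \<open>In dimension 0 every multi-index has order 0, so there are no moment
      conditions.\<close>
    have "\<phi>0 \<in> A_set n q" using A0 n by (simp add: A_set_def mi_order_def)
    then obtain C where "eventually (\<lambda>\<epsilon>. bnd n 0 \<Omega> (F (rescale n \<epsilon> \<phi>0)) (C * \<epsilon> ^ 1)) (at_right 0)"
      using q unfolding E.grows_def by fast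
    then have ev: "eventually (\<lambda>\<epsilon>. \<bar>F \<phi>0 z\<bar> \<le> C * \<epsilon>) (at_right 0)"
      by eventually_elim (simp add: rescale bnd_zero \<Omega>z)
    have "((\<lambda>\<epsilon>. C * \<epsilon>) \<longlongrightarrow> C * 0) (at_right 0)" by (intro tendsto_intros)
    then have "\<bar>F \<phi>0 z\<bar> \<le> C * 0"
      by (rule tendsto_lowerbound[OF _ ev]) simp
    then show "F \<phi>0 z = 0" by simp
  qed
qed

lemma full_algebra:
  "diffeological_space (G_e n \<Omega>)"
  "smooth_map (prod_space (G_e n \<Omega>) (G_e n \<Omega>)) (G_e n \<Omega>) (\<lambda>(a, b). a \<oplus>\<^bsub>Alg_e n \<Omega>\<^esub> b)"
  "smooth_map (prod_space (G_e n \<Omega>) (G_e n \<Omega>)) (G_e n \<Omega>) (\<lambda>(a, b). a \<otimes>\<^bsub>Alg_e n \<Omega>\<^esub> b)"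
  "smooth_map (G_e n \<Omega>) (G_e n \<Omega>) (deriv_e n \<Omega> \<alpha>)"
  "topological_algebra (D_topology (G_e n \<Omega>)) (Alg_e n \<Omega>)"
  "continuous_map (D_topology (G_e n \<Omega>)) (D_topology (G_e n \<Omega>)) (deriv_e n \<Omega> \<alpha>)"
  "i < n \<Longrightarrow> derivation (Alg_e n \<Omega>) (deriv_e n \<Omega> (mi_unit i))"
  "smooth_map (Csmooth_space n \<Omega>) (G_e n \<Omega>) (sigma_e n \<Omega>)"
proof -
  show "diffeological_space (G_e n \<Omega>)" using E.diffeological_G by (simp add: G_e_E)
  show "smooth_map (prod_space (G_e n \<Omega>) (G_e n \<Omega>)) (G_e n \<Omega>) (\<lambda>(a, b). a \<oplus>\<^bsub>Alg_e n \<Omega>\<^esub> b)"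
    using E.smooth_add by (simp add: G_e_E Alg_e_E)
  show "smooth_map (prod_space (G_e n \<Omega>) (G_e n \<Omega>)) (G_e n \<Omega>) (\<lambda>(a, b). a \<otimes>\<^bsub>Alg_e n \<Omega>\<^esub> b)"
    using E.smooth_mult by (simp add: G_e_E Alg_e_E)
  show "smooth_map (G_e n \<Omega>) (G_e n \<Omega>) (deriv_e n \<Omega> \<alpha>)" using E.smooth_der by (simp add: G_e_E deriv_e_E)
  have "topological_algebra (D_topology E.G) E.Alg"
    using topological_algebra_e_0 E.topological_algebra_indiscrete[OF D_topology_G_e_indiscrete] by blast
  then show "topological_algebra (D_topology (G_e n \<Omega>)) (Alg_e n \<Omega>)" by (simp add: G_e_E Alg_e_E)
  show "continuous_map (D_topology (G_e n \<Omega>)) (D_topology (G_e n \<Omega>)) (deriv_e n \<Omega> \<alpha>)"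
    using E.continuous_der by (simp add: G_e_E deriv_e_E)
  show "derivation (Alg_e n \<Omega>) (deriv_e n \<Omega> (mi_unit i))" if "i < n"
    using E.derivation_der[OF that] by (simp add: Alg_e_E deriv_e_E)
  have "sigma_e n \<Omega> f = E.rel `` {mk_e n \<Omega> (\<lambda>a. f)}" for f
    by (simp add: sigma_e_def rel_e_E mk_e_def)
  then show "smooth_map (Csmooth_space n \<Omega>) (G_e n \<Omega>) (sigma_e n \<Omega>)"
    using E.smooth_sigma by (simp add: G_e_E)
qed

end

theorem theorem55:
  fixes n :: nat and \<Omega> :: "(nat \<Rightarrow> real) set"
  assumes "openin (Euclidean_space n) \<Omega>"
  shows
    "(diffeological_space (G_s n \<Omega>) \<and>
      smooth_map (prod_space (G_s n \<Omega>) (G_s n \<Omega>)) (G_s n \<Omega>) (\<lambda>(a, b). a \<oplus>\<^bsub>Alg_s n \<Omega>\<^esub> b) \<and>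
      smooth_map (prod_space (G_s n \<Omega>) (G_s n \<Omega>)) (G_s n \<Omega>) (\<lambda>(a, b). a \<otimes>\<^bsub>Alg_s n \<Omega>\<^esub> b) \<and>
      (\<forall>\<alpha>. smooth_map (G_s n \<Omega>) (G_s n \<Omega>) (deriv_s n \<Omega> \<alpha>)) \<and>
      topological_algebra (D_topology (G_s n \<Omega>)) (Alg_s n \<Omega>) \<and>
      (\<forall>\<alpha>. continuous_map (D_topology (G_s n \<Omega>)) (D_topology (G_s n \<Omega>)) (deriv_s n \<Omega> \<alpha>)) \<and>
      (\<forall>i<n. derivation (Alg_s n \<Omega>) (deriv_s n \<Omega> (mi_unit i))) \<and>
      (\<forall>\<psi>. mollifier_net n \<psi> \<longrightarrow>
         smooth_map (distribution_space n \<Omega>) (G_s n \<Omega>) (iota_s n \<Omega> \<psi>)) \<and>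
      smooth_map (Csmooth_space n \<Omega>) (G_s n \<Omega>) (sigma_s n \<Omega>)) \<and>
     (diffeological_space (G_e n \<Omega>) \<and>
      smooth_map (prod_space (G_e n \<Omega>) (G_e n \<Omega>)) (G_e n \<Omega>) (\<lambda>(a, b). a \<oplus>\<^bsub>Alg_e n \<Omega>\<^esub> b) \<and>
      smooth_map (prod_space (G_e n \<Omega>) (G_e n \<Omega>)) (G_e n \<Omega>) (\<lambda>(a, b). a \<otimes>\<^bsub>Alg_e n \<Omega>\<^esub> b) \<and>
      (\<forall>\<alpha>. smooth_map (G_e n \<Omega>) (G_e n \<Omega>) (deriv_e n \<Omega> \<alpha>)) \<and>
      topological_algebra (D_topology (G_e n \<Omega>)) (Alg_e n \<Omega>) \<and>
      (\<forall>\<alpha>. continuous_map (D_topology (G_e n \<Omega>)) (D_topology (G_e n \<Omega>)) (deriv_e n \<Omega> \<alpha>)) \<and>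
      (\<forall>i<n. derivation (Alg_e n \<Omega>) (deriv_e n \<Omega> (mi_unit i))) \<and>
      smooth_map (distribution_space n \<Omega>) (G_e n \<Omega>) (iota_e n \<Omega>) \<and>
      smooth_map (Csmooth_space n \<Omega>) (G_e n \<Omega>) (sigma_e n \<Omega>))"
  by (intro conjI allI impI special_algebra[OF assms] smooth_iota_s[OF assms]
      full_algebra[OF assms] smooth_iota_e[OF assms])

end
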